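(* For every $\hat T\in\widehat{\mathsf{GT}}$, every $\mathsf{N}\in\mathsf{NFI}_{\mathrm{PB}_4}(\mathrm{B}_4)$ and every $[\hat\psi]\in\mathsf{Dessin}(\mathsf{N})$ of degree $d$, the child's drawing represented by the homomorphism $$\hat\psi\circ\hat T_{\widehat{\mathsf{F}}_2}\big|_{\mathsf{F}_2}:\mathsf{F}_2\to S_d$$ is subordinate to $\mathsf{N}^{\hat T}$. Moreover, the formulas $$\mathscr{A}(\mathsf{N}):=\mathsf{N},\qquad \mathscr{A}(\hat T)([\hat\psi]):=[\hat\psi\circ\hat T_{\widehat{\mathsf{F}}_2}]$$ define a contravariant functor $\mathscr{A}:\widehat{\mathsf{GT}}_{\mathsf{NFI}}\to\mathsf{Dessin}$.
   Context: Braid groups. $\mathrm{B}_n$ is the Artin braid group on $n$ strands with standard generators $\sigma_1,\dots,\sigma_{n-1}$; $\mathrm{PB}_n\le \mathrm{B}_n$ is the pure braid group with generators $x_{ij} := \sigma_{j-1}\cdots\sigma_{i+1}\sigma_i^2\sigma_{i+1}^{-1}\cdots\sigma_{j-1}^{-1}$, $1\le i<j\le n$. Set $c := x_{23}x_{12}x_{13}\in \mathrm{PB}_3$; it generates the center of $\mathrm{PB}_3$. The elements $x:=x_{12}$, $y:=x_{23}$ generate a free subgroup of rank 2 in $\mathrm{PB}_3$, which is identified with the free group $\mathsf{F}_2$. $\mathsf{NFI}_{\mathrm{PB}_4}(\mathrm{B}_4)$ is the poset of finite index normal subgroups $\mathsf{N}\unlhd \mathrm{B}_4$ with $\mathsf{N}\le\mathrm{PB}_4$.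 Hats denote profinite completions. Homomorphisms $\mathrm{PB}_3\to\mathrm{PB}_4$ (values on $x_{12},x_{23},x_{13}$): $\varphi_{123}: x_{12}, x_{23}, x_{13}$; $\varphi_{234}: x_{23}, x_{34}, x_{24}$; $\varphi_{12,3,4}: x_{13}x_{23},\ x_{34},\ x_{14}x_{24}$; $\varphi_{1,23,4}: x_{12}x_{13},\ x_{24}x_{34},\ x_{14}$; $\varphi_{1,2,34}: x_{12},\ x_{23}x_{24},\ x_{13}x_{14}$. For $\mathsf{N}\in\mathsf{NFI}_{\mathrm{PB}_4}(\mathrm{B}_4)$ let $\mathsf{N}_{\mathrm{PB}_3}$ be the intersection of the preimages of $\mathsf{N}$ under these five homomorphisms, and $\mathsf{N}_{\mathsf{F}_2}:=\mathsf{N}_{\mathrm{PB}_3}\cap\mathsf{F}_2$. The group $\widehat{\mathsf{GT}}$. Consider pairs $(\hat m,\hat f)\in\widehat{\mathbb{Z}}\times\widehat{\mathsf{F}}_2$ satisfying, in $\widehat{\mathrm{B}}_3$, the hexagon relations $\sigma_1 x_{12}^{\hat m} \hat f^{-1}\sigma_2 x_{23}^{\hat m} \hat f = \hat f^{-1}\sigma_1\sigma_2 x_{12}^{-\hat m}c^{\hat m}$ and $\hat f^{-1}\sigma_2x_{23}^{\hat m} \hat f\sigma_1x_{12}^{\hat m} = \sigma_2\sigma_1x_{23}^{-\hat m}c^{\hat m} \hat f$, and, in $\widehat{\mathrm{PB}}_4$, the pentagon relation $\varphi_{234}(\hat f)\varphi_{1,23,4}(\hat f)\varphi_{123}(\hat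 f)=\varphi_{1,2,34}(\hat f)\varphi_{12,3,4}(\hat f)$. They form a monoid under $(\hat m_1,\hat f_1)\circ(\hat m_2,\hat f_2)=(2\hat m_1\hat m_2+\hat m_1+\hat m_2,\ \hat f_1 E_1(\hat f_2))$, where $E_1$ is the continuous endomorphism of $\widehat{\mathsf{F}}_2$ with $x\mapsto x^{2\hat m_1+1}$, $y\mapsto\hat f_1^{-1}y^{2\hat m_1+1}\hat f_1$. $\widehat{\mathsf{GT}}$ is the group of invertible elements of this monoid. For $\hat T=(\hat m,\hat f)\in\widehat{\mathsf{GT}}$, $\hat T_{\widehat{\mathsf{F}}_2}$ is the continuous automorphism of $\widehat{\mathsf{F}}_2$ with $x\mapsto x^{2\hat m+1}$, $y\mapsto \hat f^{-1}y^{2\hat m+1}\hat f$. Action on $\mathsf{NFI}_{\mathrm{PB}_4}(\mathrm{B}_4)$. For $\hat T=(\hat m,\hat f)\in\widehat{\mathsf{GT}}$ and $\mathsf{N}\in\mathsf{NFI}_{\mathrm{PB}_4}(\mathrm{B}_4)$, let $(m,f)\in\mathbb{Z}\times\mathsf{F}_2$ be such that $m\equiv\hat m$ modulo $N_{\mathrm{ord}}$ (the least common multiple of the orders of $x_{12},x_{23},c$ in $\mathrm{PB}_3/\mathsf{N}_{\mathrm{PB}_3}$) and $f$, $\hat f$ have the same image in $\mathrm{PB}_3/\mathsf{N}_{\mathrm{PB}_3}$. The formulas $\sigma_1\mapsto\sigma_1^{2m+1}\mathsf{N}$, $\sigma_2\mapsto\varphi_{123}(f)^{-1}\sigma_2^{2m+1}\varphi_{123}(f)\mathsf{N}$,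 $\sigma_3\mapsto\varphi_{12,3,4}(f)^{-1}\sigma_3^{2m+1}\varphi_{12,3,4}(f)\mathsf{N}$ define a homomorphism $\mathrm{B}_4\to\mathrm{B}_4/\mathsf{N}$; $\mathsf{N}^{\hat T}$ is the kernel of its restriction $\mathrm{PB}_4\to\mathrm{PB}_4/\mathsf{N}$. This defines a right action of $\widehat{\mathsf{GT}}$ on $\mathsf{NFI}_{\mathrm{PB}_4}(\mathrm{B}_4)$. $\widehat{\mathsf{GT}}_{\mathsf{NFI}}$ is the transformation groupoid: objects are the elements of $\mathsf{NFI}_{\mathrm{PB}_4}(\mathrm{B}_4)$, morphisms from $\mathsf{N}^{(1)}$ to $\mathsf{N}^{(2)}$ are the $\hat T\in\widehat{\mathsf{GT}}$ with $(\mathsf{N}^{(2)})^{\hat T}=\mathsf{N}^{(1)}$, and composition is the multiplication of $\widehat{\mathsf{GT}}$. Child's drawings. A child's drawing of degree $d$ is an $S_d$-conjugacy class $[\psi]$ of homomorphisms $\psi:\mathsf{F}_2\to S_d$ with transitive image; equivalently, the class $[\hat\psi]$ of the unique continuous extension $\hat\psi:\widehat{\mathsf{F}}_2\to S_d$. It is subordinate to $\mathsf{N}$ if $\mathsf{N}_{\mathsf{F}_2}\le\ker(\psi)$; $\mathsf{Dessin}(\mathsf{N})$ is the set of child's drawings subordinate to $\mathsf{N}$. $\mathsf{Dessin}$ is the category whose objects are the elements of $\mathsf{NFI}_{\mathrm{PB}_4}(\mathrm{B}_4)$ and whose morphisms from $\mathsf{N}^{(1)}$ to $\mathsf{N}^{(2)}$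 are all functions $\mathsf{Dessin}(\mathsf{N}^{(1)})\to\mathsf{Dessin}(\mathsf{N}^{(2)})$. *)

theory Defs
  imports
    "HOL-Analysis.Function_Topology"
    "HOL-Algebra.Sym_Groups"
    "HOL-Algebra.Multiplicative_Group"
    "HOL-Algebra.Product_Groups"
begin

section \<open>Homomorphisms with prescribed values\<close>

text \<open>The homomorphism \<open>G \<rightarrow> H\<close> determined by its values on generators; \<open>V\<close> lists the
  pairs (generator, value).  Homomorphisms of \<^theory>\<open>HOL-Algebra.Group\<close> are unconstrained off the
  carrier, so uniqueness is up to extensionality.\<close>

definition hom_with_values ::
    "('a, 'm) monoid_scheme \<Rightarrow> ('b, 'n) monoid_scheme \<Rightarrow> ('a \<times> 'b) set \<Rightarrow> 'a \<Rightarrow> 'b" where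
  "hom_with_values G H V =
     (THE h. h \<in> hom G H \<and> h \<in> extensional (carrier G) \<and> (\<forall>(s, v) \<in> V. h s = v))"


section \<open>Profinite completions\<close>

definition fin_index_normals :: "('a, 'm) monoid_scheme \<Rightarrow> 'a set set" where
  "fin_index_normals G = {K. K \<lhd> G \<and> finite (rcosets\<^bsub>G\<^esub> K)}"

text \<open>The inverse limit of the finite quotients \<open>G/K\<close>: for \<open>K \<subseteq> L\<close>, the coset of \<open>L\<close> which is the
  image of the coset \<open>u K\<close> under \<open>G/K \<rightarrow> G/L\<close> is the one containing \<open>u K\<close>.\<close>

definition profinite_completion :: "('a, 'm) monoid_scheme \<Rightarrow> ('a set \<Rightarrow> 'a set) monoid" where
  "profinite_completion G = (product_group (fin_index_normals G) (\<lambda>K. G Mod K))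
     \<lparr>carrier := {u \<in> carrier (product_group (fin_index_normals G) (\<lambda>K. G Mod K)).
        \<forall>K \<in> fin_index_normals G. \<forall>L \<in> fin_index_normals G. K \<subseteq> L \<longrightarrow> u K \<subseteq> u L}\<rparr>"

definition profinite_topology :: "('a, 'm) monoid_scheme \<Rightarrow> ('a set \<Rightarrow> 'a set) topology" where
  "profinite_topology G =
     subtopology
       (product_topology (\<lambda>K. discrete_topology (carrier (G Mod K))) (fin_index_normals G))
       (carrier (profinite_completion G))"

definition to_completion :: "('a, 'm) monoid_scheme \<Rightarrow> 'a \<Rightarrow> 'a set \<Rightarrow> 'a set" where
  "to_completion G g = (\<lambda>K \<in> fin_index_normals G. K #>\<^bsub>G\<^esub> g)"

text \<open>The continuous homomorphism of completions induced by a homomorphism \<open>\<phi> : G \<rightarrow> H\<close>.  Its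
  component at \<open>L\<close> is the image, under \<open>G/\<phi>\<^sup>-\<^sup>1(L) \<rightarrow> H/L\<close>, of the component at \<open>\<phi>\<^sup>-\<^sup>1(L)\<close>.\<close>

definition completion_map ::
    "('a, 'm) monoid_scheme \<Rightarrow> ('b, 'n) monoid_scheme \<Rightarrow> ('a \<Rightarrow> 'b)
      \<Rightarrow> ('a set \<Rightarrow> 'a set) \<Rightarrow> 'b set \<Rightarrow> 'b set" where
  "completion_map G H \<phi> u =
     (\<lambda>L \<in> fin_index_normals H. L <#>\<^bsub>H\<^esub> (\<phi> ` u {g \<in> carrier G. \<phi> g \<in> L}))"

text \<open>An element of \<open>\<int>\<^sup>^\<close> is the compatible family of its least nonnegative residues modulo all
  \<open>n > 0\<close>.\<close>

definition Zhat :: "(nat \<Rightarrow> int) ring" where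
  "Zhat = \<lparr>
     carrier = {a \<in> \<Pi>\<^sub>E n \<in> {0<..}. {0..<int n}.
                  \<forall>n > 0. \<forall>k > 0. k dvd n \<longrightarrow> a n mod int k = a k},
     monoid.mult = (\<lambda>a b. \<lambda>n \<in> {0<..}. (a n * b n) mod int n),
     one = (\<lambda>n \<in> {0<..}. 1 mod int n),
     zero = (\<lambda>n \<in> {0<..}. 0),
     add = (\<lambda>a b. \<lambda>n \<in> {0<..}. (a n + b n) mod int n)\<rparr>"

text \<open>\<open>u\<^sup>a\<close> for \<open>u\<close> in the completion of \<open>G\<close> and \<open>a \<in> \<int>\<^sup>^\<close>: in the finite group \<open>G/K\<close> the exponent
  only matters modulo the order of that group.\<close>

definition zhat_pow ::
    "('a, 'm) monoid_scheme \<Rightarrow> ('a set \<Rightarrow> 'a set) \<Rightarrow> (nat \<Rightarrow> int) \<Rightarrow> 'a set \<Rightarrow> 'a set" where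
  "zhat_pow G u a =
     (\<lambda>K \<in> fin_index_normals G. u K [^]\<^bsub>G Mod K\<^esub> a (order (G Mod K)))"


section \<open>Braid groups\<close>

text \<open>A letter \<open>(i, True)\<close> stands for \<open>\<sigma>\<^sub>i\<close>, and \<open>(i, False)\<close> for its inverse.\<close>

type_synonym braid_word = "(nat \<times> bool) list"

type_synonym braid = "braid_word set"

definition braid_words :: "nat \<Rightarrow> braid_word set" where
  "braid_words n = lists ({1..<n} \<times> UNIV)"

inductive_set braid_rel :: "nat \<Rightarrow> (braid_word \<times> braid_word) set" for n :: nat where
  refl: "w \<in> braid_words n \<Longrightarrow> (w, w) \<in> braid_rel n"
| sym: "(u, v) \<in> braid_rel n \<Longrightarrow> (v, u) \<in> braid_rel n"
| trans: "(u, v) \<in> braid_rel n \<Longrightarrow> (v, w) \<in> braid_rel n \<Longrightarrow> (u, w) \<in> braid_rel n"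
| cong: "(u, u') \<in> braid_rel n \<Longrightarrow> (v, v') \<in> braid_rel n \<Longrightarrow> (u @ v, u' @ v') \<in> braid_rel n"
| cancel: "1 \<le> i \<Longrightarrow> i < n \<Longrightarrow> ([(i, b), (i, \<not> b)], []) \<in> braid_rel n"
| far: "1 \<le> i \<Longrightarrow> i + 2 \<le> j \<Longrightarrow> j < n \<Longrightarrow>
    ([(i, True), (j, True)], [(j, True), (i, True)]) \<in> braid_rel n"
| braid: "1 \<le> i \<Longrightarrow> i + 1 < n \<Longrightarrow>
    ([(i, True), (i + 1, True), (i, True)], [(i + 1, True), (i, True), (i + 1, True)])
      \<in> braid_rel n"

definition braid_group :: "nat \<Rightarrow> braid monoid" where
  "braid_group n = \<lparr>
     carrier = braid_words n // braid_rel n,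
     monoid.mult = (\<lambda>A B. \<Union>a \<in> A. \<Union>b \<in> B. braid_rel n `` {a @ b}),
     one = braid_rel n `` {[]}\<rparr>"

definition sigma :: "nat \<Rightarrow> nat \<Rightarrow> braid" where
  "sigma n i = braid_rel n `` {[(i, True)]}"

definition braid_perm :: "nat \<Rightarrow> braid \<Rightarrow> nat \<Rightarrow> nat" where
  "braid_perm n = hom_with_values (braid_group n) (sym_group n)
     ((\<lambda>i. (sigma n i, transpose i (i + 1))) ` {1..<n})"

definition pure_braid_group :: "nat \<Rightarrow> braid monoid" where
  "pure_braid_group n =
     (braid_group n)\<lparr>carrier := kernel (braid_group n) (sym_group n) (braid_perm n)\<rparr>"

definition pure_gen :: "nat \<Rightarrow> nat \<Rightarrow> nat \<Rightarrow> braid" where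
  "pure_gen n i j =
     (let G = braid_group n;
          w = foldr (\<lambda>k u. sigma n k \<otimes>\<^bsub>G\<^esub> u) (rev [i + 1..<j]) \<one>\<^bsub>G\<^esub>
      in w \<otimes>\<^bsub>G\<^esub> (sigma n i [^]\<^bsub>G\<^esub> (2::nat)) \<otimes>\<^bsub>G\<^esub> inv\<^bsub>G\<^esub> w)"

abbreviation "B3 \<equiv> braid_group 3"
abbreviation "B4 \<equiv> braid_group 4"
abbreviation "PB3 \<equiv> pure_braid_group 3"
abbreviation "PB4 \<equiv> pure_braid_group 4"

definition c3 :: braid where
  "c3 = pure_gen 3 2 3 \<otimes>\<^bsub>B3\<^esub> pure_gen 3 1 2 \<otimes>\<^bsub>B3\<^esub> pure_gen 3 1 3"

text \<open>The free group on \<open>x = x\<^sub>1\<^sub>2\<close> and \<open>y = x\<^sub>2\<^sub>3\<close>, realised inside \<open>PB\<^sub>3\<close>.\<close>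

definition F2 :: "braid monoid" where
  "F2 = subgroup_generated PB3 {pure_gen 3 1 2, pure_gen 3 2 3}"


section \<open>The five homomorphisms from \<open>PB\<^sub>3\<close> to \<open>PB\<^sub>4\<close>\<close>

definition hom_PB3_PB4 :: "braid \<Rightarrow> braid \<Rightarrow> braid \<Rightarrow> braid \<Rightarrow> braid" where
  "hom_PB3_PB4 a b d = hom_with_values PB3 PB4
     {(pure_gen 3 1 2, a), (pure_gen 3 2 3, b), (pure_gen 3 1 3, d)}"

definition phi_123 :: "braid \<Rightarrow> braid" where
  "phi_123 = hom_PB3_PB4 (pure_gen 4 1 2) (pure_gen 4 2 3) (pure_gen 4 1 3)"

definition phi_234 :: "braid \<Rightarrow> braid" where
  "phi_234 = hom_PB3_PB4 (pure_gen 4 2 3) (pure_gen 4 3 4) (pure_gen 4 2 4)"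

definition phi_12_3_4 :: "braid \<Rightarrow> braid" where
  "phi_12_3_4 = hom_PB3_PB4
     (pure_gen 4 1 3 \<otimes>\<^bsub>B4\<^esub> pure_gen 4 2 3) (pure_gen 4 3 4) (pure_gen 4 1 4 \<otimes>\<^bsub>B4\<^esub> pure_gen 4 2 4)"

definition phi_1_23_4 :: "braid \<Rightarrow> braid" where
  "phi_1_23_4 = hom_PB3_PB4
     (pure_gen 4 1 2 \<otimes>\<^bsub>B4\<^esub> pure_gen 4 1 3) (pure_gen 4 2 4 \<otimes>\<^bsub>B4\<^esub> pure_gen 4 3 4) (pure_gen 4 1 4)"

definition phi_1_2_34 :: "braid \<Rightarrow> braid" where
  "phi_1_2_34 = hom_PB3_PB4
     (pure_gen 4 1 2) (pure_gen 4 2 3 \<otimes>\<^bsub>B4\<^esub> pure_gen 4 2 4) (pure_gen 4 1 3 \<otimes>\<^bsub>B4\<^esub> pure_gen 4 1 4)"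


section \<open>The poset \<open>NFI\<^sub>P\<^sub>B\<^sub>4(B\<^sub>4)\<close>\<close>

definition NFI :: "braid set set" where
  "NFI = {N \<in> fin_index_normals B4. N \<subseteq> carrier PB4}"

definition N_PB3 :: "braid set \<Rightarrow> braid set" where
  "N_PB3 N = (\<Inter>\<phi> \<in> {phi_123, phi_234, phi_12_3_4, phi_1_23_4, phi_1_2_34}.
     {g \<in> carrier PB3. \<phi> g \<in> N})"

definition N_F2 :: "braid set \<Rightarrow> braid set" where
  "N_F2 N = N_PB3 N \<inter> carrier F2"

definition N_ord :: "braid set \<Rightarrow> nat" where
  "N_ord N = (let Q = PB3 Mod N_PB3 N; r = (\<lambda>g. group.ord Q (N_PB3 N #>\<^bsub>PB3\<^esub> g))
     in lcm (r (pure_gen 3 1 2)) (lcm (r (pure_gen 3 2 3)) (r c3)))"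


section \<open>The group \<open>GT\<^sup>^\<close>\<close>

type_synonym zhat = "nat \<Rightarrow> int"
type_synonym pro_braid = "braid set \<Rightarrow> braid set"

abbreviation "F2hat \<equiv> profinite_completion F2"
abbreviation "B3hat \<equiv> profinite_completion B3"
abbreviation "PB4hat \<equiv> profinite_completion PB4"

definition hexagon1 :: "zhat \<Rightarrow> pro_braid \<Rightarrow> bool" where
  "hexagon1 m f \<longleftrightarrow>
     (let s1 = to_completion B3 (sigma 3 1); s2 = to_completion B3 (sigma 3 2);
          x12m = zhat_pow B3 (to_completion B3 (pure_gen 3 1 2)) m;
          x23m = zhat_pow B3 (to_completion B3 (pure_gen 3 2 3)) m;
          cm = zhat_pow B3 (to_completion B3 c3) m;
          f' = completion_map F2 B3 (\<lambda>g. g) f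
      in s1 \<otimes>\<^bsub>B3hat\<^esub> x12m \<otimes>\<^bsub>B3hat\<^esub> inv\<^bsub>B3hat\<^esub> f' \<otimes>\<^bsub>B3hat\<^esub> s2 \<otimes>\<^bsub>B3hat\<^esub> x23m \<otimes>\<^bsub>B3hat\<^esub> f'
         = inv\<^bsub>B3hat\<^esub> f' \<otimes>\<^bsub>B3hat\<^esub> s1 \<otimes>\<^bsub>B3hat\<^esub> s2 \<otimes>\<^bsub>B3hat\<^esub> inv\<^bsub>B3hat\<^esub> x12m \<otimes>\<^bsub>B3hat\<^esub> cm)"

definition hexagon2 :: "zhat \<Rightarrow> pro_braid \<Rightarrow> bool" where
  "hexagon2 m f \<longleftrightarrow>
     (let s1 = to_completion B3 (sigma 3 1); s2 = to_completion B3 (sigma 3 2);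
          x12m = zhat_pow B3 (to_completion B3 (pure_gen 3 1 2)) m;
          x23m = zhat_pow B3 (to_completion B3 (pure_gen 3 2 3)) m;
          cm = zhat_pow B3 (to_completion B3 c3) m;
          f' = completion_map F2 B3 (\<lambda>g. g) f
      in inv\<^bsub>B3hat\<^esub> f' \<otimes>\<^bsub>B3hat\<^esub> s2 \<otimes>\<^bsub>B3hat\<^esub> x23m \<otimes>\<^bsub>B3hat\<^esub> f' \<otimes>\<^bsub>B3hat\<^esub> s1 \<otimes>\<^bsub>B3hat\<^esub> x12m
         = s2 \<otimes>\<^bsub>B3hat\<^esub> s1 \<otimes>\<^bsub>B3hat\<^esub> inv\<^bsub>B3hat\<^esub> x23m \<otimes>\<^bsub>B3hat\<^esub> cm \<otimes>\<^bsub>B3hat\<^esub> f')"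

definition pentagon :: "pro_braid \<Rightarrow> bool" where
  "pentagon f \<longleftrightarrow>
     completion_map F2 PB4 phi_234 f \<otimes>\<^bsub>PB4hat\<^esub> completion_map F2 PB4 phi_1_23_4 f
       \<otimes>\<^bsub>PB4hat\<^esub> completion_map F2 PB4 phi_123 f
     = completion_map F2 PB4 phi_1_2_34 f \<otimes>\<^bsub>PB4hat\<^esub> completion_map F2 PB4 phi_12_3_4 f"

definition F2hat_endo :: "zhat \<times> pro_braid \<Rightarrow> pro_braid \<Rightarrow> pro_braid" where
  "F2hat_endo = (\<lambda>(m, f).
     let k = m \<oplus>\<^bsub>Zhat\<^esub> m \<oplus>\<^bsub>Zhat\<^esub> \<one>\<^bsub>Zhat\<^esub>;
         x = to_completion F2 (pure_gen 3 1 2);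
         y = to_completion F2 (pure_gen 3 2 3)
     in THE h. h \<in> hom F2hat F2hat \<and> h \<in> extensional (carrier F2hat)
          \<and> continuous_map (profinite_topology F2) (profinite_topology F2) h
          \<and> h x = zhat_pow F2 x k
          \<and> h y = inv\<^bsub>F2hat\<^esub> f \<otimes>\<^bsub>F2hat\<^esub> zhat_pow F2 y k \<otimes>\<^bsub>F2hat\<^esub> f)"

definition GT_monoid :: "(zhat \<times> pro_braid) monoid" where
  "GT_monoid = \<lparr>
     carrier = {(m, f) \<in> carrier Zhat \<times> carrier F2hat. hexagon1 m f \<and> hexagon2 m f \<and> pentagon f},
     monoid.mult = (\<lambda>(m1, f1) (m2, f2).
       (m1 \<otimes>\<^bsub>Zhat\<^esub> m2 \<oplus>\<^bsub>Zhat\<^esub> m1 \<otimes>\<^bsub>Zhat\<^esub> m2 \<oplus>\<^bsub>Zhat\<^esub> m1 \<oplus>\<^bsub>Zhat\<^esub> m2,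
        f1 \<otimes>\<^bsub>F2hat\<^esub> F2hat_endo (m1, f1) f2)),
     one = (\<zero>\<^bsub>Zhat\<^esub>, \<one>\<^bsub>F2hat\<^esub>)\<rparr>"

definition GThat :: "(zhat \<times> pro_braid) monoid" where
  "GThat = units_of GT_monoid"


section \<open>The action on \<open>NFI\<^sub>P\<^sub>B\<^sub>4(B\<^sub>4)\<close> and its transformation groupoid\<close>

definition approximates :: "braid set \<Rightarrow> zhat \<times> pro_braid \<Rightarrow> int \<times> braid \<Rightarrow> bool" where
  "approximates N = (\<lambda>(mh, fh) (m, f).
     f \<in> carrier F2
     \<and> m mod int (N_ord N) = mh (N_ord N)
     \<and> N_PB3 N #>\<^bsub>PB3\<^esub> f = completion_map F2 PB3 (\<lambda>g. g) fh (N_PB3 N))"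

definition B4_hom :: "braid set \<Rightarrow> int \<times> braid \<Rightarrow> braid \<Rightarrow> braid set" where
  "B4_hom N = (\<lambda>(m, f).
     hom_with_values B4 (B4 Mod N)
       {(sigma 4 1, N #>\<^bsub>B4\<^esub> (sigma 4 1 [^]\<^bsub>B4\<^esub> (2 * m + 1))),
        (sigma 4 2, N #>\<^bsub>B4\<^esub>
           (inv\<^bsub>B4\<^esub> phi_123 f \<otimes>\<^bsub>B4\<^esub> (sigma 4 2 [^]\<^bsub>B4\<^esub> (2 * m + 1)) \<otimes>\<^bsub>B4\<^esub> phi_123 f)),
        (sigma 4 3, N #>\<^bsub>B4\<^esub>
           (inv\<^bsub>B4\<^esub> phi_12_3_4 f \<otimes>\<^bsub>B4\<^esub> (sigma 4 3 [^]\<^bsub>B4\<^esub> (2 * m + 1)) \<otimes>\<^bsub>B4\<^esub> phi_12_3_4 f))})"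

text \<open>\<open>N\<^sup>T\<close>; the result does not depend on the chosen approximation of \<open>T\<close>.\<close>

definition NFI_act :: "braid set \<Rightarrow> zhat \<times> pro_braid \<Rightarrow> braid set" where
  "NFI_act N T = kernel PB4 (PB4 Mod N) (B4_hom N (SOME p. approximates N T p))"

text \<open>Morphism sets are indexed by source and target and may overlap; in \<open>Comp C a b c g f\<close>,
  \<open>f\<close> goes from \<open>a\<close> to \<open>b\<close> and \<open>g\<close> from \<open>b\<close> to \<open>c\<close>.\<close>

record ('o, 'm) category_data =
  Obj :: "'o set"
  Mor :: "'o \<Rightarrow> 'o \<Rightarrow> 'm set"
  Ident :: "'o \<Rightarrow> 'm"
  Comp :: "'o \<Rightarrow> 'o \<Rightarrow> 'o \<Rightarrow> 'm \<Rightarrow> 'm \<Rightarrow> 'm"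

locale category =
  fixes C :: "('o, 'm) category_data"
  assumes ident_mor: "a \<in> Obj C \<Longrightarrow> Ident C a \<in> Mor C a a"
    and comp_mor: "\<lbrakk>a \<in> Obj C; b \<in> Obj C; c \<in> Obj C; f \<in> Mor C a b; g \<in> Mor C b c\<rbrakk>
      \<Longrightarrow> Comp C a b c g f \<in> Mor C a c"
    and comp_ident_left: "\<lbrakk>a \<in> Obj C; b \<in> Obj C; f \<in> Mor C a b\<rbrakk>
      \<Longrightarrow> Comp C a b b (Ident C b) f = f"
    and comp_ident_right: "\<lbrakk>a \<in> Obj C; b \<in> Obj C; f \<in> Mor C a b\<rbrakk>
      \<Longrightarrow> Comp C a a b f (Ident C a) = f"
    and comp_assoc: "\<lbrakk>a \<in> Obj C; b \<in> Obj C; c \<in> Obj C; d \<in> Obj C;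
        f \<in> Mor C a b; g \<in> Mor C b c; h \<in> Mor C c d\<rbrakk>
      \<Longrightarrow> Comp C a b d (Comp C b c d h g) f = Comp C a c d h (Comp C a b c g f)"

locale contravariant_functor = source: category C + target: category D
  for C :: "('o, 'm) category_data" and D :: "('p, 'n) category_data" +
  fixes Fobj :: "'o \<Rightarrow> 'p" and Fmor :: "'o \<Rightarrow> 'o \<Rightarrow> 'm \<Rightarrow> 'n"
  assumes functor_obj: "a \<in> Obj C \<Longrightarrow> Fobj a \<in> Obj D"
    and functor_mor: "\<lbrakk>a \<in> Obj C; b \<in> Obj C; f \<in> Mor C a b\<rbrakk>
      \<Longrightarrow> Fmor a b f \<in> Mor D (Fobj b) (Fobj a)"
    and functor_ident: "a \<in> Obj C \<Longrightarrow> Fmor a a (Ident C a) = Ident D (Fobj a)"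
    and functor_comp: "\<lbrakk>a \<in> Obj C; b \<in> Obj C; c \<in> Obj C; f \<in> Mor C a b; g \<in> Mor C b c\<rbrakk>
      \<Longrightarrow> Fmor a c (Comp C a b c g f)
          = Comp D (Fobj c) (Fobj b) (Fobj a) (Fmor a b f) (Fmor b c g)"

definition GT_NFI :: "(braid set, zhat \<times> pro_braid) category_data" where
  "GT_NFI = \<lparr>
     Obj = NFI,
     Mor = (\<lambda>N1 N2. {T \<in> carrier GThat. NFI_act N2 T = N1}),
     Ident = (\<lambda>N. \<one>\<^bsub>GThat\<^esub>),
     Comp = (\<lambda>N1 N2 N3 S T. S \<otimes>\<^bsub>GThat\<^esub> T)\<rparr>"


section \<open>Child's drawings\<close>

definition transitive_hom :: "nat \<Rightarrow> (braid \<Rightarrow> nat \<Rightarrow> nat) \<Rightarrow> bool" where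
  "transitive_hom d \<psi> \<longleftrightarrow> d \<ge> 1 \<and> \<psi> \<in> hom F2 (sym_group d)
     \<and> (\<forall>i \<in> {1..d}. \<forall>j \<in> {1..d}. \<exists>g \<in> carrier F2. \<psi> g i = j)"

text \<open>A child's drawing is recorded as its degree together with the conjugacy class of (extensional)
  homomorphisms.\<close>

type_synonym drawing = "nat \<times> (braid \<Rightarrow> nat \<Rightarrow> nat) set"

definition drawing_of :: "nat \<Rightarrow> (braid \<Rightarrow> nat \<Rightarrow> nat) \<Rightarrow> drawing" where
  "drawing_of d \<psi> =
     (d, {\<lambda>g \<in> carrier F2. \<tau> \<otimes>\<^bsub>sym_group d\<^esub> \<psi> g \<otimes>\<^bsub>sym_group d\<^esub> inv\<^bsub>sym_group d\<^esub> \<tau> | \<tau>.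
            \<tau> \<in> carrier (sym_group d)})"

definition Dessin :: "braid set \<Rightarrow> drawing set" where
  "Dessin N = {drawing_of d \<psi> | d \<psi>.
     transitive_hom d \<psi> \<and> N_F2 N \<subseteq> kernel F2 (sym_group d) \<psi>}"

definition continuous_ext ::
    "nat \<Rightarrow> (braid \<Rightarrow> nat \<Rightarrow> nat) \<Rightarrow> pro_braid \<Rightarrow> nat \<Rightarrow> nat" where
  "continuous_ext d \<psi> =
     (THE h. h \<in> hom F2hat (sym_group d) \<and> h \<in> extensional (carrier F2hat)
        \<and> continuous_map (profinite_topology F2) (discrete_topology (carrier (sym_group d))) h
        \<and> (\<forall>g \<in> carrier F2. h (to_completion F2 g) = \<psi> g))"

definition twisted_hom ::
    "zhat \<times> pro_braid \<Rightarrow> nat \<Rightarrow> (braid \<Rightarrow> nat \<Rightarrow> nat) \<Rightarrow> braid \<Rightarrow> nat \<Rightarrow> nat" where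
  "twisted_hom T d \<psi> =
     (\<lambda>g \<in> carrier F2. continuous_ext d \<psi> (F2hat_endo T (to_completion F2 g)))"

definition drawing_act :: "zhat \<times> pro_braid \<Rightarrow> drawing \<Rightarrow> drawing" where
  "drawing_act T D = (THE E. \<exists>d \<psi>. transitive_hom d \<psi> \<and> D = drawing_of d \<psi>
     \<and> E = drawing_of d (twisted_hom T d \<psi>))"

definition Dessin_cat :: "(braid set, drawing \<Rightarrow> drawing) category_data" where
  "Dessin_cat = \<lparr>
     Obj = NFI,
     Mor = (\<lambda>N1 N2. Dessin N1 \<rightarrow>\<^sub>E Dessin N2),
     Ident = (\<lambda>N. \<lambda>D \<in> Dessin N. D),
     Comp = (\<lambda>N1 N2 N3 g f. compose (Dessin N1) g f)\<rparr>"

text \<open>The function attached to \<open>T\<close> viewed as a morphism from \<open>N1\<close> to \<open>N2\<close>, that is, with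
  \<open>N2\<^sup>T = N1\<close>; it goes from \<open>Dessin N2\<close> to \<open>Dessin N1\<close>.\<close>

definition A_mor ::
    "braid set \<Rightarrow> braid set \<Rightarrow> zhat \<times> pro_braid \<Rightarrow> drawing \<Rightarrow> drawing" where
  "A_mor N1 N2 T = (\<lambda>D \<in> Dessin N2. drawing_act T D)"

end

theory Submission
  imports Defs
begin

text \<open>A pair \<open>T = (m, f)\<close> acts on the completions of \<open>B\<^sub>3\<close> and \<open>B\<^sub>4\<close> by \<open>\<sigma>\<^sub>1 \<mapsto> \<sigma>\<^sub>1\<^sup>\<lambda>\<close>,
  \<open>\<sigma>\<^sub>2 \<mapsto> f\<^sup>-\<^sup>1 \<sigma>\<^sub>2\<^sup>\<lambda> f\<close>, \<open>\<sigma>\<^sub>3 \<mapsto> \<phi>\<^sub>1\<^sub>2\<^sub>,\<^sub>3\<^sub>,\<^sub>4(f)\<^sup>-\<^sup>1 \<sigma>\<^sub>3\<^sup>\<lambda> \<phi>\<^sub>1\<^sub>2\<^sub>,\<^sub>3\<^sub>,\<^sub>4(f)\<close> with \<open>\<lambda> = 2m + 1\<close>: the hexagons and the pentagon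
  are what is needed for the braid relations.  These endomorphisms are compatible with the product of
  pairs, and \<open>N\<^sup>T\<close> consists of the braids which \<open>T\<close> sends to the neighbourhood of \<open>1\<close> defined by \<open>N\<close>; hence
  \<open>N\<^sup>S\<^sup>T = (N\<^sup>S)\<^sup>T\<close>.  They also commute, up to inner automorphisms, with the five homomorphisms
  \<open>\<phi>\<close> from the completion of \<open>F\<^sub>2\<close> to that of \<open>B\<^sub>4\<close>.  As inner automorphisms do not matter modulo a normal
  subgroup, an element of \<open>F\<^sub>2\<close> whose images under all \<open>\<phi>\<close> lie in \<open>N\<^sup>T\<close> is sent by \<open>T\<close> to a profinite element whose
  images are trivial modulo \<open>N\<close>, and \<open>\<psi>\<close> kills it whenever \<open>\<psi>\<close> is subordinate to \<open>N\<close>.\<close>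

section \<open>Profinite completions\<close>

text \<open>The objects given by \<open>THE\<close> or \<open>SOME\<close> must be shown to exist
  before they can be used. For \<open>F2hat_endo\<close> this requires that \<open>F2\<close>, a
  mere subgroup of \<open>PB3\<close>, be free; for the five homomorphisms it requires control of
  all relations of \<open>PB3\<close>. Both follow from the product decomposition of
  \<open>PB3\<close> into \<open>F2\<close> and the cyclic group of \<open>c3\<close>, which rests
  on coset enumeration and on ping-pong in SL_2(Z). Continuity is expressed by single coordinates:
  near each point a continuous map to a finite set depends on one finite quotient only, so
  identities are checked on generators. The cablings that occur in the homomorphisms are images of
  \<open>x13 x23 = x12^-1 c\<close> and \<open>x12 x13 = x23^-1 c\<close>; their behaviour under
  \<open>T\<close> is therefore governed by the image of \<open>c\<close>, which the hexagons
  determine. The pentagon lives in the completion of \<open>PB4\<close> but is used in that of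
  \<open>B4\<close>. As \<open>PB4\<close> has finite index, the first embeds in the second, and the
  pentagon of a product can be carried back. Invertibility of \<open>T\<close> is what keeps
  drawings connected: \<open>T\<close> is onto the completion of \<open>F2\<close>, so
  \<open>\<psi>\<close> and its twist have the same image.\<close>

abbreviation "hat \<equiv> profinite_completion"
abbreviation "eta \<equiv> to_completion"
abbreviation "FIN \<equiv> fin_index_normals"

section \<open>Normal subgroups of finite index\<close>

lemma FIN_normal: "K \<in> FIN G \<Longrightarrow> K \<lhd> G"
  by (simp add: fin_index_normals_def)

lemma FIN_subgroup: "K \<in> FIN G \<Longrightarrow> subgroup K G"
  by (simp add: FIN_normal normal_imp_subgroup)

lemma FIN_subset: "K \<in> FIN G \<Longrightarrow> K \<subseteq> carrier G"
  by (meson FIN_subgroup subgroup.subset)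

lemma FIN_quotient_group: "K \<in> FIN G \<Longrightarrow> group (G Mod K)"
  by (simp add: FIN_normal normal.factorgroup_is_group)

lemma FIN_quotient_finite: "K \<in> FIN G \<Longrightarrow> finite (carrier (G Mod K))"
  by (simp add: fin_index_normals_def FactGroup_def)

lemma FIN_order_pos: "K \<in> FIN G \<Longrightarrow> 0 < order (G Mod K)"
  using FIN_quotient_finite FIN_quotient_group group.is_monoid monoid.order_gt_0_iff_finite by metis

text \<open>A coset of \<open>K \<inter> L\<close> is the intersection of a coset of
  \<open>K\<close> with a coset of \<open>L\<close>, so there are only finitely many.\<close>

lemma (in group) FIN_Int:
  assumes "K \<in> FIN G" "L \<in> FIN G" shows "K \<inter> L \<in> FIN G"
proof -
  have "rcosets (K \<inter> L) \<subseteq> (\<lambda>(X, Y). X \<inter> Y) ` ((rcosets K) \<times> (rcosets L))"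
  proof
    fix X assume "X \<in> rcosets (K \<inter> L)"
    then obtain g where g: "g \<in> carrier G" "X = (K \<inter> L) #> g" by (auto simp: RCOSETS_def)
    have "x \<in> X" if x: "x \<in> K #> g" "x \<in> L #> g" for x
    proof -
      obtain k where k: "k \<in> K" "x = k \<otimes> g" using x(1) by (auto simp: r_coset_def)
      obtain l where l: "l \<in> L" "x = l \<otimes> g" using x(2) by (auto simp: r_coset_def)
      have "k = l" using g k l FIN_subset[OF assms(1)] FIN_subset[OF assms(2)] right_cancel[of g k l] by auto
      thus ?thesis using g k l by (auto simp: r_coset_def)
    qed
    hence "X = (K #> g) \<inter> (L #> g)" using g by (auto simp: r_coset_def)
    thus "X \<in> (\<lambda>(X, Y). X \<inter> Y) ` ((rcosets K) \<times> (rcosets L))"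
      using g by (auto simp: RCOSETS_def)
  qed
  moreover have "finite ((\<lambda>(X, Y). X \<inter> Y) ` ((rcosets K) \<times> (rcosets L)))"
    using assms by (auto simp: fin_index_normals_def)
  ultimately have "finite (rcosets (K \<inter> L))" by (rule finite_subset)
  with assms show ?thesis
    by (simp add: fin_index_normals_def normal_subgroup_intersect)
qed

text \<open>The cosets of a kernel are the fibres of \<open>h\<close>, hence indexed by its image.
  Preimages, normal cores and the groups \<open>N^T\<close> below get their finite index from
  here.\<close>

lemma FIN_kernel:
  assumes "group G" "group Q" "h \<in> hom G Q" "finite (h ` carrier G)"
  shows "{g \<in> carrier G. h g = \<one>\<^bsub>Q\<^esub>} \<in> FIN G"
proof -
  interpret group_hom G Q h using assms by (simp add: group_hom_def group_hom_axioms_def)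
  let ?K = "kernel G Q h"
  have "rcosets\<^bsub>G\<^esub> ?K \<subseteq> (\<lambda>q. {g \<in> carrier G. h g = q}) ` (h ` carrier G)"
  proof
    fix X assume "X \<in> rcosets\<^bsub>G\<^esub> ?K"
    then obtain g where g: "g \<in> carrier G" "X = ?K #>\<^bsub>G\<^esub> g" by (auto simp: RCOSETS_def)
    have "x \<in> X \<longleftrightarrow> x \<in> {x \<in> carrier G. h x = h g}" for x
    proof
      fix x assume "x \<in> {x \<in> carrier G. h x = h g}"
      hence x: "x \<in> carrier G" "h x = h g" by auto
      have "x = (x \<otimes>\<^bsub>G\<^esub> inv\<^bsub>G\<^esub> g) \<otimes>\<^bsub>G\<^esub> g" "x \<otimes>\<^bsub>G\<^esub> inv\<^bsub>G\<^esub> g \<in> ?K"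
        using x g by (auto simp: kernel_def G.m_assoc)
      thus "x \<in> X" using g(2) by (auto simp: r_coset_def)
    qed (use g in \<open>auto simp: r_coset_def kernel_def\<close>)
    hence "X = {x \<in> carrier G. h x = h g}" by blast
    thus "X \<in> (\<lambda>q. {g \<in> carrier G. h g = q}) ` (h ` carrier G)" using g by auto
  qed
  hence "finite (rcosets\<^bsub>G\<^esub> ?K)" using assms(4) finite_subset by blast
  thus ?thesis using normal_kernel by (simp add: fin_index_normals_def kernel_def)
qed

lemma (in group) coset_eq_iff:
  assumes "subgroup K G" "g \<in> carrier G" "h \<in> carrier G"
  shows "K #> g = K #> h \<longleftrightarrow> h \<in> K #> g"
  using assms repr_independence rcos_self by metis

lemma (in group) coset_mem_iff:
  assumes "subgroup K G" "g \<in> carrier G" "h \<in> carrier G"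
  shows "h \<in> K #> g \<longleftrightarrow> h \<otimes> inv g \<in> K"
  using subgroup.rcos_module[OF assms(1) group_axioms] assms by simp

lemma FIN_quotient_hom: "K \<in> FIN G \<Longrightarrow> (\<lambda>g. K #>\<^bsub>G\<^esub> g) \<in> hom G (G Mod K)"
  by (simp add: FIN_normal normal.r_coset_hom_Mod)

text \<open>The preimage is the kernel of the composite of \<open>\<phi>\<close> with
  \<open>H \<rightarrow> H/L\<close>, whose target is finite.\<close>

lemma FIN_preimage:
  assumes "group G" "group H" "\<phi> \<in> hom G H" "L \<in> FIN H"
  shows "{g \<in> carrier G. \<phi> g \<in> L} \<in> FIN G"
proof -
  interpret H: group H by fact
  have c: "\<phi> g \<in> carrier H" if "g \<in> carrier G" for g using assms that by (simp add: hom_in_carrier)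
  have "(\<lambda>h. L #>\<^bsub>H\<^esub> h) \<circ> \<phi> \<in> hom G (H Mod L)"
    using FIN_quotient_hom[OF assms(4)] assms(3) by (rule hom_compose[rotated])
  moreover have "finite (((\<lambda>h. L #>\<^bsub>H\<^esub> h) \<circ> \<phi>) ` carrier G)"
    by (rule finite_subset[OF _ FIN_quotient_finite[OF assms(4)]]) (use c in \<open>auto simp: carrier_FactGroup\<close>)
  ultimately have "{g \<in> carrier G. ((\<lambda>h. L #>\<^bsub>H\<^esub> h) \<circ> \<phi>) g = \<one>\<^bsub>H Mod L\<^esub>} \<in> FIN G"
    using FIN_kernel assms(1) FIN_quotient_group[OF assms(4)] by blast
  moreover have "L #>\<^bsub>H\<^esub> \<phi> g = L \<longleftrightarrow> \<phi> g \<in> L" if "g \<in> carrier G" for g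
    using H.coset_join1[OF _ c[OF that] FIN_subgroup[OF assms(4)]]
      H.coset_join2[OF c[OF that] FIN_subgroup[OF assms(4)]] by blast
  ultimately show ?thesis by (simp cong: conj_cong)
qed

section \<open>The completion as a group of compatible families of cosets\<close>

lemma hat_one [simp]: "\<one>\<^bsub>hat G\<^esub> = (\<lambda>K \<in> FIN G. K)"
  by (simp add: profinite_completion_def)

lemma hat_mult: "u \<otimes>\<^bsub>hat G\<^esub> v = (\<lambda>K \<in> FIN G. u K <#>\<^bsub>G\<^esub> v K)"
  by (simp add: profinite_completion_def)

lemma hat_mem: "u \<in> carrier (hat G) \<longleftrightarrow> u \<in> extensional (FIN G) \<and>
    (\<forall>K\<in>FIN G. \<exists>g\<in>carrier G. u K = K #>\<^bsub>G\<^esub> g) \<and>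
    (\<forall>K\<in>FIN G. \<forall>L\<in>FIN G. K \<subseteq> L \<longrightarrow> u K \<subseteq> u L)"
  by (auto simp: profinite_completion_def PiE_iff carrier_FactGroup image_iff Bex_def)

lemma hat_ext: "u \<in> carrier (hat G) \<Longrightarrow> v \<in> carrier (hat G) \<Longrightarrow> (\<And>K. K \<in> FIN G \<Longrightarrow> u K = v K) \<Longrightarrow> u = v"
  by (auto simp: hat_mem intro: extensionalityI)

lemma hat_rep:
  assumes "u \<in> carrier (hat G)" "K \<in> FIN G"
  obtains g where "g \<in> carrier G" "u K = K #>\<^bsub>G\<^esub> g"
  using assms by (auto simp: hat_mem)

lemma hat_coord_closed: "u \<in> carrier (hat G) \<Longrightarrow> K \<in> FIN G \<Longrightarrow> u K \<in> carrier (G Mod K)"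
  by (auto simp: hat_mem carrier_FactGroup)

lemma (in group) coset_mono:
  assumes "subgroup K G" "subgroup L G" "K \<subseteq> L" "g \<in> carrier G" "h \<in> carrier G"
  shows "K #> g \<subseteq> L #> h \<longleftrightarrow> L #> g = L #> h"
proof
  assume "K #> g \<subseteq> L #> h"
  hence "g \<in> L #> h" using rcos_self[OF assms(4,1)] by auto
  thus "L #> g = L #> h" using assms repr_independence by metis
next
  assume "L #> g = L #> h"
  moreover have "K #> g \<subseteq> L #> g" using assms(3) by (auto simp: r_coset_def)
  ultimately show "K #> g \<subseteq> L #> h" by simp
qed

text \<open>Compatibility is encoded as inclusion of cosets. Since a coset of \<open>L\<close> is
  determined by any of its elements, a representative found at the fine level \<open>K\<close> can
  be reused at every coarser level.\<close>

lemma (in group) hat_coarsen: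
  assumes "u \<in> carrier (hat G)" "K \<in> FIN G" "L \<in> FIN G" "K \<subseteq> L" "g \<in> carrier G" "u K = K #> g"
  shows "u L = L #> g"
proof -
  obtain h where h: "h \<in> carrier G" "u L = L #> h" using hat_rep assms by metis
  have "u K \<subseteq> u L" using assms(1-4) unfolding hat_mem by blast
  thus ?thesis using coset_mono[of K L g h] assms h FIN_subgroup by metis
qed

text \<open>The reverse passage: exhibiting one common representative at two nested levels is easier
  than comparing cosets as sets.\<close>

lemma (in group) hat_memI:
  assumes "u \<in> extensional (FIN G)"
    and "\<And>K. K \<in> FIN G \<Longrightarrow> u K \<in> carrier (G Mod K)"
    and "\<And>K L. K \<in> FIN G \<Longrightarrow> L \<in> FIN G \<Longrightarrow> K \<subseteq> L \<Longrightarrow> \<exists>g\<in>carrier G. u K = K #> g \<and> u L = L #> g"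
  shows "u \<in> carrier (hat G)"
proof -
  have "u K \<subseteq> u L" if "K \<in> FIN G" "L \<in> FIN G" "K \<subseteq> L" for K L
    using assms(3)[OF that] coset_mono FIN_subgroup that by metis
  thus ?thesis using assms(1,2) by (fastforce simp: hat_mem carrier_FactGroup)
qed

lemma FIN_coset_mult:
  assumes "K \<in> FIN G" "g \<in> carrier G" "h \<in> carrier G"
  shows "(K #>\<^bsub>G\<^esub> g) <#>\<^bsub>G\<^esub> (K #>\<^bsub>G\<^esub> h) = K #>\<^bsub>G\<^esub> (g \<otimes>\<^bsub>G\<^esub> h)"
  using assms by (simp add: FIN_normal normal.rcos_sum)

lemma (in group) hat_mult_closed:
  assumes "u \<in> carrier (hat G)" "v \<in> carrier (hat G)" shows "u \<otimes>\<^bsub>hat G\<^esub> v \<in> carrier (hat G)"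
proof (rule hat_memI)
  fix K L assume KL: "K \<in> FIN G" "L \<in> FIN G" "K \<subseteq> L"
  obtain g where g: "g \<in> carrier G" "u K = K #> g" using hat_rep[OF assms(1) KL(1)] by blast
  obtain h where h: "h \<in> carrier G" "v K = K #> h" using hat_rep[OF assms(2) KL(1)] by blast
  have "u L = L #> g" "v L = L #> h"
    using hat_coarsen[OF assms(1) KL g] hat_coarsen[OF assms(2) KL h] by auto
  thus "\<exists>k\<in>carrier G. (u \<otimes>\<^bsub>hat G\<^esub> v) K = K #> k \<and> (u \<otimes>\<^bsub>hat G\<^esub> v) L = L #> k"
    using KL g h by (intro bexI[of _ "g \<otimes> h"]) (auto simp: hat_mult FIN_coset_mult)
next
  fix K assume K: "K \<in> FIN G"
  obtain g where g: "g \<in> carrier G" "u K = K #> g" using hat_rep[OF assms(1) K] by blast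
  obtain h where h: "h \<in> carrier G" "v K = K #> h" using hat_rep[OF assms(2) K] by blast
  show "(u \<otimes>\<^bsub>hat G\<^esub> v) K \<in> carrier (G Mod K)"
    using K g h by (auto simp: hat_mult FIN_coset_mult carrier_FactGroup)
qed (simp add: hat_mult)

lemma (in group) eta_closed: "g \<in> carrier G \<Longrightarrow> eta G g \<in> carrier (hat G)"
  by (rule hat_memI) (auto simp: to_completion_def carrier_FactGroup)

lemma eta_coord: "K \<in> FIN G \<Longrightarrow> eta G g K = K #>\<^bsub>G\<^esub> g"
  by (simp add: to_completion_def)

lemma (in group) eta_one: "eta G \<one> = \<one>\<^bsub>hat G\<^esub>"
  by (simp add: to_completion_def FIN_subset coset_mult_one cong: restrict_cong)

lemma (in group) hat_group: "group (hat G)"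
proof (rule groupI)
  fix u v w assume uvw: "u \<in> carrier (hat G)" "v \<in> carrier (hat G)" "w \<in> carrier (hat G)"
  show "u \<otimes>\<^bsub>hat G\<^esub> v \<otimes>\<^bsub>hat G\<^esub> w = u \<otimes>\<^bsub>hat G\<^esub> (v \<otimes>\<^bsub>hat G\<^esub> w)"
  proof (rule hat_ext)
    fix K assume K: "K \<in> FIN G"
    obtain a where a: "a \<in> carrier G" "u K = K #> a" using hat_rep[OF uvw(1) K] by blast
    obtain b where b: "b \<in> carrier G" "v K = K #> b" using hat_rep[OF uvw(2) K] by blast
    obtain c where c: "c \<in> carrier G" "w K = K #> c" using hat_rep[OF uvw(3) K] by blast
    show "(u \<otimes>\<^bsub>hat G\<^esub> v \<otimes>\<^bsub>hat G\<^esub> w) K = (u \<otimes>\<^bsub>hat G\<^esub> (v \<otimes>\<^bsub>hat G\<^esub> w)) K"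
      using K a b c by (simp add: hat_mult FIN_coset_mult m_assoc)
  qed (use uvw hat_mult_closed in auto)
next
  show o: "\<one>\<^bsub>hat G\<^esub> \<in> carrier (hat G)" by (metis eta_closed eta_one one_closed)
  fix u assume u: "u \<in> carrier (hat G)"
  show "\<one>\<^bsub>hat G\<^esub> \<otimes>\<^bsub>hat G\<^esub> u = u"
  proof (rule hat_ext)
    fix K assume K: "K \<in> FIN G"
    obtain a where "a \<in> carrier G" "u K = K #> a" using hat_rep[OF u K] by blast
    thus "(\<one>\<^bsub>hat G\<^esub> \<otimes>\<^bsub>hat G\<^esub> u) K = u K"
      using K FIN_coset_mult[OF K one_closed, of a] by (simp add: hat_mult FIN_subset)
  qed (use u o hat_mult_closed in auto)
  \<comment> \<open>Inverses are taken coordinate by coordinate; by \<open>vK\<close> the inverse of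
    a representative of \<open>u K\<close> represents \<open>v K\<close>, which keeps the family
    compatible.\<close>
  define v where "v = (\<lambda>K\<in>FIN G. inv\<^bsub>G Mod K\<^esub> (u K))"
  have vK: "v K = K #> inv a" if "K \<in> FIN G" "a \<in> carrier G" "u K = K #> a" for K a
    using that normal.inv_FactGroup[OF FIN_normal[OF that(1)], of "u K"]
    by (simp add: v_def carrier_FactGroup normal.rcos_inv[OF FIN_normal[OF that(1)]])
  have v: "v \<in> carrier (hat G)"
  proof (rule hat_memI)
    fix K L assume KL: "K \<in> FIN G" "L \<in> FIN G" "K \<subseteq> L"
    obtain g where g: "g \<in> carrier G" "u K = K #> g" using hat_rep[OF u KL(1)] by blast
    hence "u L = L #> g" using hat_coarsen[OF u KL g] by simp
    thus "\<exists>k\<in>carrier G. v K = K #> k \<and> v L = L #> k"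
      using vK[OF KL(1) g] vK[OF KL(2) g(1)] g by blast
  next
    fix K assume K: "K \<in> FIN G"
    show "v K \<in> carrier (G Mod K)" using K u
      by (simp add: v_def FIN_quotient_group hat_coord_closed group.inv_closed)
  qed (simp add: v_def)
  have "v \<otimes>\<^bsub>hat G\<^esub> u = \<one>\<^bsub>hat G\<^esub>"
  proof (rule hat_ext)
    fix K assume K: "K \<in> FIN G"
    obtain a where a: "a \<in> carrier G" "u K = K #> a" using hat_rep[OF u K] by blast
    thus "(v \<otimes>\<^bsub>hat G\<^esub> u) K = \<one>\<^bsub>hat G\<^esub> K"
      using K FIN_coset_mult[OF K, of "inv a" a] vK[OF K a] by (simp add: hat_mult FIN_subset)
  qed (use u o v hat_mult_closed in auto)
  thus "\<exists>v\<in>carrier (hat G). v \<otimes>\<^bsub>hat G\<^esub> u = \<one>\<^bsub>hat G\<^esub>" using v by blast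
qed (rule hat_mult_closed)

lemma (in group) eta_hom: "eta G \<in> hom G (hat G)"
proof (rule homI)
  fix x y assume "x \<in> carrier G" "y \<in> carrier G"
  then show "eta G (x \<otimes> y) = eta G x \<otimes>\<^bsub>hat G\<^esub> eta G y"
    by (simp add: hat_mult to_completion_def FIN_coset_mult cong: restrict_cong)
qed (rule eta_closed)

lemma hat_coord_hom: "K \<in> FIN G \<Longrightarrow> (\<lambda>u. u K) \<in> hom (hat G) (G Mod K)"
  by (rule homI) (auto simp: hat_coord_closed hat_mult)

lemma (in group) eta_dense:
  assumes "u \<in> carrier (hat G)" "K \<in> FIN G"
  obtains g where "g \<in> carrier G" "u K = eta G g K"
  using hat_rep[OF assms] assms by (metis eta_coord)

lemma hom_comp: "f \<in> hom G H \<Longrightarrow> g \<in> hom H I \<Longrightarrow> (\<lambda>x. g (f x)) \<in> hom G I"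
  using Group.hom_compose[of f G H g I] by (simp add: comp_def)

lemma (in group) mult_inv_cancel:
  assumes "x \<in> carrier G" "y \<in> carrier G"
  shows "x \<otimes> (inv x \<otimes> y) = y" "inv x \<otimes> (x \<otimes> y) = y"
  using assms by (simp_all add: m_assoc[symmetric])

lemma (in group) conj_mult:
  assumes "w \<in> carrier G" "a \<in> carrier G" "b \<in> carrier G"
  shows "inv w \<otimes> (a \<otimes> b) \<otimes> w = (inv w \<otimes> a \<otimes> w) \<otimes> (inv w \<otimes> b \<otimes> w)"
  using assms by (simp add: m_assoc mult_inv_cancel)

section \<open>Locally constant functions on a completion\<close>

text \<open>Continuity into a discrete set, stated without a topology: the sets of all
  \<open>v\<close> with \<open>v K = u K\<close> form a basis of neighbourhoods of \<open>u\<close>,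
  one coordinate being enough because \<open>FIN G\<close> is closed under finite
  intersections.\<close>

definition locconst :: "('a, 'm) monoid_scheme \<Rightarrow> (('a set \<Rightarrow> 'a set) \<Rightarrow> 'c) \<Rightarrow> bool" where
  "locconst G h \<longleftrightarrow> (\<forall>u\<in>carrier (hat G). \<exists>K\<in>FIN G. \<forall>v\<in>carrier (hat G). v K = u K \<longrightarrow> h v = h u)"

lemma locconstE:
  assumes "locconst G h" "u \<in> carrier (hat G)"
  obtains K where "K \<in> FIN G" "\<And>v. v \<in> carrier (hat G) \<Longrightarrow> v K = u K \<Longrightarrow> h v = h u"
proof -
  from assms have "\<exists>K\<in>FIN G. \<forall>v\<in>carrier (hat G). v K = u K \<longrightarrow> h v = h u"
    by (simp add: locconst_def)
  then obtain K where "K \<in> FIN G" "\<forall>v\<in>carrier (hat G). v K = u K \<longrightarrow> h v = h u" ..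
  thus thesis by (intro that) auto
qed

lemma locconst_coord: "K \<in> FIN G \<Longrightarrow> locconst G (\<lambda>u. u K)"
  by (auto simp: locconst_def)

lemma locconst_comp_any: "locconst G h \<Longrightarrow> locconst G (\<lambda>u. F (h u))"
  unfolding locconst_def by metis

lemma (in group) hat_eq_coarsen:
  assumes "u \<in> carrier (hat G)" "v \<in> carrier (hat G)" "K \<in> FIN G" "L \<in> FIN G" "K \<subseteq> L" "u K = v K"
  shows "u L = v L"
  using hat_coarsen assms hat_rep[OF assms(1,3)] by metis

lemma (in group) locconst_common:
  assumes "locconst G h" "locconst G k" "u \<in> carrier (hat G)"
  obtains K where "K \<in> FIN G"
    "\<And>v. v \<in> carrier (hat G) \<Longrightarrow> v K = u K \<Longrightarrow> h v = h u \<and> k v = k u"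
proof -
  obtain K where K: "K \<in> FIN G" "\<And>v. v \<in> carrier (hat G) \<Longrightarrow> v K = u K \<Longrightarrow> h v = h u"
    using locconstE[OF assms(1,3)] by blast
  obtain L where L: "L \<in> FIN G" "\<And>v. v \<in> carrier (hat G) \<Longrightarrow> v L = u L \<Longrightarrow> k v = k u"
    using locconstE[OF assms(2,3)] by blast
  have KL: "K \<inter> L \<in> FIN G" using K L FIN_Int by blast
  have "h v = h u \<and> k v = k u" if "v \<in> carrier (hat G)" "v (K \<inter> L) = u (K \<inter> L)" for v
    using K(2)[OF that(1)] L(2)[OF that(1)]
      hat_eq_coarsen[OF that(1) assms(3) KL K(1) _ that(2)]
      hat_eq_coarsen[OF that(1) assms(3) KL L(1) _ that(2)] by auto
  thus thesis using that KL by blast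
qed

text \<open>The image of \<open>eta\<close> is dense: at a level \<open>K\<close> where both
  functions are constant near \<open>u\<close>, some \<open>eta G g\<close> has the same coordinate
  as \<open>u\<close>.\<close>

lemma (in group) locconst_eqI:
  assumes "locconst G h" "locconst G k" "u \<in> carrier (hat G)"
    and "\<And>g. g \<in> carrier G \<Longrightarrow> h (eta G g) = k (eta G g)"
  shows "h u = k u"
proof -
  obtain K where K: "K \<in> FIN G"
    "\<And>v. v \<in> carrier (hat G) \<Longrightarrow> v K = u K \<Longrightarrow> h v = h u \<and> k v = k u"
    using locconst_common[OF assms(1-3)] by blast
  obtain g where "g \<in> carrier G" "u K = eta G g K" using eta_dense[OF assms(3) K(1)] by blast
  thus ?thesis using K(2)[of "eta G g"] assms(4)[of g] eta_closed by auto
qed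

text \<open>Continuity only provides some unspecified level \<open>L\<close>. Passing to
  \<open>K \<inter> L\<close> and using that \<open>h\<close> kills \<open>K\<close> shows that the
  value is already determined at the prescribed level \<open>K\<close>.\<close>

lemma (in group) locconst_factor:
  assumes "group Q" "h \<in> hom (hat G) Q" "locconst G h" "K \<in> FIN G"
    and triv: "\<And>k. k \<in> K \<Longrightarrow> h (eta G k) = \<one>\<^bsub>Q\<^esub>"
    and u: "u \<in> carrier (hat G)" and g: "g \<in> carrier G" "u K = K #> g"
  shows "h u = h (eta G g)"
proof -
  interpret Q: group Q by fact
  obtain L where L: "L \<in> FIN G" "\<And>v. v \<in> carrier (hat G) \<Longrightarrow> v L = u L \<Longrightarrow> h v = h u"
    using locconstE[OF assms(3) u] by blast
  have KL: "K \<inter> L \<in> FIN G" using assms(4) L FIN_Int by blast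
  obtain g' where g': "g' \<in> carrier G" "u (K \<inter> L) = K \<inter> L #> g'" using hat_rep[OF u KL] by blast
  have "u L = L #> g'" using hat_coarsen[OF u KL L(1) _ g'] by simp
  hence hu: "h u = h (eta G g')" using L(2)[of "eta G g'"] eta_closed g' L(1) by (simp add: eta_coord)
  have "K #> g' = K #> g" using hat_coarsen[OF u KL assms(4) _ g'] g(2) by simp
  hence "g' \<in> K #> g" using rcos_self[OF g'(1) FIN_subgroup[OF assms(4)]] by simp
  then obtain k where k: "k \<in> K" "g' = k \<otimes> g" by (auto simp: r_coset_def)
  have kc: "k \<in> carrier G" using k FIN_subset[OF assms(4)] by auto
  have "h (eta G g') = h (eta G k) \<otimes>\<^bsub>Q\<^esub> h (eta G g)"
    using hom_mult[OF eta_hom kc g(1)] hom_mult[OF assms(2), of "eta G k" "eta G g"]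
    by (simp add: k(2) kc g eta_closed)
  also have "\<dots> = h (eta G g)" using triv[OF k(1)] hom_in_carrier[OF assms(2)] eta_closed g(1) by simp
  finally show ?thesis using hu by simp
qed

section \<open>Continuous homomorphisms between completions\<close>

text \<open>Continuity into an inverse limit can be tested on each coordinate;
  \<open>chom_iff_continuous\<close> identifies the result with continuity for the profinite
  topologies.\<close>

definition chom :: "('a, 'm) monoid_scheme \<Rightarrow> ('b, 'n) monoid_scheme \<Rightarrow> (('a set \<Rightarrow> 'a set) \<Rightarrow> 'b set \<Rightarrow> 'b set) \<Rightarrow> bool"
  where "chom G H h \<longleftrightarrow> h \<in> hom (hat G) (hat H) \<and> (\<forall>L\<in>FIN H. locconst G (\<lambda>u. h u L))"

lemma chom_hom: "chom G H h \<Longrightarrow> h \<in> hom (hat G) (hat H)"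
  by (simp add: chom_def)

lemma chom_closed: "chom G H h \<Longrightarrow> u \<in> carrier (hat G) \<Longrightarrow> h u \<in> carrier (hat H)"
  by (rule hom_in_carrier[OF chom_hom])

lemma chom_mult: "chom G H h \<Longrightarrow> u \<in> carrier (hat G) \<Longrightarrow> v \<in> carrier (hat G) \<Longrightarrow>
    h (u \<otimes>\<^bsub>hat G\<^esub> v) = h u \<otimes>\<^bsub>hat H\<^esub> h v"
  by (simp add: chom_def hom_mult)

lemma chom_group_hom: "group G \<Longrightarrow> group H \<Longrightarrow> chom G H h \<Longrightarrow> group_hom (hat G) (hat H) h"
  by (simp add: group_hom_def group_hom_axioms_def group.hat_group chom_hom)

lemma chom_inv: "group G \<Longrightarrow> group H \<Longrightarrow> chom G H h \<Longrightarrow> u \<in> carrier (hat G) \<Longrightarrow>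
    h (inv\<^bsub>hat G\<^esub> u) = inv\<^bsub>hat H\<^esub> (h u)"
  by (rule group_hom.hom_inv[OF chom_group_hom])

lemma chom_one: "group G \<Longrightarrow> group H \<Longrightarrow> chom G H h \<Longrightarrow> h \<one>\<^bsub>hat G\<^esub> = \<one>\<^bsub>hat H\<^esub>"
  by (rule group_hom.hom_one[OF chom_group_hom])

lemma chom_locconst: "chom G H h \<Longrightarrow> L \<in> FIN H \<Longrightarrow> locconst G (\<lambda>u. h u L)"
  by (simp add: chom_def)

lemma chom_locconst_comp:
  assumes "chom G H h" "locconst H k" shows "locconst G (\<lambda>u. k (h u))"
  unfolding locconst_def
proof
  fix u assume u: "u \<in> carrier (hat G)"
  obtain L where L: "L \<in> FIN H" "\<And>v. v \<in> carrier (hat H) \<Longrightarrow> v L = h u L \<Longrightarrow> k v = k (h u)"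
    using locconstE[OF assms(2) chom_closed[OF assms(1) u]] by blast
  obtain K where K: "K \<in> FIN G" "\<And>v. v \<in> carrier (hat G) \<Longrightarrow> v K = u K \<Longrightarrow> h v L = h u L"
    using locconstE[OF chom_locconst[OF assms(1) L(1)] u] by blast
  thus "\<exists>K\<in>FIN G. \<forall>v\<in>carrier (hat G). v K = u K \<longrightarrow> k (h v) = k (h u)"
    by (intro bexI[OF _ K(1)] ballI impI L(2) chom_closed[OF assms(1)] K(2))
qed

lemma chom_comp: "chom G H h \<Longrightarrow> chom H J k \<Longrightarrow> chom G J (\<lambda>u. k (h u))"
  unfolding chom_def[of G J]
  using hom_comp[OF chom_hom chom_hom, of G H h J k] chom_locconst_comp[of G H h] chom_locconst[of H J k]
  by auto

lemma chom_id: "chom G G (\<lambda>u. u)"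
  by (simp add: chom_def hom_def locconst_coord)

lemma hom_eq_on_generate:
  assumes "group G" "group H" "h \<in> hom G H" "k \<in> hom G H" "S \<subseteq> carrier G"
    and "\<And>s. s \<in> S \<Longrightarrow> h s = k s" "g \<in> generate G S"
  shows "h g = k g"
proof -
  interpret h: group_hom G H h using assms by (simp add: group_hom_def group_hom_axioms_def)
  interpret k: group_hom G H k using assms by (simp add: group_hom_def group_hom_axioms_def)
  have gc: "x \<in> carrier G" if "x \<in> generate G S" for x
    using h.G.generate_in_carrier[OF assms(5) that] .
  show ?thesis using assms(7)
  proof (induction rule: generate.induct)
    case (inv s)
    thus ?case using assms(5,6) h.hom_inv[of s] k.hom_inv[of s] by auto
  qed (use assms gc in auto)
qed

text \<open>Agreement on generators gives agreement on the dense image of \<open>G\<close>, hence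
  everywhere. Most identities between endomorphisms of completions below are verified in this
  way.\<close>

lemma (in group) chom_eqI:
  assumes "group H" "chom G H h" "chom G H k" "S \<subseteq> carrier G" "generate G S = carrier G"
    and eq: "\<And>s. s \<in> S \<Longrightarrow> h (eta G s) = k (eta G s)" and u: "u \<in> carrier (hat G)"
  shows "h u = k u"
proof -
  interpret H: group H by fact
  have "h (eta G g) = k (eta G g)" if "g \<in> carrier G" for g
    using hom_eq_on_generate[of G "hat H" "\<lambda>g. h (eta G g)" "\<lambda>g. k (eta G g)" S g]
      hom_comp[OF eta_hom chom_hom[OF assms(2)]] hom_comp[OF eta_hom chom_hom[OF assms(3)]]
      H.hat_group that assms(4,5) eq is_group by simp
  thus ?thesis
    using locconst_eqI[OF chom_locconst[OF assms(2)] chom_locconst[OF assms(3)] u]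
    by (intro hat_ext[OF chom_closed[OF assms(2) u] chom_closed[OF assms(3) u]]) auto
qed

lemma (in group) chom_conj:
  assumes "group H" "chom G H h" "w \<in> carrier (hat H)"
  shows "chom G H (\<lambda>u. inv\<^bsub>hat H\<^esub> w \<otimes>\<^bsub>hat H\<^esub> h u \<otimes>\<^bsub>hat H\<^esub> w)"
proof -
  interpret H: group H by fact
  interpret HH: group "hat H" by (rule H.hat_group)
  have c: "\<And>u. u \<in> carrier (hat G) \<Longrightarrow> h u \<in> carrier (hat H)" using chom_closed[OF assms(2)] .
  have "(\<lambda>u. inv\<^bsub>hat H\<^esub> w \<otimes>\<^bsub>hat H\<^esub> h u \<otimes>\<^bsub>hat H\<^esub> w) \<in> hom (hat G) (hat H)"
  proof (rule homI)
    fix u v assume uv: "u \<in> carrier (hat G)" "v \<in> carrier (hat G)"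
    show "inv\<^bsub>hat H\<^esub> w \<otimes>\<^bsub>hat H\<^esub> h (u \<otimes>\<^bsub>hat G\<^esub> v) \<otimes>\<^bsub>hat H\<^esub> w =
      (inv\<^bsub>hat H\<^esub> w \<otimes>\<^bsub>hat H\<^esub> h u \<otimes>\<^bsub>hat H\<^esub> w) \<otimes>\<^bsub>hat H\<^esub> (inv\<^bsub>hat H\<^esub> w \<otimes>\<^bsub>hat H\<^esub> h v \<otimes>\<^bsub>hat H\<^esub> w)"
      using uv c assms(3) HH.conj_mult[of w "h u" "h v"] by (simp add: chom_mult[OF assms(2)])
  qed (use c assms(3) in auto)
  moreover have "locconst G (\<lambda>u. (inv\<^bsub>hat H\<^esub> w \<otimes>\<^bsub>hat H\<^esub> h u \<otimes>\<^bsub>hat H\<^esub> w) L)" if L: "L \<in> FIN H" for L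
    using locconst_comp_any[OF chom_locconst[OF assms(2) L],
       of "\<lambda>X. (inv\<^bsub>hat H\<^esub> w) L <#>\<^bsub>H\<^esub> X <#>\<^bsub>H\<^esub> w L"] L by (simp add: hat_mult)
  ultimately show ?thesis by (simp add: chom_def)
qed

section \<open>Extension of homomorphisms by continuity\<close>

text \<open>For \<open>\<phi>\<close> with finite image, all elements of the coset that
  \<open>u\<close> has at the kernel of \<open>\<phi>\<close> have the same value, so the choice
  made by \<open>SOME\<close> is immaterial.\<close>

definition lim_ext :: "('a, 'm) monoid_scheme \<Rightarrow> ('b, 'n) monoid_scheme \<Rightarrow> ('a \<Rightarrow> 'b) \<Rightarrow> ('a set \<Rightarrow> 'a set) \<Rightarrow> 'b" where
  "lim_ext G Q \<phi> u = \<phi> (SOME g. g \<in> u {g \<in> carrier G. \<phi> g = \<one>\<^bsub>Q\<^esub>})"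

lemma (in group) hom_const_on_coset:
  assumes "group Q" "\<phi> \<in> hom G Q" "\<And>k. k \<in> K \<Longrightarrow> \<phi> k = \<one>\<^bsub>Q\<^esub>" "K \<subseteq> carrier G" "g \<in> carrier G" "x \<in> K #> g"
  shows "\<phi> x = \<phi> g"
proof -
  interpret Q: group Q by fact
  obtain k where k: "k \<in> K" "x = k \<otimes> g" using assms(6) by (auto simp: r_coset_def)
  hence "\<phi> x = \<phi> k \<otimes>\<^bsub>Q\<^esub> \<phi> g" using hom_mult[OF assms(2)] assms(4,5) by blast
  thus ?thesis using assms(3)[OF k(1)] hom_in_carrier[OF assms(2,5)] by simp
qed

text \<open>The kernel in the definition may be replaced by any smaller \<open>K\<close>; this
  allows two coordinates of an extension to be computed from one representative.\<close>

lemma (in group) lim_ext_eq: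
  assumes "group Q" "\<phi> \<in> hom G Q" "finite (\<phi> ` carrier G)" "u \<in> carrier (hat G)"
    "g \<in> carrier G" "K \<in> FIN G" "\<And>k. k \<in> K \<Longrightarrow> \<phi> k = \<one>\<^bsub>Q\<^esub>" "u K = K #> g"
  shows "lim_ext G Q \<phi> u = \<phi> g"
proof -
  let ?L = "{g \<in> carrier G. \<phi> g = \<one>\<^bsub>Q\<^esub>}"
  have L: "?L \<in> FIN G" by (rule FIN_kernel[OF is_group assms(1-3)])
  have "K \<subseteq> ?L" using assms(7) FIN_subset[OF assms(6)] by auto
  hence uL: "u ?L = ?L #> g" using hat_coarsen[OF assms(4,6) L _ assms(5,8)] by simp
  hence "(SOME g. g \<in> u ?L) \<in> ?L #> g"
    using rcos_self[OF assms(5) FIN_subgroup[OF L]] someI[of "\<lambda>g. g \<in> u ?L" g] by simp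
  thus ?thesis unfolding lim_ext_def
    by (rule hom_const_on_coset[OF assms(1,2), rotated -1]) (use assms in auto)
qed

lemma (in group) lim_ext_props:
  assumes "group Q" "\<phi> \<in> hom G Q" "finite (\<phi> ` carrier G)"
  shows "lim_ext G Q \<phi> \<in> hom (hat G) Q" "locconst G (lim_ext G Q \<phi>)"
    "g \<in> carrier G \<Longrightarrow> lim_ext G Q \<phi> (eta G g) = \<phi> g"
proof -
  let ?L = "{g \<in> carrier G. \<phi> g = \<one>\<^bsub>Q\<^esub>}"
  have L: "?L \<in> FIN G" by (rule FIN_kernel[OF is_group assms(1-3)])
  have e: "lim_ext G Q \<phi> u = \<phi> g" if "u \<in> carrier (hat G)" "g \<in> carrier G" "u ?L = ?L #> g" for u g
    by (rule lim_ext_eq[OF assms that(1,2) L _ that(3)]) simp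
  show "lim_ext G Q \<phi> \<in> hom (hat G) Q"
  proof (rule homI)
    fix u assume u: "u \<in> carrier (hat G)"
    obtain g where g: "g \<in> carrier G" "u ?L = ?L #> g" using hat_rep[OF u L] by blast
    show "lim_ext G Q \<phi> u \<in> carrier Q" using e[OF u g] hom_in_carrier[OF assms(2) g(1)] by simp
    fix v assume v: "v \<in> carrier (hat G)"
    obtain h where h: "h \<in> carrier G" "v ?L = ?L #> h" using hat_rep[OF v L] by blast
    have "(u \<otimes>\<^bsub>hat G\<^esub> v) ?L = ?L #> (g \<otimes> h)" using g h L by (simp add: hat_mult FIN_coset_mult)
    thus "lim_ext G Q \<phi> (u \<otimes>\<^bsub>hat G\<^esub> v) = lim_ext G Q \<phi> u \<otimes>\<^bsub>Q\<^esub> lim_ext G Q \<phi> v"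
      using e[OF u g] e[OF v h] e[OF hat_mult_closed[OF u v], of "g \<otimes> h"] g h hom_mult[OF assms(2)] by simp
  qed
  show "locconst G (lim_ext G Q \<phi>)" unfolding locconst_def
    by (intro ballI bexI[OF _ L]) (simp add: lim_ext_def)
  show "lim_ext G Q \<phi> (eta G g) = \<phi> g" if "g \<in> carrier G"
    using e[OF eta_closed[OF that] that] L by (simp add: eta_coord)
qed

definition chom_ext :: "('a, 'm) monoid_scheme \<Rightarrow> ('b, 'n) monoid_scheme \<Rightarrow> ('a \<Rightarrow> 'b set \<Rightarrow> 'b set) \<Rightarrow> ('a set \<Rightarrow> 'a set) \<Rightarrow> 'b set \<Rightarrow> 'b set" where
  "chom_ext G H \<phi> = (\<lambda>u\<in>carrier (hat G). \<lambda>L\<in>FIN H. lim_ext G (H Mod L) (\<lambda>g. \<phi> g L) u)"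

lemma (in group) chom_ext:
  assumes H: "group H" and \<phi>: "\<phi> \<in> hom G (hat H)"
  shows "chom G H (chom_ext G H \<phi>)" "g \<in> carrier G \<Longrightarrow> chom_ext G H \<phi> (eta G g) = \<phi> g"
proof -
  interpret H: group H by fact
  interpret HH: group "hat H" by (rule H.hat_group)
  have \<phi>L: "(\<lambda>g. \<phi> g L) \<in> hom G (H Mod L)" if "L \<in> FIN H" for L
    by (rule hom_comp[OF \<phi> hat_coord_hom[OF that]])
  have fin: "finite ((\<lambda>g. \<phi> g L) ` carrier G)" if "L \<in> FIN H" for L
    by (rule finite_subset[OF _ FIN_quotient_finite[OF that]])
      (use hom_in_carrier[OF \<phi>L[OF that]] in auto)
  note ext = lim_ext_props[OF FIN_quotient_group \<phi>L fin]
  have cl: "chom_ext G H \<phi> u \<in> carrier (hat H)" if u: "u \<in> carrier (hat G)" for u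
  proof (rule H.hat_memI)
    fix L assume L: "L \<in> FIN H"
    show "chom_ext G H \<phi> u L \<in> carrier (H Mod L)"
      using hom_in_carrier[OF ext(1)[OF L L L] u] u L by (simp add: chom_ext_def)
  next
    fix L M assume LM: "L \<in> FIN H" "M \<in> FIN H" "L \<subseteq> M"
    let ?K = "\<lambda>L. {g \<in> carrier G. \<phi> g L = \<one>\<^bsub>H Mod L\<^esub>}"
    have K: "?K L \<in> FIN G" if "L \<in> FIN H" for L
      by (rule FIN_kernel[OF is_group FIN_quotient_group \<phi>L fin]) (use that in auto)
    have KK: "?K L \<inter> ?K M \<in> FIN G" using FIN_Int K LM by blast
    \<comment> \<open>A single \<open>g\<close>, taken at the intersection of the kernels for
      \<open>L\<close> and \<open>M\<close>, computes both coordinates, so that compatibility is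
      inherited from \<open>\<phi> g\<close>.\<close>
    obtain g where g: "g \<in> carrier G" "u (?K L \<inter> ?K M) = (?K L \<inter> ?K M) #> g" using hat_rep[OF u KK] by blast
    have "chom_ext G H \<phi> u L = \<phi> g L" "chom_ext G H \<phi> u M = \<phi> g M"
      using lim_ext_eq[OF FIN_quotient_group \<phi>L fin u g(1) KK _ g(2)] LM u by (auto simp: chom_ext_def)
    moreover obtain h where h: "h \<in> carrier H" "\<phi> g L = L #>\<^bsub>H\<^esub> h"
      using hat_rep[OF hom_in_carrier[OF \<phi> g(1)] LM(1)] by blast
    moreover have "\<phi> g M = M #>\<^bsub>H\<^esub> h" using H.hat_coarsen[OF hom_in_carrier[OF \<phi> g(1)] LM h] .
    ultimately show "\<exists>h\<in>carrier H. chom_ext G H \<phi> u L = L #>\<^bsub>H\<^esub> h \<and> chom_ext G H \<phi> u M = M #>\<^bsub>H\<^esub> h" by auto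
  qed (use u in \<open>simp add: chom_ext_def\<close>)
  have "chom_ext G H \<phi> \<in> hom (hat G) (hat H)"
  proof (rule homI)
    fix u v assume uv: "u \<in> carrier (hat G)" "v \<in> carrier (hat G)"
    show "chom_ext G H \<phi> (u \<otimes>\<^bsub>hat G\<^esub> v) = chom_ext G H \<phi> u \<otimes>\<^bsub>hat H\<^esub> chom_ext G H \<phi> v"
    proof (rule hat_ext)
      fix L assume L: "L \<in> FIN H"
      show "chom_ext G H \<phi> (u \<otimes>\<^bsub>hat G\<^esub> v) L = (chom_ext G H \<phi> u \<otimes>\<^bsub>hat H\<^esub> chom_ext G H \<phi> v) L"
        using hom_mult[OF ext(1)[OF L L L] uv] uv L hat_mult_closed[OF uv]
        by (simp add: chom_ext_def hat_mult[where G=H])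
    qed (use uv cl hat_mult_closed HH.m_closed in auto)
  qed (rule cl)
  moreover have "locconst G (\<lambda>u. chom_ext G H \<phi> u L)" if L: "L \<in> FIN H" for L
    using ext(2)[OF L L L] L by (simp add: chom_ext_def locconst_def)
  ultimately show "chom G H (chom_ext G H \<phi>)" by (simp add: chom_def)
  show "chom_ext G H \<phi> (eta G g) = \<phi> g" if g: "g \<in> carrier G"
  proof (rule hat_ext)
    fix L assume L: "L \<in> FIN H"
    show "chom_ext G H \<phi> (eta G g) L = \<phi> g L"
      using ext(3)[OF L L L g] L eta_closed[OF g] by (simp add: chom_ext_def)
  qed (use cl eta_closed g hom_in_carrier[OF \<phi>] in auto)
qed

text \<open>\<open>\<phi>\<close> maps the coset of \<open>g\<close> into the coset of
  \<open>\<phi> g\<close>, and the image contains \<open>\<phi> g\<close>; multiplying it by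
  \<open>L\<close> therefore fills out exactly one coset.\<close>

lemma (in group) completion_map_coord:
  assumes H: "group H" and \<phi>: "\<phi> \<in> hom G H" and L: "L \<in> FIN H"
    and g: "g \<in> carrier G" "u {g \<in> carrier G. \<phi> g \<in> L} = {g \<in> carrier G. \<phi> g \<in> L} #> g"
  shows "completion_map G H \<phi> u L = L #>\<^bsub>H\<^esub> \<phi> g"
proof -
  interpret H: group H by fact
  interpret L: normal L H using FIN_normal[OF L] .
  let ?K = "{g \<in> carrier G. \<phi> g \<in> L}"
  have c: "\<phi> g \<in> carrier H" using hom_in_carrier[OF \<phi> g(1)] .
  have "\<phi> x \<in> L #>\<^bsub>H\<^esub> \<phi> g" if "x \<in> ?K #> g" for x
    using that hom_mult[OF \<phi> _ g(1)] by (auto simp: r_coset_def)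
  moreover have "g \<in> ?K #> g" using rcos_self[OF g(1)] FIN_subgroup[OF FIN_preimage[OF is_group H \<phi> L]] by blast
  ultimately have "L <#>\<^bsub>H\<^esub> (\<phi> ` (?K #> g)) = L #>\<^bsub>H\<^esub> \<phi> g"
  proof (intro subset_antisym subsetI, goal_cases)
    case (1 z)
    then obtain l x where lx: "l \<in> L" "x \<in> ?K #> g" "z = l \<otimes>\<^bsub>H\<^esub> \<phi> x" by (auto simp: set_mult_def)
    then obtain l' where "l' \<in> L" "\<phi> x = l' \<otimes>\<^bsub>H\<^esub> \<phi> g" using 1(1) by (force simp: r_coset_def)
    thus ?case using lx c by (auto simp: r_coset_def H.m_assoc[symmetric] intro!: bexI[of _ "l \<otimes>\<^bsub>H\<^esub> l'"])
  next
    case (2 z)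
    then obtain l where "l \<in> L" "z = l \<otimes>\<^bsub>H\<^esub> \<phi> g" by (auto simp: r_coset_def)
    thus ?case using 2(2) unfolding set_mult_def by blast
  qed
  thus ?thesis using g L by (simp add: completion_map_def)
qed

text \<open>Links the concrete coset formula to extension by continuity, from which the homomorphism
  property and continuity are then inherited.\<close>

lemma (in group) completion_map_eq_ext:
  assumes H: "group H" and \<phi>: "\<phi> \<in> hom G H" and u: "u \<in> carrier (hat G)"
  shows "completion_map G H \<phi> u = chom_ext G H (\<lambda>g. eta H (\<phi> g)) u"
proof
  fix L
  interpret H: group H by fact
  have h: "(\<lambda>g. eta H (\<phi> g)) \<in> hom G (hat H)" by (rule hom_comp[OF \<phi> H.eta_hom])
  show "completion_map G H \<phi> u L = chom_ext G H (\<lambda>g. eta H (\<phi> g)) u L"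
  proof (cases "L \<in> FIN H")
    case L: True
    let ?K = "{g \<in> carrier G. \<phi> g \<in> L}"
    have K: "?K \<in> FIN G" using FIN_preimage[OF is_group H \<phi> L] .
    obtain g where g: "g \<in> carrier G" "u ?K = ?K #> g" using hat_rep[OF u K] by blast
    have c: "L #>\<^bsub>H\<^esub> \<phi> g = L" if "g \<in> ?K" for g
      using H.coset_join2[OF hom_in_carrier[OF \<phi>] FIN_subgroup[OF L]] that by auto
    have \<phi>L: "(\<lambda>g. eta H (\<phi> g) L) \<in> hom G (H Mod L)"
      by (rule hom_comp[OF h hat_coord_hom[OF L]])
    have "lim_ext G (H Mod L) (\<lambda>g. eta H (\<phi> g) L) u = eta H (\<phi> g) L"
    proof (rule lim_ext_eq[OF FIN_quotient_group[OF L] \<phi>L _ u g(1) K _ g(2)])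
      show "finite ((\<lambda>g. eta H (\<phi> g) L) ` carrier G)"
        by (rule finite_subset[OF _ FIN_quotient_finite[OF L]]) (use hom_in_carrier[OF \<phi>L] in auto)
    qed (use c L in \<open>auto simp: eta_coord\<close>)
    thus ?thesis using completion_map_coord[of H \<phi> L g u] H \<phi> g L u by (simp add: chom_ext_def eta_coord)
  qed (use u in \<open>simp add: completion_map_def chom_ext_def\<close>)
qed

lemma locconst_cong: "(\<And>u. u \<in> carrier (hat G) \<Longrightarrow> h u = k u) \<Longrightarrow> locconst G h \<longleftrightarrow> locconst G k"
  by (simp add: locconst_def cong: ball_cong)

lemma chom_cong:
  assumes "group G" "\<And>u. u \<in> carrier (hat G) \<Longrightarrow> h u = k u" shows "chom G H h \<longleftrightarrow> chom G H k"
proof -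
  have "locconst G (\<lambda>u. h u L) \<longleftrightarrow> locconst G (\<lambda>u. k u L)" for L
    by (rule locconst_cong) (simp add: assms)
  moreover have "h \<in> hom (hat G) (hat H) \<longleftrightarrow> k \<in> hom (hat G) (hat H)"
    using assms group.hat_mult_closed[OF assms(1)] by (auto simp: hom_def Pi_iff)
  ultimately show ?thesis by (simp add: chom_def)
qed

lemma (in group) completion_map:
  assumes H: "group H" and \<phi>: "\<phi> \<in> hom G H"
  shows "chom G H (completion_map G H \<phi>)" "g \<in> carrier G \<Longrightarrow> completion_map G H \<phi> (eta G g) = eta H (\<phi> g)"
proof -
  have h: "(\<lambda>g. eta H (\<phi> g)) \<in> hom G (hat H)"
    by (rule hom_comp[OF \<phi> group.eta_hom[OF H]])
  show "chom G H (completion_map G H \<phi>)"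
    using chom_cong[of G "completion_map G H \<phi>" "chom_ext G H (\<lambda>g. eta H (\<phi> g))" H]
      completion_map_eq_ext[OF H \<phi>] chom_ext(1)[OF H h] is_group by simp
  show "g \<in> carrier G \<Longrightarrow> completion_map G H \<phi> (eta G g) = eta H (\<phi> g)"
    using completion_map_eq_ext[OF H \<phi>] chom_ext(2)[OF H h] eta_closed by simp
qed

section \<open>The profinite topology in terms of single coordinates\<close>

lemma (in group) carrier_FIN: "carrier G \<in> FIN G"
proof -
  have "(\<lambda>_. \<one>) \<in> hom G G" by (simp add: hom_def)
  moreover have "finite ((\<lambda>_. \<one>) ` carrier G)" by (rule finite_subset[of _ "{\<one>}"]) auto
  ultimately have "{g \<in> carrier G. \<one> = \<one>} \<in> FIN G" by (rule FIN_kernel[OF is_group is_group])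
  thus ?thesis by simp
qed

lemma (in group) FIN_lower_bound:
  assumes "finite J" "J \<subseteq> FIN G"
  shows "\<exists>K\<in>FIN G. \<forall>L\<in>J. K \<subseteq> L"
  using assms
proof (induction J rule: finite_induct)
  case empty thus ?case using carrier_FIN by blast
next
  case (insert L J)
  then obtain K where K: "K \<in> FIN G" "\<forall>L\<in>J. K \<subseteq> L" by auto
  have "K \<inter> L \<in> FIN G" using K insert FIN_Int by auto
  thus ?case using K(2) by (intro bexI[of _ "K \<inter> L"]) auto
qed

lemma topspace_profinite: "topspace (profinite_topology G) = carrier (hat G)"
proof -
  have "carrier (hat G) \<subseteq> (\<Pi>\<^sub>E K\<in>FIN G. carrier (G Mod K))"
  proof
    fix u assume u: "u \<in> carrier (hat G)"
    hence "u \<in> extensional (FIN G)" unfolding hat_mem by simp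
    thus "u \<in> (\<Pi>\<^sub>E K\<in>FIN G. carrier (G Mod K))"
      using hat_coord_closed[OF u] by (simp add: PiE_iff)
  qed
  thus ?thesis by (auto simp: profinite_topology_def topspace_subtopology)
qed

lemma openin_profinite_coord:
  assumes "K \<in> FIN G" shows "openin (profinite_topology G) {v \<in> carrier (hat G). v K \<in> {X}}"
proof (cases "X \<in> carrier (G Mod K)")
  case True
  have "continuous_map (profinite_topology G) (discrete_topology (carrier (G Mod K))) (\<lambda>v. v K)"
    unfolding profinite_topology_def
    by (intro continuous_map_from_subtopology continuous_map_product_projection assms)
  from openin_continuous_map_preimage[OF this, of "{X}"] True show ?thesis
    by (simp add: topspace_profinite)
next
  case False
  hence "{v \<in> carrier (hat G). v K \<in> {X}} = {}" using hat_coord_closed[OF _ assms] by auto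
  thus ?thesis by (simp only: openin_empty)
qed

lemma locconst_continuous:
  assumes "locconst G h" "\<And>u. u \<in> carrier (hat G) \<Longrightarrow> h u \<in> S"
  shows "continuous_map (profinite_topology G) (discrete_topology S) h"
  unfolding continuous_map_def
proof (intro conjI allI impI)
  show "h \<in> topspace (profinite_topology G) \<rightarrow> topspace (discrete_topology S)"
    using assms(2) by (simp add: topspace_profinite)
  fix U
  show "openin (profinite_topology G) {x \<in> topspace (profinite_topology G). h x \<in> U}"
  proof (subst openin_subopen, intro ballI)
    fix u assume "u \<in> {x \<in> topspace (profinite_topology G). h x \<in> U}"
    hence u: "u \<in> carrier (hat G)" "h u \<in> U" by (auto simp: topspace_profinite)
    obtain K where K: "K \<in> FIN G" "\<And>v. v \<in> carrier (hat G) \<Longrightarrow> v K = u K \<Longrightarrow> h v = h u"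
      using locconstE[OF assms(1) u(1)] by metis
    have "{v \<in> carrier (hat G). v K \<in> {u K}} \<subseteq> {x \<in> topspace (profinite_topology G). h x \<in> U}"
      using K(2) u(2) by (auto simp: topspace_profinite)
    thus "\<exists>T. openin (profinite_topology G) T \<and> u \<in> T \<and> T \<subseteq> {x \<in> topspace (profinite_topology G). h x \<in> U}"
      using openin_profinite_coord[OF K(1), of "u K"] u(1)
      by (intro exI[of _ "{v \<in> carrier (hat G). v K \<in> {u K}}"]) simp
  qed
qed

text \<open>A basic open set of the product topology restricts finitely many coordinates, and
  \<open>FIN_lower_bound\<close> replaces them by one finer coordinate.\<close>

lemma (in group) continuous_locconst:
  assumes "continuous_map (profinite_topology G) (discrete_topology S) h"
  shows "locconst G h"
  unfolding locconst_def
proof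
  fix u assume u: "u \<in> carrier (hat G)"
  let ?P = "product_topology (\<lambda>K. discrete_topology (carrier (G Mod K))) (FIN G)"
  have "h u \<in> S" using assms u by (auto simp: continuous_map_def topspace_profinite Pi_iff)
  hence "openin (profinite_topology G) {v \<in> carrier (hat G). h v \<in> {h u}}"
    using openin_continuous_map_preimage[OF assms, of "{h u}"] by (simp add: topspace_profinite)
  then obtain T where T: "openin ?P T" "{v \<in> carrier (hat G). h v \<in> {h u}} = T \<inter> carrier (hat G)"
    by (auto simp: profinite_topology_def openin_subtopology)
  have "u \<in> T" using T(2) u by blast
  with T(1) obtain U where U: "finite {K \<in> FIN G. U K \<noteq> carrier (G Mod K)}" "u \<in> Pi\<^sub>E (FIN G) U" "Pi\<^sub>E (FIN G) U \<subseteq> T"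
    by (force simp: openin_product_topology_alt)
  obtain K where K: "K \<in> FIN G" "\<forall>L\<in>{K \<in> FIN G. U K \<noteq> carrier (G Mod K)}. K \<subseteq> L"
    using FIN_lower_bound[OF U(1)] by auto
  have "h v = h u" if v: "v \<in> carrier (hat G)" "v K = u K" for v
  proof -
    have "v L \<in> U L" if L: "L \<in> FIN G" for L
    proof (cases "U L = carrier (G Mod L)")
      case True thus ?thesis using hat_coord_closed[OF v(1) L] by simp
    next
      case False
      hence "v L = u L" using K L by (intro hat_eq_coarsen[OF v(1) u K(1) L _ v(2)]) simp
      thus ?thesis using U(2) L by (simp add: PiE_iff)
    qed
    moreover have "v \<in> extensional (FIN G)" using v(1) by (simp add: hat_mem)
    ultimately have "v \<in> T" using U(3) by (auto simp: PiE_iff subset_iff)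
    hence "v \<in> {v \<in> carrier (hat G). h v \<in> {h u}}" using T(2) v(1) by simp
    thus ?thesis by simp
  qed
  thus "\<exists>K\<in>FIN G. \<forall>v\<in>carrier (hat G). v K = u K \<longrightarrow> h v = h u"
    by (intro bexI[OF _ K(1)]) simp
qed

text \<open>Brings the topological clause in the definition of \<open>F2hat_endo\<close> into the
  language of coordinates.\<close>

lemma (in group) chom_iff_continuous:
  "chom G H h \<longleftrightarrow> h \<in> hom (hat G) (hat H) \<and> continuous_map (profinite_topology G) (profinite_topology H) h"
  unfolding chom_def
proof (rule conj_cong[OF HOL.refl])
  assume h: "h \<in> hom (hat G) (hat H)"
  have c: "h u \<in> carrier (hat H)" if "u \<in> carrier (hat G)" for u using hom_in_carrier[OF h that] .
  hence "continuous_map (profinite_topology G) (profinite_topology H) h \<longleftrightarrow>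
    (\<forall>L\<in>FIN H. continuous_map (profinite_topology G) (discrete_topology (carrier (H Mod L))) (\<lambda>u. h u L))"
    unfolding profinite_topology_def[of H] continuous_map_in_subtopology continuous_map_componentwise
    by (auto simp: topspace_profinite hat_mem)
  also have "\<dots> \<longleftrightarrow> (\<forall>L\<in>FIN H. locconst G (\<lambda>u. h u L))"
    using locconst_continuous[OF _ hat_coord_closed[OF c]] continuous_locconst by (intro ball_cong) auto
  finally show "(\<forall>L\<in>FIN H. locconst G (\<lambda>u. h u L)) = continuous_map (profinite_topology G) (profinite_topology H) h" ..
qed

text \<open>Uniform continuity: followed by the projection to the finite group \<open>H/L\<close>,
  \<open>h\<close> becomes a homomorphism that kills \<open>K\<close>, so the same level
  \<open>K\<close> serves all \<open>u\<close>.\<close>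

lemma (in group) chom_coord_factor:
  assumes "group H" "chom G H h" "L \<in> FIN H"
  defines "K \<equiv> {g \<in> carrier G. h (eta G g) L = L}"
  shows "K \<in> FIN G"
    "u \<in> carrier (hat G) \<Longrightarrow> v \<in> carrier (hat G) \<Longrightarrow> u K = v K \<Longrightarrow> h u L = h v L"
proof -
  interpret H: group H by fact
  have hL: "(\<lambda>u. h u L) \<in> hom (hat G) (H Mod L)"
    by (rule hom_comp[OF chom_hom[OF assms(2)] hat_coord_hom[OF assms(3)]])
  have gL: "(\<lambda>g. h (eta G g) L) \<in> hom G (H Mod L)" by (rule hom_comp[OF eta_hom hL])
  have "finite ((\<lambda>g. h (eta G g) L) ` carrier G)"
    by (rule finite_subset[OF _ FIN_quotient_finite[OF assms(3)]]) (use hom_in_carrier[OF gL] in auto)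
  from FIN_kernel[OF is_group FIN_quotient_group[OF assms(3)] gL this]
  show K: "K \<in> FIN G" by (simp add: K_def)
  assume uv: "u \<in> carrier (hat G)" "v \<in> carrier (hat G)" "u K = v K"
  obtain g where g: "g \<in> carrier G" "u K = K #> g" using hat_rep[OF uv(1) K] by blast
  note f = locconst_factor[OF FIN_quotient_group[OF assms(3)] hL chom_locconst[OF assms(2,3)] K]
  show "h u L = h v L"
    using f[OF _ uv(1) g] f[OF _ uv(2) g(1)] g(2) uv(3) by (simp add: K_def)
qed

subsection \<open>Profinite integers and exponents\<close>

lemma Zhat_range: "a \<in> carrier Zhat \<Longrightarrow> n > 0 \<Longrightarrow> a n mod int n = a n"
  by (auto simp: Zhat_def PiE_iff)

lemma Zhat_dvd: "a \<in> carrier Zhat \<Longrightarrow> n > 0 \<Longrightarrow> k > 0 \<Longrightarrow> k dvd n \<Longrightarrow> a n mod int k = a k"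
  by (auto simp: Zhat_def)

lemma Zhat_coord:
  "n > 0 \<Longrightarrow> (a \<oplus>\<^bsub>Zhat\<^esub> b) n = (a n + b n) mod int n"
  "n > 0 \<Longrightarrow> (a \<otimes>\<^bsub>Zhat\<^esub> b) n = (a n * b n) mod int n"
  "n > 0 \<Longrightarrow> \<one>\<^bsub>Zhat\<^esub> n = 1 mod int n" "n > 0 \<Longrightarrow> \<zero>\<^bsub>Zhat\<^esub> n = 0"
  by (simp_all add: Zhat_def)

lemma Zhat_eqI: "a \<in> carrier Zhat \<Longrightarrow> b \<in> carrier Zhat \<Longrightarrow> (\<And>n. n > 0 \<Longrightarrow> a n = b n) \<Longrightarrow> a = b"
  by (auto simp: Zhat_def PiE_iff intro: extensionalityI)

lemma Zhat_memI:
  assumes "a \<in> extensional {0<..}" "\<And>n. n > 0 \<Longrightarrow> a n mod int n = a n"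
    "\<And>n k. n > 0 \<Longrightarrow> k > 0 \<Longrightarrow> k dvd n \<Longrightarrow> a n mod int k = a k"
  shows "a \<in> carrier Zhat"
proof -
  have "0 \<le> a n \<and> a n < int n" if "n > 0" for n
    using assms(2)[OF that] that by (metis of_nat_0_less_iff pos_mod_bound pos_mod_sign)
  thus ?thesis using assms(1,3) by (auto simp: Zhat_def PiE_iff)
qed

lemma Zhat_closed:
  shows "a \<in> carrier Zhat \<Longrightarrow> b \<in> carrier Zhat \<Longrightarrow> a \<oplus>\<^bsub>Zhat\<^esub> b \<in> carrier Zhat"
    "a \<in> carrier Zhat \<Longrightarrow> b \<in> carrier Zhat \<Longrightarrow> a \<otimes>\<^bsub>Zhat\<^esub> b \<in> carrier Zhat"
    "\<one>\<^bsub>Zhat\<^esub> \<in> carrier Zhat" "\<zero>\<^bsub>Zhat\<^esub> \<in> carrier Zhat"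
proof -
  have m: "x mod int n mod int k = x mod int k" if "k dvd n" for x n k
    using that by (simp add: mod_mod_cancel)
  show "a \<oplus>\<^bsub>Zhat\<^esub> b \<in> carrier Zhat" if "a \<in> carrier Zhat" "b \<in> carrier Zhat"
  proof (rule Zhat_memI)
    show "(a \<oplus>\<^bsub>Zhat\<^esub> b) n mod int k = (a \<oplus>\<^bsub>Zhat\<^esub> b) k" if "n > 0" "k > 0" "k dvd n" for n k
      using that Zhat_dvd[OF \<open>a \<in> carrier Zhat\<close> that] Zhat_dvd[OF \<open>b \<in> carrier Zhat\<close> that]
      by (simp add: Zhat_coord m) (metis mod_add_eq)
  qed (auto simp: Zhat_coord, simp add: Zhat_def)
  show "a \<otimes>\<^bsub>Zhat\<^esub> b \<in> carrier Zhat" if "a \<in> carrier Zhat" "b \<in> carrier Zhat"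
  proof (rule Zhat_memI)
    show "(a \<otimes>\<^bsub>Zhat\<^esub> b) n mod int k = (a \<otimes>\<^bsub>Zhat\<^esub> b) k" if "n > 0" "k > 0" "k dvd n" for n k
      using that Zhat_dvd[OF \<open>a \<in> carrier Zhat\<close> that] Zhat_dvd[OF \<open>b \<in> carrier Zhat\<close> that]
      by (simp add: Zhat_coord m) (metis mod_mult_eq)
  qed (auto simp: Zhat_coord, simp add: Zhat_def)
  show "\<one>\<^bsub>Zhat\<^esub> \<in> carrier Zhat"
    by (rule Zhat_memI) (auto simp: Zhat_coord m, simp add: Zhat_def)
  show "\<zero>\<^bsub>Zhat\<^esub> \<in> carrier Zhat"
    by (rule Zhat_memI) (auto simp: Zhat_coord m, simp add: Zhat_def)
qed

lemma (in group) int_pow_mod_order: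
  assumes "x \<in> carrier G" "order G dvd n"
  shows "x [^] (k mod int n) = x [^] k"
proof -
  have "int (ord x) dvd int n"
    using ord_dvd_group_order[OF assms(1)] assms(2) by (meson dvd_trans of_nat_dvd_iff)
  hence "int (ord x) dvd k - k mod int n" by (metis dvd_trans minus_mod_eq_mult_div dvd_triv_left)
  thus ?thesis using int_pow_eq[OF assms(1)] by simp
qed

lemma hat_int_pow_coord:
  assumes "group G" "u \<in> carrier (hat G)" "K \<in> FIN G"
  shows "(u [^]\<^bsub>hat G\<^esub> (k::int)) K = u K [^]\<^bsub>G Mod K\<^esub> k"
  using hom_int_pow[OF hat_coord_hom[OF assms(3)] assms(2) group.hat_group[OF assms(1)]
    FIN_quotient_group[OF assms(3)]] by simp

text \<open>The exponent may be read off modulo any positive multiple of the order of the quotient,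
  so powers in different quotients can be written with one common integer exponent.\<close>

lemma zhat_pow_coord:
  assumes "group G" "u \<in> carrier (hat G)" "a \<in> carrier Zhat" "K \<in> FIN G" "N > 0" "order (G Mod K) dvd N"
  shows "zhat_pow G u a K = (u [^]\<^bsub>hat G\<^esub> a N) K"
proof -
  let ?n = "order (G Mod K)"
  have "a ?n = a N mod int ?n" using Zhat_dvd[OF assms(3,5) FIN_order_pos[OF assms(4)] assms(6)] by simp
  thus ?thesis
    using group.int_pow_mod_order[OF FIN_quotient_group[OF assms(4)] hat_coord_closed[OF assms(2,4)], of ?n "a N"]
      hat_int_pow_coord[OF assms(1,2,4)] assms(4) by (simp add: zhat_pow_def)
qed

lemma (in group) zhat_pow_closed:
  assumes "u \<in> carrier (hat G)" "a \<in> carrier Zhat" shows "zhat_pow G u a \<in> carrier (hat G)"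
proof -
  interpret h: group "hat G" by (rule hat_group)
  show ?thesis
  proof (rule hat_memI)
    fix K L assume KL: "K \<in> FIN G" "L \<in> FIN G" "K \<subseteq> L"
    let ?N = "order (G Mod K) * order (G Mod L)"
    have N: "?N > 0" using FIN_order_pos KL by auto
    obtain g where g: "g \<in> carrier G" "(u [^]\<^bsub>hat G\<^esub> a ?N) K = K #> g"
      using hat_rep[OF h.int_pow_closed[OF assms(1)] KL(1)] by blast
    moreover have "(u [^]\<^bsub>hat G\<^esub> a ?N) L = L #> g"
      by (rule hat_coarsen[OF h.int_pow_closed[OF assms(1)] KL g])
    ultimately show "\<exists>g\<in>carrier G. zhat_pow G u a K = K #> g \<and> zhat_pow G u a L = L #> g"
      using zhat_pow_coord[OF is_group assms KL(1) N] zhat_pow_coord[OF is_group assms KL(2) N] by auto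
  next
    fix K assume K: "K \<in> FIN G"
    show "zhat_pow G u a K \<in> carrier (G Mod K)"
      using zhat_pow_coord[OF is_group assms K FIN_order_pos[OF K] dvd_refl]
        hat_coord_closed[OF h.int_pow_closed[OF assms(1)] K] by simp
  qed (simp add: zhat_pow_def)
qed

lemma (in group) zhat_pow_add:
  assumes "u \<in> carrier (hat G)" "a \<in> carrier Zhat" "b \<in> carrier Zhat"
  shows "zhat_pow G u (a \<oplus>\<^bsub>Zhat\<^esub> b) = zhat_pow G u a \<otimes>\<^bsub>hat G\<^esub> zhat_pow G u b"
proof (rule hat_ext)
  fix K assume K: "K \<in> FIN G"
  let ?n = "order (G Mod K)"
  interpret Q: group "G Mod K" by (rule FIN_quotient_group[OF K])
  show "zhat_pow G u (a \<oplus>\<^bsub>Zhat\<^esub> b) K = (zhat_pow G u a \<otimes>\<^bsub>hat G\<^esub> zhat_pow G u b) K"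
    using K Q.int_pow_mod_order[OF hat_coord_closed[OF assms(1) K], of ?n "a ?n + b ?n"]
      Q.int_pow_mult[OF hat_coord_closed[OF assms(1) K], of "a ?n" "b ?n"]
    by (simp add: zhat_pow_def hat_mult Zhat_coord FIN_order_pos)
qed (use assms zhat_pow_closed Zhat_closed hat_mult_closed in auto)

lemma (in group) zhat_pow_mult:
  assumes "u \<in> carrier (hat G)" "a \<in> carrier Zhat" "b \<in> carrier Zhat"
  shows "zhat_pow G u (a \<otimes>\<^bsub>Zhat\<^esub> b) = zhat_pow G (zhat_pow G u a) b"
proof (rule hat_ext)
  fix K assume K: "K \<in> FIN G"
  let ?n = "order (G Mod K)"
  interpret Q: group "G Mod K" by (rule FIN_quotient_group[OF K])
  show "zhat_pow G u (a \<otimes>\<^bsub>Zhat\<^esub> b) K = zhat_pow G (zhat_pow G u a) b K"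
    using K Q.int_pow_mod_order[OF hat_coord_closed[OF assms(1) K], of ?n "a ?n * b ?n"]
      Q.int_pow_pow[OF hat_coord_closed[OF assms(1) K], of "a ?n" "b ?n"]
    by (simp add: zhat_pow_def Zhat_coord FIN_order_pos)
qed (use assms zhat_pow_closed Zhat_closed in auto)

lemma (in group) zhat_pow_one:
  assumes "u \<in> carrier (hat G)" shows "zhat_pow G u \<one>\<^bsub>Zhat\<^esub> = u"
proof (rule hat_ext)
  fix K assume K: "K \<in> FIN G"
  let ?n = "order (G Mod K)"
  interpret Q: group "G Mod K" by (rule FIN_quotient_group[OF K])
  show "zhat_pow G u \<one>\<^bsub>Zhat\<^esub> K = u K"
    using K Q.int_pow_mod_order[OF hat_coord_closed[OF assms(1) K], of ?n 1] hat_coord_closed[OF assms(1) K]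
    by (simp add: zhat_pow_def Zhat_coord FIN_order_pos)
qed (use assms zhat_pow_closed Zhat_closed in auto)

lemma (in group) zhat_pow_zero: "zhat_pow G u \<zero>\<^bsub>Zhat\<^esub> = \<one>\<^bsub>hat G\<^esub>"
  by (simp add: zhat_pow_def Zhat_coord FIN_order_pos cong: restrict_cong)

lemma (in group) zhat_pow_mult_distrib:
  assumes "u \<in> carrier (hat G)" "v \<in> carrier (hat G)" "a \<in> carrier Zhat" "u \<otimes>\<^bsub>hat G\<^esub> v = v \<otimes>\<^bsub>hat G\<^esub> u"
  shows "zhat_pow G (u \<otimes>\<^bsub>hat G\<^esub> v) a = zhat_pow G u a \<otimes>\<^bsub>hat G\<^esub> zhat_pow G v a"
proof (rule hat_ext)
  fix K assume K: "K \<in> FIN G"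
  let ?n = "order (G Mod K)"
  interpret Q: group "G Mod K" by (rule FIN_quotient_group[OF K])
  have "(u \<otimes>\<^bsub>hat G\<^esub> v) K = (v \<otimes>\<^bsub>hat G\<^esub> u) K" using assms(4) by simp
  hence "u K \<otimes>\<^bsub>G Mod K\<^esub> v K = v K \<otimes>\<^bsub>G Mod K\<^esub> u K" using K by (simp add: hat_mult)
  from Q.int_pow_mult_distrib[OF this hat_coord_closed[OF assms(1) K] hat_coord_closed[OF assms(2) K], of "a ?n"]
  show "zhat_pow G (u \<otimes>\<^bsub>hat G\<^esub> v) a K = (zhat_pow G u a \<otimes>\<^bsub>hat G\<^esub> zhat_pow G v a) K"
    using K by (simp add: zhat_pow_def hat_mult)
qed (use assms zhat_pow_closed hat_mult_closed in auto)

text \<open>The powers on the two sides are defined through orders of different quotients. With the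
  product of the two orders as modulus both become powers with the same integer exponent.\<close>

lemma (in group) zhat_pow_chom:
  assumes H: "group H" and h: "chom G H h" and u: "u \<in> carrier (hat G)" and a: "a \<in> carrier Zhat"
  shows "h (zhat_pow G u a) = zhat_pow H (h u) a"
proof (rule hat_ext)
  interpret H: group H by fact
  interpret hG: group "hat G" by (rule hat_group)
  interpret hH: group "hat H" by (rule H.hat_group)
  show "h (zhat_pow G u a) \<in> carrier (hat H)" by (rule chom_closed[OF h zhat_pow_closed[OF u a]])
  show "zhat_pow H (h u) a \<in> carrier (hat H)" by (rule H.zhat_pow_closed[OF chom_closed[OF h u] a])
  fix L assume L: "L \<in> FIN H"
  note fac = chom_coord_factor[OF H h L]
  let ?K = "{g \<in> carrier G. h (eta G g) L = L}"
  let ?N = "order (G Mod ?K) * order (H Mod L)"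
  have N: "?N > 0" using FIN_order_pos[OF fac(1)] FIN_order_pos[OF L] by simp
  have "zhat_pow G u a ?K = (u [^]\<^bsub>hat G\<^esub> a ?N) ?K"
    by (rule zhat_pow_coord[OF is_group u a fac(1) N]) simp
  hence "h (zhat_pow G u a) L = h (u [^]\<^bsub>hat G\<^esub> a ?N) L"
    by (rule fac(2)[OF zhat_pow_closed[OF u a] hG.int_pow_closed[OF u]])
  also have "\<dots> = (h u [^]\<^bsub>hat H\<^esub> a ?N) L"
    using hom_int_pow[OF chom_hom[OF h] u hG.is_group hH.is_group, of "a ?N"] by simp
  also have "\<dots> = zhat_pow H (h u) a L"
    by (rule zhat_pow_coord[OF H chom_closed[OF h u] a L N, symmetric]) simp
  finally show "h (zhat_pow G u a) L = zhat_pow H (h u) a L" .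
qed

lemma (in group) zhat_pow_conj:
  assumes "u \<in> carrier (hat G)" "w \<in> carrier (hat G)" "a \<in> carrier Zhat"
  shows "zhat_pow G (inv\<^bsub>hat G\<^esub> w \<otimes>\<^bsub>hat G\<^esub> u \<otimes>\<^bsub>hat G\<^esub> w) a = inv\<^bsub>hat G\<^esub> w \<otimes>\<^bsub>hat G\<^esub> zhat_pow G u a \<otimes>\<^bsub>hat G\<^esub> w"
  using zhat_pow_chom[OF is_group chom_conj[OF is_group chom_id assms(2)] assms(1,3)] by simp

lemma (in group) zhat_pow_inv:
  assumes "u \<in> carrier (hat G)" "a \<in> carrier Zhat"
  shows "zhat_pow G (inv\<^bsub>hat G\<^esub> u) a = inv\<^bsub>hat G\<^esub> (zhat_pow G u a)"
proof -
  interpret hG: group "hat G" by (rule hat_group)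
  have iu: "inv\<^bsub>hat G\<^esub> u \<in> carrier (hat G)" using assms by simp
  have "zhat_pow G \<one>\<^bsub>hat G\<^esub> a = \<one>\<^bsub>hat G\<^esub>"
  proof (rule hat_ext[OF zhat_pow_closed[OF hG.one_closed assms(2)] hG.one_closed])
    fix K assume K: "K \<in> FIN G"
    interpret Q: group "G Mod K" by (rule FIN_quotient_group[OF K])
    show "zhat_pow G \<one>\<^bsub>hat G\<^esub> a K = \<one>\<^bsub>hat G\<^esub> K"
      using K Q.int_pow_one[of "a (order (G Mod K))"] by (simp add: zhat_pow_def)
  qed
  hence "zhat_pow G (inv\<^bsub>hat G\<^esub> u) a \<otimes>\<^bsub>hat G\<^esub> zhat_pow G u a = \<one>\<^bsub>hat G\<^esub>"
    using zhat_pow_mult_distrib[OF iu assms(1,2)] assms(1) hG.l_inv[OF assms(1)] hG.r_inv[OF assms(1)] by (simp del: hat_one)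
  thus ?thesis using hG.inv_equality zhat_pow_closed assms iu by metis
qed

section \<open>Words and braid groups\<close>

fun letter_val :: "('a, 'm) monoid_scheme \<Rightarrow> (nat \<Rightarrow> 'a) \<Rightarrow> nat \<times> bool \<Rightarrow> 'a" where
  "letter_val G s (i, b) = (if b then s i else inv\<^bsub>G\<^esub> s i)"

definition word_val :: "('a, 'm) monoid_scheme \<Rightarrow> (nat \<Rightarrow> 'a) \<Rightarrow> (nat \<times> bool) list \<Rightarrow> 'a" where
  "word_val G s w = foldr (\<lambda>l u. letter_val G s l \<otimes>\<^bsub>G\<^esub> u) w \<one>\<^bsub>G\<^esub>"

lemma word_val_simps [simp]:
  "word_val G s [] = \<one>\<^bsub>G\<^esub>" "word_val G s (l # w) = letter_val G s l \<otimes>\<^bsub>G\<^esub> word_val G s w"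
  by (simp_all add: word_val_def)

lemma (in group) letter_val_closed: "s ` I \<subseteq> carrier G \<Longrightarrow> l \<in> I \<times> UNIV \<Longrightarrow> letter_val G s l \<in> carrier G"
  by (cases l) auto

lemma (in group) word_val_closed:
  "s ` I \<subseteq> carrier G \<Longrightarrow> w \<in> lists (I \<times> UNIV) \<Longrightarrow> word_val G s w \<in> carrier G"
  by (induction w) (simp_all add: letter_val_closed[of s I] del: letter_val.simps)

lemma (in group) word_val_append:
  "s ` I \<subseteq> carrier G \<Longrightarrow> u \<in> lists (I \<times> UNIV) \<Longrightarrow> v \<in> lists (I \<times> UNIV) \<Longrightarrow>
    word_val G s (u @ v) = word_val G s u \<otimes> word_val G s v"
  by (induction u) (simp_all add: letter_val_closed[of s I] word_val_closed[of s I] m_assoc del: letter_val.simps)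

definition word_inv :: "(nat \<times> bool) list \<Rightarrow> (nat \<times> bool) list" where
  "word_inv w = rev (map (\<lambda>(i, b). (i, \<not> b)) w)"

lemma word_inv_lists: "w \<in> lists (I \<times> UNIV) \<Longrightarrow> word_inv w \<in> lists (I \<times> UNIV)"
  by (fastforce simp: word_inv_def in_lists_conv_set)

lemma (in group) word_val_inv:
  assumes "s ` I \<subseteq> carrier G" "w \<in> lists (I \<times> UNIV)"
  shows "word_val G s (word_inv w) = inv (word_val G s w)"
  using assms(2)
proof (induction w)
  case (Cons l w)
  obtain i b where l: "l = (i, b)" by (cases l)
  have i: "s i \<in> carrier G" using Cons(1) assms(1) l by auto
  have "word_val G s (word_inv w @ [(i, \<not> b)]) = word_val G s (word_inv w) \<otimes> word_val G s [(i, \<not> b)]"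
    using Cons l by (intro word_val_append[OF assms(1) word_inv_lists]) auto
  thus ?case using Cons l i word_val_closed[OF assms(1), of w] by (auto simp: word_inv_def inv_mult_group)
qed (simp add: word_inv_def)

lemma (in group) generate_eq_words:
  assumes "s ` I \<subseteq> carrier G"
  shows "generate G (s ` I) = word_val G s ` lists (I \<times> UNIV)"
proof (intro subset_antisym subsetI)
  fix g assume "g \<in> generate G (s ` I)"
  thus "g \<in> word_val G s ` lists (I \<times> UNIV)"
  proof (induction rule: generate.induct)
    case one
    have "[] \<in> lists (I \<times> (UNIV :: bool set))" "word_val G s [] = \<one>" by simp_all
    thus ?case by (metis imageI)
  next
    case (incl h)
    then obtain i where i: "i \<in> I" "h = s i" by auto
    hence "word_val G s [(i, True)] = h" using assms by auto
    moreover have "[(i, True)] \<in> lists (I \<times> UNIV)" using i by simp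
    ultimately show ?case by (metis imageI)
  next
    case (inv h)
    then obtain i where i: "i \<in> I" "h = s i" by auto
    hence "word_val G s [(i, False)] = inv h" using assms by auto
    moreover have "[(i, False)] \<in> lists (I \<times> UNIV)" using i by simp
    ultimately show ?case by (metis imageI)
  next
    case (eng g h)
    then obtain u v where uv: "u \<in> lists (I \<times> UNIV)" "v \<in> lists (I \<times> UNIV)"
      "g = word_val G s u" "h = word_val G s v" by auto
    hence "g \<otimes> h = word_val G s (u @ v)" using word_val_append[OF assms] by simp
    moreover have "u @ v \<in> lists (I \<times> UNIV)" using uv by simp
    ultimately show ?case by (metis imageI)
  qed
next
  fix g assume "g \<in> word_val G s ` lists (I \<times> UNIV)"
  then obtain w where w: "w \<in> lists (I \<times> UNIV)" "g = word_val G s w" by auto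
  have "word_val G s w \<in> generate G (s ` I)" using w(1)
  proof (induction w)
    case (Cons l w)
    obtain i b where l: "l = (i, b)" by (cases l)
    have "letter_val G s l \<in> generate G (s ` I)" using Cons(1) l
      by (auto intro: generate.incl generate.inv)
    thus ?case using Cons by (simp add: generate.eng del: letter_val.simps)
  qed (simp add: generate.one)
  thus "g \<in> generate G (s ` I)" using w by simp
qed

section \<open>The universal property of the braid group\<close>

text \<open>Artin's relations for \<open>s 1, ..., s (n - 1)\<close>, with products nested to the
  right, the normal form under \<open>m_assoc\<close>.\<close>

definition braid_images :: "nat \<Rightarrow> ('a, 'm) monoid_scheme \<Rightarrow> (nat \<Rightarrow> 'a) \<Rightarrow> bool" where
  "braid_images n G s \<longleftrightarrow> s ` {1..<n} \<subseteq> carrier G \<and>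
    (\<forall>i j. 1 \<le> i \<and> i + 2 \<le> j \<and> j < n \<longrightarrow> s i \<otimes>\<^bsub>G\<^esub> s j = s j \<otimes>\<^bsub>G\<^esub> s i) \<and>
    (\<forall>i. 1 \<le> i \<and> i + 1 < n \<longrightarrow>
      s i \<otimes>\<^bsub>G\<^esub> (s (i + 1) \<otimes>\<^bsub>G\<^esub> s i) = s (i + 1) \<otimes>\<^bsub>G\<^esub> (s i \<otimes>\<^bsub>G\<^esub> s (i + 1)))"

lemma braid_rel_words: "(u, v) \<in> braid_rel n \<Longrightarrow> u \<in> braid_words n \<and> v \<in> braid_words n"
  by (induction rule: braid_rel.induct) (auto simp: braid_words_def)

lemma (in group) word_val_braid_rel:
  assumes "braid_images n G s" "(u, v) \<in> braid_rel n"
  shows "word_val G s u = word_val G s v"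
proof -
  have s: "s ` {1..<n} \<subseteq> carrier G" using assms(1) by (simp add: braid_images_def)
  hence si: "s i \<in> carrier G" if "1 \<le> i" "i < n" for i using that by auto
  show ?thesis using assms(2)
  proof (induction rule: braid_rel.induct)
    case (cong u u' v v')
    thus ?case using braid_rel_words[OF cong(1)] braid_rel_words[OF cong(2)]
      by (simp add: word_val_append[OF s] braid_words_def)
  next
    case (cancel i b) thus ?case using si[of i] by auto
  next
    case (far i j)
    hence "s i \<otimes> s j = s j \<otimes> s i" using assms(1) unfolding braid_images_def by blast
    thus ?case using far si[of i] si[of j] by simp
  next
    case (braid i) thus ?case using assms(1) si[of i] si[of "i + 1"] by (simp add: braid_images_def)
  qed auto
qed

lemma equiv_braid_rel: "equiv (braid_words n) (braid_rel n)"
proof (rule equivI)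
  show "braid_rel n \<subseteq> braid_words n \<times> braid_words n" using braid_rel_words by fastforce
  show "refl_on (braid_words n) (braid_rel n)" by (simp add: refl_on_def braid_rel.refl)
  show "sym (braid_rel n)" by (meson braid_rel.sym symI)
  show "trans (braid_rel n)" by (meson braid_rel.trans transI)
qed

abbreviation braid_class :: "nat \<Rightarrow> braid_word \<Rightarrow> braid" where
  "braid_class n w \<equiv> braid_rel n `` {w}"

lemma braid_class_eq: "w \<in> braid_words n \<Longrightarrow> w' \<in> braid_words n \<Longrightarrow>
    braid_class n w = braid_class n w' \<longleftrightarrow> (w, w') \<in> braid_rel n"
  using eq_equiv_class_iff[OF equiv_braid_rel] .

lemma braid_carrier: "carrier (braid_group n) = braid_class n ` braid_words n"
  by (auto simp: braid_group_def quotient_def)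

lemma braid_one: "\<one>\<^bsub>braid_group n\<^esub> = braid_class n []"
  by (simp add: braid_group_def)

lemma braid_mult:
  assumes "u \<in> braid_words n" "v \<in> braid_words n"
  shows "braid_class n u \<otimes>\<^bsub>braid_group n\<^esub> braid_class n v = braid_class n (u @ v)"
proof -
  have "congruent2 (braid_rel n) (braid_rel n) (\<lambda>a b. braid_class n (a @ b))"
    unfolding congruent2_def
    by (auto intro!: equiv_class_eq[OF equiv_braid_rel] braid_rel.cong)
  from UN_equiv_class2[OF equiv_braid_rel equiv_braid_rel this assms]
  show ?thesis by (simp add: braid_group_def)
qed

lemma braid_words_append: "u \<in> braid_words n \<Longrightarrow> v \<in> braid_words n \<Longrightarrow> u @ v \<in> braid_words n"
  by (simp add: braid_words_def)

lemma braid_inv_rel: "w \<in> braid_words n \<Longrightarrow> (word_inv w @ w, []) \<in> braid_rel n"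
proof (induction w)
  case Nil thus ?case by (simp add: word_inv_def braid_rel.refl)
next
  case (Cons l w)
  obtain i b where l: "l = (i, b)" by (cases l)
  have w: "w \<in> braid_words n" and i: "1 \<le> i" "i < n" using Cons(2) l by (auto simp: braid_words_def)
  have r: "([(i, \<not> b), (i, \<not> \<not> b)], []) \<in> braid_rel n" by (rule braid_rel.cancel[OF i])
  have w': "(word_inv w, word_inv w) \<in> braid_rel n"
    using w word_inv_lists[of w "{1..<n}"] by (intro braid_rel.refl) (simp add: braid_words_def)
  have "(word_inv w @ ([(i, \<not> b), (i, \<not> \<not> b)] @ w), word_inv w @ ([] @ w)) \<in> braid_rel n"
    by (rule braid_rel.cong[OF w' braid_rel.cong[OF r braid_rel.refl[OF w]]])
  hence "(word_inv (l # w) @ l # w, word_inv w @ w) \<in> braid_rel n"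
    by (simp add: word_inv_def l)
  thus ?case using Cons.IH[OF w] by (rule braid_rel.trans)
qed

lemma braid_group: "group (braid_group n)"
proof (rule groupI)
  show "\<one>\<^bsub>braid_group n\<^esub> \<in> carrier (braid_group n)"
    by (simp add: braid_one braid_carrier braid_words_def)
next
  fix x assume "x \<in> carrier (braid_group n)"
  then obtain w where w: "w \<in> braid_words n" "x = braid_class n w" by (auto simp: braid_carrier)
  have wi: "word_inv w \<in> braid_words n" using w(1) word_inv_lists by (simp add: braid_words_def)
  show "\<one>\<^bsub>braid_group n\<^esub> \<otimes>\<^bsub>braid_group n\<^esub> x = x"
    using w braid_mult[of "[]" n w] by (simp add: braid_one braid_words_def)
  have "braid_class n (word_inv w) \<otimes>\<^bsub>braid_group n\<^esub> x = \<one>\<^bsub>braid_group n\<^esub>"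
    using braid_inv_rel[OF w(1)] w wi braid_class_eq[of "word_inv w @ w" n "[]"] braid_words_append[OF wi w(1)]
    by (simp add: braid_one braid_mult) (simp add: braid_words_def)
  thus "\<exists>y\<in>carrier (braid_group n). y \<otimes>\<^bsub>braid_group n\<^esub> x = \<one>\<^bsub>braid_group n\<^esub>"
    using wi by (auto simp: braid_carrier)
qed (auto simp: braid_carrier braid_mult braid_words_append)

text \<open>Evaluation of words respects \<open>braid_rel\<close>, so evaluating an arbitrarily
  chosen word of a class is well defined.\<close>

lemma braid_hom:
  assumes "group G" "braid_images n G s"
  obtains h where "h \<in> hom (braid_group n) G" "\<And>i. 1 \<le> i \<Longrightarrow> i < n \<Longrightarrow> h (sigma n i) = s i"
proof -
  interpret group G by fact
  have s: "s ` {1..<n} \<subseteq> carrier G" using assms(2) by (simp add: braid_images_def)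
  define h where "h A = word_val G s (SOME w. w \<in> A)" for A
  have h: "h (braid_class n w) = word_val G s w" if "w \<in> braid_words n" for w
  proof -
    have "w \<in> braid_class n w" using that by (simp add: braid_rel.refl)
    hence "(SOME w'. w' \<in> braid_class n w) \<in> braid_class n w" by (rule someI)
    hence "(w, SOME w'. w' \<in> braid_class n w) \<in> braid_rel n" by blast
    from word_val_braid_rel[OF assms(2) this] show ?thesis by (simp add: h_def)
  qed
  have "word_val G s w \<in> carrier G" if "w \<in> braid_words n" for w
    using word_val_closed[OF s] that by (simp add: braid_words_def)
  moreover have "word_val G s (u @ v) = word_val G s u \<otimes>\<^bsub>G\<^esub> word_val G s v"
    if "u \<in> braid_words n" "v \<in> braid_words n" for u v
    using word_val_append[OF s] that by (simp add: braid_words_def)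
  ultimately have "h \<in> hom (braid_group n) G"
    by (intro homI) (auto simp: braid_carrier braid_mult h braid_words_append)
  moreover have "h (sigma n i) = s i" if "1 \<le> i" "i < n" for i
  proof -
    have "s i \<in> carrier G" using s that by auto
    thus ?thesis using h[of "[(i, True)]"] that by (simp add: sigma_def braid_words_def)
  qed
  ultimately show thesis using that by blast
qed

lemma sigma_closed: "1 \<le> i \<Longrightarrow> i < n \<Longrightarrow> sigma n i \<in> carrier (braid_group n)"
  by (auto simp: sigma_def braid_carrier braid_words_def)

lemma sigma_images: "braid_images n (braid_group n) (sigma n)"
proof -
  have w: "[(i, True)] \<in> braid_words n" if "1 \<le> i" "i < n" for i using that by (simp add: braid_words_def)
  have w2: "[(i, True), (j, True)] \<in> braid_words n" if "1 \<le> i" "i < n" "1 \<le> j" "j < n" for i j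
    using that by (simp add: braid_words_def)
  have w3: "[(i, True), (j, True), (k, True)] \<in> braid_words n"
    if "1 \<le> i" "i < n" "1 \<le> j" "j < n" "1 \<le> k" "k < n" for i j k
    using that by (simp add: braid_words_def)
  show ?thesis unfolding braid_images_def
  proof (intro conjI allI impI)
    show "sigma n ` {1..<n} \<subseteq> carrier (braid_group n)" using sigma_closed by auto
  next
    fix i j assume ij: "1 \<le> i \<and> i + 2 \<le> j \<and> j < n"
    thus "sigma n i \<otimes>\<^bsub>braid_group n\<^esub> sigma n j = sigma n j \<otimes>\<^bsub>braid_group n\<^esub> sigma n i"
      using w[of i] w[of j] w2[of i j] w2[of j i] braid_rel.far[of i j n]
      by (simp add: sigma_def braid_mult braid_class_eq)
  next
    fix i assume i: "1 \<le> i \<and> i + 1 < n"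
    thus "sigma n i \<otimes>\<^bsub>braid_group n\<^esub> (sigma n (i + 1) \<otimes>\<^bsub>braid_group n\<^esub> sigma n i) =
      sigma n (i + 1) \<otimes>\<^bsub>braid_group n\<^esub> (sigma n i \<otimes>\<^bsub>braid_group n\<^esub> sigma n (i + 1))"
      using w[of i] w[of "i + 1"] w2[of i "i + 1"] w2[of "i + 1" i] w3[of i "i + 1" i]
        w3[of "i + 1" i "i + 1"] braid_rel.braid[of i n]
      by (simp add: sigma_def braid_mult braid_class_eq)
  qed
qed

lemma braid_generated: "generate (braid_group n) (sigma n ` {1..<n}) = carrier (braid_group n)"
proof -
  interpret group "braid_group n" by (rule braid_group)
  have s: "sigma n ` {1..<n} \<subseteq> carrier (braid_group n)" using sigma_closed by auto
  have "braid_class n w \<in> generate (braid_group n) (sigma n ` {1..<n})" if "w \<in> braid_words n" for w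
    using that
  proof (induction w)
    case Nil thus ?case using generate.one[of "braid_group n"] by (simp add: braid_one)
  next
    case (Cons l w)
    obtain i b where l: "l = (i, b)" by (cases l)
    have w: "w \<in> braid_words n" and i: "1 \<le> i" "i < n" using Cons(2) l by (auto simp: braid_words_def)
    have ww: "[(i, b)] \<in> braid_words n" for b using i by (simp add: braid_words_def)
    have "braid_class n [(i, False)] \<otimes>\<^bsub>braid_group n\<^esub> sigma n i = \<one>\<^bsub>braid_group n\<^esub>"
      using braid_rel.cancel[OF i, of False] ww
        braid_class_eq[of "[(i, False), (i, True)]" n "[]"] i
      by (simp add: sigma_def braid_mult braid_one braid_words_def)
    hence "braid_class n [(i, False)] = inv\<^bsub>braid_group n\<^esub> (sigma n i)"
      using inv_equality[OF _ sigma_closed[OF i]] ww by (force simp: braid_carrier)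
    hence "braid_class n [(i, b)] \<in> generate (braid_group n) (sigma n ` {1..<n})"
      using i by (cases b) (auto simp: sigma_def[symmetric] intro: generate.incl generate.inv)
    moreover have "braid_class n (l # w) = braid_class n [(i, b)] \<otimes>\<^bsub>braid_group n\<^esub> braid_class n w"
      using braid_mult[OF ww w, of b] l by simp
    ultimately show ?case using generate.eng Cons.IH[OF w] by metis
  qed
  thus ?thesis using generate_incl[OF s] by (auto simp: braid_carrier)
qed

text \<open>Every use of \<open>hom_with_values\<close> in the definitions is resolved here:
  existence is supplied by \<open>h\<close>, uniqueness by generation, and extensionality fixes the
  values off the carrier.\<close>

lemma hom_with_values_eq:
  assumes "group G" "group H" "h \<in> hom G H" "\<And>s v. (s, v) \<in> V \<Longrightarrow> h s = v"
    "fst ` V \<subseteq> carrier G" "generate G (fst ` V) = carrier G"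
  shows "hom_with_values G H V = restrict h (carrier G)"
  unfolding hom_with_values_def
proof (rule the_equality)
  interpret group G by fact
  have "restrict h (carrier G) \<in> hom G H"
    using assms(3) by (auto simp: hom_def Pi_iff)
  moreover have "restrict h (carrier G) s = v" if "(s, v) \<in> V" for s v
    using assms(4)[OF that] assms(5) that by force
  ultimately show "restrict h (carrier G) \<in> hom G H \<and> restrict h (carrier G) \<in> extensional (carrier G) \<and>
      (\<forall>(s, v)\<in>V. restrict h (carrier G) s = v)" by auto
  fix k assume k: "k \<in> hom G H \<and> k \<in> extensional (carrier G) \<and> (\<forall>(s, v)\<in>V. k s = v)"
  have "k g = h g" if "g \<in> carrier G" for g
  proof (rule hom_eq_on_generate[OF assms(1,2) _ assms(3,5)])
    show "k s = h s" if "s \<in> fst ` V" for s using that k assms(4) by auto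
  qed (use k that assms(6) in auto)
  thus "k = restrict h (carrier G)" using k by (auto simp: fun_eq_iff extensional_def)
qed

section \<open>Pure braids\<close>

lemma transpositions_images: "braid_images n (sym_group n) (\<lambda>i. transpose i (i + 1))"
proof -
  have "transpose i (Suc i) permutes {Suc 0..n}" if "1 \<le> i" "i < n" for i
    using that by (intro permutes_swap_id) auto
  thus ?thesis
    by (auto simp: braid_images_def sym_group_def fun_eq_iff transpose_def)
qed

lemma braid_perm:
  shows "braid_perm n \<in> hom (braid_group n) (sym_group n)"
    "1 \<le> i \<Longrightarrow> i < n \<Longrightarrow> braid_perm n (sigma n i) = transpose i (i + 1)"
proof -
  obtain h where h: "h \<in> hom (braid_group n) (sym_group n)"
    "\<And>i. 1 \<le> i \<Longrightarrow> i < n \<Longrightarrow> h (sigma n i) = transpose i (i + 1)"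
    using braid_hom[OF sym_group_is_group transpositions_images] by metis
  have "braid_perm n = restrict h (carrier (braid_group n))"
    unfolding braid_perm_def
  proof (rule hom_with_values_eq[OF braid_group sym_group_is_group h(1)])
    show "fst ` ((\<lambda>i. (sigma n i, transpose i (i + 1))) ` {1..<n}) \<subseteq> carrier (braid_group n)"
      using sigma_closed by auto
    show "generate (braid_group n) (fst ` ((\<lambda>i. (sigma n i, transpose i (i + 1))) ` {1..<n})) = carrier (braid_group n)"
      using braid_generated[of n] by (simp add: image_image)
  qed (use h(2) in auto)
  thus "braid_perm n \<in> hom (braid_group n) (sym_group n)"
    "1 \<le> i \<Longrightarrow> i < n \<Longrightarrow> braid_perm n (sigma n i) = transpose i (i + 1)"
    using h sigma_closed group.is_monoid[OF braid_group] by (auto simp: hom_def Pi_iff monoid.m_closed)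
qed

lemma braid_perm_group_hom: "group_hom (braid_group n) (sym_group n) (braid_perm n)"
  by (simp add: group_hom_def group_hom_axioms_def braid_group sym_group_is_group braid_perm)

lemma pure_braid_carrier:
  "carrier (pure_braid_group n) = {g \<in> carrier (braid_group n). braid_perm n g = id}"
  by (simp add: pure_braid_group_def kernel_def sym_group_one)

lemma pure_braid_ops [simp]:
  "(\<otimes>\<^bsub>pure_braid_group n\<^esub>) = (\<otimes>\<^bsub>braid_group n\<^esub>)" "\<one>\<^bsub>pure_braid_group n\<^esub> = \<one>\<^bsub>braid_group n\<^esub>"
  by (simp_all add: pure_braid_group_def)

lemma pure_braid_subgroup: "subgroup (carrier (pure_braid_group n)) (braid_group n)"
  using group_hom.subgroup_kernel[OF braid_perm_group_hom] by (simp add: pure_braid_group_def)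

lemma pure_braid_group: "group (pure_braid_group n)"
  using subgroup.subgroup_is_group[OF pure_braid_subgroup braid_group, of n]
  by (simp add: pure_braid_group_def)

lemma pure_braid_FIN: "carrier (pure_braid_group n) \<in> FIN (braid_group n)"
proof -
  have "finite (carrier (sym_group n))" by (simp add: sym_group_def finite_permutations)
  hence "finite (braid_perm n ` carrier (braid_group n))"
    by (rule finite_subset[rotated]) (use hom_in_carrier[OF braid_perm(1)] in auto)
  from FIN_kernel[OF braid_group sym_group_is_group braid_perm(1) this]
  show ?thesis by (simp add: pure_braid_carrier sym_group_one)
qed

lemma pure_braid_inv:
  "g \<in> carrier (pure_braid_group n) \<Longrightarrow> inv\<^bsub>pure_braid_group n\<^esub> g = inv\<^bsub>braid_group n\<^esub> g"
  using group.m_inv_consistent[OF braid_group pure_braid_subgroup, of g n]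
  by (simp add: pure_braid_group_def)

lemma pure_braid_inclusion: "(\<lambda>g. g) \<in> hom (pure_braid_group n) (braid_group n)"
  by (auto simp: hom_def pure_braid_carrier)

lemma pure_gen_pure:
  assumes "1 \<le> i" "i < j" "j \<le> n" shows "pure_gen n i j \<in> carrier (pure_braid_group n)"
proof -
  interpret group_hom "braid_group n" "sym_group n" "braid_perm n" by (rule braid_perm_group_hom)
  define w where "w = foldr (\<lambda>k u. sigma n k \<otimes>\<^bsub>braid_group n\<^esub> u) (rev [i + 1..<j]) \<one>\<^bsub>braid_group n\<^esub>"
  have "foldr (\<lambda>k u. sigma n k \<otimes>\<^bsub>braid_group n\<^esub> u) ks \<one>\<^bsub>braid_group n\<^esub> \<in> carrier (braid_group n)"
    if "set ks \<subseteq> {1..<n}" for ks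
    using that by (induction ks) (auto intro!: sigma_closed)
  hence w: "w \<in> carrier (braid_group n)" using assms by (auto simp: w_def)
  have s: "sigma n i \<in> carrier (braid_group n)" using assms sigma_closed by simp
  have "sigma n i [^]\<^bsub>braid_group n\<^esub> (2::nat) = sigma n i \<otimes>\<^bsub>braid_group n\<^esub> sigma n i"
    using s by (simp add: numeral_2_eq_2)
  moreover have "braid_perm n (sigma n i \<otimes>\<^bsub>braid_group n\<^esub> sigma n i) = \<one>\<^bsub>sym_group n\<^esub>"
    using s braid_perm(2)[of i n] assms by (simp add: sym_group_def fun_eq_iff)
  moreover have "pure_gen n i j = w \<otimes>\<^bsub>braid_group n\<^esub> (sigma n i [^]\<^bsub>braid_group n\<^esub> (2::nat)) \<otimes>\<^bsub>braid_group n\<^esub> inv\<^bsub>braid_group n\<^esub> w"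
    by (simp add: pure_gen_def w_def Let_def)
  ultimately have "pure_gen n i j \<in> carrier (braid_group n)" "braid_perm n (pure_gen n i j) = \<one>\<^bsub>sym_group n\<^esub>"
    using w s H.r_inv[of "braid_perm n w"] by (auto simp del: sym_group_inv_equality H.r_inv)
  thus ?thesis by (simp add: pure_braid_carrier sym_group_one)
qed

subsection \<open>Identities between braids\<close>

lemma (in group) assoc3:
  assumes "x \<otimes> (y \<otimes> w) = x' \<otimes> (y' \<otimes> w')" "x \<in> carrier G" "y \<in> carrier G" "w \<in> carrier G"
    "x' \<in> carrier G" "y' \<in> carrier G" "w' \<in> carrier G" "z \<in> carrier G"
  shows "x \<otimes> (y \<otimes> (w \<otimes> z)) = x' \<otimes> (y' \<otimes> (w' \<otimes> z))"
proof -
  have "(x \<otimes> (y \<otimes> w)) \<otimes> z = (x' \<otimes> (y' \<otimes> w')) \<otimes> z" using assms(1) by simp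
  thus ?thesis using assms(2-) by (simp add: m_assoc)
qed

lemma (in group) commute_mult:
  assumes "x \<otimes> y = y \<otimes> x" "x \<otimes> z = z \<otimes> x" "x \<in> carrier G" "y \<in> carrier G" "z \<in> carrier G"
  shows "x \<otimes> (y \<otimes> z) = (y \<otimes> z) \<otimes> x"
proof -
  have "x \<otimes> (y \<otimes> z) = (x \<otimes> y) \<otimes> z" using assms(3-5) by (simp add: m_assoc)
  also have "\<dots> = (y \<otimes> x) \<otimes> z" using assms(1) by simp
  also have "\<dots> = y \<otimes> (x \<otimes> z)" using assms(3-5) by (simp add: m_assoc)
  also have "\<dots> = y \<otimes> (z \<otimes> x)" using assms(2) by simp
  also have "\<dots> = (y \<otimes> z) \<otimes> x" using assms(3-5) by (simp add: m_assoc)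
  finally show ?thesis .
qed

lemma (in group) commute_inv:
  assumes "x \<otimes> y = y \<otimes> x" "x \<in> carrier G" "y \<in> carrier G"
  shows "x \<otimes> inv y = inv y \<otimes> x"
proof -
  have "inv y \<otimes> ((y \<otimes> x) \<otimes> inv y) = inv y \<otimes> ((x \<otimes> y) \<otimes> inv y)" using assms by simp
  thus ?thesis using assms(2,3) by (simp add: m_assoc mult_inv_cancel)
qed

lemma (in group) commute_conj:
  assumes "x \<otimes> y = y \<otimes> x" "x \<in> carrier G" "y \<in> carrier G"
  shows "inv x \<otimes> y \<otimes> x = y"
  using assms by (simp add: m_assoc mult_inv_cancel flip: assms(1))

context group
begin

context
  fixes a b
  assumes ab: "a \<in> carrier G" "b \<in> carrier G" and aba: "a \<otimes> (b \<otimes> a) = b \<otimes> (a \<otimes> b)"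
begin

text \<open>The relation with a tail, in the shape in which it applies inside a right-nested
  product.\<close>

lemma aba': "z \<in> carrier G \<Longrightarrow> a \<otimes> (b \<otimes> (a \<otimes> z)) = b \<otimes> (a \<otimes> (b \<otimes> z))"
  using assoc3[OF aba] ab by simp

text \<open>For \<open>a = \<sigma>_1\<close> and \<open>b = \<sigma>_2\<close> the braid
  \<open>b a a b\<close> carries the third strand once around the first two, so it commutes with
  their crossing.\<close>

lemma braid_commute: "a \<otimes> (b \<otimes> (a \<otimes> (a \<otimes> b))) = (b \<otimes> (a \<otimes> (a \<otimes> b))) \<otimes> a"
proof -
  have "a \<otimes> (b \<otimes> (a \<otimes> (a \<otimes> b))) = b \<otimes> (a \<otimes> (b \<otimes> (a \<otimes> b)))" using ab by (simp add: aba')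
  thus ?thesis using ab aba by (simp add: m_assoc)
qed

text \<open>Two expressions for \<open>x13\<close>: the conjugate of one squared generator by the
  other is also a conjugate with the roles exchanged, in the opposite sense.\<close>

lemma braid_conj_sq: "b \<otimes> (a \<otimes> (a \<otimes> inv b)) = inv a \<otimes> (b \<otimes> (b \<otimes> a))"
proof -
  have "a \<otimes> (b \<otimes> (a \<otimes> (a \<otimes> inv b))) = b \<otimes> (a \<otimes> (b \<otimes> (a \<otimes> inv b)))" using ab by (simp add: aba')
  also have "a \<otimes> (b \<otimes> (a \<otimes> inv b)) = b \<otimes> (a \<otimes> (b \<otimes> inv b))" using ab by (simp add: aba')
  finally have "inv a \<otimes> (a \<otimes> (b \<otimes> (a \<otimes> (a \<otimes> inv b)))) = inv a \<otimes> (b \<otimes> (b \<otimes> a))" using ab by simp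
  thus ?thesis using ab by (simp add: mult_inv_cancel)
qed

lemma braid_sq_conj: "a \<otimes> (a \<otimes> (b \<otimes> (a \<otimes> (a \<otimes> inv b)))) = a \<otimes> (b \<otimes> (b \<otimes> a))"
  using ab by (simp add: braid_conj_sq mult_inv_cancel)

text \<open>Both sides are the full twist on three strands, with the twist of the last two or of the
  first two strands split off.\<close>

lemma full_twist: "b \<otimes> (b \<otimes> (a \<otimes> (b \<otimes> (b \<otimes> a)))) = a \<otimes> (a \<otimes> (b \<otimes> (a \<otimes> (a \<otimes> b))))"
proof -
  have "b \<otimes> (b \<otimes> (a \<otimes> (b \<otimes> (b \<otimes> a)))) = b \<otimes> (a \<otimes> (b \<otimes> (a \<otimes> (b \<otimes> a))))"
    using ab aba'[of "b \<otimes> a"] by simp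
  also have "\<dots> = a \<otimes> (b \<otimes> (a \<otimes> (a \<otimes> (b \<otimes> a))))" using ab aba'[of "a \<otimes> (b \<otimes> a)"] by simp
  also have "\<dots> = a \<otimes> ((b \<otimes> (a \<otimes> (a \<otimes> b))) \<otimes> a)" using ab by (simp add: m_assoc)
  also have "\<dots> = a \<otimes> (a \<otimes> (b \<otimes> (a \<otimes> (a \<otimes> b))))" using braid_commute by simp
  finally show ?thesis .
qed

end

text \<open>Each factorisation in \<open>full_twist\<close> makes one commutation visible:
  \<open>b\<close> commutes with \<open>b b\<close> and with \<open>a b b a\<close>, and
  \<open>a\<close> with \<open>a a\<close> and with \<open>b a a b\<close>.\<close>

lemma full_twist_commute:
  assumes "a \<in> carrier G" "b \<in> carrier G" "a \<otimes> (b \<otimes> a) = b \<otimes> (a \<otimes> b)"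
  defines "c \<equiv> b \<otimes> (b \<otimes> (a \<otimes> (b \<otimes> (b \<otimes> a))))"
  shows "a \<otimes> c = c \<otimes> a" "b \<otimes> c = c \<otimes> b"
proof -
  have "b \<otimes> ((b \<otimes> b) \<otimes> (a \<otimes> (b \<otimes> (b \<otimes> a)))) = ((b \<otimes> b) \<otimes> (a \<otimes> (b \<otimes> (b \<otimes> a)))) \<otimes> b"
    using assms(1,2) by (intro commute_mult braid_commute assms(3)[symmetric]) (simp_all add: m_assoc)
  moreover have "c = (b \<otimes> b) \<otimes> (a \<otimes> (b \<otimes> (b \<otimes> a)))" using assms(1,2) by (simp add: c_def m_assoc)
  ultimately show "b \<otimes> c = c \<otimes> b" by simp
  have "a \<otimes> ((a \<otimes> a) \<otimes> (b \<otimes> (a \<otimes> (a \<otimes> b)))) = ((a \<otimes> a) \<otimes> (b \<otimes> (a \<otimes> (a \<otimes> b)))) \<otimes> a"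
    using assms(1,2) by (intro commute_mult braid_commute assms(3)) (simp_all add: m_assoc)
  moreover have "c = (a \<otimes> a) \<otimes> (b \<otimes> (a \<otimes> (a \<otimes> b)))"
    using assms(1,2) full_twist[OF assms(1-3)] by (simp add: c_def m_assoc)
  ultimately show "a \<otimes> c = c \<otimes> a" by simp
qed

context
  fixes a b c
  assumes abc: "a \<in> carrier G" "b \<in> carrier G" "c \<in> carrier G"
    and aba: "a \<otimes> (b \<otimes> a) = b \<otimes> (a \<otimes> b)" and bcb: "b \<otimes> (c \<otimes> b) = c \<otimes> (b \<otimes> c)" and ac: "a \<otimes> c = c \<otimes> a"
begin

lemma bcb': "z \<in> carrier G \<Longrightarrow> b \<otimes> (c \<otimes> (b \<otimes> z)) = c \<otimes> (b \<otimes> (c \<otimes> z))"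
  using assoc3[OF bcb] abc by simp

lemma ac': "z \<in> carrier G \<Longrightarrow> a \<otimes> (c \<otimes> z) = c \<otimes> (a \<otimes> z)"
  using abc ac by (metis m_assoc)

lemma aac': "z \<in> carrier G \<Longrightarrow> a \<otimes> (a \<otimes> (c \<otimes> z)) = c \<otimes> (a \<otimes> (a \<otimes> z))"
  using abc by (simp add: ac')

text \<open>The defining relation of the braid group of type \<open>B\<^sub>2\<close>.\<close>

lemma type_B_relation:
  defines "D \<equiv> b \<otimes> (a \<otimes> (a \<otimes> b))"
  shows "c \<otimes> (D \<otimes> (c \<otimes> D)) = D \<otimes> (c \<otimes> (D \<otimes> c))"
proof -
  have "c \<otimes> (D \<otimes> (c \<otimes> D)) = c \<otimes> (b \<otimes> (a \<otimes> (a \<otimes> (b \<otimes> (c \<otimes> (b \<otimes> (a \<otimes> (a \<otimes> b))))))))"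
    using abc by (simp add: D_def m_assoc)
  also have "\<dots> = c \<otimes> (b \<otimes> (a \<otimes> (a \<otimes> (c \<otimes> (b \<otimes> (c \<otimes> (a \<otimes> (a \<otimes> b))))))))"
    using abc bcb'[of "a \<otimes> (a \<otimes> b)"] by simp
  also have "\<dots> = c \<otimes> (b \<otimes> (c \<otimes> (a \<otimes> (a \<otimes> (b \<otimes> (a \<otimes> (a \<otimes> (c \<otimes> b))))))))"
    using abc aac'[of b] aac'[of "b \<otimes> (a \<otimes> (a \<otimes> (c \<otimes> b)))"] by simp
  also have "\<dots> = b \<otimes> (c \<otimes> (b \<otimes> (a \<otimes> (a \<otimes> (b \<otimes> (a \<otimes> (a \<otimes> (c \<otimes> b))))))))"
    using abc bcb'[of "a \<otimes> (a \<otimes> (b \<otimes> (a \<otimes> (a \<otimes> (c \<otimes> b)))))"] by simp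
  also have "b \<otimes> (a \<otimes> (a \<otimes> (b \<otimes> (a \<otimes> (a \<otimes> (c \<otimes> b)))))) = D \<otimes> ((a \<otimes> a) \<otimes> (c \<otimes> b))"
    using abc by (simp add: D_def m_assoc)
  also have "D \<otimes> ((a \<otimes> a) \<otimes> (c \<otimes> b)) = (D \<otimes> (a \<otimes> a)) \<otimes> (c \<otimes> b)" using abc by (simp add: D_def m_assoc)
  also have "D \<otimes> (a \<otimes> a) = (a \<otimes> a) \<otimes> D"
  proof (rule commute_mult)
    have "a \<otimes> D = D \<otimes> a" unfolding D_def by (rule braid_commute[OF abc(1,2) aba])
    thus "D \<otimes> a = a \<otimes> D" "D \<otimes> a = a \<otimes> D" by simp_all
  qed (use abc in \<open>simp_all add: D_def\<close>)
  also have "((a \<otimes> a) \<otimes> D) \<otimes> (c \<otimes> b) = a \<otimes> (a \<otimes> (b \<otimes> (a \<otimes> (a \<otimes> (b \<otimes> (c \<otimes> b))))))"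
    using abc by (simp add: D_def m_assoc)
  finally have l: "c \<otimes> (D \<otimes> (c \<otimes> D)) = b \<otimes> (c \<otimes> (a \<otimes> (a \<otimes> (b \<otimes> (a \<otimes> (a \<otimes> (b \<otimes> (c \<otimes> b))))))))" .
  have "D \<otimes> (c \<otimes> (D \<otimes> c)) = b \<otimes> (a \<otimes> (a \<otimes> (b \<otimes> (c \<otimes> (b \<otimes> (a \<otimes> (a \<otimes> (b \<otimes> c))))))))"
    using abc by (simp add: D_def m_assoc)
  also have "\<dots> = b \<otimes> (a \<otimes> (a \<otimes> (c \<otimes> (b \<otimes> (c \<otimes> (a \<otimes> (a \<otimes> (b \<otimes> c))))))))"
    using abc bcb'[of "a \<otimes> (a \<otimes> (b \<otimes> c))"] by simp
  also have "\<dots> = b \<otimes> (c \<otimes> (a \<otimes> (a \<otimes> (b \<otimes> (a \<otimes> (a \<otimes> (c \<otimes> (b \<otimes> c))))))))"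
    using abc aac'[of "b \<otimes> c"] aac'[of "b \<otimes> (a \<otimes> (a \<otimes> (c \<otimes> (b \<otimes> c))))"] by simp
  finally show ?thesis using l bcb by simp
qed

text \<open>The braid \<open>a b c c b a\<close> carries an outer strand around the three others,
  and \<open>b\<close>, a crossing of two of those, slides through it.\<close>

lemma strand_around_commute:
  "b \<otimes> (a \<otimes> (b \<otimes> (c \<otimes> (c \<otimes> b))) \<otimes> a) = (a \<otimes> (b \<otimes> (c \<otimes> (c \<otimes> b))) \<otimes> a) \<otimes> b"
proof -
  have "(a \<otimes> (b \<otimes> (c \<otimes> (c \<otimes> b))) \<otimes> a) \<otimes> b = a \<otimes> (b \<otimes> (c \<otimes> (c \<otimes> (b \<otimes> (a \<otimes> b)))))"
    using abc by (simp add: m_assoc)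
  also have "\<dots> = a \<otimes> (b \<otimes> (a \<otimes> (c \<otimes> (c \<otimes> (b \<otimes> a)))))" using abc by (simp add: aba[symmetric] ac'[symmetric])
  also have "\<dots> = b \<otimes> (a \<otimes> (b \<otimes> (c \<otimes> (c \<otimes> (b \<otimes> a)))))"
    using abc aba'[OF abc(1,2) aba, of "c \<otimes> (c \<otimes> (b \<otimes> a))"] by simp
  finally show ?thesis using abc by (simp add: m_assoc)
qed

end

text \<open>The hypotheses amount to \<open>b a d = a d b = d b a\<close>. With \<open>a\<close>,
  \<open>b\<close>, \<open>d\<close> as values at \<open>x12\<close>, \<open>x23\<close>,
  \<open>x13\<close> this product is the value at \<open>c3\<close>, and the commutations are those
  demanded by \<open>PB3_universal\<close>.\<close>

lemma central_from_cyclic: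
  assumes "a \<in> carrier G" "b \<in> carrier G" "d \<in> carrier G"
    "a \<otimes> (d \<otimes> b) = (d \<otimes> b) \<otimes> a" "b \<otimes> (a \<otimes> d) = (a \<otimes> d) \<otimes> b"
  shows "a \<otimes> (b \<otimes> a \<otimes> d) = (b \<otimes> a \<otimes> d) \<otimes> a" "b \<otimes> (b \<otimes> a \<otimes> d) = (b \<otimes> a \<otimes> d) \<otimes> b"
proof -
  have e: "b \<otimes> a \<otimes> d = a \<otimes> d \<otimes> b" using assms by (simp add: m_assoc)
  have "(b \<otimes> a \<otimes> d) \<otimes> a = (a \<otimes> d \<otimes> b) \<otimes> a" using e by simp
  also have "\<dots> = a \<otimes> ((d \<otimes> b) \<otimes> a)" using assms(1-3) by (simp add: m_assoc)
  also have "\<dots> = a \<otimes> (a \<otimes> (d \<otimes> b))" using assms(4) by simp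
  also have "\<dots> = a \<otimes> (b \<otimes> a \<otimes> d)" using e assms(1-3) by (simp add: m_assoc)
  finally show "a \<otimes> (b \<otimes> a \<otimes> d) = (b \<otimes> a \<otimes> d) \<otimes> a" by simp
  have "b \<otimes> (b \<otimes> a \<otimes> d) = b \<otimes> (b \<otimes> (a \<otimes> d))" using assms(1-3) by (simp add: m_assoc)
  also have "\<dots> = b \<otimes> ((a \<otimes> d) \<otimes> b)" using assms(5) by simp
  also have "\<dots> = (b \<otimes> a \<otimes> d) \<otimes> b" using assms(1-3) by (simp add: m_assoc)
  finally show "b \<otimes> (b \<otimes> a \<otimes> d) = (b \<otimes> a \<otimes> d) \<otimes> b" .
qed

end

lemma braid_sigma_rel: "1 \<le> i \<Longrightarrow> i + 1 < n \<Longrightarrow>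
    sigma n i \<otimes>\<^bsub>braid_group n\<^esub> (sigma n (i + 1) \<otimes>\<^bsub>braid_group n\<^esub> sigma n i) =
    sigma n (i + 1) \<otimes>\<^bsub>braid_group n\<^esub> (sigma n i \<otimes>\<^bsub>braid_group n\<^esub> sigma n (i + 1))"
  using sigma_images[of n] by (simp add: braid_images_def)

lemma pure_gen_1:
  assumes "1 \<le> i" "i < n"
  shows "pure_gen n i (i + 1) = sigma n i \<otimes>\<^bsub>braid_group n\<^esub> sigma n i"
proof -
  interpret group "braid_group n" by (rule braid_group)
  have s: "sigma n i \<in> carrier (braid_group n)" using assms sigma_closed by simp
  thus ?thesis by (simp add: pure_gen_def Let_def numeral_2_eq_2)
qed

lemma pure_gen_2:
  assumes "1 \<le> i" "i + 1 < n"
  shows "pure_gen n i (i + 2) = sigma n (i + 1) \<otimes>\<^bsub>braid_group n\<^esub> (sigma n i \<otimes>\<^bsub>braid_group n\<^esub>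
    (sigma n i \<otimes>\<^bsub>braid_group n\<^esub> inv\<^bsub>braid_group n\<^esub> sigma n (i + 1)))"
proof -
  interpret group "braid_group n" by (rule braid_group)
  have s: "sigma n i \<in> carrier (braid_group n)" "sigma n (i + 1) \<in> carrier (braid_group n)"
    using assms sigma_closed by simp_all
  thus ?thesis by (simp add: pure_gen_def Let_def numeral_2_eq_2 m_assoc)
qed

lemma pure_gen_3:
  assumes "1 \<le> i" "i + 2 < n"
  shows "pure_gen n i (i + 3) = sigma n (i + 2) \<otimes>\<^bsub>braid_group n\<^esub> (sigma n (i + 1) \<otimes>\<^bsub>braid_group n\<^esub>
    (sigma n i \<otimes>\<^bsub>braid_group n\<^esub> (sigma n i \<otimes>\<^bsub>braid_group n\<^esub>
    (inv\<^bsub>braid_group n\<^esub> sigma n (i + 1) \<otimes>\<^bsub>braid_group n\<^esub> inv\<^bsub>braid_group n\<^esub> sigma n (i + 2)))))"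
proof -
  interpret group "braid_group n" by (rule braid_group)
  have s: "sigma n i \<in> carrier (braid_group n)" "sigma n (i + 1) \<in> carrier (braid_group n)"
     "sigma n (i + 2) \<in> carrier (braid_group n)"
    using assms sigma_closed by simp_all
  have "[i + 1..<i + 3] = [i + 1, i + 2]" by (simp add: upt_rec)
  thus ?thesis using s by (simp add: pure_gen_def Let_def numeral_2_eq_2 m_assoc inv_mult_group)
qed

declare One_nat_def [simp del]

subsection \<open>The structure of \<open>PB\<^sub>3\<close>\<close>

abbreviation "x12 \<equiv> pure_gen 3 1 2"
abbreviation "x23 \<equiv> pure_gen 3 2 3"
abbreviation "x13 \<equiv> pure_gen 3 1 3"

lemma B3_sigmas:
  "sigma 3 1 \<in> carrier B3" "sigma 3 2 \<in> carrier B3"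
  "sigma 3 1 \<otimes>\<^bsub>B3\<^esub> (sigma 3 2 \<otimes>\<^bsub>B3\<^esub> sigma 3 1) = sigma 3 2 \<otimes>\<^bsub>B3\<^esub> (sigma 3 1 \<otimes>\<^bsub>B3\<^esub> sigma 3 2)"
  using braid_sigma_rel[of 1 3] sigma_closed[of _ 3] by (simp_all add: numeral_2_eq_2)

lemma B3_pure_gens:
  "x12 = sigma 3 1 \<otimes>\<^bsub>B3\<^esub> sigma 3 1" "x23 = sigma 3 2 \<otimes>\<^bsub>B3\<^esub> sigma 3 2"
  "x13 = sigma 3 2 \<otimes>\<^bsub>B3\<^esub> (sigma 3 1 \<otimes>\<^bsub>B3\<^esub> (sigma 3 1 \<otimes>\<^bsub>B3\<^esub> inv\<^bsub>B3\<^esub> sigma 3 2))"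
  using pure_gen_1[of 1 3] pure_gen_1[of 2 3] pure_gen_2[of 1 3] by (simp_all add: numeral_2_eq_2 numeral_3_eq_3)

lemma B3_gens_closed: "x12 \<in> carrier B3" "x23 \<in> carrier B3" "x13 \<in> carrier B3" "c3 \<in> carrier B3"
proof -
  interpret group B3 by (rule braid_group)
  show "x12 \<in> carrier B3" "x23 \<in> carrier B3" "x13 \<in> carrier B3" "c3 \<in> carrier B3"
    using B3_sigmas by (simp_all add: c3_def B3_pure_gens)
qed

lemma x12_x13: "x12 \<otimes>\<^bsub>B3\<^esub> x13 = sigma 3 1 \<otimes>\<^bsub>B3\<^esub> (sigma 3 2 \<otimes>\<^bsub>B3\<^esub> (sigma 3 2 \<otimes>\<^bsub>B3\<^esub> sigma 3 1))"
proof -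
  interpret group B3 by (rule braid_group)
  show ?thesis using B3_sigmas(1,2) braid_sq_conj[OF B3_sigmas] by (simp add: B3_pure_gens m_assoc)
qed

lemma x13_x23: "x13 \<otimes>\<^bsub>B3\<^esub> x23 = sigma 3 2 \<otimes>\<^bsub>B3\<^esub> (sigma 3 1 \<otimes>\<^bsub>B3\<^esub> (sigma 3 1 \<otimes>\<^bsub>B3\<^esub> sigma 3 2))"
proof -
  interpret group B3 by (rule braid_group)
  show ?thesis using B3_sigmas(1,2) by (simp add: B3_pure_gens m_assoc mult_inv_cancel)
qed

text \<open>The last two forms, which are the two factorisations of the full twist, express
  \<open>x12 x13\<close> and \<open>x13 x23\<close> through \<open>x12\<close>, \<open>x23\<close>
  and the central \<open>c3\<close>. The cablings in \<open>B4\<close> will be images of these two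
  products.\<close>

lemma c3_eq:
  "c3 = sigma 3 2 \<otimes>\<^bsub>B3\<^esub> (sigma 3 2 \<otimes>\<^bsub>B3\<^esub> (sigma 3 1 \<otimes>\<^bsub>B3\<^esub> (sigma 3 2 \<otimes>\<^bsub>B3\<^esub> (sigma 3 2 \<otimes>\<^bsub>B3\<^esub> sigma 3 1))))"
  "c3 = x23 \<otimes>\<^bsub>B3\<^esub> (x12 \<otimes>\<^bsub>B3\<^esub> x13)" "c3 = x12 \<otimes>\<^bsub>B3\<^esub> (x13 \<otimes>\<^bsub>B3\<^esub> x23)"
proof -
  interpret group B3 by (rule braid_group)
  show 1: "c3 = x23 \<otimes>\<^bsub>B3\<^esub> (x12 \<otimes>\<^bsub>B3\<^esub> x13)" using B3_gens_closed by (simp add: c3_def m_assoc)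
  show 2: "c3 = sigma 3 2 \<otimes>\<^bsub>B3\<^esub> (sigma 3 2 \<otimes>\<^bsub>B3\<^esub> (sigma 3 1 \<otimes>\<^bsub>B3\<^esub> (sigma 3 2 \<otimes>\<^bsub>B3\<^esub> (sigma 3 2 \<otimes>\<^bsub>B3\<^esub> sigma 3 1))))"
    unfolding 1 x12_x13 using B3_sigmas(1,2) by (simp add: B3_pure_gens(2) m_assoc)
  show "c3 = x12 \<otimes>\<^bsub>B3\<^esub> (x13 \<otimes>\<^bsub>B3\<^esub> x23)"
    unfolding x13_x23 2 full_twist[OF B3_sigmas] using B3_sigmas(1,2) by (simp add: B3_pure_gens(1) m_assoc)
qed

lemma c3_commute_sigma:
  "sigma 3 1 \<otimes>\<^bsub>B3\<^esub> c3 = c3 \<otimes>\<^bsub>B3\<^esub> sigma 3 1" "sigma 3 2 \<otimes>\<^bsub>B3\<^esub> c3 = c3 \<otimes>\<^bsub>B3\<^esub> sigma 3 2"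
  unfolding c3_eq(1) using group.full_twist_commute[OF braid_group B3_sigmas] by simp_all

lemma (in group) commute_generate:
  assumes "S \<subseteq> carrier G" "c \<in> carrier G" "\<And>s. s \<in> S \<Longrightarrow> s \<otimes> c = c \<otimes> s" "g \<in> generate G S"
  shows "g \<otimes> c = c \<otimes> g"
proof -
  have "c \<otimes> g = g \<otimes> c" using assms(4)
  proof (induction rule: generate.induct)
    case one thus ?case using assms(2) by simp
  next
    case (incl h) thus ?case using assms(3)[of h] by simp
  next
    case (inv h)
    have "c \<otimes> h = h \<otimes> c" using inv assms(3)[of h] by simp
    thus ?case using inv assms(1,2) by (intro commute_inv) auto
  next
    case (eng h k)
    thus ?case using assms(2) generate_in_carrier[OF assms(1)] by (intro commute_mult) auto
  qed
  thus ?thesis by simp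
qed

lemma c3_central: "g \<in> carrier B3 \<Longrightarrow> g \<otimes>\<^bsub>B3\<^esub> c3 = c3 \<otimes>\<^bsub>B3\<^esub> g"
proof (rule group.commute_generate[OF braid_group _ B3_gens_closed(4)])
  show "sigma 3 ` {1..<3} \<subseteq> carrier B3" using sigma_closed by auto
  show "s \<otimes>\<^bsub>B3\<^esub> c3 = c3 \<otimes>\<^bsub>B3\<^esub> s" if "s \<in> sigma 3 ` {1..<3}" for s
  proof -
    have "{1..<3} = {1, 2::nat}" by auto
    hence "s = sigma 3 1 \<or> s = sigma 3 2" using that by (simp only: image_insert image_empty insert_iff empty_iff simp_thms)
    thus ?thesis using c3_commute_sigma by (elim disjE) simp_all
  qed
qed (simp add: braid_generated)

lemma PB3_gens_pure:
  "x12 \<in> carrier PB3" "x23 \<in> carrier PB3" "x13 \<in> carrier PB3" "c3 \<in> carrier PB3"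
proof -
  interpret group PB3 by (rule pure_braid_group)
  show g: "x12 \<in> carrier PB3" "x23 \<in> carrier PB3" "x13 \<in> carrier PB3" by (rule pure_gen_pure; simp)+
  have "x23 \<otimes>\<^bsub>PB3\<^esub> x12 \<otimes>\<^bsub>PB3\<^esub> x13 \<in> carrier PB3" using g by blast
  thus "c3 \<in> carrier PB3" by (simp add: c3_def)
qed

text \<open>Schreier's argument: six lifts of the elements of \<open>S\<^sub>3\<close> represent the cosets of the subgroup
  generated by \<open>x\<^sub>1\<^sub>2\<close>, \<open>x\<^sub>2\<^sub>3\<close>, \<open>c\<close>, so that this subgroup is all of \<open>PB\<^sub>3\<close>.\<close>

lemma B3_cosets:
  fixes s t
  defines "s \<equiv> sigma 3 1" and "t \<equiv> sigma 3 2"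
  defines "H \<equiv> generate B3 {x12, x23, c3}"
    and "T \<equiv> {\<one>\<^bsub>B3\<^esub>, sigma 3 1, sigma 3 2, sigma 3 1 \<otimes>\<^bsub>B3\<^esub> sigma 3 2, sigma 3 2 \<otimes>\<^bsub>B3\<^esub> sigma 3 1,
           sigma 3 1 \<otimes>\<^bsub>B3\<^esub> (sigma 3 2 \<otimes>\<^bsub>B3\<^esub> sigma 3 1)}"
  assumes g: "g \<in> carrier B3"
  shows "\<exists>r\<in>T. \<exists>h\<in>H. g = r \<otimes>\<^bsub>B3\<^esub> h"
proof -
  interpret group B3 by (rule braid_group)
  have st [simp]: "s \<in> carrier B3" "t \<in> carrier B3" and sts: "s \<otimes>\<^bsub>B3\<^esub> (t \<otimes>\<^bsub>B3\<^esub> s) = t \<otimes>\<^bsub>B3\<^esub> (s \<otimes>\<^bsub>B3\<^esub> t)"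
    using B3_sigmas by (simp_all add: s_def t_def)
  note x12 = B3_pure_gens(1)[folded s_def] and x23 = B3_pure_gens(2)[folded t_def]
  have Hs: "{x12, x23, c3} \<subseteq> carrier B3" using B3_gens_closed by simp
  interpret H: subgroup H B3 unfolding H_def by (rule generate_is_subgroup[OF Hs])
  have H: "x12 \<in> H" "x23 \<in> H" "c3 \<in> H" unfolding H_def by (auto intro: generate.incl)
  have Hc [simp]: "h \<in> carrier B3" if "h \<in> H" for h using that H.subset by auto
  \<comment> \<open>\<open>p\<close> is \<open>t^-1 x12 t\<close> and \<open>q\<close> is
    \<open>s^-1 x23 s\<close>, written in the generators of \<open>H\<close>; this is verified below
    in the forms \<open>x12 t = t p\<close> and \<open>x23 s = s q\<close>.\<close>
  define p where "p = inv\<^bsub>B3\<^esub> x23 \<otimes>\<^bsub>B3\<^esub> c3 \<otimes>\<^bsub>B3\<^esub> inv\<^bsub>B3\<^esub> x12"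
  define q where "q = inv\<^bsub>B3\<^esub> x12 \<otimes>\<^bsub>B3\<^esub> c3 \<otimes>\<^bsub>B3\<^esub> inv\<^bsub>B3\<^esub> x23"
  have pq: "p \<in> H" "q \<in> H" using H by (simp_all add: p_def q_def)
  have i: "inv\<^bsub>B3\<^esub> x12 \<in> H" "inv\<^bsub>B3\<^esub> x23 \<in> H" using H by simp_all
  have c: "inv\<^bsub>B3\<^esub> x23 \<otimes>\<^bsub>B3\<^esub> c3 = s \<otimes>\<^bsub>B3\<^esub> (t \<otimes>\<^bsub>B3\<^esub> (t \<otimes>\<^bsub>B3\<^esub> s))" "inv\<^bsub>B3\<^esub> x12 \<otimes>\<^bsub>B3\<^esub> c3 = t \<otimes>\<^bsub>B3\<^esub> (s \<otimes>\<^bsub>B3\<^esub> (s \<otimes>\<^bsub>B3\<^esub> t))"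
  proof -
    have "inv\<^bsub>B3\<^esub> x23 \<otimes>\<^bsub>B3\<^esub> c3 = x12 \<otimes>\<^bsub>B3\<^esub> x13" "inv\<^bsub>B3\<^esub> x12 \<otimes>\<^bsub>B3\<^esub> c3 = x13 \<otimes>\<^bsub>B3\<^esub> x23"
      by (subst c3_eq(2), simp add: mult_inv_cancel B3_gens_closed)
        (subst c3_eq(3), simp add: mult_inv_cancel B3_gens_closed)
    thus "inv\<^bsub>B3\<^esub> x23 \<otimes>\<^bsub>B3\<^esub> c3 = s \<otimes>\<^bsub>B3\<^esub> (t \<otimes>\<^bsub>B3\<^esub> (t \<otimes>\<^bsub>B3\<^esub> s))"
      "inv\<^bsub>B3\<^esub> x12 \<otimes>\<^bsub>B3\<^esub> c3 = t \<otimes>\<^bsub>B3\<^esub> (s \<otimes>\<^bsub>B3\<^esub> (s \<otimes>\<^bsub>B3\<^esub> t))"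
      unfolding x12_x13 x13_x23 s_def t_def .
  qed
  have p: "x12 \<otimes>\<^bsub>B3\<^esub> t = t \<otimes>\<^bsub>B3\<^esub> p"
  proof -
    have "p \<otimes>\<^bsub>B3\<^esub> s = s \<otimes>\<^bsub>B3\<^esub> (t \<otimes>\<^bsub>B3\<^esub> t)" unfolding p_def c x12 by (simp add: m_assoc inv_mult_group mult_inv_cancel)
    moreover have "t \<otimes>\<^bsub>B3\<^esub> (s \<otimes>\<^bsub>B3\<^esub> (t \<otimes>\<^bsub>B3\<^esub> t)) = s \<otimes>\<^bsub>B3\<^esub> (s \<otimes>\<^bsub>B3\<^esub> (t \<otimes>\<^bsub>B3\<^esub> s))"
      using aba'[OF st sts, of t] sts by simp
    ultimately have "(t \<otimes>\<^bsub>B3\<^esub> p) \<otimes>\<^bsub>B3\<^esub> s = (x12 \<otimes>\<^bsub>B3\<^esub> t) \<otimes>\<^bsub>B3\<^esub> s" using pq by (simp add: x12 m_assoc)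
    thus ?thesis using right_cancel[of s "t \<otimes>\<^bsub>B3\<^esub> p" "x12 \<otimes>\<^bsub>B3\<^esub> t"] pq H by simp
  qed
  have q: "x23 \<otimes>\<^bsub>B3\<^esub> s = s \<otimes>\<^bsub>B3\<^esub> q"
  proof -
    have "q \<otimes>\<^bsub>B3\<^esub> t = t \<otimes>\<^bsub>B3\<^esub> (s \<otimes>\<^bsub>B3\<^esub> s)" unfolding q_def c x23 by (simp add: m_assoc inv_mult_group mult_inv_cancel)
    moreover have "s \<otimes>\<^bsub>B3\<^esub> (t \<otimes>\<^bsub>B3\<^esub> (s \<otimes>\<^bsub>B3\<^esub> s)) = t \<otimes>\<^bsub>B3\<^esub> (t \<otimes>\<^bsub>B3\<^esub> (s \<otimes>\<^bsub>B3\<^esub> t))"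
      using aba'[OF st sts, of s] sts by simp
    ultimately have "(s \<otimes>\<^bsub>B3\<^esub> q) \<otimes>\<^bsub>B3\<^esub> t = (x23 \<otimes>\<^bsub>B3\<^esub> s) \<otimes>\<^bsub>B3\<^esub> t" using pq by (simp add: x23 m_assoc)
    thus ?thesis using right_cancel[of t "s \<otimes>\<^bsub>B3\<^esub> q" "x23 \<otimes>\<^bsub>B3\<^esub> s"] pq H by simp
  qed
  have xts: "x12 \<otimes>\<^bsub>B3\<^esub> (t \<otimes>\<^bsub>B3\<^esub> s) = (t \<otimes>\<^bsub>B3\<^esub> s) \<otimes>\<^bsub>B3\<^esub> x23"
    using sts aba'[OF st sts, of t] by (simp add: x12 x23 m_assoc)
  have yst: "x23 \<otimes>\<^bsub>B3\<^esub> (s \<otimes>\<^bsub>B3\<^esub> t) = (s \<otimes>\<^bsub>B3\<^esub> t) \<otimes>\<^bsub>B3\<^esub> x12"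
    using sts aba'[OF st sts, of s] by (simp add: x12 x23 m_assoc)
  define S where "S = {r \<otimes>\<^bsub>B3\<^esub> h | r h. r \<in> T \<and> h \<in> H}"
  have T: "\<one>\<^bsub>B3\<^esub> \<in> T" "s \<in> T" "t \<in> T" "s \<otimes>\<^bsub>B3\<^esub> t \<in> T" "t \<otimes>\<^bsub>B3\<^esub> s \<in> T" "s \<otimes>\<^bsub>B3\<^esub> (t \<otimes>\<^bsub>B3\<^esub> s) \<in> T"
    unfolding T_def s_def t_def by simp_all
  have Tc: "r \<in> T \<Longrightarrow> r \<in> carrier B3" for r unfolding T_def using st by (auto simp: s_def t_def)
  have SI: "r \<otimes>\<^bsub>B3\<^esub> h \<in> S" if "r \<in> T" "h \<in> H" for r h using that by (auto simp: S_def)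
  \<comment> \<open>Multiplication by \<open>s\<close> or \<open>t\<close> moves a representative
    into a coset of some representative, and \<open>x12\<close>, \<open>x23\<close> preserve each
    coset. The latter handles inverse letters through \<open>s^-1 = s x12^-1\<close> and
    \<open>t^-1 = t x23^-1\<close>.\<close>
  have key: "(\<exists>r'\<in>T. \<exists>k\<in>H. s \<otimes>\<^bsub>B3\<^esub> r = r' \<otimes>\<^bsub>B3\<^esub> k) \<and> (\<exists>k\<in>H. x12 \<otimes>\<^bsub>B3\<^esub> r = r \<otimes>\<^bsub>B3\<^esub> k) \<and>
      (\<exists>r'\<in>T. \<exists>k\<in>H. t \<otimes>\<^bsub>B3\<^esub> r = r' \<otimes>\<^bsub>B3\<^esub> k) \<and> (\<exists>k\<in>H. x23 \<otimes>\<^bsub>B3\<^esub> r = r \<otimes>\<^bsub>B3\<^esub> k)" if r: "r \<in> T" for r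
  proof -
    have one: "\<one>\<^bsub>B3\<^esub> \<in> H" by simp
    consider "r = \<one>\<^bsub>B3\<^esub>" | "r = s" | "r = t" | "r = s \<otimes>\<^bsub>B3\<^esub> t" | "r = t \<otimes>\<^bsub>B3\<^esub> s" | "r = s \<otimes>\<^bsub>B3\<^esub> (t \<otimes>\<^bsub>B3\<^esub> s)"
      using r by (auto simp: T_def s_def t_def)
    thus ?thesis
    proof cases
      case 1
      have "s \<otimes>\<^bsub>B3\<^esub> r = s \<otimes>\<^bsub>B3\<^esub> \<one>\<^bsub>B3\<^esub>" "x12 \<otimes>\<^bsub>B3\<^esub> r = r \<otimes>\<^bsub>B3\<^esub> x12" "t \<otimes>\<^bsub>B3\<^esub> r = t \<otimes>\<^bsub>B3\<^esub> \<one>\<^bsub>B3\<^esub>" "x23 \<otimes>\<^bsub>B3\<^esub> r = r \<otimes>\<^bsub>B3\<^esub> x23"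
        using H by (simp_all add: 1)
      thus ?thesis using T H one by metis
    next
      case 2
      have "s \<otimes>\<^bsub>B3\<^esub> r = \<one>\<^bsub>B3\<^esub> \<otimes>\<^bsub>B3\<^esub> x12" "x12 \<otimes>\<^bsub>B3\<^esub> r = r \<otimes>\<^bsub>B3\<^esub> x12" "t \<otimes>\<^bsub>B3\<^esub> r = (t \<otimes>\<^bsub>B3\<^esub> s) \<otimes>\<^bsub>B3\<^esub> \<one>\<^bsub>B3\<^esub>" "x23 \<otimes>\<^bsub>B3\<^esub> r = r \<otimes>\<^bsub>B3\<^esub> q"
        using H q by (simp_all add: 2 x12 m_assoc)
      thus ?thesis using T H one pq by metis
    next
      case 3
      have "s \<otimes>\<^bsub>B3\<^esub> r = (s \<otimes>\<^bsub>B3\<^esub> t) \<otimes>\<^bsub>B3\<^esub> \<one>\<^bsub>B3\<^esub>" "x12 \<otimes>\<^bsub>B3\<^esub> r = r \<otimes>\<^bsub>B3\<^esub> p" "t \<otimes>\<^bsub>B3\<^esub> r = \<one>\<^bsub>B3\<^esub> \<otimes>\<^bsub>B3\<^esub> x23" "x23 \<otimes>\<^bsub>B3\<^esub> r = r \<otimes>\<^bsub>B3\<^esub> x23"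
        using H p by (simp_all add: 3 x23 m_assoc)
      thus ?thesis using T H one pq by metis
    next
      case 4
      have "s \<otimes>\<^bsub>B3\<^esub> r = t \<otimes>\<^bsub>B3\<^esub> p" "x12 \<otimes>\<^bsub>B3\<^esub> r = s \<otimes>\<^bsub>B3\<^esub> (x12 \<otimes>\<^bsub>B3\<^esub> t)"
        "t \<otimes>\<^bsub>B3\<^esub> r = (s \<otimes>\<^bsub>B3\<^esub> (t \<otimes>\<^bsub>B3\<^esub> s)) \<otimes>\<^bsub>B3\<^esub> \<one>\<^bsub>B3\<^esub>" "x23 \<otimes>\<^bsub>B3\<^esub> r = r \<otimes>\<^bsub>B3\<^esub> x12"
        using H p yst sts by (simp_all add: 4 m_assoc x12)
      moreover have "s \<otimes>\<^bsub>B3\<^esub> (x12 \<otimes>\<^bsub>B3\<^esub> t) = r \<otimes>\<^bsub>B3\<^esub> p" using p pq by (simp add: 4 m_assoc)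
      ultimately show ?thesis using T H one pq by metis
    next
      case 5
      have "s \<otimes>\<^bsub>B3\<^esub> r = (s \<otimes>\<^bsub>B3\<^esub> (t \<otimes>\<^bsub>B3\<^esub> s)) \<otimes>\<^bsub>B3\<^esub> \<one>\<^bsub>B3\<^esub>" "x12 \<otimes>\<^bsub>B3\<^esub> r = r \<otimes>\<^bsub>B3\<^esub> x23"
        "t \<otimes>\<^bsub>B3\<^esub> r = s \<otimes>\<^bsub>B3\<^esub> q" "x23 \<otimes>\<^bsub>B3\<^esub> r = t \<otimes>\<^bsub>B3\<^esub> (x23 \<otimes>\<^bsub>B3\<^esub> s)"
        using H q xts by (simp_all add: 5 m_assoc x23)
      moreover have "t \<otimes>\<^bsub>B3\<^esub> (x23 \<otimes>\<^bsub>B3\<^esub> s) = r \<otimes>\<^bsub>B3\<^esub> q" using q pq by (simp add: 5 m_assoc)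
      ultimately show ?thesis using T H one pq by metis
    next
      case 6
      have "s \<otimes>\<^bsub>B3\<^esub> r = x12 \<otimes>\<^bsub>B3\<^esub> (t \<otimes>\<^bsub>B3\<^esub> s)" "x12 \<otimes>\<^bsub>B3\<^esub> r = s \<otimes>\<^bsub>B3\<^esub> (x12 \<otimes>\<^bsub>B3\<^esub> (t \<otimes>\<^bsub>B3\<^esub> s))"
        using H by (simp_all add: 6 m_assoc x12)
      hence 1: "s \<otimes>\<^bsub>B3\<^esub> r = (t \<otimes>\<^bsub>B3\<^esub> s) \<otimes>\<^bsub>B3\<^esub> x23" "x12 \<otimes>\<^bsub>B3\<^esub> r = r \<otimes>\<^bsub>B3\<^esub> x23"
        unfolding xts using H by (simp_all add: 6 m_assoc)
      have r: "r = t \<otimes>\<^bsub>B3\<^esub> (s \<otimes>\<^bsub>B3\<^esub> t)" using sts 6 by simp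
      have "t \<otimes>\<^bsub>B3\<^esub> r = x23 \<otimes>\<^bsub>B3\<^esub> (s \<otimes>\<^bsub>B3\<^esub> t)" "x23 \<otimes>\<^bsub>B3\<^esub> r = t \<otimes>\<^bsub>B3\<^esub> (x23 \<otimes>\<^bsub>B3\<^esub> (s \<otimes>\<^bsub>B3\<^esub> t))"
        using H by (simp_all add: r m_assoc x23)
      hence "t \<otimes>\<^bsub>B3\<^esub> r = (s \<otimes>\<^bsub>B3\<^esub> t) \<otimes>\<^bsub>B3\<^esub> x12" "x23 \<otimes>\<^bsub>B3\<^esub> r = r \<otimes>\<^bsub>B3\<^esub> x12"
        unfolding yst using H by (simp_all add: r m_assoc)
      with 1 show ?thesis using T H by metis
    qed
  qed
  have closed: "s \<otimes>\<^bsub>B3\<^esub> z \<in> S" "t \<otimes>\<^bsub>B3\<^esub> z \<in> S" "inv\<^bsub>B3\<^esub> s \<otimes>\<^bsub>B3\<^esub> z \<in> S" "inv\<^bsub>B3\<^esub> t \<otimes>\<^bsub>B3\<^esub> z \<in> S" if z: "z \<in> S" for z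
  proof -
    obtain r h where rh: "r \<in> T" "h \<in> H" "z = r \<otimes>\<^bsub>B3\<^esub> h" using z by (auto simp: S_def)
    have rc [simp]: "r \<in> carrier B3" using Tc[OF rh(1)] .
    obtain r1 k1 where 1: "r1 \<in> T" "k1 \<in> H" "s \<otimes>\<^bsub>B3\<^esub> r = r1 \<otimes>\<^bsub>B3\<^esub> k1" using key[OF rh(1)] by blast
    obtain r2 k2 where 2: "r2 \<in> T" "k2 \<in> H" "t \<otimes>\<^bsub>B3\<^esub> r = r2 \<otimes>\<^bsub>B3\<^esub> k2" using key[OF rh(1)] by blast
    obtain k3 where 3: "k3 \<in> H" "x12 \<otimes>\<^bsub>B3\<^esub> r = r \<otimes>\<^bsub>B3\<^esub> k3" using key[OF rh(1)] by blast
    obtain k4 where 4: "k4 \<in> H" "x23 \<otimes>\<^bsub>B3\<^esub> r = r \<otimes>\<^bsub>B3\<^esub> k4" using key[OF rh(1)] by blast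
    have e: "s \<otimes>\<^bsub>B3\<^esub> (r \<otimes>\<^bsub>B3\<^esub> k) = r1 \<otimes>\<^bsub>B3\<^esub> (k1 \<otimes>\<^bsub>B3\<^esub> k)" "t \<otimes>\<^bsub>B3\<^esub> (r \<otimes>\<^bsub>B3\<^esub> k) = r2 \<otimes>\<^bsub>B3\<^esub> (k2 \<otimes>\<^bsub>B3\<^esub> k)" if "k \<in> H" for k
      using that 1 2 Tc by (simp_all add: m_assoc[symmetric])
    thus "s \<otimes>\<^bsub>B3\<^esub> z \<in> S" "t \<otimes>\<^bsub>B3\<^esub> z \<in> S" using rh 1 2 by (auto intro!: SI)
    have k: "inv\<^bsub>B3\<^esub> k3 \<otimes>\<^bsub>B3\<^esub> h \<in> H" "inv\<^bsub>B3\<^esub> k4 \<otimes>\<^bsub>B3\<^esub> h \<in> H" using 3 4 rh by simp_all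
    have "x12 \<otimes>\<^bsub>B3\<^esub> (r \<otimes>\<^bsub>B3\<^esub> (inv\<^bsub>B3\<^esub> k3 \<otimes>\<^bsub>B3\<^esub> h)) = z" "x23 \<otimes>\<^bsub>B3\<^esub> (r \<otimes>\<^bsub>B3\<^esub> (inv\<^bsub>B3\<^esub> k4 \<otimes>\<^bsub>B3\<^esub> h)) = z"
      using H 3 4 rh by (simp_all add: m_assoc[symmetric]) (simp_all add: m_assoc mult_inv_cancel)
    moreover have "inv\<^bsub>B3\<^esub> s \<otimes>\<^bsub>B3\<^esub> (x12 \<otimes>\<^bsub>B3\<^esub> u) = s \<otimes>\<^bsub>B3\<^esub> u" "inv\<^bsub>B3\<^esub> t \<otimes>\<^bsub>B3\<^esub> (x23 \<otimes>\<^bsub>B3\<^esub> u) = t \<otimes>\<^bsub>B3\<^esub> u"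
      if "u \<in> carrier B3" for u
      using that by (simp_all add: x12 x23 m_assoc mult_inv_cancel)
    ultimately have "inv\<^bsub>B3\<^esub> s \<otimes>\<^bsub>B3\<^esub> z = s \<otimes>\<^bsub>B3\<^esub> (r \<otimes>\<^bsub>B3\<^esub> (inv\<^bsub>B3\<^esub> k3 \<otimes>\<^bsub>B3\<^esub> h))"
      "inv\<^bsub>B3\<^esub> t \<otimes>\<^bsub>B3\<^esub> z = t \<otimes>\<^bsub>B3\<^esub> (r \<otimes>\<^bsub>B3\<^esub> (inv\<^bsub>B3\<^esub> k4 \<otimes>\<^bsub>B3\<^esub> h))"
      using k Hc rc m_closed by metis+
    thus "inv\<^bsub>B3\<^esub> s \<otimes>\<^bsub>B3\<^esub> z \<in> S" "inv\<^bsub>B3\<^esub> t \<otimes>\<^bsub>B3\<^esub> z \<in> S" using e[OF k(1)] e[OF k(2)] 1 2 k by (auto intro!: SI)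
  qed
  have "word_val B3 (sigma 3) w \<in> S" if "w \<in> lists ({1..<3} \<times> UNIV)" for w
    using that
  proof (induction w)
    case Nil
    have "\<one>\<^bsub>B3\<^esub> \<otimes>\<^bsub>B3\<^esub> \<one>\<^bsub>B3\<^esub> \<in> S" by (rule SI[OF T(1)]) simp
    thus ?case by simp
  next
    case (Cons l w)
    obtain i b where l: "l = (i, b)" by (cases l)
    hence "i = 1 \<or> i = 2" using Cons(1) by auto
    thus ?case using Cons closed[of "word_val B3 (sigma 3) w"] l by (auto simp: s_def t_def)
  qed
  moreover have "g \<in> word_val B3 (sigma 3) ` lists ({1..<3} \<times> UNIV)"
  proof -
    have "sigma 3 ` {1..<3} \<subseteq> carrier B3" by (rule image_subsetI) (simp add: sigma_closed)
    from generate_eq_words[OF this] show ?thesis using g braid_generated[of 3] by simp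
  qed
  ultimately have "g \<in> S" by auto
  thus ?thesis by (auto simp: S_def)
qed

lemma PB3_generated: "carrier PB3 = generate B3 {x12, x23, c3}"
proof
  interpret B3: group B3 by (rule braid_group)
  interpret P: subgroup "carrier PB3" B3 by (rule pure_braid_subgroup)
  interpret h: group_hom B3 "sym_group 3" "braid_perm 3" by (rule braid_perm_group_hom)
  have "{x12, x23, c3} \<subseteq> carrier PB3" using PB3_gens_pure by simp
  thus sub: "generate B3 {x12, x23, c3} \<subseteq> carrier PB3" by (rule B3.generate_subgroup_incl[OF _ pure_braid_subgroup])
  show "carrier PB3 \<subseteq> generate B3 {x12, x23, c3}"
  proof
    fix g assume g: "g \<in> carrier PB3"
    then obtain r h where rh: "g = r \<otimes>\<^bsub>B3\<^esub> h" "h \<in> generate B3 {x12, x23, c3}" and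
      r: "r \<in> {\<one>\<^bsub>B3\<^esub>, sigma 3 1, sigma 3 2, sigma 3 1 \<otimes>\<^bsub>B3\<^esub> sigma 3 2, sigma 3 2 \<otimes>\<^bsub>B3\<^esub> sigma 3 1,
           sigma 3 1 \<otimes>\<^bsub>B3\<^esub> (sigma 3 2 \<otimes>\<^bsub>B3\<^esub> sigma 3 1)}"
      using B3_cosets[of g] P.subset by blast
    have h: "h \<in> carrier PB3" using rh(2) sub by blast
    hence hc: "h \<in> carrier B3" using P.subset by blast
    have rc: "r \<in> carrier B3" using r B3_sigmas(1,2) by (elim insertE emptyE) simp_all
    have "r = g \<otimes>\<^bsub>B3\<^esub> inv\<^bsub>B3\<^esub> h" using rh(1) rc hc by (simp add: B3.m_assoc)
    hence "r \<in> carrier PB3" using g h by simp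
    hence id: "braid_perm 3 r = id" unfolding pure_braid_carrier by (elim CollectE conjE)
    \<comment> \<open>Among the six permutations realised by the representatives only the identity
      fixes both 1 and 3.\<close>
    hence fx: "braid_perm 3 r 1 = 1" "braid_perm 3 r 3 = 3" by (simp_all only: id_apply)
    have p: "braid_perm 3 (sigma 3 1) = transpose 1 2" "braid_perm 3 (sigma 3 2) = transpose 2 3"
      using braid_perm(2)[of 1 3] braid_perm(2)[of 2 3] by simp_all
    have pm: "braid_perm 3 (u \<otimes>\<^bsub>B3\<^esub> v) i = braid_perm 3 u (braid_perm 3 v i)"
      if "u \<in> carrier B3" "v \<in> carrier B3" for u v i
      using that by (simp add: sym_group_mult)
    have "r = \<one>\<^bsub>B3\<^esub>"
    proof (rule ccontr)
      assume "r \<noteq> \<one>\<^bsub>B3\<^esub>"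
      then consider "r = sigma 3 1" | "r = sigma 3 2" | "r = sigma 3 1 \<otimes>\<^bsub>B3\<^esub> sigma 3 2"
        | "r = sigma 3 2 \<otimes>\<^bsub>B3\<^esub> sigma 3 1" | "r = sigma 3 1 \<otimes>\<^bsub>B3\<^esub> (sigma 3 2 \<otimes>\<^bsub>B3\<^esub> sigma 3 1)"
        using r unfolding insert_iff empty_iff by satx
      thus False
        using fx by cases (simp_all add: pm p B3_sigmas(1,2) sym_group_mult transpose_def)
    qed
    hence "g = h" using rh(1) hc by simp
    thus "g \<in> generate B3 {x12, x23, c3}" using rh(2) by simp
  qed
qed

subsection \<open>Freeness by ping-pong\<close>

definition bij_group :: "('a \<Rightarrow> 'a) monoid" where
  "bij_group = \<lparr>carrier = {f. bij f}, monoid.mult = (\<circ>), one = id\<rparr>"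

lemma bij_group: "group bij_group"
proof (rule groupI)
  fix f :: "'a \<Rightarrow> 'a" assume "f \<in> carrier bij_group"
  hence "bij f" by (simp add: bij_group_def)
  thus "\<exists>g\<in>carrier bij_group. g \<otimes>\<^bsub>bij_group\<^esub> f = \<one>\<^bsub>bij_group\<^esub>"
    by (intro bexI[of _ "Hilbert_Choice.inv f"]) (simp_all add: bij_group_def bij_imp_bij_inv bij_is_inj)
qed (auto simp: bij_group_def bij_comp comp_assoc)

lemma bij_group_inv: "bij f \<Longrightarrow> (\<And>v. g (f v) = v) \<Longrightarrow> inv\<^bsub>bij_group\<^esub> f = g"
proof -
  assume f: "bij f" and g: "\<And>v. g (f v) = v"
  have "g = Hilbert_Choice.inv f" using f g by (metis bij_inv_eq_iff ext)
  hence "bij g" using f by (simp add: bij_imp_bij_inv)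
  moreover have "g \<circ> f = id" using g by auto
  ultimately show ?thesis
    using group.inv_equality[OF bij_group, of g f] f by (simp add: bij_group_def)
qed

text \<open>\<open>B\<^sub>3\<close> acts on \<open>\<int>\<^sup>2\<close> through \<open>SL\<^sub>2(\<int>)\<close>; \<open>shear\<close> is the action of \<open>\<sigma>\<^sub>1\<^sup>2\<close>, \<open>\<sigma>\<^sub>2\<^sup>2\<close> and their inverses, and
  \<open>region l\<close> is the cone attracting \<open>shear l\<close>.\<close>

fun shear :: "nat \<times> bool \<Rightarrow> int \<times> int \<Rightarrow> int \<times> int" where
  "shear (i, b) (p, q) = (if i = 1 then (if b then (p + 2 * q, q) else (p - 2 * q, q))
     else (if b then (p, q - 2 * p) else (p, q + 2 * p)))"

fun region :: "nat \<times> bool \<Rightarrow> int \<times> int \<Rightarrow> bool" where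
  "region (i, b) (p, q) \<longleftrightarrow> (if i = 1 then \<bar>q\<bar> < \<bar>p\<bar> else \<bar>p\<bar> < \<bar>q\<bar>) \<and>
     (if b = (i = 1) then (0 < p \<and> 0 < q \<or> p < 0 \<and> q < 0) else (0 < p \<and> q < 0 \<or> p < 0 \<and> 0 < q))"

fun flip :: "nat \<times> bool \<Rightarrow> nat \<times> bool" where "flip (i, b) = (i, \<not> b)"

text \<open>If \<open>|p| < |q|\<close>, adding \<open>2q\<close> to \<open>p\<close> overshoots:
  the result has the sign of \<open>q\<close> and absolute value above \<open>|q|\<close>. Inside
  its own cone a shear only enlarges the larger coordinate. With \<open>q\<close> in place of
  \<open>2q\<close> the first argument would fail, hence the squares of the braid
  generators.\<close>

lemma ping_pong:
  assumes "i \<in> {1, 2::nat}" "j \<in> {1, 2}" "(j, b') \<noteq> flip (i, b)" "region (j, b') v"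
  shows "region (i, b) (shear (i, b) v)"
proof -
  obtain p q where v: "v = (p, q)" by (cases v)
  show ?thesis using assms unfolding v
    by (cases b; cases b') (auto split: if_splits)
qed

fun reduced :: "(nat \<times> bool) list \<Rightarrow> bool" where
  "reduced (l # l' # w) \<longleftrightarrow> l' \<noteq> flip l \<and> reduced (l' # w)"
| "reduced w \<longleftrightarrow> True"

lemma not_reduced_split: "\<not> reduced w \<Longrightarrow> \<exists>u i b v. w = u @ [(i, b), (i, \<not> b)] @ v"
proof (induction w rule: reduced.induct)
  case (1 l l' w)
  obtain i b where l: "l = (i, b)" by (cases l)
  show ?case
  proof (cases "l' = flip l")
    case True
    hence "l # l' # w = [] @ [(i, b), (i, \<not> b)] @ w" by (simp add: l)
    thus ?thesis by blast
  next
    case False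
    then obtain u i' b' v where "l' # w = u @ [(i', b'), (i', \<not> b')] @ v" using 1 by auto
    hence "l # l' # w = (l # u) @ [(i', b'), (i', \<not> b')] @ v" by simp
    thus ?thesis by blast
  qed
qed auto

lemma reduced_region:
  assumes "reduced w" "w \<noteq> []" "w \<in> lists ({1, 2} \<times> UNIV)" "l \<in> {1, 2} \<times> UNIV" "l \<noteq> flip (last w)" "region l v"
  shows "region (hd w) (foldr shear w v)"
  using assms(1-3,5)
proof (induction w)
  case (Cons l' w)
  obtain i b where l': "l' = (i, b)" by (cases l')
  have i: "i \<in> {1, 2}" using Cons(4) l' by simp
  show ?case
  proof (cases w)
    case Nil
    obtain j b' where l: "l = (j, b')" by (cases l)
    show ?thesis using ping_pong[OF i, of j b' b v] assms(4,6) Cons(5) by (simp add: Nil l l' del: region.simps shear.simps)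
  next
    case (Cons l'' w')
    obtain j b' where l'': "l'' = (j, b')" by (cases l'')
    have "region l'' (foldr shear w v)" using Cons.IH Cons.prems by (simp add: Cons)
    moreover have "j \<in> {1, 2}" "(j, b') \<noteq> flip (i, b)" using Cons.prems l' l'' by (auto simp: Cons)
    ultimately show ?thesis using ping_pong[OF i, of j b' b "foldr shear w v"] l' l''
      by (simp del: region.simps shear.simps)
  qed
qed simp

lemma region_nonempty: "l \<in> {1, 2} \<times> UNIV \<Longrightarrow> \<exists>v. region l v"
proof -
  assume "l \<in> {1, 2} \<times> UNIV"
  then consider "l = (1, True)" | "l = (1, False)" | "l = (2, True)" | "l = (2, False)"
    by (cases l) (auto simp: bool.split)
  thus ?thesis
  proof cases
    case 1 thus ?thesis by (intro exI[of _ "(2, 1)"]) simp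
  next
    case 2 thus ?thesis by (intro exI[of _ "(2, - 1)"]) simp
  next
    case 3 thus ?thesis by (intro exI[of _ "(1, - 2)"]) simp
  next
    case 4 thus ?thesis by (intro exI[of _ "(1, 2)"]) simp
  qed
qed

text \<open>The matrix -1, by which \<open>c3\<close> acts. Because of it words have to be separated
  from both 1 and -1.\<close>

definition neg_pair :: "int \<times> int \<Rightarrow> int \<times> int" where "neg_pair v = (- fst v, - snd v)"

lemma region_neg: "region l (neg_pair v) = region l v"
  by (cases l; cases v) (auto simp: neg_pair_def)

lemma region_unique: "l \<in> {1, 2} \<times> UNIV \<Longrightarrow> l' \<in> {1, 2} \<times> UNIV \<Longrightarrow> region l v \<Longrightarrow> region l' v \<Longrightarrow> l = l'"
  by (cases l; cases l'; cases v) (auto split: if_splits)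

lemma reduced_nontrivial:
  assumes "reduced w" "w \<noteq> []" "w \<in> lists ({1, 2} \<times> UNIV)"
  shows "\<exists>v. foldr shear w v \<noteq> v \<and> foldr shear w v \<noteq> neg_pair v"
proof -
  let ?L = "{1, 2::nat} \<times> (UNIV :: bool set)"
  \<comment> \<open>At most two of the four letters are excluded: the first letter of
    \<open>w\<close>, so that source and target cones differ, and the inverse of the last letter, so
    that \<open>reduced_region\<close> applies.\<close>
  have "card ?L = 4" by (simp add: card_cartesian_product)
  moreover have "card {hd w, flip (last w)} \<le> 2" by (simp add: card_insert_if)
  ultimately have "\<not> ?L \<subseteq> {hd w, flip (last w)}"
    using card_mono[of "{hd w, flip (last w)}" ?L] by auto
  then obtain l where l: "l \<in> ?L" "l \<noteq> hd w" "l \<noteq> flip (last w)" by blast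
  obtain v where v: "region l v" using region_nonempty[OF l(1)] by blast
  have r: "region (hd w) (foldr shear w v)" by (rule reduced_region[OF assms l(1,3) v])
  have h: "hd w \<in> ?L" using assms(2,3) by (cases w) auto
  have "region l (foldr shear w v)" if "foldr shear w v = v \<or> foldr shear w v = neg_pair v"
    using that v region_neg[of l v] by (elim disjE) (simp_all only:)
  hence "\<not> (foldr shear w v = v \<or> foldr shear w v = neg_pair v)"
    using region_unique[OF l(1) h _ r] l(2) by blast
  thus ?thesis by blast
qed

text \<open>A nonempty word acting by 1 or -1 at each vector cannot be reduced, and removing a
  cancelling pair changes neither the action nor the value in \<open>G\<close>. The conclusion is
  available in every group, and this is the form in which freeness is used.\<close>

lemma word_val_trivial:
  assumes "w \<in> lists ({1, 2} \<times> UNIV)" "\<And>v. foldr shear w v = v \<or> foldr shear w v = neg_pair v"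
    "group G" "s ` {1, 2} \<subseteq> carrier G"
  shows "word_val G s w = \<one>\<^bsub>G\<^esub>"
  using assms(1,2)
proof (induction "length w" arbitrary: w rule: less_induct)
  case less
  interpret group G by fact
  show ?case
  proof (cases "w = []")
    case False
    hence "\<not> reduced w" using reduced_nontrivial less by blast
    then obtain u i b v where w: "w = u @ [(i, b), (i, \<not> b)] @ v" using not_reduced_split by blast
    have l: "u \<in> lists ({1, 2} \<times> UNIV)" "v \<in> lists ({1, 2} \<times> UNIV)" "i \<in> {1, 2}" using less(2) w by auto
    have i: "s i \<in> carrier G" using l assms(4) by auto
    have c: "shear (i, b) (shear (i, \<not> b) z) = z" for z by (cases z) auto
    have "foldr shear w z = foldr shear (u @ v) z" for z by (simp add: w c del: shear.simps)
    hence "word_val G s (u @ v) = \<one>\<^bsub>G\<^esub>"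
      using less l w by (intro less(1)) auto
    moreover have "word_val G s w = word_val G s (u @ v)"
    proof -
      have "word_val G s w = word_val G s u \<otimes>\<^bsub>G\<^esub> word_val G s ([(i, b), (i, \<not> b)] @ v)"
        unfolding w using l by (intro word_val_append[OF assms(4)]) auto
      also have "word_val G s ([(i, b), (i, \<not> b)] @ v) = word_val G s v"
        using i word_val_closed[OF assms(4) l(2)] by (simp add: mult_inv_cancel)
      finally show ?thesis using word_val_append[OF assms(4) l(1,2)] by simp
    qed
    ultimately show ?thesis by simp
  qed simp
qed

lemma hom_word_val:
  assumes "group G" "group H" "h \<in> hom G H" "s ` I \<subseteq> carrier G" "w \<in> lists (I \<times> UNIV)"
  shows "h (word_val G s w) = word_val H (\<lambda>i. h (s i)) w"
  using assms(5)
proof (induction w)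
  interpret group_hom G H h using assms(1-3) by (simp add: group_hom_def group_hom_axioms_def)
  case (Cons l w)
  obtain i b where l: "l = (i, b)" by (cases l)
  have "s i \<in> carrier G" "word_val G s w \<in> carrier G"
    using Cons l assms(4) G.word_val_closed[OF assms(4)] by auto
  thus ?case using Cons l by simp
qed (simp add: hom_one[OF assms(3,1,2)])

section \<open>The free group and the full twist inside \<open>PB3\<close>\<close>

definition free_gens :: "nat \<Rightarrow> braid" where "free_gens i = (if i = 1 then x12 else x23)"

lemma free_gens_closed: "free_gens ` {1, 2} \<subseteq> carrier B3"
  using B3_gens_closed by (simp add: free_gens_def)

text \<open>Two invariants: the action on the integer plane detects the word up to sign; once the
  word is known to be trivial, the exponent sum detects \<open>k\<close>.\<close>

lemma word_c3_eq_one: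
  assumes w: "w \<in> lists ({1, 2} \<times> UNIV)" and e: "word_val B3 free_gens w \<otimes>\<^bsub>B3\<^esub> c3 [^]\<^bsub>B3\<^esub> (k::int) = \<one>\<^bsub>B3\<^esub>"
  shows "(\<forall>v. foldr shear w v = v \<or> foldr shear w v = neg_pair v) \<and> k = 0"
proof -
  interpret B: group B3 by (rule braid_group)
  interpret Q: group "bij_group :: (int \<times> int \<Rightarrow> int \<times> int) monoid" by (rule bij_group)
  \<comment> \<open>The opposite signs of the two elementary matrices make the braid relation
    hold.\<close>
  define S :: "nat \<Rightarrow> int \<times> int \<Rightarrow> int \<times> int"
    where "S i = (\<lambda>(p, q). if i = 1 then (p + q, q) else (p, q - p))" for i
  define S' :: "nat \<Rightarrow> int \<times> int \<Rightarrow> int \<times> int"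
    where "S' i = (\<lambda>(p, q). if i = 1 then (p - q, q) else (p, q + p))" for i
  have SS: "S i (S' i v) = v" "S' i (S i v) = v" for i v by (cases v; simp add: S_def S'_def)+
  have S: "bij (S i)" for i by (rule bij_betw_byWitness[of UNIV "S' i"]) (auto simp: SS)
  have "braid_images 3 bij_group S"
    unfolding braid_images_def
  proof (intro conjI allI impI)
    show "S ` {1..<3} \<subseteq> carrier bij_group" using S by (auto simp: bij_group_def)
    show "S i \<otimes>\<^bsub>bij_group\<^esub> (S (i + 1) \<otimes>\<^bsub>bij_group\<^esub> S i) = S (i + 1) \<otimes>\<^bsub>bij_group\<^esub> (S i \<otimes>\<^bsub>bij_group\<^esub> S (i + 1))"
      if "1 \<le> i \<and> i + 1 < 3" for i
    proof -
      have "i = 1" using that by simp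
      thus ?thesis by (auto simp: bij_group_def S_def fun_eq_iff)
    qed
  qed auto
  then obtain h where h: "h \<in> hom B3 bij_group" "\<And>i. 1 \<le> i \<Longrightarrow> i < 3 \<Longrightarrow> h (sigma 3 i) = S i"
    using braid_hom[OF bij_group] by metis
  interpret h: group_hom B3 bij_group h using h(1) by unfold_locales
  have hs: "h (sigma 3 1) = S 1" "h (sigma 3 2) = S 2" using h(2) by simp_all
  have hm: "h (u \<otimes>\<^bsub>B3\<^esub> v) = h u \<circ> h v" if "u \<in> carrier B3" "v \<in> carrier B3" for u v
    using that by (simp add: bij_group_def)
  have letter: "letter_val bij_group (\<lambda>i. h (free_gens i)) (i, b) = shear (i, b)" if "i \<in> {1, 2}" for i b
  proof -
    have t: "h (free_gens i) = shear (i, True)"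
      using that B3_sigmas(1,2)
      by (auto simp: free_gens_def B3_pure_gens hm hs S_def fun_eq_iff simp del: h.hom_mult)
    have "shear (i, False) (shear (i, True) z) = z" "shear (i, True) (shear (i, False) z) = z" for z
      by (cases z; simp)+
    moreover from this have "bij (shear (i, True))" by (intro bij_betw_byWitness[of UNIV "shear (i, False)"]) auto
    ultimately have "inv\<^bsub>bij_group\<^esub> (shear (i, True)) = shear (i, False)" by (intro bij_group_inv)
    thus ?thesis using t by (cases b) (simp_all del: shear.simps)
  qed
  have hw: "word_val bij_group (\<lambda>i. h (free_gens i)) w = foldr shear w"
    using w
  proof (induction w)
    case (Cons l w)
    obtain i b where l: "l = (i, b)" by (cases l)
    have i: "i \<in> {1, 2}" using Cons(1) l by simp
    have "word_val bij_group (\<lambda>i. h (free_gens i)) (l # w) = shear l \<circ> foldr shear w"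
      using Cons.IH letter[OF i, of b] by (simp add: bij_group_def l del: letter_val.simps shear.simps)
    thus ?case by (simp add: fun_eq_iff)
  qed (simp add: bij_group_def fun_eq_iff)
  have hc: "h c3 = neg_pair"
    using B3_sigmas(1,2)
    by (auto simp: c3_eq(1) hm hs S_def fun_eq_iff neg_pair_def simp del: h.hom_mult)
  have nn: "neg_pair (neg_pair v) = v" for v by (simp add: neg_pair_def)
  have nb: "bij neg_pair" by (rule bij_betw_byWitness[of UNIV neg_pair]) (auto simp: nn)
  have ninv: "inv\<^bsub>bij_group\<^esub> neg_pair = neg_pair" by (rule bij_group_inv[OF nb nn])
  have np: "neg_pair [^]\<^bsub>bij_group\<^esub> (n::nat) \<in> {id, neg_pair}" for n
  proof (induction n)
    case (Suc n)
    have "neg_pair \<circ> neg_pair = id" using nn by auto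
    hence "f \<circ> neg_pair \<in> {id, neg_pair}" if "f \<in> {id, neg_pair}" for f using that by auto
    moreover have "f \<otimes>\<^bsub>bij_group\<^esub> neg_pair = f \<circ> neg_pair" for f by (simp add: bij_group_def)
    ultimately show ?case using Suc unfolding nat_pow_Suc by metis
  qed (simp add: bij_group_def)
  have ninvid: "inv\<^bsub>bij_group\<^esub> (id :: int \<times> int \<Rightarrow> int \<times> int) = id" by (rule bij_group_inv) auto
  have nk: "neg_pair [^]\<^bsub>bij_group\<^esub> k \<in> {id, neg_pair}"
  proof (cases "k < 0")
    case True
    have "neg_pair [^]\<^bsub>bij_group\<^esub> nat (- k) = id \<or> neg_pair [^]\<^bsub>bij_group\<^esub> nat (- k) = neg_pair"
      using np[of "nat (- k)"] by (simp only: insert_iff empty_iff simp_thms)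
    thus ?thesis using True ninv ninvid unfolding int_pow_def2 insert_iff by metis
  next
    case False thus ?thesis using np[of "nat k"] unfolding int_pow_def2 by (simp only: if_False)
  qed
  have wc: "word_val B3 free_gens w \<in> carrier B3" by (rule B.word_val_closed[OF free_gens_closed w])
  have "foldr shear w \<circ> neg_pair [^]\<^bsub>bij_group\<^esub> k = id"
    using arg_cong[OF e, of h] wc B3_gens_closed(4) h.hom_int_pow[OF B3_gens_closed(4), of k]
      hom_word_val[OF braid_group bij_group h(1) free_gens_closed w] hw hc
    by (simp add: hm[OF wc] del: h.hom_mult) (simp add: bij_group_def)
  hence e': "foldr shear w ((neg_pair [^]\<^bsub>bij_group\<^esub> k) v) = v" for v by (metis comp_apply id_apply)
  have sh: "foldr shear w v = v \<or> foldr shear w v = neg_pair v" for v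
  proof -
    from nk have "neg_pair [^]\<^bsub>bij_group\<^esub> k = id \<or> neg_pair [^]\<^bsub>bij_group\<^esub> k = neg_pair" by simp
    thus ?thesis using e'[of v] e'[of "neg_pair v"] by (elim disjE) (simp_all add: nn)
  qed
  hence "word_val B3 free_gens w = \<one>\<^bsub>B3\<^esub>" by (intro word_val_trivial[OF w _ braid_group free_gens_closed]) auto
  hence ck: "c3 [^]\<^bsub>B3\<^esub> k = \<one>\<^bsub>B3\<^esub>" using e B3_gens_closed(4) by simp
  \<comment> \<open>The exponent sum: every generator goes to 1, and \<open>c3\<close> is a product
    of six generators.\<close>
  have "braid_images 3 integer_group (\<lambda>i. 1)" by (auto simp: braid_images_def)
  then obtain a where a: "a \<in> hom B3 integer_group" "\<And>i. 1 \<le> i \<Longrightarrow> i < 3 \<Longrightarrow> a (sigma 3 i) = 1"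
    using braid_hom[OF group_integer_group] by metis
  interpret a: group_hom B3 integer_group a
    using a(1) by (simp add: group_hom_def group_hom_axioms_def braid_group)
  have "a c3 = 6" using B3_sigmas(1,2) a(2)[of 1] a(2)[of 2] by (simp add: c3_eq(1))
  hence "6 [^]\<^bsub>integer_group\<^esub> k = (0::int)"
    using arg_cong[OF ck, of a] a.hom_int_pow[OF B3_gens_closed(4), of k] by simp
  hence "k = 0" by simp
  with sh show ?thesis by blast
qed

lemma (in group) commute_int_pow:
  assumes "x \<otimes> y = y \<otimes> x" "x \<in> carrier G" "y \<in> carrier G"
  shows "x \<otimes> y [^] (k::int) = y [^] k \<otimes> x"
proof -
  have "x \<otimes> y [^] n = y [^] n \<otimes> x" for n :: nat
    using group_commutes_pow[OF assms(1)[symmetric] assms(3,2)] by (rule HOL.sym)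
  note n = this
  show ?thesis
  proof (cases "k < 0")
    case True
    thus ?thesis using commute_inv[OF n assms(2) nat_pow_closed[OF assms(3)]] unfolding int_pow_def2 by (simp only: if_True)
  next
    case False
    thus ?thesis using n unfolding int_pow_def2 by (simp only: if_False)
  qed
qed

lemma free_gens_simps: "free_gens 1 = x12" "free_gens 2 = x23"
  by (simp_all add: free_gens_def)

abbreviation "free_words \<equiv> lists ({1, 2::nat} \<times> (UNIV :: bool set))"
abbreviation "free_val \<equiv> word_val B3 free_gens"

lemma free_val_closed: "w \<in> free_words \<Longrightarrow> free_val w \<in> carrier B3"
  using group.word_val_closed[OF braid_group free_gens_closed] .

lemma free_val_append: "u \<in> free_words \<Longrightarrow> v \<in> free_words \<Longrightarrow> free_val (u @ v) = free_val u \<otimes>\<^bsub>B3\<^esub> free_val v"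
  using group.word_val_append[OF braid_group free_gens_closed] .

lemma PB3_normal_form_mult:
  assumes "u \<in> free_words" "v \<in> free_words"
  shows "(free_val u \<otimes>\<^bsub>B3\<^esub> c3 [^]\<^bsub>B3\<^esub> (k::int)) \<otimes>\<^bsub>B3\<^esub> (free_val v \<otimes>\<^bsub>B3\<^esub> c3 [^]\<^bsub>B3\<^esub> (l::int)) =
    free_val (u @ v) \<otimes>\<^bsub>B3\<^esub> c3 [^]\<^bsub>B3\<^esub> (k + l)"
proof -
  interpret group B3 by (rule braid_group)
  have u: "free_val u \<in> carrier B3" and v: "free_val v \<in> carrier B3" using assms free_val_closed by simp_all
  have c: "c3 [^]\<^bsub>B3\<^esub> (i::int) \<in> carrier B3" for i using B3_gens_closed(4) by simp
  have "(free_val u \<otimes>\<^bsub>B3\<^esub> c3 [^]\<^bsub>B3\<^esub> k) \<otimes>\<^bsub>B3\<^esub> (free_val v \<otimes>\<^bsub>B3\<^esub> c3 [^]\<^bsub>B3\<^esub> l)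
    = free_val u \<otimes>\<^bsub>B3\<^esub> ((c3 [^]\<^bsub>B3\<^esub> k \<otimes>\<^bsub>B3\<^esub> free_val v) \<otimes>\<^bsub>B3\<^esub> c3 [^]\<^bsub>B3\<^esub> l)"
    using u v c by (simp add: m_assoc)
  also have "c3 [^]\<^bsub>B3\<^esub> k \<otimes>\<^bsub>B3\<^esub> free_val v = free_val v \<otimes>\<^bsub>B3\<^esub> c3 [^]\<^bsub>B3\<^esub> k"
    by (rule commute_int_pow[OF c3_central[OF v] v B3_gens_closed(4), symmetric])
  finally show ?thesis
    using u v c B3_gens_closed(4) by (simp add: m_assoc free_val_append[OF assms] int_pow_mult)
qed

lemma PB3_normal_form:
  assumes "g \<in> carrier PB3"
  obtains w k where "w \<in> free_words" "g = free_val w \<otimes>\<^bsub>B3\<^esub> c3 [^]\<^bsub>B3\<^esub> (k::int)"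
proof -
  interpret group B3 by (rule braid_group)
  note cl = B3_gens_closed
  have "\<exists>w\<in>free_words. \<exists>k::int. g = free_val w \<otimes>\<^bsub>B3\<^esub> c3 [^]\<^bsub>B3\<^esub> k"
    using assms unfolding PB3_generated
  proof (induction rule: generate.induct)
    case one
    show ?case by (intro bexI[of _ "[]"] exI[of _ 0]) simp_all
  next
    case (incl h)
    hence "h = x12 \<or> h = x23 \<or> h = c3" by simp
    hence "h = free_val [(1, True)] \<otimes>\<^bsub>B3\<^esub> c3 [^]\<^bsub>B3\<^esub> (0::int) \<or> h = free_val [(2, True)] \<otimes>\<^bsub>B3\<^esub> c3 [^]\<^bsub>B3\<^esub> (0::int)
        \<or> h = free_val [] \<otimes>\<^bsub>B3\<^esub> c3 [^]\<^bsub>B3\<^esub> (1::int)"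
      using cl by (simp add: free_gens_simps)
    moreover have "[(1, True)] \<in> free_words" "[(2, True)] \<in> free_words" "[] \<in> free_words" by simp_all
    ultimately show ?case by metis
  next
    case (inv h)
    hence "h = x12 \<or> h = x23 \<or> h = c3" by simp
    hence "inv\<^bsub>B3\<^esub> h = free_val [(1, False)] \<otimes>\<^bsub>B3\<^esub> c3 [^]\<^bsub>B3\<^esub> (0::int) \<or> inv\<^bsub>B3\<^esub> h = free_val [(2, False)] \<otimes>\<^bsub>B3\<^esub> c3 [^]\<^bsub>B3\<^esub> (0::int)
        \<or> inv\<^bsub>B3\<^esub> h = free_val [] \<otimes>\<^bsub>B3\<^esub> c3 [^]\<^bsub>B3\<^esub> (-1::int)"
      using cl by (elim disjE) (simp_all add: free_gens_simps int_pow_neg)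
    moreover have "[(1, False)] \<in> free_words" "[(2, False)] \<in> free_words" "[] \<in> free_words" by simp_all
    ultimately show ?case by metis
  next
    case (eng g h)
    then obtain u k v l where "u \<in> free_words" "v \<in> free_words"
      "g = free_val u \<otimes>\<^bsub>B3\<^esub> c3 [^]\<^bsub>B3\<^esub> (k::int)" "h = free_val v \<otimes>\<^bsub>B3\<^esub> c3 [^]\<^bsub>B3\<^esub> (l::int)" by metis
    thus ?case using PB3_normal_form_mult[of u v k l]
      by (intro bexI[of _ "u @ v"] exI[of _ "k + l"]) simp_all
  qed
  thus thesis using that by metis
qed

text \<open>\<open>PB\<^sub>3\<close> is the product of the free group on \<open>x\<^sub>1\<^sub>2\<close>, \<open>x\<^sub>2\<^sub>3\<close> and the infinite cyclic group generated by \<open>c\<close>.\<close>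

lemma PB3_universal:
  fixes G (structure)
  assumes "group G" "a \<in> carrier G" "b \<in> carrier G" "z \<in> carrier G"
    "a \<otimes>\<^bsub>G\<^esub> z = z \<otimes>\<^bsub>G\<^esub> a" "b \<otimes>\<^bsub>G\<^esub> z = z \<otimes>\<^bsub>G\<^esub> b"
  obtains h where "h \<in> hom PB3 G" "h x12 = a" "h x23 = b" "h c3 = z"
proof -
  interpret group G by fact
  interpret B: group B3 by (rule braid_group)
  define s where "s i = (if i = (1::nat) then a else b)" for i
  have s: "s ` {1, 2} \<subseteq> carrier G" using assms by (simp add: s_def)
  have sz: "word_val G s w \<otimes> z = z \<otimes> word_val G s w" if "w \<in> free_words" for w
  proof (rule commute_generate[OF s assms(4)])
    show "y \<otimes> z = z \<otimes> y" if "y \<in> s ` {1, 2}" for y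
      using that assms(5,6) unfolding s_def by (elim imageE) (simp split: if_splits)
    show "word_val G s w \<in> generate G (s ` {1, 2})" using generate_eq_words[OF s] that by simp
  qed
  \<comment> \<open>The graph of the homomorphism sought, described through normal forms
    \<open>w c^k\<close>.\<close>
  define R where "R g v \<longleftrightarrow> (\<exists>w\<in>free_words. \<exists>k::int. g = free_val w \<otimes>\<^bsub>B3\<^esub> c3 [^]\<^bsub>B3\<^esub> k \<and> v = word_val G s w \<otimes> z [^] k)" for g v
  have ex: "\<exists>v. R g v" if "g \<in> carrier PB3" for g
    using PB3_normal_form[OF that] unfolding R_def by metis
  \<comment> \<open>Two normal forms of \<open>g\<close> differ by a relation
    \<open>w'^-1 w c^(k - k') = 1\<close>. By \<open>word_c3_eq_one\<close> the exponents agree and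
    the word acts by 1 or -1, so it is trivial in \<open>G\<close> as well.\<close>
  have uniq: "v = v'" if vv: "R g v" "R g v'" for g v v'
  proof -
    obtain w k where w: "w \<in> free_words" "g = free_val w \<otimes>\<^bsub>B3\<^esub> c3 [^]\<^bsub>B3\<^esub> (k::int)" "v = word_val G s w \<otimes> z [^] k"
      using vv(1) unfolding R_def by metis
    obtain w' k' where w': "w' \<in> free_words" "g = free_val w' \<otimes>\<^bsub>B3\<^esub> c3 [^]\<^bsub>B3\<^esub> (k'::int)" "v' = word_val G s w' \<otimes> z [^] k'"
      using vv(2) unfolding R_def by metis
    have wi: "word_inv w' \<in> free_words" using word_inv_lists[OF w'(1)] .
    have c: "free_val w \<in> carrier B3" "free_val w' \<in> carrier B3" "\<And>i. c3 [^]\<^bsub>B3\<^esub> (i::int) \<in> carrier B3"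
      using w(1) w'(1) free_val_closed B3_gens_closed(4) by simp_all
    have "free_val (word_inv w' @ w) \<otimes>\<^bsub>B3\<^esub> c3 [^]\<^bsub>B3\<^esub> (k - k') =
        inv\<^bsub>B3\<^esub> free_val w' \<otimes>\<^bsub>B3\<^esub> ((free_val w \<otimes>\<^bsub>B3\<^esub> c3 [^]\<^bsub>B3\<^esub> k) \<otimes>\<^bsub>B3\<^esub> inv\<^bsub>B3\<^esub> (c3 [^]\<^bsub>B3\<^esub> k'))"
      using c B.word_val_inv[OF free_gens_closed w'(1)] B3_gens_closed(4)
      by (simp add: free_val_append[OF wi w(1)] B.int_pow_diff B.m_assoc)
    also have "free_val w \<otimes>\<^bsub>B3\<^esub> c3 [^]\<^bsub>B3\<^esub> k = free_val w' \<otimes>\<^bsub>B3\<^esub> c3 [^]\<^bsub>B3\<^esub> k'" using w(2) w'(2) by simp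
    also have "inv\<^bsub>B3\<^esub> free_val w' \<otimes>\<^bsub>B3\<^esub> ((free_val w' \<otimes>\<^bsub>B3\<^esub> c3 [^]\<^bsub>B3\<^esub> k') \<otimes>\<^bsub>B3\<^esub> inv\<^bsub>B3\<^esub> (c3 [^]\<^bsub>B3\<^esub> k')) = \<one>\<^bsub>B3\<^esub>"
      using c by (simp add: B.m_assoc)
    finally have t: "(\<forall>v. foldr shear (word_inv w' @ w) v = v \<or> foldr shear (word_inv w' @ w) v = neg_pair v) \<and> k - k' = 0"
      using wi w(1) by (intro word_c3_eq_one) simp_all
    hence "word_val G s (word_inv w' @ w) = \<one>"
      using wi w(1) by (intro word_val_trivial[OF _ conjunct1[OF t, rule_format] assms(1) s]) simp
    hence "inv (word_val G s w') \<otimes> word_val G s w = \<one>"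
      using word_val_append[OF s wi w(1)] word_val_inv[OF s w'(1)] by simp
    hence "word_val G s w = word_val G s w'"
      using word_val_closed[OF s w(1)] word_val_closed[OF s w'(1)] by (metis inv_closed inv_equality inv_inv)
    thus ?thesis using w(3) w'(3) t by simp
  qed
  define h where "h g = (THE v. R g v)" for g
  have h: "h g = v" if "R g v" for g v
    unfolding h_def by (rule the_equality[where P = "R g", OF that]) (rule uniq[OF _ that])
  have "h \<in> hom PB3 G"
  proof (rule homI)
    fix g assume g: "g \<in> carrier PB3"
    obtain w k where w: "w \<in> free_words" "g = free_val w \<otimes>\<^bsub>B3\<^esub> c3 [^]\<^bsub>B3\<^esub> (k::int)" using PB3_normal_form[OF g] .
    hence hg: "h g = word_val G s w \<otimes> z [^] k" by (intro h) (auto simp: R_def)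
    thus "h g \<in> carrier G" using word_val_closed[OF s w(1)] assms(4) by simp
    fix g' assume g': "g' \<in> carrier PB3"
    obtain w' k' where w': "w' \<in> free_words" "g' = free_val w' \<otimes>\<^bsub>B3\<^esub> c3 [^]\<^bsub>B3\<^esub> (k'::int)" using PB3_normal_form[OF g'] .
    hence hg': "h g' = word_val G s w' \<otimes> z [^] k'" by (intro h) (auto simp: R_def)
    note c = word_val_closed[OF s w(1)] word_val_closed[OF s w'(1)]
    have "R (g \<otimes>\<^bsub>B3\<^esub> g') (word_val G s (w @ w') \<otimes> z [^] (k + k'))"
      unfolding R_def using w w' PB3_normal_form_mult[OF w(1) w'(1), of k k']
      by (intro bexI[of _ "w @ w'"] exI[of _ "k + k'"]) simp_all
    hence "h (g \<otimes>\<^bsub>B3\<^esub> g') = word_val G s (w @ w') \<otimes> z [^] (k + k')" by (rule h)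
    also have "\<dots> = word_val G s w \<otimes> ((word_val G s w' \<otimes> z [^] k) \<otimes> z [^] k')"
      using c assms(4) by (simp add: word_val_append[OF s w(1) w'(1)] int_pow_mult m_assoc)
    also have "word_val G s w' \<otimes> z [^] k = z [^] k \<otimes> word_val G s w'"
      by (rule commute_int_pow[OF sz[OF w'(1)] c(2) assms(4)])
    finally show "h (g \<otimes>\<^bsub>PB3\<^esub> g') = h g \<otimes> h g'" using c assms(4) by (simp add: hg hg' m_assoc)
  qed
  moreover have "h x12 = a"
    using assms B3_gens_closed by (intro h) (auto simp: R_def free_gens_simps s_def intro!: bexI[of _ "[(1, True)]"] exI[of _ "0::int"])
  moreover have "h x23 = b"
    using assms B3_gens_closed by (intro h) (auto simp: R_def free_gens_simps s_def intro!: bexI[of _ "[(2, True)]"] exI[of _ "0::int"])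
  moreover have "h c3 = z"
    using assms B3_gens_closed by (intro h) (auto simp: R_def intro!: bexI[of _ "[]"] exI[of _ "1::int"])
  ultimately show thesis using that by blast
qed

lemma PB3_generated': "generate PB3 {x12, x23, c3} = carrier PB3"
  using group.generate_consistent[OF braid_group _ pure_braid_subgroup, of "{x12, x23, c3}" 3] PB3_gens_pure PB3_generated
  by (simp add: pure_braid_group_def)

section \<open>The subgroup \<open>F2\<close> and its freeness\<close>

lemma F2_carrier: "carrier F2 = generate PB3 {x12, x23}"
proof -
  have "carrier PB3 \<inter> {x12, x23} = {x12, x23}" using PB3_gens_pure by blast
  thus ?thesis by (simp add: F2_def subgroup_generated_def)
qed

lemma F2_ops [simp]: "(\<otimes>\<^bsub>F2\<^esub>) = (\<otimes>\<^bsub>B3\<^esub>)" "\<one>\<^bsub>F2\<^esub> = \<one>\<^bsub>B3\<^esub>"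
  by (simp_all add: F2_def subgroup_generated_def)

lemma F2_group: "group F2"
  unfolding F2_def by (rule group.group_subgroup_generated[OF pure_braid_group])

lemma F2_PB3: "g \<in> carrier F2 \<Longrightarrow> g \<in> carrier PB3"
proof -
  have "{x12, x23} \<subseteq> carrier PB3" using PB3_gens_pure by simp
  from group.generate_in_carrier[OF pure_braid_group this]
  show "g \<in> carrier F2 \<Longrightarrow> g \<in> carrier PB3" unfolding F2_carrier .
qed

lemma PB_B: "g \<in> carrier (pure_braid_group n) \<Longrightarrow> g \<in> carrier (braid_group n)"
  by (simp add: pure_braid_carrier)

lemma F2_gens: "x12 \<in> carrier F2" "x23 \<in> carrier F2"
  unfolding F2_carrier by (auto intro: generate.incl)

lemma F2_generated: "generate F2 {x12, x23} = carrier F2"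
proof -
  have "subgroup (carrier F2) PB3" unfolding F2_carrier
    using group.generate_is_subgroup[OF pure_braid_group, of "{x12, x23}"] PB3_gens_pure by simp
  from group.generate_consistent[OF pure_braid_group _ this, of "{x12, x23}"] F2_gens
  have 1: "generate (PB3\<lparr>carrier := carrier F2\<rparr>) {x12, x23} = generate PB3 {x12, x23}" by simp
  have "PB3\<lparr>carrier := carrier F2\<rparr> = F2" by (simp add: F2_def subgroup_generated_def)
  with 1 show ?thesis unfolding F2_carrier[symmetric] by simp
qed

lemma F2_inclusion: "(\<lambda>g. g) \<in> hom F2 PB3" "(\<lambda>g. g) \<in> hom F2 B3"
  using F2_PB3 PB_B by (auto simp: hom_def)

lemma F2_inv: "g \<in> carrier F2 \<Longrightarrow> inv\<^bsub>F2\<^esub> g = inv\<^bsub>B3\<^esub> g"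
  using group_hom.hom_inv[of F2 B3 "\<lambda>g. g" g] F2_inclusion(2) F2_group braid_group
  by (simp add: group_hom_def group_hom_axioms_def)

text \<open>Sending \<open>c3\<close> to 1 in \<open>PB3_universal\<close> leaves the values at
  \<open>x12\<close> and \<open>x23\<close> unconstrained.\<close>

lemma F2_universal:
  assumes "group G" "a \<in> carrier G" "b \<in> carrier G"
  obtains h where "h \<in> hom F2 G" "h x12 = a" "h x23 = b"
proof -
  interpret group G by fact
  obtain h where h: "h \<in> hom PB3 G" "h x12 = a" "h x23 = b"
    using PB3_universal[OF assms one_closed] assms by auto
  have "(\<lambda>g. h g) \<in> hom F2 G" by (rule hom_comp[OF F2_inclusion(1) h(1)])
  thus thesis using that h by simp
qed

section \<open>The five homomorphisms\<close>

text \<open>The third datum in \<open>PB3_universal\<close> is the value at \<open>c3\<close>, not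
  at \<open>x13\<close>. It is taken to be \<open>b a d\<close>, which the two commutation
  hypotheses make commute with \<open>a\<close> and \<open>b\<close>; the value at
  \<open>x13\<close> then follows from \<open>c3 = x23 x12 x13\<close>.\<close>

lemma hom_PB3_PB4:
  assumes "a \<in> carrier PB4" "b \<in> carrier PB4" "d \<in> carrier PB4"
    "a \<otimes>\<^bsub>B4\<^esub> (d \<otimes>\<^bsub>B4\<^esub> b) = (d \<otimes>\<^bsub>B4\<^esub> b) \<otimes>\<^bsub>B4\<^esub> a" "b \<otimes>\<^bsub>B4\<^esub> (a \<otimes>\<^bsub>B4\<^esub> d) = (a \<otimes>\<^bsub>B4\<^esub> d) \<otimes>\<^bsub>B4\<^esub> b"
  shows "hom_PB3_PB4 a b d \<in> hom PB3 PB4" "hom_PB3_PB4 a b d x12 = a" "hom_PB3_PB4 a b d x23 = b"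
proof -
  interpret P: group PB4 by (rule pure_braid_group)
  interpret P3: group PB3 by (rule pure_braid_group)
  have "a \<otimes>\<^bsub>PB4\<^esub> (d \<otimes>\<^bsub>PB4\<^esub> b) = (d \<otimes>\<^bsub>PB4\<^esub> b) \<otimes>\<^bsub>PB4\<^esub> a" "b \<otimes>\<^bsub>PB4\<^esub> (a \<otimes>\<^bsub>PB4\<^esub> d) = (a \<otimes>\<^bsub>PB4\<^esub> d) \<otimes>\<^bsub>PB4\<^esub> b"
    using assms(4,5) by simp_all
  note z = P.central_from_cyclic[OF assms(1-3) this]
  obtain h where h: "h \<in> hom PB3 PB4" "h x12 = a" "h x23 = b" "h c3 = b \<otimes>\<^bsub>PB4\<^esub> a \<otimes>\<^bsub>PB4\<^esub> d"
    using PB3_universal[OF P.is_group assms(1,2) _ z] assms(1-3) P.m_closed by metis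
  have x13: "x13 = inv\<^bsub>PB3\<^esub> x12 \<otimes>\<^bsub>PB3\<^esub> (inv\<^bsub>PB3\<^esub> x23 \<otimes>\<^bsub>PB3\<^esub> c3)"
  proof -
    have "c3 = x23 \<otimes>\<^bsub>PB3\<^esub> (x12 \<otimes>\<^bsub>PB3\<^esub> x13)" using c3_eq(2) by simp
    hence "inv\<^bsub>PB3\<^esub> x12 \<otimes>\<^bsub>PB3\<^esub> (inv\<^bsub>PB3\<^esub> x23 \<otimes>\<^bsub>PB3\<^esub> c3) = x13"
      using PB3_gens_pure P3.mult_inv_cancel(2) P3.m_closed by metis
    thus ?thesis by simp
  qed
  interpret h: group_hom PB3 PB4 h using h(1) by unfold_locales
  have "h x13 = inv\<^bsub>PB4\<^esub> a \<otimes>\<^bsub>PB4\<^esub> (inv\<^bsub>PB4\<^esub> b \<otimes>\<^bsub>PB4\<^esub> (b \<otimes>\<^bsub>PB4\<^esub> a \<otimes>\<^bsub>PB4\<^esub> d))"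
    by (subst x13) (simp only: h.hom_mult h.hom_inv PB3_gens_pure P3.inv_closed P3.m_closed h)
  also have "\<dots> = inv\<^bsub>PB4\<^esub> a \<otimes>\<^bsub>PB4\<^esub> (inv\<^bsub>PB4\<^esub> b \<otimes>\<^bsub>PB4\<^esub> (b \<otimes>\<^bsub>PB4\<^esub> (a \<otimes>\<^bsub>PB4\<^esub> d)))"
    by (simp only: P.m_assoc assms(1-3))
  also have "\<dots> = d" by (simp only: P.mult_inv_cancel(2) P.m_closed assms(1-3))
  finally have hx: "h x13 = d" .
  let ?S = "{x12, x23, x13}"
  have S: "?S \<subseteq> carrier PB3" using PB3_gens_pure by simp
  have "c3 \<in> generate PB3 ?S"
  proof -
    have "x23 \<otimes>\<^bsub>PB3\<^esub> (x12 \<otimes>\<^bsub>PB3\<^esub> x13) \<in> generate PB3 ?S" by (intro generate.eng generate.incl) simp_all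
    thus ?thesis using c3_eq(2) by simp
  qed
  hence "{x12, x23, c3} \<subseteq> generate PB3 ?S" by (simp add: generate.incl)
  hence "generate PB3 {x12, x23, c3} \<subseteq> generate PB3 ?S"
    by (rule P3.generate_subgroup_incl[OF _ P3.generate_is_subgroup[OF S]])
  hence gen: "generate PB3 ?S = carrier PB3" using PB3_generated' P3.generate_incl[OF S] by simp
  have V: "fst ` {(x12, a), (x23, b), (x13, d)} = ?S" by simp
  have eq: "hom_PB3_PB4 a b d = restrict h (carrier PB3)"
    unfolding hom_PB3_PB4_def
  proof (rule hom_with_values_eq[OF P3.is_group P.is_group h(1)])
    show "h s = v" if "(s, v) \<in> {(x12, a), (x23, b), (x13, d)}" for s v
      using that h(2,3) hx by auto
  qed (simp_all only: V S gen)
  show "hom_PB3_PB4 a b d \<in> hom PB3 PB4" using h(1) P3.m_closed unfolding eq by (simp add: hom_def Pi_iff)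
  show "hom_PB3_PB4 a b d x12 = a" "hom_PB3_PB4 a b d x23 = b"
    unfolding eq using h PB3_gens_pure by simp_all
qed

section \<open>Cablings in \<open>B4\<close> and the relations they satisfy\<close>

abbreviation "s1 \<equiv> sigma 4 1"
abbreviation "s2 \<equiv> sigma 4 2"
abbreviation "s3 \<equiv> sigma 4 3"

lemma braid_sigma_far: "1 \<le> i \<Longrightarrow> i + 2 \<le> j \<Longrightarrow> j < n \<Longrightarrow>
    sigma n i \<otimes>\<^bsub>braid_group n\<^esub> sigma n j = sigma n j \<otimes>\<^bsub>braid_group n\<^esub> sigma n i"
  using sigma_images[of n] unfolding braid_images_def by blast

lemma B4_sigmas:
  "s1 \<in> carrier B4" "s2 \<in> carrier B4" "s3 \<in> carrier B4"
  "s1 \<otimes>\<^bsub>B4\<^esub> (s2 \<otimes>\<^bsub>B4\<^esub> s1) = s2 \<otimes>\<^bsub>B4\<^esub> (s1 \<otimes>\<^bsub>B4\<^esub> s2)"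
  "s2 \<otimes>\<^bsub>B4\<^esub> (s3 \<otimes>\<^bsub>B4\<^esub> s2) = s3 \<otimes>\<^bsub>B4\<^esub> (s2 \<otimes>\<^bsub>B4\<^esub> s3)"
  "s1 \<otimes>\<^bsub>B4\<^esub> s3 = s3 \<otimes>\<^bsub>B4\<^esub> s1"
  using braid_sigma_rel[of 1 4] braid_sigma_rel[of 2 4] sigma_closed[of _ 4] braid_sigma_far[of 1 3 4]
  by simp_all

lemma B4_pure_gens:
  "pure_gen 4 1 2 = s1 \<otimes>\<^bsub>B4\<^esub> s1" "pure_gen 4 2 3 = s2 \<otimes>\<^bsub>B4\<^esub> s2" "pure_gen 4 3 4 = s3 \<otimes>\<^bsub>B4\<^esub> s3"
  "pure_gen 4 1 3 = s2 \<otimes>\<^bsub>B4\<^esub> (s1 \<otimes>\<^bsub>B4\<^esub> (s1 \<otimes>\<^bsub>B4\<^esub> inv\<^bsub>B4\<^esub> s2))"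
  "pure_gen 4 2 4 = s3 \<otimes>\<^bsub>B4\<^esub> (s2 \<otimes>\<^bsub>B4\<^esub> (s2 \<otimes>\<^bsub>B4\<^esub> inv\<^bsub>B4\<^esub> s3))"
  "pure_gen 4 1 4 = s3 \<otimes>\<^bsub>B4\<^esub> (s2 \<otimes>\<^bsub>B4\<^esub> (s1 \<otimes>\<^bsub>B4\<^esub> (s1 \<otimes>\<^bsub>B4\<^esub> (inv\<^bsub>B4\<^esub> s2 \<otimes>\<^bsub>B4\<^esub> inv\<^bsub>B4\<^esub> s3))))"
  using pure_gen_1[of 1 4] pure_gen_1[of 2 4] pure_gen_1[of 3 4] pure_gen_2[of 1 4] pure_gen_2[of 2 4] pure_gen_3[of 1 4]
  by simp_all

lemma PB4_gens_pure: "1 \<le> i \<Longrightarrow> i < j \<Longrightarrow> j \<le> 4 \<Longrightarrow> pure_gen 4 i j \<in> carrier PB4"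
  by (rule pure_gen_pure)

text \<open>\<open>cab12_3\<close> carries strand 3 once around strands 1 and 2, that is, a single
  strand makes a double crossing with a doubled one. The names of all four give the grouping of the
  strands.\<close>

definition "cab12_3 = s2 \<otimes>\<^bsub>B4\<^esub> (s1 \<otimes>\<^bsub>B4\<^esub> (s1 \<otimes>\<^bsub>B4\<^esub> s2))"
definition "cab1_23 = s1 \<otimes>\<^bsub>B4\<^esub> (s2 \<otimes>\<^bsub>B4\<^esub> (s2 \<otimes>\<^bsub>B4\<^esub> s1))"
definition "cab23_4 = s3 \<otimes>\<^bsub>B4\<^esub> (s2 \<otimes>\<^bsub>B4\<^esub> (s2 \<otimes>\<^bsub>B4\<^esub> s3))"
definition "cab2_34 = s2 \<otimes>\<^bsub>B4\<^esub> (s3 \<otimes>\<^bsub>B4\<^esub> (s3 \<otimes>\<^bsub>B4\<^esub> s2))"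

lemma cab_closed:
  "cab12_3 \<in> carrier B4" "cab1_23 \<in> carrier B4" "cab23_4 \<in> carrier B4" "cab2_34 \<in> carrier B4"
proof -
  interpret group B4 by (rule braid_group)
  show "cab12_3 \<in> carrier B4" "cab1_23 \<in> carrier B4" "cab23_4 \<in> carrier B4" "cab2_34 \<in> carrier B4"
    using B4_sigmas(1-3) by (simp_all add: cab12_3_def cab1_23_def cab23_4_def cab2_34_def)
qed

lemma cab_pure_gens:
  "pure_gen 4 1 3 \<otimes>\<^bsub>B4\<^esub> pure_gen 4 2 3 = cab12_3"
  "pure_gen 4 1 2 \<otimes>\<^bsub>B4\<^esub> pure_gen 4 1 3 = cab1_23"
  "pure_gen 4 2 4 \<otimes>\<^bsub>B4\<^esub> pure_gen 4 3 4 = cab23_4"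
  "pure_gen 4 2 3 \<otimes>\<^bsub>B4\<^esub> pure_gen 4 2 4 = cab2_34"
  "pure_gen 4 1 4 \<otimes>\<^bsub>B4\<^esub> pure_gen 4 2 4 = s3 \<otimes>\<^bsub>B4\<^esub> (cab12_3 \<otimes>\<^bsub>B4\<^esub> inv\<^bsub>B4\<^esub> s3)"
  "pure_gen 4 1 3 \<otimes>\<^bsub>B4\<^esub> pure_gen 4 1 4 = inv\<^bsub>B4\<^esub> s1 \<otimes>\<^bsub>B4\<^esub> (cab2_34 \<otimes>\<^bsub>B4\<^esub> s1)"
  "pure_gen 4 1 2 \<otimes>\<^bsub>B4\<^esub> (pure_gen 4 1 3 \<otimes>\<^bsub>B4\<^esub> pure_gen 4 1 4) = s1 \<otimes>\<^bsub>B4\<^esub> cab2_34 \<otimes>\<^bsub>B4\<^esub> s1"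
  "pure_gen 4 1 4 \<otimes>\<^bsub>B4\<^esub> (pure_gen 4 2 4 \<otimes>\<^bsub>B4\<^esub> pure_gen 4 3 4) = s3 \<otimes>\<^bsub>B4\<^esub> cab12_3 \<otimes>\<^bsub>B4\<^esub> s3"
proof -
  interpret group B4 by (rule braid_group)
  note s = B4_sigmas(1-3)
  show "pure_gen 4 1 3 \<otimes>\<^bsub>B4\<^esub> pure_gen 4 2 3 = cab12_3"
    using s by (simp add: B4_pure_gens cab12_3_def m_assoc mult_inv_cancel)
  show "pure_gen 4 1 2 \<otimes>\<^bsub>B4\<^esub> pure_gen 4 1 3 = cab1_23"
    using s braid_sq_conj[OF s(1,2) B4_sigmas(4)] by (simp add: B4_pure_gens cab1_23_def m_assoc)
  show 3: "pure_gen 4 2 4 \<otimes>\<^bsub>B4\<^esub> pure_gen 4 3 4 = cab23_4"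
    using s by (simp add: B4_pure_gens cab23_4_def m_assoc mult_inv_cancel)
  show "pure_gen 4 2 3 \<otimes>\<^bsub>B4\<^esub> pure_gen 4 2 4 = cab2_34"
    using s braid_sq_conj[OF s(2,3) B4_sigmas(5)] by (simp add: B4_pure_gens cab2_34_def m_assoc)
  show "pure_gen 4 1 4 \<otimes>\<^bsub>B4\<^esub> pure_gen 4 2 4 = s3 \<otimes>\<^bsub>B4\<^esub> (cab12_3 \<otimes>\<^bsub>B4\<^esub> inv\<^bsub>B4\<^esub> s3)"
    using s by (simp add: B4_pure_gens cab12_3_def m_assoc mult_inv_cancel)
  show 6: "pure_gen 4 1 3 \<otimes>\<^bsub>B4\<^esub> pure_gen 4 1 4 = inv\<^bsub>B4\<^esub> s1 \<otimes>\<^bsub>B4\<^esub> (cab2_34 \<otimes>\<^bsub>B4\<^esub> s1)"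
  proof -
    \<comment> \<open>Both conjugations are turned around by \<open>braid_conj_sq\<close>. As
      \<open>s1\<close> and \<open>s3\<close> commute, \<open>pure_gen 4 1 4\<close> becomes the
      conjugate of \<open>pure_gen 4 2 4\<close> by \<open>s1\<close>.\<close>
    have 1: "s2 \<otimes>\<^bsub>B4\<^esub> (s1 \<otimes>\<^bsub>B4\<^esub> (s1 \<otimes>\<^bsub>B4\<^esub> inv\<^bsub>B4\<^esub> s2)) = inv\<^bsub>B4\<^esub> s1 \<otimes>\<^bsub>B4\<^esub> (s2 \<otimes>\<^bsub>B4\<^esub> (s2 \<otimes>\<^bsub>B4\<^esub> s1))"
      by (rule braid_conj_sq[OF s(1,2) B4_sigmas(4)])
    have 2: "s3 \<otimes>\<^bsub>B4\<^esub> (s2 \<otimes>\<^bsub>B4\<^esub> (s2 \<otimes>\<^bsub>B4\<^esub> inv\<^bsub>B4\<^esub> s3)) = inv\<^bsub>B4\<^esub> s2 \<otimes>\<^bsub>B4\<^esub> (s3 \<otimes>\<^bsub>B4\<^esub> (s3 \<otimes>\<^bsub>B4\<^esub> s2))"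
      by (rule braid_conj_sq[OF s(2,3) B4_sigmas(5)])
    have c: "s3 \<otimes>\<^bsub>B4\<^esub> inv\<^bsub>B4\<^esub> s1 = inv\<^bsub>B4\<^esub> s1 \<otimes>\<^bsub>B4\<^esub> s3" "s1 \<otimes>\<^bsub>B4\<^esub> inv\<^bsub>B4\<^esub> s3 = inv\<^bsub>B4\<^esub> s3 \<otimes>\<^bsub>B4\<^esub> s1"
      using commute_inv[OF B4_sigmas(6)[symmetric]] commute_inv[OF B4_sigmas(6)] s by simp_all
    have "pure_gen 4 1 4 = s3 \<otimes>\<^bsub>B4\<^esub> ((s2 \<otimes>\<^bsub>B4\<^esub> (s1 \<otimes>\<^bsub>B4\<^esub> (s1 \<otimes>\<^bsub>B4\<^esub> inv\<^bsub>B4\<^esub> s2))) \<otimes>\<^bsub>B4\<^esub> inv\<^bsub>B4\<^esub> s3)"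
      using s by (simp add: B4_pure_gens m_assoc)
    also have "\<dots> = (s3 \<otimes>\<^bsub>B4\<^esub> inv\<^bsub>B4\<^esub> s1) \<otimes>\<^bsub>B4\<^esub> (s2 \<otimes>\<^bsub>B4\<^esub> (s2 \<otimes>\<^bsub>B4\<^esub> (s1 \<otimes>\<^bsub>B4\<^esub> inv\<^bsub>B4\<^esub> s3)))"
      unfolding 1 using s by (simp add: m_assoc)
    also have "\<dots> = inv\<^bsub>B4\<^esub> s1 \<otimes>\<^bsub>B4\<^esub> ((s3 \<otimes>\<^bsub>B4\<^esub> (s2 \<otimes>\<^bsub>B4\<^esub> (s2 \<otimes>\<^bsub>B4\<^esub> inv\<^bsub>B4\<^esub> s3))) \<otimes>\<^bsub>B4\<^esub> s1)"
      unfolding c using s by (simp add: m_assoc)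
    also have "\<dots> = inv\<^bsub>B4\<^esub> s1 \<otimes>\<^bsub>B4\<^esub> ((inv\<^bsub>B4\<^esub> s2 \<otimes>\<^bsub>B4\<^esub> (s3 \<otimes>\<^bsub>B4\<^esub> (s3 \<otimes>\<^bsub>B4\<^esub> s2))) \<otimes>\<^bsub>B4\<^esub> s1)"
      unfolding 2 ..
    finally have "pure_gen 4 1 4 = inv\<^bsub>B4\<^esub> s1 \<otimes>\<^bsub>B4\<^esub> ((inv\<^bsub>B4\<^esub> s2 \<otimes>\<^bsub>B4\<^esub> (s3 \<otimes>\<^bsub>B4\<^esub> (s3 \<otimes>\<^bsub>B4\<^esub> s2))) \<otimes>\<^bsub>B4\<^esub> s1)" .
    thus ?thesis unfolding B4_pure_gens(4) 1 using s by (simp add: cab2_34_def m_assoc mult_inv_cancel)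
  qed
  show "pure_gen 4 1 2 \<otimes>\<^bsub>B4\<^esub> (pure_gen 4 1 3 \<otimes>\<^bsub>B4\<^esub> pure_gen 4 1 4) = s1 \<otimes>\<^bsub>B4\<^esub> cab2_34 \<otimes>\<^bsub>B4\<^esub> s1"
    unfolding 6 B4_pure_gens(1) using s cab_closed by (simp add: m_assoc mult_inv_cancel)
  show "pure_gen 4 1 4 \<otimes>\<^bsub>B4\<^esub> (pure_gen 4 2 4 \<otimes>\<^bsub>B4\<^esub> pure_gen 4 3 4) = s3 \<otimes>\<^bsub>B4\<^esub> cab12_3 \<otimes>\<^bsub>B4\<^esub> s3"
    unfolding 3 B4_pure_gens(6) using s by (simp add: cab23_4_def cab12_3_def m_assoc mult_inv_cancel)
qed

lemma (in group) commute_sq: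
  assumes "x \<otimes> y = y \<otimes> x" "x \<in> carrier G" "y \<in> carrier G"
  shows "(x \<otimes> x) \<otimes> y = y \<otimes> (x \<otimes> x)"
  by (rule commute_mult[OF assms(1)[symmetric] assms(1)[symmetric] assms(3,2,2), symmetric])

text \<open>Rearrangements of the type B relation into the commutations that
  \<open>hom_PB3_PB4\<close> requires for \<open>phi_12_3_4\<close> and
  \<open>phi_1_2_34\<close>.\<close>

lemma (in group) type_B_consequences:
  assumes "u \<otimes> (D \<otimes> (u \<otimes> D)) = D \<otimes> (u \<otimes> (D \<otimes> u))" "u \<in> carrier G" "D \<in> carrier G"
  shows "D \<otimes> (u \<otimes> D \<otimes> u) = (u \<otimes> D \<otimes> u) \<otimes> D"
    "u \<otimes> (D \<otimes> (u \<otimes> (D \<otimes> inv u))) = (D \<otimes> (u \<otimes> (D \<otimes> inv u))) \<otimes> u"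
    "u \<otimes> (inv u \<otimes> (D \<otimes> (u \<otimes> D))) = (inv u \<otimes> (D \<otimes> (u \<otimes> D))) \<otimes> u"
proof -
  show "D \<otimes> (u \<otimes> D \<otimes> u) = (u \<otimes> D \<otimes> u) \<otimes> D" using assms by (simp add: m_assoc)
  have "(u \<otimes> (D \<otimes> (u \<otimes> D))) \<otimes> inv u = (D \<otimes> (u \<otimes> (D \<otimes> u))) \<otimes> inv u" using assms(1) by simp
  thus "u \<otimes> (D \<otimes> (u \<otimes> (D \<otimes> inv u))) = (D \<otimes> (u \<otimes> (D \<otimes> inv u))) \<otimes> u" using assms(2,3) by (simp add: m_assoc)
  have "(inv u \<otimes> (D \<otimes> (u \<otimes> D))) \<otimes> u = inv u \<otimes> (D \<otimes> (u \<otimes> (D \<otimes> u)))"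
    using assms(2,3) by (simp add: m_assoc)
  also have "\<dots> = inv u \<otimes> (u \<otimes> (D \<otimes> (u \<otimes> D)))" using assms(1) by simp
  also have "\<dots> = u \<otimes> (inv u \<otimes> (D \<otimes> (u \<otimes> D)))" using assms(2,3) by (simp add: mult_inv_cancel)
  finally show "u \<otimes> (inv u \<otimes> (D \<otimes> (u \<otimes> D))) = (inv u \<otimes> (D \<otimes> (u \<otimes> D))) \<otimes> u" by (rule HOL.sym)
qed

lemma sigma_cab_commute:
  "s1 \<otimes>\<^bsub>B4\<^esub> cab12_3 = cab12_3 \<otimes>\<^bsub>B4\<^esub> s1" "s2 \<otimes>\<^bsub>B4\<^esub> cab1_23 = cab1_23 \<otimes>\<^bsub>B4\<^esub> s2"
  "s2 \<otimes>\<^bsub>B4\<^esub> cab23_4 = cab23_4 \<otimes>\<^bsub>B4\<^esub> s2" "s3 \<otimes>\<^bsub>B4\<^esub> cab2_34 = cab2_34 \<otimes>\<^bsub>B4\<^esub> s3"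
  unfolding cab12_3_def cab1_23_def cab23_4_def cab2_34_def
  using group.braid_commute[OF braid_group[of 4]] B4_sigmas by metis+

lemma type_B_B4:
  "s3 \<otimes>\<^bsub>B4\<^esub> (cab12_3 \<otimes>\<^bsub>B4\<^esub> (s3 \<otimes>\<^bsub>B4\<^esub> cab12_3)) = cab12_3 \<otimes>\<^bsub>B4\<^esub> (s3 \<otimes>\<^bsub>B4\<^esub> (cab12_3 \<otimes>\<^bsub>B4\<^esub> s3))"
  "s1 \<otimes>\<^bsub>B4\<^esub> (cab2_34 \<otimes>\<^bsub>B4\<^esub> (s1 \<otimes>\<^bsub>B4\<^esub> cab2_34)) = cab2_34 \<otimes>\<^bsub>B4\<^esub> (s1 \<otimes>\<^bsub>B4\<^esub> (cab2_34 \<otimes>\<^bsub>B4\<^esub> s1))"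
  unfolding cab12_3_def cab2_34_def
  by (rule group.type_B_relation[OF braid_group B4_sigmas(1-6)],
      rule group.type_B_relation[OF braid_group B4_sigmas(3,2,1) B4_sigmas(5,4,6)[symmetric]])

text \<open>Each of the five needs only the two commutations of \<open>hom_PB3_PB4\<close>. For
  \<open>phi_123\<close> and \<open>phi_234\<close> a crossing commutes with a strand carried around
  it; for \<open>phi_12_3_4\<close> and \<open>phi_1_2_34\<close> the type B relation is used; for
  \<open>phi_1_23_4\<close> an outer strand carried around the three others commutes with the
  crossings of those.\<close>

lemma
  shows phi_123: "phi_123 \<in> hom PB3 PB4" "phi_123 x12 = s1 \<otimes>\<^bsub>B4\<^esub> s1" "phi_123 x23 = s2 \<otimes>\<^bsub>B4\<^esub> s2"
    and phi_234: "phi_234 \<in> hom PB3 PB4" "phi_234 x12 = s2 \<otimes>\<^bsub>B4\<^esub> s2" "phi_234 x23 = s3 \<otimes>\<^bsub>B4\<^esub> s3"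
    and phi_12_3_4: "phi_12_3_4 \<in> hom PB3 PB4" "phi_12_3_4 x12 = cab12_3" "phi_12_3_4 x23 = s3 \<otimes>\<^bsub>B4\<^esub> s3"
    and phi_1_23_4: "phi_1_23_4 \<in> hom PB3 PB4" "phi_1_23_4 x12 = cab1_23" "phi_1_23_4 x23 = cab23_4"
    and phi_1_2_34: "phi_1_2_34 \<in> hom PB3 PB4" "phi_1_2_34 x12 = s1 \<otimes>\<^bsub>B4\<^esub> s1" "phi_1_2_34 x23 = cab2_34"
proof -
  interpret group B4 by (rule braid_group)
  interpret P: subgroup "carrier PB4" B4 by (rule pure_braid_subgroup)
  note s = B4_sigmas(1-3) and cab = cab_closed
  note p = PB4_gens_pure[of 1 2, simplified] PB4_gens_pure[of 2 3, simplified] PB4_gens_pure[of 3 4, simplified]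
    PB4_gens_pure[of 1 3, simplified] PB4_gens_pure[of 2 4, simplified] PB4_gens_pure[of 1 4, simplified]
  note pp = P.m_closed[OF p(4,2)] P.m_closed[OF p(6,5)] P.m_closed[OF p(1,4)] P.m_closed[OF p(5,3)] P.m_closed[OF p(2,5)] P.m_closed[OF p(4,6)]
  have c1: "pure_gen 4 1 2 \<otimes>\<^bsub>B4\<^esub> (pure_gen 4 1 3 \<otimes>\<^bsub>B4\<^esub> pure_gen 4 2 3) = (pure_gen 4 1 3 \<otimes>\<^bsub>B4\<^esub> pure_gen 4 2 3) \<otimes>\<^bsub>B4\<^esub> pure_gen 4 1 2"
    unfolding cab_pure_gens unfolding B4_pure_gens(1-3) by (rule commute_sq[OF sigma_cab_commute(1) s(1) cab(1)])
  have c2: "pure_gen 4 2 3 \<otimes>\<^bsub>B4\<^esub> (pure_gen 4 1 2 \<otimes>\<^bsub>B4\<^esub> pure_gen 4 1 3) = (pure_gen 4 1 2 \<otimes>\<^bsub>B4\<^esub> pure_gen 4 1 3) \<otimes>\<^bsub>B4\<^esub> pure_gen 4 2 3"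
    unfolding cab_pure_gens unfolding B4_pure_gens(1-3) by (rule commute_sq[OF sigma_cab_commute(2) s(2) cab(2)])
  show "phi_123 \<in> hom PB3 PB4" "phi_123 x12 = s1 \<otimes>\<^bsub>B4\<^esub> s1" "phi_123 x23 = s2 \<otimes>\<^bsub>B4\<^esub> s2"
    unfolding phi_123_def B4_pure_gens(1,2)[symmetric] by (rule hom_PB3_PB4[OF p(1,2,4) c1 c2])+
  have c1: "pure_gen 4 2 3 \<otimes>\<^bsub>B4\<^esub> (pure_gen 4 2 4 \<otimes>\<^bsub>B4\<^esub> pure_gen 4 3 4) = (pure_gen 4 2 4 \<otimes>\<^bsub>B4\<^esub> pure_gen 4 3 4) \<otimes>\<^bsub>B4\<^esub> pure_gen 4 2 3"
    unfolding cab_pure_gens unfolding B4_pure_gens(1-3) by (rule commute_sq[OF sigma_cab_commute(3) s(2) cab(3)])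
  have c2: "pure_gen 4 3 4 \<otimes>\<^bsub>B4\<^esub> (pure_gen 4 2 3 \<otimes>\<^bsub>B4\<^esub> pure_gen 4 2 4) = (pure_gen 4 2 3 \<otimes>\<^bsub>B4\<^esub> pure_gen 4 2 4) \<otimes>\<^bsub>B4\<^esub> pure_gen 4 3 4"
    unfolding cab_pure_gens unfolding B4_pure_gens(1-3) by (rule commute_sq[OF sigma_cab_commute(4) s(3) cab(4)])
  show "phi_234 \<in> hom PB3 PB4" "phi_234 x12 = s2 \<otimes>\<^bsub>B4\<^esub> s2" "phi_234 x23 = s3 \<otimes>\<^bsub>B4\<^esub> s3"
    unfolding phi_234_def B4_pure_gens(2,3)[symmetric] by (rule hom_PB3_PB4[OF p(2,3,5) c1 c2])+
  have c1: "cab12_3 \<otimes>\<^bsub>B4\<^esub> (pure_gen 4 1 4 \<otimes>\<^bsub>B4\<^esub> pure_gen 4 2 4 \<otimes>\<^bsub>B4\<^esub> pure_gen 4 3 4) =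
      (pure_gen 4 1 4 \<otimes>\<^bsub>B4\<^esub> pure_gen 4 2 4 \<otimes>\<^bsub>B4\<^esub> pure_gen 4 3 4) \<otimes>\<^bsub>B4\<^esub> cab12_3"
  proof -
    have "pure_gen 4 1 4 \<otimes>\<^bsub>B4\<^esub> pure_gen 4 2 4 \<otimes>\<^bsub>B4\<^esub> pure_gen 4 3 4 = s3 \<otimes>\<^bsub>B4\<^esub> cab12_3 \<otimes>\<^bsub>B4\<^esub> s3"
      unfolding cab_pure_gens unfolding B4_pure_gens(3) using s cab by (simp add: m_assoc mult_inv_cancel)
    thus ?thesis using type_B_consequences(1)[OF type_B_B4(1) s(3) cab(1)] by simp
  qed
  have c2: "pure_gen 4 3 4 \<otimes>\<^bsub>B4\<^esub> (cab12_3 \<otimes>\<^bsub>B4\<^esub> (pure_gen 4 1 4 \<otimes>\<^bsub>B4\<^esub> pure_gen 4 2 4)) =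
      (cab12_3 \<otimes>\<^bsub>B4\<^esub> (pure_gen 4 1 4 \<otimes>\<^bsub>B4\<^esub> pure_gen 4 2 4)) \<otimes>\<^bsub>B4\<^esub> pure_gen 4 3 4"
    unfolding cab_pure_gens unfolding B4_pure_gens(3)
    using s cab by (intro commute_sq type_B_consequences(2)[OF type_B_B4(1) s(3) cab(1)]) simp_all
  show "phi_12_3_4 \<in> hom PB3 PB4" "phi_12_3_4 x12 = cab12_3" "phi_12_3_4 x23 = s3 \<otimes>\<^bsub>B4\<^esub> s3"
    unfolding phi_12_3_4_def B4_pure_gens(3)[symmetric] cab_pure_gens(1) by (rule hom_PB3_PB4[OF pp(1)[unfolded cab_pure_gens(1)] p(3) pp(2) c1 c2])+
  have c1: "cab1_23 \<otimes>\<^bsub>B4\<^esub> (pure_gen 4 1 4 \<otimes>\<^bsub>B4\<^esub> cab23_4) = (pure_gen 4 1 4 \<otimes>\<^bsub>B4\<^esub> cab23_4) \<otimes>\<^bsub>B4\<^esub> cab1_23"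
  proof -
    have e: "pure_gen 4 1 4 \<otimes>\<^bsub>B4\<^esub> cab23_4 = s3 \<otimes>\<^bsub>B4\<^esub> cab12_3 \<otimes>\<^bsub>B4\<^esub> s3" using cab_pure_gens(8) unfolding cab_pure_gens(3) .
    let ?R = "s3 \<otimes>\<^bsub>B4\<^esub> cab12_3 \<otimes>\<^bsub>B4\<^esub> s3"
    have R: "?R \<in> carrier B4" using s cab by simp
    have 1: "s1 \<otimes>\<^bsub>B4\<^esub> ?R = ?R \<otimes>\<^bsub>B4\<^esub> s1"
      using s cab by (intro commute_mult B4_sigmas(6) sigma_cab_commute) simp_all
    have 2: "s2 \<otimes>\<^bsub>B4\<^esub> ?R = ?R \<otimes>\<^bsub>B4\<^esub> s2"
      unfolding cab12_3_def by (rule strand_around_commute[OF s(3,2,1) B4_sigmas(5,4,6)[symmetric]])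
    have "?R \<otimes>\<^bsub>B4\<^esub> cab1_23 = cab1_23 \<otimes>\<^bsub>B4\<^esub> ?R"
      unfolding cab1_23_def using R s 1 2 by (intro commute_mult) (simp_all only: m_closed)
    thus ?thesis unfolding e by (rule HOL.sym)
  qed
  have c2: "cab23_4 \<otimes>\<^bsub>B4\<^esub> (cab1_23 \<otimes>\<^bsub>B4\<^esub> pure_gen 4 1 4) = (cab1_23 \<otimes>\<^bsub>B4\<^esub> pure_gen 4 1 4) \<otimes>\<^bsub>B4\<^esub> cab23_4"
  proof -
    have e: "cab1_23 \<otimes>\<^bsub>B4\<^esub> pure_gen 4 1 4 = s1 \<otimes>\<^bsub>B4\<^esub> cab2_34 \<otimes>\<^bsub>B4\<^esub> s1"
      using cab_pure_gens(7) p P.subset unfolding cab_pure_gens(2)[symmetric] by (simp add: m_assoc subset_iff)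
    let ?R = "s1 \<otimes>\<^bsub>B4\<^esub> cab2_34 \<otimes>\<^bsub>B4\<^esub> s1"
    have R: "?R \<in> carrier B4" using s cab by simp
    have 1: "s3 \<otimes>\<^bsub>B4\<^esub> ?R = ?R \<otimes>\<^bsub>B4\<^esub> s3"
      using s cab by (intro commute_mult B4_sigmas(6)[symmetric] sigma_cab_commute) simp_all
    have 2: "s2 \<otimes>\<^bsub>B4\<^esub> ?R = ?R \<otimes>\<^bsub>B4\<^esub> s2"
      unfolding cab2_34_def by (rule strand_around_commute[OF s(1,2,3) B4_sigmas(4,5,6)])
    have "?R \<otimes>\<^bsub>B4\<^esub> cab23_4 = cab23_4 \<otimes>\<^bsub>B4\<^esub> ?R"
      unfolding cab23_4_def using R s 1 2 by (intro commute_mult) (simp_all only: m_closed)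
    thus ?thesis unfolding e by (rule HOL.sym)
  qed
  show "phi_1_23_4 \<in> hom PB3 PB4" "phi_1_23_4 x12 = cab1_23" "phi_1_23_4 x23 = cab23_4"
    unfolding phi_1_23_4_def cab_pure_gens(2,3) by (rule hom_PB3_PB4[OF pp(3)[unfolded cab_pure_gens(2)] pp(4)[unfolded cab_pure_gens(3)] p(6) c1 c2])+
  have c1: "pure_gen 4 1 2 \<otimes>\<^bsub>B4\<^esub> (pure_gen 4 1 3 \<otimes>\<^bsub>B4\<^esub> pure_gen 4 1 4 \<otimes>\<^bsub>B4\<^esub> cab2_34) =
      (pure_gen 4 1 3 \<otimes>\<^bsub>B4\<^esub> pure_gen 4 1 4 \<otimes>\<^bsub>B4\<^esub> cab2_34) \<otimes>\<^bsub>B4\<^esub> pure_gen 4 1 2"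
  proof -
    have "pure_gen 4 1 3 \<otimes>\<^bsub>B4\<^esub> pure_gen 4 1 4 \<otimes>\<^bsub>B4\<^esub> cab2_34 = inv\<^bsub>B4\<^esub> s1 \<otimes>\<^bsub>B4\<^esub> (cab2_34 \<otimes>\<^bsub>B4\<^esub> (s1 \<otimes>\<^bsub>B4\<^esub> cab2_34))"
      unfolding cab_pure_gens using s cab by (simp add: m_assoc)
    thus ?thesis unfolding B4_pure_gens(1)
      using commute_sq[OF type_B_consequences(3)[OF type_B_B4(2) s(1) cab(4)]] s cab by simp
  qed
  have c2: "cab2_34 \<otimes>\<^bsub>B4\<^esub> (pure_gen 4 1 2 \<otimes>\<^bsub>B4\<^esub> (pure_gen 4 1 3 \<otimes>\<^bsub>B4\<^esub> pure_gen 4 1 4)) =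
      (pure_gen 4 1 2 \<otimes>\<^bsub>B4\<^esub> (pure_gen 4 1 3 \<otimes>\<^bsub>B4\<^esub> pure_gen 4 1 4)) \<otimes>\<^bsub>B4\<^esub> cab2_34"
    unfolding cab_pure_gens(7) by (rule type_B_consequences(1)[OF type_B_B4(2) s(1) cab(4)])
  show "phi_1_2_34 \<in> hom PB3 PB4" "phi_1_2_34 x12 = s1 \<otimes>\<^bsub>B4\<^esub> s1" "phi_1_2_34 x23 = cab2_34"
    unfolding phi_1_2_34_def B4_pure_gens(1)[symmetric] cab_pure_gens(4) by (rule hom_PB3_PB4[OF p(1) pp(5)[unfolded cab_pure_gens(4)] pp(6) c1 c2])+
qed

section \<open>The maps from \<open>B3\<close> to the first and to the last three strands\<close>

lemma iota_exists:
  assumes "i \<in> {0, 1}"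
  shows "\<exists>h. h \<in> hom B3 B4 \<and> h (sigma 3 1) = sigma 4 (1 + i) \<and> h (sigma 3 2) = sigma 4 (2 + i)"
proof -
  have "braid_images 3 B4 (\<lambda>k. sigma 4 (k + i))"
  proof -
    have "sigma 4 (k + i) \<in> carrier B4" if "k \<in> {1..<3}" for k
      using that assms by (intro sigma_closed) auto
    moreover have "sigma 4 (k + i) \<otimes>\<^bsub>B4\<^esub> (sigma 4 (k + 1 + i) \<otimes>\<^bsub>B4\<^esub> sigma 4 (k + i)) =
        sigma 4 (k + 1 + i) \<otimes>\<^bsub>B4\<^esub> (sigma 4 (k + i) \<otimes>\<^bsub>B4\<^esub> sigma 4 (k + 1 + i))" if "1 \<le> k \<and> k + 1 < 3" for k
    proof -
      have "k + i + 1 < 4" using that assms by auto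
      thus ?thesis using braid_sigma_rel[of "k + i" 4] that by (simp add: add.commute add.left_commute)
    qed
    ultimately show ?thesis unfolding braid_images_def by auto
  qed
  from braid_hom[OF braid_group this] obtain h where h: "h \<in> hom B3 B4" "\<And>k. 1 \<le> k \<Longrightarrow> k < 3 \<Longrightarrow> h (sigma 3 k) = sigma 4 (k + i)"
    by blast
  show ?thesis using h(1) h(2)[of 1] h(2)[of 2] by (intro exI[of _ h]) simp
qed

text \<open>On \<open>F2\<close> these maps restrict to \<open>phi_123\<close> and
  \<open>phi_234\<close>. Having them on all of \<open>B3\<close> makes the braid relation and the
  image of \<open>c3\<close> available in \<open>B4\<close>.\<close>

definition iota :: "nat \<Rightarrow> braid \<Rightarrow> braid" where
  "iota i = (SOME h. h \<in> hom B3 B4 \<and> h (sigma 3 1) = sigma 4 (1 + i) \<and> h (sigma 3 2) = sigma 4 (2 + i))"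

abbreviation "iota123 \<equiv> iota 0"
abbreviation "iota234 \<equiv> iota 1"

lemma iota:
  "iota123 \<in> hom B3 B4" "iota123 (sigma 3 1) = s1" "iota123 (sigma 3 2) = s2"
  "iota234 \<in> hom B3 B4" "iota234 (sigma 3 1) = s2" "iota234 (sigma 3 2) = s3"
  using someI_ex[OF iota_exists[of 0]] someI_ex[OF iota_exists[of 1]] unfolding iota_def by simp_all

lemma iota_gens:
  "iota123 x12 = s1 \<otimes>\<^bsub>B4\<^esub> s1" "iota123 x23 = s2 \<otimes>\<^bsub>B4\<^esub> s2" "iota234 x12 = s2 \<otimes>\<^bsub>B4\<^esub> s2" "iota234 x23 = s3 \<otimes>\<^bsub>B4\<^esub> s3"
  "iota123 (x13 \<otimes>\<^bsub>B3\<^esub> x23) = cab12_3" "iota123 (x12 \<otimes>\<^bsub>B3\<^esub> x13) = cab1_23"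
  "iota234 (x13 \<otimes>\<^bsub>B3\<^esub> x23) = cab23_4" "iota234 (x12 \<otimes>\<^bsub>B3\<^esub> x13) = cab2_34"
proof -
  interpret group B3 by (rule braid_group)
  note m = hom_mult[OF iota(1)] hom_mult[OF iota(4)] and s = B3_sigmas(1,2)
  show "iota123 x12 = s1 \<otimes>\<^bsub>B4\<^esub> s1" "iota123 x23 = s2 \<otimes>\<^bsub>B4\<^esub> s2" "iota234 x12 = s2 \<otimes>\<^bsub>B4\<^esub> s2" "iota234 x23 = s3 \<otimes>\<^bsub>B4\<^esub> s3"
    unfolding B3_pure_gens using s by (simp_all add: m iota)
  show "iota123 (x13 \<otimes>\<^bsub>B3\<^esub> x23) = cab12_3" "iota123 (x12 \<otimes>\<^bsub>B3\<^esub> x13) = cab1_23"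
    "iota234 (x13 \<otimes>\<^bsub>B3\<^esub> x23) = cab23_4" "iota234 (x12 \<otimes>\<^bsub>B3\<^esub> x13) = cab2_34"
    unfolding x13_x23 x12_x13 cab12_3_def cab1_23_def cab23_4_def cab2_34_def using s by (simp_all add: m iota)
qed

section \<open>Automorphisms attached to elements of \<open>GT\<^sup>^\<close>\<close>

text \<open>Conjugation by \<open>v\<close> is a continuous homomorphism fixing \<open>u\<close>,
  hence fixing the profinite powers of \<open>u\<close>.\<close>

lemma (in group) zhat_pow_commute:
  assumes "u \<otimes>\<^bsub>hat G\<^esub> v = v \<otimes>\<^bsub>hat G\<^esub> u" "u \<in> carrier (hat G)" "v \<in> carrier (hat G)" "a \<in> carrier Zhat"
  shows "zhat_pow G u a \<otimes>\<^bsub>hat G\<^esub> v = v \<otimes>\<^bsub>hat G\<^esub> zhat_pow G u a"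
proof -
  interpret h: group "hat G" by (rule hat_group)
  have c: "zhat_pow G u a \<in> carrier (hat G)" by (rule zhat_pow_closed[OF assms(2,4)])
  have "inv\<^bsub>hat G\<^esub> v \<otimes>\<^bsub>hat G\<^esub> u \<otimes>\<^bsub>hat G\<^esub> v = u" by (rule h.commute_conj[OF assms(1)[symmetric] assms(3,2)])
  hence "zhat_pow G u a = inv\<^bsub>hat G\<^esub> v \<otimes>\<^bsub>hat G\<^esub> zhat_pow G u a \<otimes>\<^bsub>hat G\<^esub> v"
    using zhat_pow_conj[OF assms(2,3,4)] by simp
  hence "v \<otimes>\<^bsub>hat G\<^esub> zhat_pow G u a = v \<otimes>\<^bsub>hat G\<^esub> (inv\<^bsub>hat G\<^esub> v \<otimes>\<^bsub>hat G\<^esub> zhat_pow G u a \<otimes>\<^bsub>hat G\<^esub> v)" by simp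
  also have "\<dots> = zhat_pow G u a \<otimes>\<^bsub>hat G\<^esub> v" using c assms(3) by (simp add: h.m_assoc h.mult_inv_cancel)
  finally show ?thesis by (rule HOL.sym)
qed

abbreviation dbl_one :: "zhat \<Rightarrow> zhat" where
  "dbl_one m \<equiv> m \<oplus>\<^bsub>Zhat\<^esub> m \<oplus>\<^bsub>Zhat\<^esub> \<one>\<^bsub>Zhat\<^esub>"

lemma dbl_one_closed: "m \<in> carrier Zhat \<Longrightarrow> dbl_one m \<in> carrier Zhat"
  by (simp add: Zhat_closed)

text \<open>Rewrites \<open>\<sigma>^(2m+1)\<close> as \<open>\<sigma> x^m\<close> with
  \<open>x = \<sigma>^2\<close>, the shape in which the hexagons are stated.\<close>

lemma (in group) zhat_pow_dbl_one:
  assumes "u \<in> carrier (hat G)" "m \<in> carrier Zhat"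
  shows "zhat_pow G u (dbl_one m) = u \<otimes>\<^bsub>hat G\<^esub> zhat_pow G (u \<otimes>\<^bsub>hat G\<^esub> u) m"
proof -
  interpret h: group "hat G" by (rule hat_group)
  have c: "zhat_pow G u m \<in> carrier (hat G)" by (rule zhat_pow_closed[OF assms])
  have "zhat_pow G (u \<otimes>\<^bsub>hat G\<^esub> u) m = zhat_pow G u m \<otimes>\<^bsub>hat G\<^esub> zhat_pow G u m"
    by (rule zhat_pow_mult_distrib[OF assms(1,1,2) HOL.refl])
  moreover have "zhat_pow G u (dbl_one m) = zhat_pow G u m \<otimes>\<^bsub>hat G\<^esub> zhat_pow G u m \<otimes>\<^bsub>hat G\<^esub> u"
    using assms by (simp add: zhat_pow_add Zhat_closed zhat_pow_one)
  moreover have "u \<otimes>\<^bsub>hat G\<^esub> (zhat_pow G u m \<otimes>\<^bsub>hat G\<^esub> zhat_pow G u m) = (zhat_pow G u m \<otimes>\<^bsub>hat G\<^esub> zhat_pow G u m) \<otimes>\<^bsub>hat G\<^esub> u"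
    by (intro h.commute_mult zhat_pow_commute[symmetric] assms c HOL.refl)
  ultimately show ?thesis by simp
qed

lemma (in group) eta_commute:
  "x \<otimes> y = y \<otimes> x \<Longrightarrow> x \<in> carrier G \<Longrightarrow> y \<in> carrier G \<Longrightarrow> eta G x \<otimes>\<^bsub>hat G\<^esub> eta G y = eta G y \<otimes>\<^bsub>hat G\<^esub> eta G x"
  using hom_mult[OF eta_hom, of x y] hom_mult[OF eta_hom, of y x] by simp

text \<open>The two hexagons say that \<open>\<sigma>\<^sub>1 \<mapsto> \<sigma>\<^sub>1\<^sup>2\<^sup>m\<^sup>+\<^sup>1\<close>, \<open>\<sigma>\<^sub>2 \<mapsto> f\<^sup>-\<^sup>1 \<sigma>\<^sub>2\<^sup>2\<^sup>m\<^sup>+\<^sup>1 f\<close> respects the braid relation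
  and that conjugation by the half twist inverts \<open>f\<close>.\<close>

lemma (in group) hexagon_algebra:
  assumes c [simp]: "a \<in> carrier G" "b \<in> carrier G" "X \<in> carrier G" "Y \<in> carrier G" "C \<in> carrier G" "F \<in> carrier G"
    and aba: "a \<otimes> (b \<otimes> a) = b \<otimes> (a \<otimes> b)" and aX: "a \<otimes> X = X \<otimes> a" and bY: "b \<otimes> Y = Y \<otimes> b"
    and Yab: "Y \<otimes> (a \<otimes> b) = a \<otimes> (b \<otimes> X)" and C: "\<And>u. u \<in> carrier G \<Longrightarrow> C \<otimes> u = u \<otimes> C"
    and h1: "a \<otimes> X \<otimes> inv F \<otimes> b \<otimes> Y \<otimes> F = inv F \<otimes> a \<otimes> b \<otimes> inv X \<otimes> C"
    and h2: "inv F \<otimes> b \<otimes> Y \<otimes> F \<otimes> a \<otimes> X = b \<otimes> a \<otimes> inv Y \<otimes> C \<otimes> F"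
  defines "S1 \<equiv> a \<otimes> X" and "S2 \<equiv> inv F \<otimes> (b \<otimes> Y) \<otimes> F" and "D \<equiv> a \<otimes> (b \<otimes> a)"
  shows "S1 \<otimes> (S2 \<otimes> S1) = inv F \<otimes> (D \<otimes> C)" "S1 \<otimes> (S2 \<otimes> S1) = S2 \<otimes> (S1 \<otimes> S2)" "inv F \<otimes> D = D \<otimes> F"
proof -
  have S [simp]: "S1 \<in> carrier G" "S2 \<in> carrier G" "D \<in> carrier G" by (simp_all add: S1_def S2_def D_def)
  have S12: "S1 \<otimes> S2 = inv F \<otimes> (a \<otimes> (b \<otimes> (inv X \<otimes> C)))"
    using h1 by (simp add: S1_def S2_def m_assoc)
  have S21: "S2 \<otimes> S1 = b \<otimes> (a \<otimes> (inv Y \<otimes> (C \<otimes> F)))"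
    using h2 by (simp add: S1_def S2_def m_assoc)
  have "S1 \<otimes> (S2 \<otimes> S1) = (S1 \<otimes> S2) \<otimes> S1" by (simp add: m_assoc)
  also have "\<dots> = inv F \<otimes> (a \<otimes> (b \<otimes> (inv X \<otimes> (C \<otimes> (a \<otimes> X)))))" unfolding S12 by (simp add: S1_def m_assoc)
  also have "C \<otimes> (a \<otimes> X) = (X \<otimes> a) \<otimes> C" using C[of "a \<otimes> X"] aX by simp
  also have "inv X \<otimes> ((X \<otimes> a) \<otimes> C) = a \<otimes> C" by (simp add: m_assoc mult_inv_cancel)
  finally show 1: "S1 \<otimes> (S2 \<otimes> S1) = inv F \<otimes> (D \<otimes> C)" by (simp add: D_def m_assoc)
  have "S2 \<otimes> (S1 \<otimes> S2) = inv F \<otimes> (b \<otimes> ((Y \<otimes> (a \<otimes> b)) \<otimes> (inv X \<otimes> C)))"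
    unfolding S12 by (simp add: S2_def m_assoc mult_inv_cancel)
  also have "\<dots> = inv F \<otimes> ((b \<otimes> (a \<otimes> b)) \<otimes> C)" unfolding Yab by (simp add: m_assoc mult_inv_cancel)
  also have "\<dots> = inv F \<otimes> (D \<otimes> C)" by (simp add: D_def aba)
  finally show "S1 \<otimes> (S2 \<otimes> S1) = S2 \<otimes> (S1 \<otimes> S2)" using 1 by simp
  \<comment> \<open>The second hexagon evaluates the same element to \<open>D F C\<close>.
    Comparison with \<open>F^-1 D C\<close> and cancellation of \<open>C\<close> give the last
    claim.\<close>
  have "S2 \<otimes> (S1 \<otimes> S2) = (S2 \<otimes> S1) \<otimes> S2" by (simp add: m_assoc)
  also have "\<dots> = b \<otimes> (a \<otimes> (inv Y \<otimes> (C \<otimes> ((b \<otimes> Y) \<otimes> F))))" unfolding S21 by (simp add: S2_def m_assoc mult_inv_cancel)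
  also have "C \<otimes> ((b \<otimes> Y) \<otimes> F) = (Y \<otimes> b) \<otimes> (C \<otimes> F)"
    using C[of "b \<otimes> Y"] bY by (simp add: m_assoc[symmetric])
  also have "inv Y \<otimes> ((Y \<otimes> b) \<otimes> (C \<otimes> F)) = b \<otimes> (C \<otimes> F)" by (simp add: m_assoc mult_inv_cancel)
  also have "b \<otimes> (a \<otimes> (b \<otimes> (C \<otimes> F))) = (b \<otimes> (a \<otimes> b)) \<otimes> (C \<otimes> F)" by (simp add: m_assoc)
  also have "\<dots> = D \<otimes> (F \<otimes> C)" using C[of F] aba by (simp add: D_def)
  finally have "(inv F \<otimes> D) \<otimes> C = (D \<otimes> F) \<otimes> C"
    using 1 \<open>S1 \<otimes> (S2 \<otimes> S1) = S2 \<otimes> (S1 \<otimes> S2)\<close> by (simp add: m_assoc)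
  thus "inv F \<otimes> D = D \<otimes> F" by simp
qed

lemma completion_map_comp:
  assumes "group G" "group H" "group J" "\<phi> \<in> hom G H" "\<psi> \<in> hom H J" "u \<in> carrier (hat G)"
  shows "completion_map H J \<psi> (completion_map G H \<phi> u) = completion_map G J (\<lambda>g. \<psi> (\<phi> g)) u"
proof -
  interpret G: group G by fact
  interpret H: group H by fact
  have c: "(\<lambda>g. \<psi> (\<phi> g)) \<in> hom G J" by (rule hom_comp[OF assms(4,5)])
  show ?thesis
  proof (rule G.chom_eqI[OF assms(3) chom_comp[OF G.completion_map(1)[OF assms(2,4)] H.completion_map(1)[OF assms(3,5)]]
        G.completion_map(1)[OF assms(3) c] order_refl _ _ assms(6)])
    show "generate G (carrier G) = carrier G" using G.generate_incl[of "carrier G"] generate.incl[of _ "carrier G" G] by blast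
    show "completion_map H J \<psi> (completion_map G H \<phi> (eta G s)) = completion_map G J (\<lambda>g. \<psi> (\<phi> g)) (eta G s)" if "s \<in> carrier G" for s
      using that hom_in_carrier[OF assms(4) that]
      by (simp add: G.completion_map(2)[OF assms(2,4)] H.completion_map(2)[OF assms(3,5)] G.completion_map(2)[OF assms(3) c])
  qed
qed

section \<open>Continuous homomorphisms out of completed braid and free groups\<close>

lemma braid_chom:
  assumes "group H" "braid_images n (hat H) s"
  obtains h where "chom (braid_group n) H h" "\<And>i. 1 \<le> i \<Longrightarrow> i < n \<Longrightarrow> h (eta (braid_group n) (sigma n i)) = s i"
proof -
  interpret B: group "braid_group n" by (rule braid_group)
  interpret H: group H by fact
  obtain h where h: "h \<in> hom (braid_group n) (hat H)" "\<And>i. 1 \<le> i \<Longrightarrow> i < n \<Longrightarrow> h (sigma n i) = s i"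
    using braid_hom[OF H.hat_group assms(2)] by metis
  show thesis
    by (rule that[OF B.chom_ext(1)[OF assms(1) h(1)]])
      (simp add: B.chom_ext(2)[OF assms(1) h(1)] sigma_closed h(2))
qed

lemma F2hat_chom:
  assumes "group H" "u \<in> carrier (hat H)" "v \<in> carrier (hat H)"
  obtains h where "chom F2 H h" "h (eta F2 x12) = u" "h (eta F2 x23) = v" "h \<in> extensional (carrier F2hat)"
proof -
  interpret F: group F2 by (rule F2_group)
  interpret H: group H by fact
  obtain h where h: "h \<in> hom F2 (hat H)" "h x12 = u" "h x23 = v"
    using F2_universal[OF H.hat_group assms(2,3)] by metis
  have "chom_ext F2 H h \<in> extensional (carrier F2hat)" by (simp add: chom_ext_def)
  thus thesis using that F.chom_ext[OF assms(1) h(1)] F2_gens h by metis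
qed

lemma F2hat_eqI:
  assumes "group H" "chom F2 H h" "chom F2 H k" "h (eta F2 x12) = k (eta F2 x12)" "h (eta F2 x23) = k (eta F2 x23)"
    "u \<in> carrier F2hat"
  shows "h u = k u"
proof (rule group.chom_eqI[OF F2_group assms(1-3) _ F2_generated _ assms(6)])
  show "{x12, x23} \<subseteq> carrier F2" using F2_gens by simp
  show "h (eta F2 s) = k (eta F2 s)" if "s \<in> {x12, x23}" for s using that assms(4,5) by auto
qed

lemma braid_hat_eqI:
  assumes "group H" "chom (braid_group n) H h" "chom (braid_group n) H k"
    "\<And>i. 1 \<le> i \<Longrightarrow> i < n \<Longrightarrow> h (eta (braid_group n) (sigma n i)) = k (eta (braid_group n) (sigma n i))"
    "u \<in> carrier (hat (braid_group n))"
  shows "h u = k u"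
proof (rule group.chom_eqI[OF braid_group assms(1-3) _ braid_generated _ assms(5)])
  show "sigma n ` {1..<n} \<subseteq> carrier (braid_group n)" by (rule image_subsetI) (simp add: sigma_closed)
  show "h (eta (braid_group n) s) = k (eta (braid_group n) s)" if "s \<in> sigma n ` {1..<n}" for s
    using that assms(4) by (elim imageE) simp
qed

text \<open>Existence comes from the freeness of \<open>F2\<close> and uniqueness from its density;
  together they give the definite description in \<open>F2hat_endo\<close> its meaning.\<close>

lemma F2hat_endo:
  assumes "m \<in> carrier Zhat" "f \<in> carrier F2hat"
  shows "chom F2 F2 (F2hat_endo (m, f))"
    "F2hat_endo (m, f) (eta F2 x12) = zhat_pow F2 (eta F2 x12) (dbl_one m)"
    "F2hat_endo (m, f) (eta F2 x23) = inv\<^bsub>F2hat\<^esub> f \<otimes>\<^bsub>F2hat\<^esub> zhat_pow F2 (eta F2 x23) (dbl_one m) \<otimes>\<^bsub>F2hat\<^esub> f"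
proof -
  interpret F: group F2 by (rule F2_group)
  interpret h: group F2hat by (rule F.hat_group)
  let ?u = "zhat_pow F2 (eta F2 x12) (dbl_one m)"
  let ?v = "inv\<^bsub>F2hat\<^esub> f \<otimes>\<^bsub>F2hat\<^esub> zhat_pow F2 (eta F2 x23) (dbl_one m) \<otimes>\<^bsub>F2hat\<^esub> f"
  have u: "?u \<in> carrier F2hat" "?v \<in> carrier F2hat"
    using assms dbl_one_closed F2_gens by (simp_all add: F.zhat_pow_closed F.eta_closed)
  obtain e where e: "chom F2 F2 e" "e (eta F2 x12) = ?u" "e (eta F2 x23) = ?v" "e \<in> extensional (carrier F2hat)"
    using F2hat_chom[OF F.is_group u] .
  have "F2hat_endo (m, f) = e"
    unfolding F2hat_endo_def prod.case Let_def
  proof (rule the_equality)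
    show "e \<in> hom F2hat F2hat \<and> e \<in> extensional (carrier F2hat) \<and>
      continuous_map (profinite_topology F2) (profinite_topology F2) e \<and> e (eta F2 x12) = ?u \<and> e (eta F2 x23) = ?v"
      using e unfolding F.chom_iff_continuous by simp
    fix k assume k: "k \<in> hom F2hat F2hat \<and> k \<in> extensional (carrier F2hat) \<and>
      continuous_map (profinite_topology F2) (profinite_topology F2) k \<and> k (eta F2 x12) = ?u \<and> k (eta F2 x23) = ?v"
    hence kc: "chom F2 F2 k" unfolding F.chom_iff_continuous by simp
    show "k = e"
    proof (rule extensionalityI)
      show "k u = e u" if "u \<in> carrier F2hat" for u
        by (rule F2hat_eqI[OF F.is_group kc e(1) _ _ that]) (use k e in simp_all)
    qed (use k e in simp_all)
  qed
  thus "chom F2 F2 (F2hat_endo (m, f))" "F2hat_endo (m, f) (eta F2 x12) = ?u" "F2hat_endo (m, f) (eta F2 x23) = ?v"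
    using e by simp_all
qed

lemma F2hat_endo_unique:
  assumes "m \<in> carrier Zhat" "f \<in> carrier F2hat" "chom F2 F2 k"
    "k (eta F2 x12) = zhat_pow F2 (eta F2 x12) (dbl_one m)"
    "k (eta F2 x23) = inv\<^bsub>F2hat\<^esub> f \<otimes>\<^bsub>F2hat\<^esub> zhat_pow F2 (eta F2 x23) (dbl_one m) \<otimes>\<^bsub>F2hat\<^esub> f"
    "u \<in> carrier F2hat"
  shows "k u = F2hat_endo (m, f) u"
  by (rule F2hat_eqI[OF F2_group assms(3) F2hat_endo(1)[OF assms(1,2)] _ _ assms(6)])
    (simp_all only: assms(4,5) F2hat_endo(2,3)[OF assms(1,2)])

section \<open>Completions of subgroups of finite index\<close>

text \<open>\<open>K\<close> is normal in \<open>H\<close> only. It contains its normal core in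
  \<open>G\<close>, the kernel of the action of \<open>G\<close> on the finitely many cosets of
  \<open>K\<close>.\<close>

lemma finite_index_core:
  assumes "group G" "H \<in> FIN G" "K \<in> FIN (G\<lparr>carrier := H\<rparr>)"
  shows "\<exists>L\<in>FIN G. L \<subseteq> K"
proof -
  interpret G: group G by fact
  interpret H: subgroup H G by (rule FIN_subgroup[OF assms(2)])
  have K: "subgroup K G"
    using G.incl_subgroup[OF H.subgroup_axioms FIN_subgroup[OF assms(3)]] .
  interpret K: subgroup K G by (rule K)
  have KH: "K \<subseteq> H" using FIN_subset[OF assms(3)] by simp
  define R where "R = rcosets\<^bsub>G\<^esub> K"
  have fR: "finite R"
  proof -
    let ?t = "\<lambda>X. SOME t. t \<in> X"
    \<comment> \<open>A coset of \<open>K\<close> in \<open>G\<close> is recovered from a coset of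
      \<open>K\<close> inside \<open>H\<close> and the chosen representative of a coset of
      \<open>H\<close>, so there are finitely many.\<close>
    have "R \<subseteq> (\<lambda>(X, t). X #>\<^bsub>G\<^esub> t) ` ((rcosets\<^bsub>G\<lparr>carrier := H\<rparr>\<^esub> K) \<times> (?t ` (rcosets\<^bsub>G\<^esub> H)))"
    proof
      fix Z assume "Z \<in> R"
      then obtain g where g: "g \<in> carrier G" "Z = K #>\<^bsub>G\<^esub> g" by (auto simp: R_def RCOSETS_def)
      let ?u = "?t (H #>\<^bsub>G\<^esub> g)"
      have u: "?u \<in> H #>\<^bsub>G\<^esub> g" using G.rcos_self[OF g(1) H.subgroup_axioms] by (rule someI)
      then obtain h where h: "h \<in> H" "?u = h \<otimes>\<^bsub>G\<^esub> g" by (auto simp: r_coset_def)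
      have hi: "inv\<^bsub>G\<^esub> h \<in> H" using h by simp
      have uc: "?u \<in> carrier G" using h g H.subset by auto
      have "g = inv\<^bsub>G\<^esub> h \<otimes>\<^bsub>G\<^esub> ?u" unfolding h(2) using h(1) g(1) H.subset by (simp add: G.mult_inv_cancel subset_iff)
      hence "Z = (K #>\<^bsub>G\<^esub> inv\<^bsub>G\<^esub> h) #>\<^bsub>G\<^esub> ?u"
        using G.coset_mult_assoc[OF K.subset _ uc, of "inv\<^bsub>G\<^esub> h"] hi H.subset g(2) by auto
      moreover have "K #>\<^bsub>G\<^esub> inv\<^bsub>G\<^esub> h \<in> rcosets\<^bsub>G\<lparr>carrier := H\<rparr>\<^esub> K" using hi by (auto simp: RCOSETS_def r_coset_def)
      moreover have "H #>\<^bsub>G\<^esub> g \<in> rcosets\<^bsub>G\<^esub> H" using g(1) by (auto simp: RCOSETS_def)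
      ultimately show "Z \<in> (\<lambda>(X, t). X #>\<^bsub>G\<^esub> t) ` ((rcosets\<^bsub>G\<lparr>carrier := H\<rparr>\<^esub> K) \<times> (?t ` (rcosets\<^bsub>G\<^esub> H)))" by force
    qed
    moreover have "finite (rcosets\<^bsub>G\<lparr>carrier := H\<rparr>\<^esub> K)" "finite (rcosets\<^bsub>G\<^esub> H)"
      using assms(2,3) by (simp_all add: fin_index_normals_def)
    ultimately show ?thesis by (meson finite_SigmaI finite_imageI finite_subset)
  qed
  \<comment> \<open>Right multiplication by the inverse gives a left action; letting
    \<open>g\<close> act trivially off \<open>R\<close> makes \<open>act g\<close> a bijection of
    the whole type.\<close>
  define act where "act g X = (if X \<in> R then X #>\<^bsub>G\<^esub> inv\<^bsub>G\<^esub> g else X)" for g X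
  have R: "X #>\<^bsub>G\<^esub> g \<in> R" if "X \<in> R" "g \<in> carrier G" for X g
    using that G.coset_mult_assoc[OF K.subset] by (auto simp: R_def RCOSETS_def)
  have RC: "X \<subseteq> carrier G" if "X \<in> R" for X
    using that G.r_coset_subset_G[OF K.subset] by (auto simp: R_def RCOSETS_def)
  have am: "act (g \<otimes>\<^bsub>G\<^esub> h) X = act g (act h X)" if "g \<in> carrier G" "h \<in> carrier G" for g h X
    using that R[of X "inv\<^bsub>G\<^esub> h"] G.coset_mult_assoc[OF RC, of X "inv\<^bsub>G\<^esub> h" "inv\<^bsub>G\<^esub> g"]
    by (simp add: act_def G.inv_mult_group)
  have a1: "act \<one>\<^bsub>G\<^esub> X = X" for X using G.coset_mult_one[OF RC, of X] by (simp add: act_def)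
  have inv: "act g (act (inv\<^bsub>G\<^esub> g) X) = X" "act (inv\<^bsub>G\<^esub> g) (act g X) = X" if "g \<in> carrier G" for g X
    using am[of g "inv\<^bsub>G\<^esub> g" X] am[of "inv\<^bsub>G\<^esub> g" g X] a1 that by simp_all
  have bij: "bij (act g)" if "g \<in> carrier G" for g
    by (rule bij_betw_byWitness[of UNIV "act (inv\<^bsub>G\<^esub> g)"]) (auto simp: inv[OF that])
  have hom: "act \<in> hom G bij_group"
    by (rule homI) (auto simp: bij_group_def bij am fun_eq_iff)
  have "act ` carrier G \<subseteq> {p. p permutes R}"
  proof
    fix p assume "p \<in> act ` carrier G"
    then obtain g where g: "g \<in> carrier G" "p = act g" by blast
    have "\<forall>y. \<exists>!x. act g x = y" by (rule bij[OF g(1), unfolded bij_iff])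
    moreover have "\<forall>x. x \<notin> R \<longrightarrow> act g x = x" by (simp add: act_def)
    ultimately have "act g permutes R" unfolding permutes_def by (intro conjI)
    thus "p \<in> {p. p permutes R}" using g(2) by simp
  qed
  hence "finite (act ` carrier G)" using finite_permutations[OF fR] by (rule finite_subset)
  hence "{g \<in> carrier G. act g = \<one>\<^bsub>bij_group\<^esub>} \<in> FIN G"
    by (rule FIN_kernel[OF assms(1) bij_group hom])
  moreover have "g \<in> K" if g: "g \<in> carrier G" "act g = \<one>\<^bsub>bij_group\<^esub>" for g
  proof -
    have "K \<in> R" unfolding R_def by (rule K.subgroup_in_rcosets[OF assms(1)])
    hence "K #>\<^bsub>G\<^esub> inv\<^bsub>G\<^esub> g = K" using fun_cong[OF g(2), of K] by (simp add: act_def bij_group_def)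
    hence "inv\<^bsub>G\<^esub> g \<in> K" by (rule G.coset_join1[OF _ G.inv_closed[OF g(1)] K])
    from K.m_inv_closed[OF this] show ?thesis using G.inv_inv[OF g(1)] by simp
  qed
  hence "{g \<in> carrier G. act g = \<one>\<^bsub>bij_group\<^esub>} \<subseteq> K" by (intro subsetI) simp
  ultimately show ?thesis by (intro bexI)
qed

text \<open>Below every \<open>K\<close> there is an \<open>L\<close> normal of finite index in
  \<open>G\<close>, and at \<open>L\<close> the completed inclusion leaves the coordinate unchanged.
  Applied to \<open>PB4\<close> inside \<open>B4\<close> it allows the pentagon to be moved between
  the two completions.\<close>

lemma completion_inclusion_inj:
  assumes "group G" "H \<in> FIN G"
    and u: "u \<in> carrier (hat (G\<lparr>carrier := H\<rparr>))" and v: "v \<in> carrier (hat (G\<lparr>carrier := H\<rparr>))"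
    and eq: "completion_map (G\<lparr>carrier := H\<rparr>) G (\<lambda>g. g) u = completion_map (G\<lparr>carrier := H\<rparr>) G (\<lambda>g. g) v"
  shows "u = v"
proof (rule hat_ext[OF u v])
  let ?H = "G\<lparr>carrier := H\<rparr>"
  interpret G: group G by fact
  interpret S: subgroup H G by (rule FIN_subgroup[OF assms(2)])
  interpret H: group ?H by (rule S.subgroup_is_group[OF assms(1)])
  have i: "(\<lambda>g. g) \<in> hom ?H G" using S.subset by (auto simp: hom_def)
  fix K assume K: "K \<in> FIN ?H"
  obtain L where L: "L \<in> FIN G" "L \<subseteq> K" using finite_index_core[OF assms(1,2) K] by blast
  have LH: "L \<subseteq> H" using L(2) FIN_subset[OF K] by simp
  have eL: "{g \<in> carrier ?H. g \<in> L} = L" using LH by auto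
  have L': "L \<in> FIN ?H" using FIN_preimage[OF H.is_group assms(1) i L(1)] unfolding eL .
  have c: "completion_map ?H G (\<lambda>g. g) w L = w L" if w: "w \<in> carrier (hat ?H)" for w
  proof -
    obtain g where g: "g \<in> carrier ?H" "w L = L #>\<^bsub>?H\<^esub> g" using hat_rep[OF w L'] .
    have "completion_map ?H G (\<lambda>g. g) w L = L #>\<^bsub>G\<^esub> g"
      by (rule H.completion_map_coord[OF assms(1) i L(1) g(1)]) (simp only: eL g(2))
    thus ?thesis using g(2) by (simp add: r_coset_def)
  qed
  have "u L = v L" using c[OF u] c[OF v] eq by simp
  thus "u K = v K" by (rule H.hat_eq_coarsen[OF u v L' K L(2)])
qed

lemma c3_half_twist:
  "c3 = (sigma 3 1 \<otimes>\<^bsub>B3\<^esub> (sigma 3 2 \<otimes>\<^bsub>B3\<^esub> sigma 3 1)) \<otimes>\<^bsub>B3\<^esub> (sigma 3 1 \<otimes>\<^bsub>B3\<^esub> (sigma 3 2 \<otimes>\<^bsub>B3\<^esub> sigma 3 1))"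
proof -
  interpret group B3 by (rule braid_group)
  note s = B3_sigmas(1,2)
  have "c3 = sigma 3 1 \<otimes>\<^bsub>B3\<^esub> (sigma 3 1 \<otimes>\<^bsub>B3\<^esub> (sigma 3 2 \<otimes>\<^bsub>B3\<^esub> (sigma 3 1 \<otimes>\<^bsub>B3\<^esub> (sigma 3 1 \<otimes>\<^bsub>B3\<^esub> sigma 3 2))))"
    unfolding c3_eq(1) by (rule full_twist[OF B3_sigmas])
  also have "\<dots> = sigma 3 1 \<otimes>\<^bsub>B3\<^esub> ((sigma 3 2 \<otimes>\<^bsub>B3\<^esub> (sigma 3 1 \<otimes>\<^bsub>B3\<^esub> (sigma 3 1 \<otimes>\<^bsub>B3\<^esub> sigma 3 2))) \<otimes>\<^bsub>B3\<^esub> sigma 3 1)"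
    using braid_commute[OF B3_sigmas] by simp
  finally show ?thesis using s by (simp add: m_assoc)
qed

section \<open>Images of the completed free group in the completions of \<open>B3\<close> and
  \<open>B4\<close>\<close>

abbreviation "F2_B3 \<equiv> completion_map F2 B3 (\<lambda>g. g)"
abbreviation "F2_B4 \<phi> \<equiv> completion_map F2 B4 \<phi>"
abbreviation "iota_hat i \<equiv> completion_map B3 B4 (iota i)"

lemma phi_F2_B4:
  assumes "\<phi> \<in> hom PB3 PB4" shows "\<phi> \<in> hom F2 B4"
  using hom_comp[OF hom_comp[OF F2_inclusion(1) assms] pure_braid_inclusion] .

lemma F2_B4:
  assumes "\<phi> \<in> hom PB3 PB4"
  shows "chom F2 B4 (F2_B4 \<phi>)" "F2_B4 \<phi> (eta F2 x12) = eta B4 (\<phi> x12)" "F2_B4 \<phi> (eta F2 x23) = eta B4 (\<phi> x23)"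
  using group.completion_map[OF F2_group braid_group phi_F2_B4[OF assms]] F2_gens by simp_all

lemma F2_B3:
  "chom F2 B3 F2_B3" "F2_B3 (eta F2 x12) = eta B3 x12" "F2_B3 (eta F2 x23) = eta B3 x23"
  using group.completion_map[OF F2_group braid_group F2_inclusion(2)] F2_gens by simp_all

lemma iota_hat:
  "chom B3 B4 (iota_hat 0)" "chom B3 B4 (iota_hat 1)"
  "g \<in> carrier B3 \<Longrightarrow> iota_hat 0 (eta B3 g) = eta B4 (iota 0 g)" "g \<in> carrier B3 \<Longrightarrow> iota_hat 1 (eta B3 g) = eta B4 (iota 1 g)"
  using group.completion_map[OF braid_group braid_group iota(1)] group.completion_map[OF braid_group braid_group iota(4)] by simp_all

lemma iota_hat_F2:
  assumes "u \<in> carrier F2hat"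
  shows "iota_hat 0 (F2_B3 u) = F2_B4 phi_123 u" "iota_hat 1 (F2_B3 u) = F2_B4 phi_234 u"
  by (rule F2hat_eqI[OF braid_group chom_comp[OF F2_B3(1) iota_hat(1)] F2_B4(1)[OF phi_123(1)] _ _ assms];
      simp add: F2_B3 F2_B4[OF phi_123(1)] iota_hat B3_gens_closed iota_gens phi_123)
    (rule F2hat_eqI[OF braid_group chom_comp[OF F2_B3(1) iota_hat(2)] F2_B4(1)[OF phi_234(1)] _ _ assms];
      simp add: F2_B3 F2_B4[OF phi_234(1)] iota_hat B3_gens_closed iota_gens phi_234)

text \<open>Conjugation by \<open>w\<close> fixes the images of both generators of
  \<open>F2\<close>, hence by continuity the image of every \<open>u\<close>.\<close>

lemma F2_B4_commute:
  assumes phi: "\<phi> \<in> hom PB3 PB4" and w: "w \<in> carrier B4"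
    and "w \<otimes>\<^bsub>B4\<^esub> \<phi> x12 = \<phi> x12 \<otimes>\<^bsub>B4\<^esub> w" "w \<otimes>\<^bsub>B4\<^esub> \<phi> x23 = \<phi> x23 \<otimes>\<^bsub>B4\<^esub> w" and u: "u \<in> carrier F2hat"
  shows "eta B4 w \<otimes>\<^bsub>hat B4\<^esub> F2_B4 \<phi> u = F2_B4 \<phi> u \<otimes>\<^bsub>hat B4\<^esub> eta B4 w"
proof -
  interpret B: group B4 by (rule braid_group)
  interpret Bh: group "hat B4" by (rule B.hat_group)
  note c = F2_B4[OF phi]
  have p: "\<phi> x12 \<in> carrier B4" "\<phi> x23 \<in> carrier B4" using hom_in_carrier[OF phi_F2_B4[OF phi]] F2_gens by simp_all
  have w': "eta B4 w \<in> carrier (hat B4)" by (rule B.eta_closed[OF w])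
  have "inv\<^bsub>hat B4\<^esub> eta B4 w \<otimes>\<^bsub>hat B4\<^esub> F2_B4 \<phi> u \<otimes>\<^bsub>hat B4\<^esub> eta B4 w = F2_B4 \<phi> u"
    by (rule F2hat_eqI[OF B.is_group group.chom_conj[OF F2_group B.is_group c(1) w'] c(1) _ _ u];
        unfold c(2,3); intro Bh.commute_conj B.eta_commute assms(3,4) w p w' B.eta_closed)
  hence "eta B4 w \<otimes>\<^bsub>hat B4\<^esub> F2_B4 \<phi> u = eta B4 w \<otimes>\<^bsub>hat B4\<^esub> (inv\<^bsub>hat B4\<^esub> eta B4 w \<otimes>\<^bsub>hat B4\<^esub> F2_B4 \<phi> u \<otimes>\<^bsub>hat B4\<^esub> eta B4 w)" by simp
  also have "\<dots> = F2_B4 \<phi> u \<otimes>\<^bsub>hat B4\<^esub> eta B4 w" using w' chom_closed[OF c(1) u] by (simp add: Bh.m_assoc Bh.mult_inv_cancel)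
  finally show ?thesis .
qed

lemma sigma_F2_B4_commute:
  assumes "u \<in> carrier F2hat"
  shows "eta B4 s1 \<otimes>\<^bsub>hat B4\<^esub> F2_B4 phi_12_3_4 u = F2_B4 phi_12_3_4 u \<otimes>\<^bsub>hat B4\<^esub> eta B4 s1"
    "eta B4 s2 \<otimes>\<^bsub>hat B4\<^esub> F2_B4 phi_1_23_4 u = F2_B4 phi_1_23_4 u \<otimes>\<^bsub>hat B4\<^esub> eta B4 s2"
    "eta B4 s3 \<otimes>\<^bsub>hat B4\<^esub> F2_B4 phi_1_2_34 u = F2_B4 phi_1_2_34 u \<otimes>\<^bsub>hat B4\<^esub> eta B4 s3"
proof -
  interpret B: group B4 by (rule braid_group)
  note s = B4_sigmas(1-3)
  show "eta B4 s1 \<otimes>\<^bsub>hat B4\<^esub> F2_B4 phi_12_3_4 u = F2_B4 phi_12_3_4 u \<otimes>\<^bsub>hat B4\<^esub> eta B4 s1"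
    by (rule F2_B4_commute[OF phi_12_3_4(1) s(1) _ _ assms]; unfold phi_12_3_4;
        intro sigma_cab_commute B.commute_mult B4_sigmas)
  show "eta B4 s2 \<otimes>\<^bsub>hat B4\<^esub> F2_B4 phi_1_23_4 u = F2_B4 phi_1_23_4 u \<otimes>\<^bsub>hat B4\<^esub> eta B4 s2"
    by (rule F2_B4_commute[OF phi_1_23_4(1) s(2) _ _ assms]; unfold phi_1_23_4; intro sigma_cab_commute)
  show "eta B4 s3 \<otimes>\<^bsub>hat B4\<^esub> F2_B4 phi_1_2_34 u = F2_B4 phi_1_2_34 u \<otimes>\<^bsub>hat B4\<^esub> eta B4 s3"
    by (rule F2_B4_commute[OF phi_1_2_34(1) s(3) _ _ assms]; unfold phi_1_2_34;
        intro sigma_cab_commute B.commute_mult B4_sigmas(6)[symmetric] B4_sigmas(1-3))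
qed

lemma eta_c3_central:
  assumes "u \<in> carrier B3hat" shows "eta B3 c3 \<otimes>\<^bsub>B3hat\<^esub> u = u \<otimes>\<^bsub>B3hat\<^esub> eta B3 c3"
proof -
  interpret B: group B3 by (rule braid_group)
  interpret Bh: group B3hat by (rule B.hat_group)
  have c: "eta B3 c3 \<in> carrier B3hat" by (rule B.eta_closed[OF B3_gens_closed(4)])
  have "inv\<^bsub>B3hat\<^esub> eta B3 c3 \<otimes>\<^bsub>B3hat\<^esub> u \<otimes>\<^bsub>B3hat\<^esub> eta B3 c3 = u"
  proof (rule braid_hat_eqI[OF B.is_group B.chom_conj[OF B.is_group chom_id c] chom_id _ assms])
    fix i :: nat assume i: "1 \<le> i" "i < 3"
    have s: "sigma 3 i \<in> carrier B3" by (rule sigma_closed[OF i])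
    show "inv\<^bsub>B3hat\<^esub> eta B3 c3 \<otimes>\<^bsub>B3hat\<^esub> eta B3 (sigma 3 i) \<otimes>\<^bsub>B3hat\<^esub> eta B3 c3 = eta B3 (sigma 3 i)"
      by (intro Bh.commute_conj B.eta_commute c3_central[symmetric] s B3_gens_closed(4) B.eta_closed)
  qed
  hence "eta B3 c3 \<otimes>\<^bsub>B3hat\<^esub> (inv\<^bsub>B3hat\<^esub> eta B3 c3 \<otimes>\<^bsub>B3hat\<^esub> u \<otimes>\<^bsub>B3hat\<^esub> eta B3 c3) = eta B3 c3 \<otimes>\<^bsub>B3hat\<^esub> u" by simp
  thus ?thesis using c assms by (simp add: Bh.m_assoc Bh.mult_inv_cancel)
qed

text \<open>Conjugation by \<open>\<sigma>_1 \<sigma>_2\<close> takes \<open>x23\<close> to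
  \<open>x12\<close>, and therefore powers to powers. This is the hypothesis \<open>Yab\<close> of
  \<open>hexagon_algebra\<close>.\<close>

lemma B3hat_power_conj:
  assumes "m \<in> carrier Zhat"
  shows "zhat_pow B3 (eta B3 x23) m \<otimes>\<^bsub>B3hat\<^esub> (eta B3 (sigma 3 1) \<otimes>\<^bsub>B3hat\<^esub> eta B3 (sigma 3 2)) =
    eta B3 (sigma 3 1) \<otimes>\<^bsub>B3hat\<^esub> (eta B3 (sigma 3 2) \<otimes>\<^bsub>B3hat\<^esub> zhat_pow B3 (eta B3 x12) m)"
proof -
  interpret B: group B3 by (rule braid_group)
  interpret Bh: group B3hat by (rule B.hat_group)
  note s = B3_sigmas(1,2) and sh = B.eta_closed[OF B3_sigmas(1)] B.eta_closed[OF B3_sigmas(2)]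
  note xh = B.eta_closed[OF B3_gens_closed(1)] B.eta_closed[OF B3_gens_closed(2)]
  let ?w = "eta B3 (sigma 3 1) \<otimes>\<^bsub>B3hat\<^esub> eta B3 (sigma 3 2)"
  have w: "?w \<in> carrier B3hat" using sh by simp
  have e: "x23 \<otimes>\<^bsub>B3\<^esub> (sigma 3 1 \<otimes>\<^bsub>B3\<^esub> sigma 3 2) = (sigma 3 1 \<otimes>\<^bsub>B3\<^esub> sigma 3 2) \<otimes>\<^bsub>B3\<^esub> x12"
    using s B3_sigmas(3) B.aba'[OF B3_sigmas, of "sigma 3 1"] by (simp add: B3_pure_gens B.m_assoc)
  have "eta B3 x23 \<otimes>\<^bsub>B3hat\<^esub> ?w = ?w \<otimes>\<^bsub>B3hat\<^esub> eta B3 x12"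
    using arg_cong[OF e, of "eta B3"] s B3_gens_closed by (simp add: hom_mult[OF B.eta_hom])
  hence "inv\<^bsub>B3hat\<^esub> ?w \<otimes>\<^bsub>B3hat\<^esub> eta B3 x23 \<otimes>\<^bsub>B3hat\<^esub> ?w = eta B3 x12"
    using w xh by (simp add: Bh.m_assoc Bh.mult_inv_cancel del: Bh.inv_mult_group)
  hence "zhat_pow B3 (eta B3 x12) m = inv\<^bsub>B3hat\<^esub> ?w \<otimes>\<^bsub>B3hat\<^esub> zhat_pow B3 (eta B3 x23) m \<otimes>\<^bsub>B3hat\<^esub> ?w"
    using B.zhat_pow_conj[OF xh(2) w assms] by simp
  hence "?w \<otimes>\<^bsub>B3hat\<^esub> zhat_pow B3 (eta B3 x12) m = ?w \<otimes>\<^bsub>B3hat\<^esub> (inv\<^bsub>B3hat\<^esub> ?w \<otimes>\<^bsub>B3hat\<^esub> (zhat_pow B3 (eta B3 x23) m \<otimes>\<^bsub>B3hat\<^esub> ?w))"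
    using w B.zhat_pow_closed[OF xh(2) assms] by (simp add: Bh.m_assoc)
  also have "\<dots> = zhat_pow B3 (eta B3 x23) m \<otimes>\<^bsub>B3hat\<^esub> ?w"
    using w B.zhat_pow_closed[OF xh(2) assms] by (intro Bh.mult_inv_cancel) simp_all
  finally show ?thesis using sh B.zhat_pow_closed[OF xh(1) assms] by (simp add: Bh.m_assoc)
qed

text \<open>The twisted generators only make sense in the completion of \<open>B4\<close>, where the
  pentagon is used. The way back to \<open>PB4\<close>, needed to prove the pentagon for a product,
  rests on injectivity of the completed inclusion.\<close>

lemma pentagon_B4:
  assumes "u \<in> carrier F2hat"
  shows "pentagon u \<longleftrightarrow> F2_B4 phi_234 u \<otimes>\<^bsub>hat B4\<^esub> F2_B4 phi_1_23_4 u \<otimes>\<^bsub>hat B4\<^esub> F2_B4 phi_123 u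
    = F2_B4 phi_1_2_34 u \<otimes>\<^bsub>hat B4\<^esub> F2_B4 phi_12_3_4 u"
proof -
  interpret F: group F2 by (rule F2_group)
  interpret P: group PB4 by (rule pure_braid_group)
  interpret Ph: group PB4hat by (rule P.hat_group)
  let ?j = "completion_map PB4 B4 (\<lambda>g. g)"
  have j: "chom PB4 B4 ?j" by (rule P.completion_map(1)[OF braid_group pure_braid_inclusion])
  have p: "\<phi> \<in> hom F2 PB4" if "\<phi> \<in> hom PB3 PB4" for \<phi> using hom_comp[OF F2_inclusion(1) that] .
  have c: "completion_map F2 PB4 \<phi> u \<in> carrier PB4hat" if "\<phi> \<in> hom PB3 PB4" for \<phi>
    by (rule chom_closed[OF F.completion_map(1)[OF P.is_group p[OF that]] assms])
  have e: "?j (completion_map F2 PB4 \<phi> u) = F2_B4 \<phi> u" if "\<phi> \<in> hom PB3 PB4" for \<phi>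
    by (rule completion_map_comp[OF F.is_group P.is_group braid_group p[OF that] pure_braid_inclusion assms])
  have inj: "v = w" if "v \<in> carrier PB4hat" "w \<in> carrier PB4hat" "?j v = ?j w" for v w
  proof -
    have PB: "B4\<lparr>carrier := carrier PB4\<rparr> = PB4" by (simp add: pure_braid_group_def)
    show ?thesis
      by (rule completion_inclusion_inj[OF braid_group pure_braid_FIN[of 4], unfolded PB, OF that])
  qed
  note \<phi> = phi_123(1) phi_234(1) phi_12_3_4(1) phi_1_23_4(1) phi_1_2_34(1)
  note cs = c[OF \<phi>(1)] c[OF \<phi>(2)] c[OF \<phi>(3)] c[OF \<phi>(4)] c[OF \<phi>(5)]
  note es = e[OF \<phi>(1)] e[OF \<phi>(2)] e[OF \<phi>(3)] e[OF \<phi>(4)] e[OF \<phi>(5)]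
  let ?l = "completion_map F2 PB4 phi_234 u \<otimes>\<^bsub>PB4hat\<^esub> completion_map F2 PB4 phi_1_23_4 u \<otimes>\<^bsub>PB4hat\<^esub> completion_map F2 PB4 phi_123 u"
  let ?r = "completion_map F2 PB4 phi_1_2_34 u \<otimes>\<^bsub>PB4hat\<^esub> completion_map F2 PB4 phi_12_3_4 u"
  have lr: "?l \<in> carrier PB4hat" "?r \<in> carrier PB4hat" by (intro Ph.m_closed cs)+
  have "?j ?l = F2_B4 phi_234 u \<otimes>\<^bsub>hat B4\<^esub> F2_B4 phi_1_23_4 u \<otimes>\<^bsub>hat B4\<^esub> F2_B4 phi_123 u"
    "?j ?r = F2_B4 phi_1_2_34 u \<otimes>\<^bsub>hat B4\<^esub> F2_B4 phi_12_3_4 u"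
    by (simp_all only: chom_mult[OF j] cs Ph.m_closed es)
  thus ?thesis unfolding pentagon_def using inj[OF lr] by metis
qed

lemma (in group) conj_conj:
  assumes "g \<in> carrier G" "h \<in> carrier G" "z \<in> carrier G"
  shows "inv h \<otimes> (inv g \<otimes> z \<otimes> g) \<otimes> h = inv (g \<otimes> h) \<otimes> z \<otimes> (g \<otimes> h)"
  using assms by (simp add: inv_mult_group m_assoc)

text \<open>With \<open>p g q = k l\<close> the pentagon itself, conjugation by \<open>p g q\<close>
  can be exchanged for conjugation by \<open>k l\<close>. The element \<open>z\<close> will be a
  power of a generator or of a cabling.\<close>

lemma (in group) pentagon_algebra:
  assumes c: "p \<in> carrier G" "g \<in> carrier G" "q \<in> carrier G" "k \<in> carrier G" "l \<in> carrier G" "z \<in> carrier G"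
    and "p \<otimes> g \<otimes> q = k \<otimes> l"
  shows "g \<otimes> z = z \<otimes> g \<Longrightarrow> inv (g \<otimes> q) \<otimes> z \<otimes> (g \<otimes> q) = inv q \<otimes> z \<otimes> q"
    "inv (g \<otimes> q) \<otimes> (inv p \<otimes> z \<otimes> p) \<otimes> (g \<otimes> q) = inv l \<otimes> (inv k \<otimes> z \<otimes> k) \<otimes> l"
proof -
  show "inv (g \<otimes> q) \<otimes> z \<otimes> (g \<otimes> q) = inv q \<otimes> z \<otimes> q" if "g \<otimes> z = z \<otimes> g"
    using conj_conj[OF c(2,3,6)] commute_conj[OF that c(2,6)] by simp
  have "p \<otimes> (g \<otimes> q) = k \<otimes> l" using assms(7) c by (simp add: m_assoc)
  thus "inv (g \<otimes> q) \<otimes> (inv p \<otimes> z \<otimes> p) \<otimes> (g \<otimes> q) = inv l \<otimes> (inv k \<otimes> z \<otimes> k) \<otimes> l"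
    using conj_conj[of p "g \<otimes> q" z] conj_conj[of k l z] c by simp
qed

section \<open>The endomorphism of the completion of \<open>B3\<close>\<close>

definition T3_spec :: "zhat \<Rightarrow> pro_braid \<Rightarrow> (pro_braid \<Rightarrow> pro_braid) \<Rightarrow> bool" where
  "T3_spec m f h \<longleftrightarrow> chom B3 B3 h \<and> h (eta B3 (sigma 3 1)) = zhat_pow B3 (eta B3 (sigma 3 1)) (dbl_one m) \<and>
     h (eta B3 (sigma 3 2)) = inv\<^bsub>B3hat\<^esub> F2_B3 f \<otimes>\<^bsub>B3hat\<^esub> zhat_pow B3 (eta B3 (sigma 3 2)) (dbl_one m) \<otimes>\<^bsub>B3hat\<^esub> F2_B3 f"

definition T4_spec :: "zhat \<Rightarrow> pro_braid \<Rightarrow> (pro_braid \<Rightarrow> pro_braid) \<Rightarrow> bool" where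
  "T4_spec m f h \<longleftrightarrow> chom B4 B4 h \<and> h (eta B4 s1) = zhat_pow B4 (eta B4 s1) (dbl_one m) \<and>
     h (eta B4 s2) = inv\<^bsub>hat B4\<^esub> F2_B4 phi_123 f \<otimes>\<^bsub>hat B4\<^esub> zhat_pow B4 (eta B4 s2) (dbl_one m) \<otimes>\<^bsub>hat B4\<^esub> F2_B4 phi_123 f \<and>
     h (eta B4 s3) = inv\<^bsub>hat B4\<^esub> F2_B4 phi_12_3_4 f \<otimes>\<^bsub>hat B4\<^esub> zhat_pow B4 (eta B4 s3) (dbl_one m) \<otimes>\<^bsub>hat B4\<^esub> F2_B4 phi_12_3_4 f"

text \<open>An element of \<open>GT_monoid\<close>, without invertibility: the monoid laws, and with
  them the endomorphisms that prove them, have to be established before inverses can be spoken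
  of.\<close>

locale gt_pair =
  fixes m :: zhat and f :: pro_braid
  assumes m: "m \<in> carrier Zhat" and f: "f \<in> carrier F2hat"
    and hex1: "hexagon1 m f" and hex2: "hexagon2 m f" and pent: "pentagon f"
begin

sublocale F2: group F2 by (rule F2_group)
sublocale B3: group B3 by (rule braid_group)
sublocale B4: group B4 by (rule braid_group)
sublocale F2h: group F2hat by (rule F2.hat_group)
sublocale B3h: group B3hat by (rule B3.hat_group)
sublocale B4h: group "hat B4" by (rule B4.hat_group)

abbreviation "lam \<equiv> dbl_one m"
abbreviation "E \<equiv> F2hat_endo (m, f)"
abbreviation "F3 \<equiv> F2_B3 f"

lemmas lam = dbl_one_closed[OF m]
lemmas E = F2hat_endo[OF m f]

lemma F3: "F3 \<in> carrier B3hat"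
  by (rule chom_closed[OF F2_B3(1) f])

lemmas eta3 = B3.eta_closed[OF B3_sigmas(1)] B3.eta_closed[OF B3_sigmas(2)]
  B3.eta_closed[OF B3_gens_closed(1)] B3.eta_closed[OF B3_gens_closed(2)] B3.eta_closed[OF B3_gens_closed(3)]
  B3.eta_closed[OF B3_gens_closed(4)]

lemma eta3_gens:
  "eta B3 x12 = eta B3 (sigma 3 1) \<otimes>\<^bsub>B3hat\<^esub> eta B3 (sigma 3 1)"
  "eta B3 x23 = eta B3 (sigma 3 2) \<otimes>\<^bsub>B3hat\<^esub> eta B3 (sigma 3 2)"
  by (simp_all add: B3_pure_gens hom_mult[OF B3.eta_hom] B3_sigmas)

abbreviation "half_twist \<equiv> eta B3 (sigma 3 1) \<otimes>\<^bsub>B3hat\<^esub> (eta B3 (sigma 3 2) \<otimes>\<^bsub>B3hat\<^esub> eta B3 (sigma 3 1))"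

lemma eta3_c3: "eta B3 c3 = half_twist \<otimes>\<^bsub>B3hat\<^esub> half_twist"
  unfolding c3_half_twist using B3_sigmas(1,2) by (simp add: hom_mult[OF B3.eta_hom])

lemma c3_pow_central:
  assumes "a \<in> carrier Zhat" "u \<in> carrier B3hat"
  shows "zhat_pow B3 (eta B3 c3) a \<otimes>\<^bsub>B3hat\<^esub> u = u \<otimes>\<^bsub>B3hat\<^esub> zhat_pow B3 (eta B3 c3) a"
  by (rule B3.zhat_pow_commute[OF eta_c3_central[OF assms(2)] eta3(6) assms(2,1)])

lemma sigma3_pow:
  "zhat_pow B3 (eta B3 (sigma 3 1)) lam = eta B3 (sigma 3 1) \<otimes>\<^bsub>B3hat\<^esub> zhat_pow B3 (eta B3 x12) m"
  "zhat_pow B3 (eta B3 (sigma 3 2)) lam = eta B3 (sigma 3 2) \<otimes>\<^bsub>B3hat\<^esub> zhat_pow B3 (eta B3 x23) m"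
  unfolding eta3_gens by (rule B3.zhat_pow_dbl_one[OF eta3(1) m], rule B3.zhat_pow_dbl_one[OF eta3(2) m])

lemma braid3_images:
  defines "S1 \<equiv> zhat_pow B3 (eta B3 (sigma 3 1)) lam"
    and "S2 \<equiv> inv\<^bsub>B3hat\<^esub> F3 \<otimes>\<^bsub>B3hat\<^esub> zhat_pow B3 (eta B3 (sigma 3 2)) lam \<otimes>\<^bsub>B3hat\<^esub> F3"
  shows "S1 \<otimes>\<^bsub>B3hat\<^esub> (S2 \<otimes>\<^bsub>B3hat\<^esub> S1) = inv\<^bsub>B3hat\<^esub> F3 \<otimes>\<^bsub>B3hat\<^esub> (half_twist \<otimes>\<^bsub>B3hat\<^esub> zhat_pow B3 (eta B3 c3) m)"
    "S1 \<otimes>\<^bsub>B3hat\<^esub> (S2 \<otimes>\<^bsub>B3hat\<^esub> S1) = S2 \<otimes>\<^bsub>B3hat\<^esub> (S1 \<otimes>\<^bsub>B3hat\<^esub> S2)"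
    "inv\<^bsub>B3hat\<^esub> F3 \<otimes>\<^bsub>B3hat\<^esub> half_twist = half_twist \<otimes>\<^bsub>B3hat\<^esub> F3"
proof -
  have aba: "half_twist = eta B3 (sigma 3 2) \<otimes>\<^bsub>B3hat\<^esub> (eta B3 (sigma 3 1) \<otimes>\<^bsub>B3hat\<^esub> eta B3 (sigma 3 2))"
    using arg_cong[OF B3_sigmas(3), of "eta B3"] B3_sigmas(1,2) by (simp add: hom_mult[OF B3.eta_hom])
  have aX: "eta B3 (sigma 3 1) \<otimes>\<^bsub>B3hat\<^esub> zhat_pow B3 (eta B3 x12) m = zhat_pow B3 (eta B3 x12) m \<otimes>\<^bsub>B3hat\<^esub> eta B3 (sigma 3 1)"
    by (rule HOL.sym, rule B3.zhat_pow_commute[OF _ eta3(3,1) m]) (simp add: eta3_gens B3h.m_assoc eta3)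
  have bY: "eta B3 (sigma 3 2) \<otimes>\<^bsub>B3hat\<^esub> zhat_pow B3 (eta B3 x23) m = zhat_pow B3 (eta B3 x23) m \<otimes>\<^bsub>B3hat\<^esub> eta B3 (sigma 3 2)"
    by (rule HOL.sym, rule B3.zhat_pow_commute[OF _ eta3(4,2) m]) (simp add: eta3_gens B3h.m_assoc eta3)
  note h = B3h.hexagon_algebra[OF eta3(1,2) B3.zhat_pow_closed[OF eta3(3) m] B3.zhat_pow_closed[OF eta3(4) m]
      B3.zhat_pow_closed[OF eta3(6) m] F3 aba aX bY B3hat_power_conj[OF m] c3_pow_central[OF m]
      hex1[unfolded hexagon1_def Let_def] hex2[unfolded hexagon2_def Let_def]]
  show "S1 \<otimes>\<^bsub>B3hat\<^esub> (S2 \<otimes>\<^bsub>B3hat\<^esub> S1) = inv\<^bsub>B3hat\<^esub> F3 \<otimes>\<^bsub>B3hat\<^esub> (half_twist \<otimes>\<^bsub>B3hat\<^esub> zhat_pow B3 (eta B3 c3) m)"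
    unfolding S1_def S2_def sigma3_pow by (rule h(1))
  show "S1 \<otimes>\<^bsub>B3hat\<^esub> (S2 \<otimes>\<^bsub>B3hat\<^esub> S1) = S2 \<otimes>\<^bsub>B3hat\<^esub> (S1 \<otimes>\<^bsub>B3hat\<^esub> S2)"
    unfolding S1_def S2_def sigma3_pow by (rule h(2))
  show "inv\<^bsub>B3hat\<^esub> F3 \<otimes>\<^bsub>B3hat\<^esub> half_twist = half_twist \<otimes>\<^bsub>B3hat\<^esub> F3"
    by (rule h(3))
qed

lemma T3_exists: "\<exists>h. T3_spec m f h"
proof -
  let ?S1 = "zhat_pow B3 (eta B3 (sigma 3 1)) lam"
  let ?S2 = "inv\<^bsub>B3hat\<^esub> F3 \<otimes>\<^bsub>B3hat\<^esub> zhat_pow B3 (eta B3 (sigma 3 2)) lam \<otimes>\<^bsub>B3hat\<^esub> F3"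
  have c: "?S1 \<in> carrier B3hat" "?S2 \<in> carrier B3hat"
    using B3.zhat_pow_closed[OF eta3(1) lam] B3.zhat_pow_closed[OF eta3(2) lam] F3 by simp_all
  let ?s = "\<lambda>i::nat. if i = 1 then ?S1 else ?S2"
  have "braid_images 3 B3hat ?s"
    unfolding braid_images_def
  proof (intro conjI allI impI)
    show "?s ` {1..<3} \<subseteq> carrier B3hat" by (rule image_subsetI) (simp only: c split: if_split, simp)
    fix i :: nat assume "1 \<le> i \<and> i + 1 < 3"
    hence "i = 1" by simp
    thus "?s i \<otimes>\<^bsub>B3hat\<^esub> (?s (i + 1) \<otimes>\<^bsub>B3hat\<^esub> ?s i) = ?s (i + 1) \<otimes>\<^bsub>B3hat\<^esub> (?s i \<otimes>\<^bsub>B3hat\<^esub> ?s (i + 1))"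
      using braid3_images(2) by simp
  qed auto
  then obtain h where h: "chom B3 B3 h" "\<And>i. 1 \<le> i \<Longrightarrow> i < 3 \<Longrightarrow> h (eta B3 (sigma 3 i)) = ?s i"
    using braid_chom[OF braid_group] by blast
  show ?thesis unfolding T3_spec_def using h(1) h(2)[of 1] h(2)[of 2] by (intro exI[of _ h]) simp
qed

definition T3 :: "pro_braid \<Rightarrow> pro_braid" where "T3 = (SOME h. T3_spec m f h)"

lemma T3: "chom B3 B3 T3" "T3 (eta B3 (sigma 3 1)) = zhat_pow B3 (eta B3 (sigma 3 1)) lam"
  "T3 (eta B3 (sigma 3 2)) = inv\<^bsub>B3hat\<^esub> F3 \<otimes>\<^bsub>B3hat\<^esub> zhat_pow B3 (eta B3 (sigma 3 2)) lam \<otimes>\<^bsub>B3hat\<^esub> F3"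
  using someI_ex[OF T3_exists] unfolding T3_def T3_spec_def by simp_all

lemma T3_x12: "T3 (eta B3 x12) = zhat_pow B3 (eta B3 x12) lam"
  unfolding eta3_gens by (simp add: chom_mult[OF T3(1)] eta3 T3(2) B3.zhat_pow_mult_distrib[OF eta3(1,1) lam])

lemma T3_x23: "T3 (eta B3 x23) = inv\<^bsub>B3hat\<^esub> F3 \<otimes>\<^bsub>B3hat\<^esub> zhat_pow B3 (eta B3 x23) lam \<otimes>\<^bsub>B3hat\<^esub> F3"
  unfolding eta3_gens
  by (simp add: chom_mult[OF T3(1)] eta3 T3(3) B3.zhat_pow_mult_distrib[OF eta3(2,2) lam]
      B3h.conj_mult F3 B3.zhat_pow_closed lam)

text \<open>\<open>c3\<close> is the square of the half twist, whose image is \<open>f^-1\<close>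
  times the half twist times \<open>c3^m\<close>. Since conjugation by the half twist inverts
  \<open>f\<close>, the two factors coming from \<open>f\<close> cancel.\<close>

lemma T3_c3: "T3 (eta B3 c3) = zhat_pow B3 (eta B3 c3) lam"
proof -
  let ?C = "zhat_pow B3 (eta B3 c3) m"
  have C: "?C \<in> carrier B3hat" by (rule B3.zhat_pow_closed[OF eta3(6) m])
  have D: "half_twist \<in> carrier B3hat" using eta3 by simp
  have "T3 half_twist = inv\<^bsub>B3hat\<^esub> F3 \<otimes>\<^bsub>B3hat\<^esub> (half_twist \<otimes>\<^bsub>B3hat\<^esub> ?C)"
    using braid3_images(1) by (simp add: chom_mult[OF T3(1)] eta3 T3)
  hence "T3 (eta B3 c3) = (inv\<^bsub>B3hat\<^esub> F3 \<otimes>\<^bsub>B3hat\<^esub> (half_twist \<otimes>\<^bsub>B3hat\<^esub> ?C)) \<otimes>\<^bsub>B3hat\<^esub> (inv\<^bsub>B3hat\<^esub> F3 \<otimes>\<^bsub>B3hat\<^esub> (half_twist \<otimes>\<^bsub>B3hat\<^esub> ?C))"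
    unfolding eta3_c3 using chom_mult[OF T3(1) D D] by simp
  also have "\<dots> = (inv\<^bsub>B3hat\<^esub> F3 \<otimes>\<^bsub>B3hat\<^esub> half_twist) \<otimes>\<^bsub>B3hat\<^esub> ((?C \<otimes>\<^bsub>B3hat\<^esub> inv\<^bsub>B3hat\<^esub> F3) \<otimes>\<^bsub>B3hat\<^esub> (half_twist \<otimes>\<^bsub>B3hat\<^esub> ?C))"
    using C D F3 by (simp only: B3h.m_assoc B3h.m_closed B3h.inv_closed)
  also have "?C \<otimes>\<^bsub>B3hat\<^esub> inv\<^bsub>B3hat\<^esub> F3 = inv\<^bsub>B3hat\<^esub> F3 \<otimes>\<^bsub>B3hat\<^esub> ?C"
    by (rule c3_pow_central[OF m B3h.inv_closed[OF F3]])
  also have "(inv\<^bsub>B3hat\<^esub> F3 \<otimes>\<^bsub>B3hat\<^esub> ?C) \<otimes>\<^bsub>B3hat\<^esub> (half_twist \<otimes>\<^bsub>B3hat\<^esub> ?C) = inv\<^bsub>B3hat\<^esub> F3 \<otimes>\<^bsub>B3hat\<^esub> ((?C \<otimes>\<^bsub>B3hat\<^esub> half_twist) \<otimes>\<^bsub>B3hat\<^esub> ?C)"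
    using C D F3 by (simp only: B3h.m_assoc B3h.m_closed B3h.inv_closed)
  also have "?C \<otimes>\<^bsub>B3hat\<^esub> half_twist = half_twist \<otimes>\<^bsub>B3hat\<^esub> ?C" by (rule c3_pow_central[OF m D])
  also have "inv\<^bsub>B3hat\<^esub> F3 \<otimes>\<^bsub>B3hat\<^esub> half_twist = half_twist \<otimes>\<^bsub>B3hat\<^esub> F3" by (rule braid3_images(3))
  also have "(half_twist \<otimes>\<^bsub>B3hat\<^esub> F3) \<otimes>\<^bsub>B3hat\<^esub> (inv\<^bsub>B3hat\<^esub> F3 \<otimes>\<^bsub>B3hat\<^esub> ((half_twist \<otimes>\<^bsub>B3hat\<^esub> ?C) \<otimes>\<^bsub>B3hat\<^esub> ?C))
      = (half_twist \<otimes>\<^bsub>B3hat\<^esub> half_twist) \<otimes>\<^bsub>B3hat\<^esub> (?C \<otimes>\<^bsub>B3hat\<^esub> ?C)"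
    using C D F3 by (simp only: B3h.m_assoc B3h.m_closed B3h.inv_closed B3h.mult_inv_cancel)
  also have "\<dots> = eta B3 c3 \<otimes>\<^bsub>B3hat\<^esub> (?C \<otimes>\<^bsub>B3hat\<^esub> ?C)" unfolding eta3_c3 ..
  also have "?C \<otimes>\<^bsub>B3hat\<^esub> ?C = zhat_pow B3 (eta B3 c3 \<otimes>\<^bsub>B3hat\<^esub> eta B3 c3) m"
    by (rule B3.zhat_pow_mult_distrib[OF eta3(6,6) m HOL.refl, symmetric])
  finally show ?thesis unfolding B3.zhat_pow_dbl_one[OF eta3(6) m] .
qed

lemma eta3_products:
  "eta B3 (x13 \<otimes>\<^bsub>B3\<^esub> x23) = inv\<^bsub>B3hat\<^esub> eta B3 x12 \<otimes>\<^bsub>B3hat\<^esub> eta B3 c3"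
  "eta B3 (x12 \<otimes>\<^bsub>B3\<^esub> x13) = inv\<^bsub>B3hat\<^esub> eta B3 x23 \<otimes>\<^bsub>B3hat\<^esub> eta B3 c3"
proof -
  note g = B3_gens_closed
  have e: "eta B3 c3 = eta B3 x12 \<otimes>\<^bsub>B3hat\<^esub> eta B3 (x13 \<otimes>\<^bsub>B3\<^esub> x23)" "eta B3 c3 = eta B3 x23 \<otimes>\<^bsub>B3hat\<^esub> eta B3 (x12 \<otimes>\<^bsub>B3\<^esub> x13)"
    unfolding hom_mult[OF B3.eta_hom g(1) B3.m_closed[OF g(3,2)], symmetric] hom_mult[OF B3.eta_hom g(2) B3.m_closed[OF g(1,3)], symmetric]
    using c3_eq(2,3) by simp_all
  have c: "eta B3 (x13 \<otimes>\<^bsub>B3\<^esub> x23) \<in> carrier B3hat" "eta B3 (x12 \<otimes>\<^bsub>B3\<^esub> x13) \<in> carrier B3hat"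
    using g by (simp_all add: B3.eta_closed)
  show "eta B3 (x13 \<otimes>\<^bsub>B3\<^esub> x23) = inv\<^bsub>B3hat\<^esub> eta B3 x12 \<otimes>\<^bsub>B3hat\<^esub> eta B3 c3"
    unfolding e(1) using B3h.mult_inv_cancel(2)[OF eta3(3) c(1)] by simp
  show "eta B3 (x12 \<otimes>\<^bsub>B3\<^esub> x13) = inv\<^bsub>B3hat\<^esub> eta B3 x23 \<otimes>\<^bsub>B3hat\<^esub> eta B3 c3"
    unfolding e(2) using B3h.mult_inv_cancel(2)[OF eta3(4) c(2)] by simp
qed

text \<open>By \<open>x13 x23 = x12^-1 c\<close> and \<open>x12 x13 = x23^-1 c\<close> only the
  images of \<open>x12\<close>, \<open>x23\<close> and \<open>c3\<close> enter. The maps to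
  \<open>B4\<close> turn these products into the cablings.\<close>

lemma T3_products:
  "T3 (eta B3 (x13 \<otimes>\<^bsub>B3\<^esub> x23)) = zhat_pow B3 (eta B3 (x13 \<otimes>\<^bsub>B3\<^esub> x23)) lam"
  "T3 (eta B3 (x12 \<otimes>\<^bsub>B3\<^esub> x13)) = inv\<^bsub>B3hat\<^esub> F3 \<otimes>\<^bsub>B3hat\<^esub> zhat_pow B3 (eta B3 (x12 \<otimes>\<^bsub>B3\<^esub> x13)) lam \<otimes>\<^bsub>B3hat\<^esub> F3"
proof -
  let ?C = "zhat_pow B3 (eta B3 c3) lam"
  have C: "?C \<in> carrier B3hat" by (rule B3.zhat_pow_closed[OF eta3(6) lam])
  have e: "zhat_pow B3 (inv\<^bsub>B3hat\<^esub> u \<otimes>\<^bsub>B3hat\<^esub> eta B3 c3) lam = inv\<^bsub>B3hat\<^esub> zhat_pow B3 u lam \<otimes>\<^bsub>B3hat\<^esub> ?C" if u: "u \<in> carrier B3hat" for u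
    using B3.zhat_pow_mult_distrib[OF B3h.inv_closed[OF u] eta3(6) lam eta_c3_central[OF B3h.inv_closed[OF u], symmetric]]
    by (simp add: B3.zhat_pow_inv[OF u lam])
  show "T3 (eta B3 (x13 \<otimes>\<^bsub>B3\<^esub> x23)) = zhat_pow B3 (eta B3 (x13 \<otimes>\<^bsub>B3\<^esub> x23)) lam"
    unfolding eta3_products e[OF eta3(3)]
    by (simp only: chom_mult[OF T3(1)] chom_inv[OF braid_group braid_group T3(1)] B3h.inv_closed eta3 T3_x12 T3_c3)
  let ?Y = "zhat_pow B3 (eta B3 x23) lam"
  have Y: "?Y \<in> carrier B3hat" by (rule B3.zhat_pow_closed[OF eta3(4) lam])
  have "T3 (eta B3 (x12 \<otimes>\<^bsub>B3\<^esub> x13)) = inv\<^bsub>B3hat\<^esub> (inv\<^bsub>B3hat\<^esub> F3 \<otimes>\<^bsub>B3hat\<^esub> ?Y \<otimes>\<^bsub>B3hat\<^esub> F3) \<otimes>\<^bsub>B3hat\<^esub> ?C"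
    unfolding eta3_products
    by (simp only: chom_mult[OF T3(1)] chom_inv[OF braid_group braid_group T3(1)] B3h.inv_closed eta3 T3_x23 T3_c3)
  also have "\<dots> = inv\<^bsub>B3hat\<^esub> F3 \<otimes>\<^bsub>B3hat\<^esub> (inv\<^bsub>B3hat\<^esub> ?Y \<otimes>\<^bsub>B3hat\<^esub> (F3 \<otimes>\<^bsub>B3hat\<^esub> ?C))"
    using Y F3 C by (simp add: B3h.inv_mult_group B3h.m_assoc)
  also have "F3 \<otimes>\<^bsub>B3hat\<^esub> ?C = ?C \<otimes>\<^bsub>B3hat\<^esub> F3" by (rule c3_pow_central[OF lam F3, symmetric])
  finally show "T3 (eta B3 (x12 \<otimes>\<^bsub>B3\<^esub> x13)) = inv\<^bsub>B3hat\<^esub> F3 \<otimes>\<^bsub>B3hat\<^esub> zhat_pow B3 (eta B3 (x12 \<otimes>\<^bsub>B3\<^esub> x13)) lam \<otimes>\<^bsub>B3hat\<^esub> F3"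
    unfolding eta3_products e[OF eta3(4)] using Y F3 C by (simp add: B3h.m_assoc)
qed

lemma T3_F2:
  assumes "u \<in> carrier F2hat" shows "T3 (F2_B3 u) = F2_B3 (E u)"
proof (rule F2hat_eqI[OF braid_group chom_comp[OF F2_B3(1) T3(1)] chom_comp[OF E(1) F2_B3(1)] _ _ assms])
  have g: "eta F2 x12 \<in> carrier F2hat" "eta F2 x23 \<in> carrier F2hat" using F2.eta_closed F2_gens by simp_all
  show "T3 (F2_B3 (eta F2 x12)) = F2_B3 (E (eta F2 x12))"
    by (simp add: F2_B3 T3_x12 E F2.zhat_pow_chom[OF braid_group F2_B3(1) g(1) lam])
  have y: "zhat_pow F2 (eta F2 x23) lam \<in> carrier F2hat" by (rule F2.zhat_pow_closed[OF g(2) lam])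
  show "T3 (F2_B3 (eta F2 x23)) = F2_B3 (E (eta F2 x23))"
    using f y by (simp add: F2_B3(2,3) T3_x23 E chom_mult[OF F2_B3(1)] chom_inv[OF F2_group braid_group F2_B3(1)]
      F2.zhat_pow_chom[OF braid_group F2_B3(1) g(2) lam])
qed

end

text \<open>A source of braid relations in other completions: applied to \<open>T3\<close> followed
  by a map to \<open>B4\<close>, it relates the images of neighbouring generators there.\<close>

lemma chom_braid3_rel:
  assumes "group H" "chom B3 H h"
  shows "h (eta B3 (sigma 3 1)) \<otimes>\<^bsub>hat H\<^esub> (h (eta B3 (sigma 3 2)) \<otimes>\<^bsub>hat H\<^esub> h (eta B3 (sigma 3 1))) =
    h (eta B3 (sigma 3 2)) \<otimes>\<^bsub>hat H\<^esub> (h (eta B3 (sigma 3 1)) \<otimes>\<^bsub>hat H\<^esub> h (eta B3 (sigma 3 2)))"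
proof -
  interpret B: group B3 by (rule braid_group)
  have "(\<lambda>g. h (eta B3 g)) \<in> hom B3 (hat H)" by (rule hom_comp[OF B.eta_hom chom_hom[OF assms(2)]])
  from arg_cong[OF B3_sigmas(3), of "\<lambda>g. h (eta B3 g)"] hom_mult[OF this] B3_sigmas(1,2)
  show ?thesis by simp
qed

section \<open>The endomorphism of the completion of \<open>B4\<close>\<close>

context gt_pair
begin

abbreviation "p123 \<equiv> F2_B4 phi_123 f"
abbreviation "p234 \<equiv> F2_B4 phi_234 f"
abbreviation "p12_3_4 \<equiv> F2_B4 phi_12_3_4 f"
abbreviation "p1_23_4 \<equiv> F2_B4 phi_1_23_4 f"
abbreviation "p1_2_34 \<equiv> F2_B4 phi_1_2_34 f"
abbreviation "pw u \<equiv> zhat_pow B4 u lam"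

lemmas p_closed = chom_closed[OF F2_B4(1)[OF phi_123(1)] f] chom_closed[OF F2_B4(1)[OF phi_234(1)] f]
  chom_closed[OF F2_B4(1)[OF phi_12_3_4(1)] f] chom_closed[OF F2_B4(1)[OF phi_1_23_4(1)] f]
  chom_closed[OF F2_B4(1)[OF phi_1_2_34(1)] f]

lemmas eta4 = B4.eta_closed[OF B4_sigmas(1)] B4.eta_closed[OF B4_sigmas(2)] B4.eta_closed[OF B4_sigmas(3)]
lemmas pw_closed = B4.zhat_pow_closed[OF _ lam]

lemmas pent4 = iffD1[OF pentagon_B4[OF f] pent]

lemma iota_T3:
  "iota_hat 0 (T3 (eta B3 (sigma 3 1))) = pw (eta B4 s1)"
  "iota_hat 0 (T3 (eta B3 (sigma 3 2))) = inv\<^bsub>hat B4\<^esub> p123 \<otimes>\<^bsub>hat B4\<^esub> pw (eta B4 s2) \<otimes>\<^bsub>hat B4\<^esub> p123"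
  "iota_hat 1 (T3 (eta B3 (sigma 3 1))) = pw (eta B4 s2)"
  "iota_hat 1 (T3 (eta B3 (sigma 3 2))) = inv\<^bsub>hat B4\<^esub> p234 \<otimes>\<^bsub>hat B4\<^esub> pw (eta B4 s3) \<otimes>\<^bsub>hat B4\<^esub> p234"
proof -
  have c: "zhat_pow B3 (eta B3 (sigma 3 1)) lam \<in> carrier B3hat" "zhat_pow B3 (eta B3 (sigma 3 2)) lam \<in> carrier B3hat"
    by (rule B3.zhat_pow_closed[OF eta3(1) lam], rule B3.zhat_pow_closed[OF eta3(2) lam])
  note p = B3.zhat_pow_chom[OF braid_group _ _ lam] and s = B3_sigmas(1,2)
  show "iota_hat 0 (T3 (eta B3 (sigma 3 1))) = pw (eta B4 s1)"
    by (simp add: T3(2) p[OF iota_hat(1) eta3(1)] iota_hat(3)[OF s(1)] iota)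
  show "iota_hat 1 (T3 (eta B3 (sigma 3 1))) = pw (eta B4 s2)"
    by (simp add: T3(2) p[OF iota_hat(2) eta3(1)] iota_hat(4)[OF s(1)] iota)
  show "iota_hat 0 (T3 (eta B3 (sigma 3 2))) = inv\<^bsub>hat B4\<^esub> p123 \<otimes>\<^bsub>hat B4\<^esub> pw (eta B4 s2) \<otimes>\<^bsub>hat B4\<^esub> p123"
    by (simp only: T3(3) chom_mult[OF iota_hat(1)] chom_inv[OF braid_group braid_group iota_hat(1)] c F3 B3h.inv_closed B3h.m_closed
        p[OF iota_hat(1) eta3(2)] iota_hat(3)[OF s(2)] iota iota_hat_F2(1)[OF f])
  show "iota_hat 1 (T3 (eta B3 (sigma 3 2))) = inv\<^bsub>hat B4\<^esub> p234 \<otimes>\<^bsub>hat B4\<^esub> pw (eta B4 s3) \<otimes>\<^bsub>hat B4\<^esub> p234"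
    by (simp only: T3(3) chom_mult[OF iota_hat(2)] chom_inv[OF braid_group braid_group iota_hat(2)] c F3 B3h.inv_closed B3h.m_closed
        p[OF iota_hat(2) eta3(2)] iota_hat(4)[OF s(2)] iota iota_hat_F2(2)[OF f])
qed

text \<open>The conjugator by which the action on the last three strands differs from its model on
  three strands. By the pentagon, \<open>p234 hh = p1_2_34 p12_3_4\<close>.\<close>

abbreviation "hh \<equiv> p1_23_4 \<otimes>\<^bsub>hat B4\<^esub> p123"

lemma hh: "hh \<in> carrier (hat B4)"
  using p_closed by simp

lemma pw_commute:
  "pw (eta B4 s1) \<otimes>\<^bsub>hat B4\<^esub> p12_3_4 = p12_3_4 \<otimes>\<^bsub>hat B4\<^esub> pw (eta B4 s1)"
  "pw (eta B4 s2) \<otimes>\<^bsub>hat B4\<^esub> p1_23_4 = p1_23_4 \<otimes>\<^bsub>hat B4\<^esub> pw (eta B4 s2)"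
  "pw (eta B4 s3) \<otimes>\<^bsub>hat B4\<^esub> p1_2_34 = p1_2_34 \<otimes>\<^bsub>hat B4\<^esub> pw (eta B4 s3)"
  by (rule B4.zhat_pow_commute[OF sigma_F2_B4_commute(1)[OF f] eta4(1) p_closed(3) lam],
      rule B4.zhat_pow_commute[OF sigma_F2_B4_commute(2)[OF f] eta4(2) p_closed(4) lam],
      rule B4.zhat_pow_commute[OF sigma_F2_B4_commute(3)[OF f] eta4(3) p_closed(5) lam])

text \<open>For \<open>s2\<close> the factor \<open>p1_23_4\<close> of \<open>hh\<close> commutes
  with the power, and only \<open>p123\<close> remains. For \<open>s3\<close> the pentagon turns
  \<open>p234 hh\<close> into \<open>p1_2_34 p12_3_4\<close>, whose first factor commutes with the
  power.\<close>

lemma conj_iota_T3: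
  "inv\<^bsub>hat B4\<^esub> hh \<otimes>\<^bsub>hat B4\<^esub> iota_hat 1 (T3 (eta B3 (sigma 3 1))) \<otimes>\<^bsub>hat B4\<^esub> hh =
    inv\<^bsub>hat B4\<^esub> p123 \<otimes>\<^bsub>hat B4\<^esub> pw (eta B4 s2) \<otimes>\<^bsub>hat B4\<^esub> p123"
  "inv\<^bsub>hat B4\<^esub> hh \<otimes>\<^bsub>hat B4\<^esub> iota_hat 1 (T3 (eta B3 (sigma 3 2))) \<otimes>\<^bsub>hat B4\<^esub> hh =
    inv\<^bsub>hat B4\<^esub> p12_3_4 \<otimes>\<^bsub>hat B4\<^esub> pw (eta B4 s3) \<otimes>\<^bsub>hat B4\<^esub> p12_3_4"
  unfolding iota_T3
    B4h.pentagon_algebra(1)[OF p_closed(2,4,1,5,3) pw_closed[OF eta4(2)] pent4 pw_commute(2)[symmetric]]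
    B4h.pentagon_algebra(2)[OF p_closed(2,4,1,5,3) pw_closed[OF eta4(3)] pent4]
    B4h.commute_conj[OF pw_commute(3)[symmetric] p_closed(5) pw_closed[OF eta4(3)]]
  by (rule HOL.refl)+

lemma T4_exists: "\<exists>h. T4_spec m f h"
proof -
  let ?S1 = "pw (eta B4 s1)"
  let ?S2 = "inv\<^bsub>hat B4\<^esub> p123 \<otimes>\<^bsub>hat B4\<^esub> pw (eta B4 s2) \<otimes>\<^bsub>hat B4\<^esub> p123"
  let ?S3 = "inv\<^bsub>hat B4\<^esub> p12_3_4 \<otimes>\<^bsub>hat B4\<^esub> pw (eta B4 s3) \<otimes>\<^bsub>hat B4\<^esub> p12_3_4"
  have c: "?S1 \<in> carrier (hat B4)" "?S2 \<in> carrier (hat B4)" "?S3 \<in> carrier (hat B4)"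
    using p_closed pw_closed[OF eta4(1)] pw_closed[OF eta4(2)] pw_closed[OF eta4(3)] by simp_all
  have r12: "?S1 \<otimes>\<^bsub>hat B4\<^esub> (?S2 \<otimes>\<^bsub>hat B4\<^esub> ?S1) = ?S2 \<otimes>\<^bsub>hat B4\<^esub> (?S1 \<otimes>\<^bsub>hat B4\<^esub> ?S2)"
    using chom_braid3_rel[OF braid_group chom_comp[OF T3(1) iota_hat(1)]] unfolding iota_T3 .
  \<comment> \<open>The relation on the last three strands holds for the model and survives
    conjugation by \<open>hh\<close>; identifying the conjugated elements with \<open>?S2\<close>
    and \<open>?S3\<close> is what the pentagon achieves.\<close>
  have r23: "?S2 \<otimes>\<^bsub>hat B4\<^esub> (?S3 \<otimes>\<^bsub>hat B4\<^esub> ?S2) = ?S3 \<otimes>\<^bsub>hat B4\<^esub> (?S2 \<otimes>\<^bsub>hat B4\<^esub> ?S3)"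
    using chom_braid3_rel[OF braid_group B3.chom_conj[OF braid_group chom_comp[OF T3(1) iota_hat(2)] hh]]
    unfolding conj_iota_T3 .
  have e: "eta B4 s1 \<otimes>\<^bsub>hat B4\<^esub> eta B4 s3 = eta B4 s3 \<otimes>\<^bsub>hat B4\<^esub> eta B4 s1"
    by (rule B4.eta_commute[OF B4_sigmas(6,1,3)])
  have "?S1 \<otimes>\<^bsub>hat B4\<^esub> eta B4 s3 = eta B4 s3 \<otimes>\<^bsub>hat B4\<^esub> ?S1"
    by (rule B4.zhat_pow_commute[OF e eta4(1,3) lam])
  hence p13: "?S1 \<otimes>\<^bsub>hat B4\<^esub> pw (eta B4 s3) = pw (eta B4 s3) \<otimes>\<^bsub>hat B4\<^esub> ?S1"
    using B4.zhat_pow_commute[OF _ eta4(3) c(1) lam] by metis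
  \<comment> \<open>Far commutativity survives because the conjugator \<open>p12_3_4\<close> of the
    third image commutes with \<open>s1\<close>.\<close>
  have r13: "?S1 \<otimes>\<^bsub>hat B4\<^esub> ?S3 = ?S3 \<otimes>\<^bsub>hat B4\<^esub> ?S1"
    by (intro B4h.commute_mult B4h.commute_inv pw_commute p13 c p_closed B4h.inv_closed B4h.m_closed pw_closed eta4)
  let ?s = "\<lambda>i::nat. if i = 1 then ?S1 else if i = 2 then ?S2 else ?S3"
  have "braid_images 4 (hat B4) ?s"
    unfolding braid_images_def
  proof (intro conjI allI impI)
    show "?s ` {1..<4} \<subseteq> carrier (hat B4)" by (rule image_subsetI) (use c in simp)
  next
    fix i j :: nat assume "1 \<le> i \<and> i + 2 \<le> j \<and> j < 4"
    hence "i = 1" "j = 3" by simp_all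
    thus "?s i \<otimes>\<^bsub>hat B4\<^esub> ?s j = ?s j \<otimes>\<^bsub>hat B4\<^esub> ?s i" using r13 by simp
  next
    fix i :: nat assume "1 \<le> i \<and> i + 1 < 4"
    hence "i = 1 \<or> i = 2" by auto
    thus "?s i \<otimes>\<^bsub>hat B4\<^esub> (?s (i + 1) \<otimes>\<^bsub>hat B4\<^esub> ?s i) = ?s (i + 1) \<otimes>\<^bsub>hat B4\<^esub> (?s i \<otimes>\<^bsub>hat B4\<^esub> ?s (i + 1))"
      using r12 r23 by (elim disjE) simp_all
  qed
  then obtain h where h: "chom B4 B4 h" "\<And>i. 1 \<le> i \<Longrightarrow> i < 4 \<Longrightarrow> h (eta B4 (sigma 4 i)) = ?s i"
    using braid_chom[OF braid_group] by blast
  show ?thesis unfolding T4_spec_def using h(1) h(2)[of 1] h(2)[of 2] h(2)[of 3] by (intro exI[of _ h]) simp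
qed

definition T4 :: "pro_braid \<Rightarrow> pro_braid" where "T4 = (SOME h. T4_spec m f h)"

lemma T4_spec: "T4_spec m f T4"
  using someI_ex[OF T4_exists] unfolding T4_def .

lemma T4: "chom B4 B4 T4" "T4 (eta B4 s1) = pw (eta B4 s1)"
  "T4 (eta B4 s2) = inv\<^bsub>hat B4\<^esub> p123 \<otimes>\<^bsub>hat B4\<^esub> pw (eta B4 s2) \<otimes>\<^bsub>hat B4\<^esub> p123"
  "T4 (eta B4 s3) = inv\<^bsub>hat B4\<^esub> p12_3_4 \<otimes>\<^bsub>hat B4\<^esub> pw (eta B4 s3) \<otimes>\<^bsub>hat B4\<^esub> p12_3_4"
  using T4_spec unfolding T4_spec_def by simp_all

lemma nat_1_2: "1 \<le> (i::nat) \<Longrightarrow> i < 3 \<Longrightarrow> i = 1 \<or> i = 2"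
  by auto

lemma T4_iota:
  assumes "u \<in> carrier B3hat"
  shows "T4 (iota_hat 0 u) = iota_hat 0 (T3 u)"
    "T4 (iota_hat 1 u) = inv\<^bsub>hat B4\<^esub> hh \<otimes>\<^bsub>hat B4\<^esub> iota_hat 1 (T3 u) \<otimes>\<^bsub>hat B4\<^esub> hh"
proof -
  note s = B3_sigmas(1,2)
  show "T4 (iota_hat 0 u) = iota_hat 0 (T3 u)"
  proof (rule braid_hat_eqI[OF braid_group chom_comp[OF iota_hat(1) T4(1)] chom_comp[OF T3(1) iota_hat(1)] _ assms])
    fix i :: nat assume "1 \<le> i" "i < 3"
    from nat_1_2[OF this] show "T4 (iota_hat 0 (eta B3 (sigma 3 i))) = iota_hat 0 (T3 (eta B3 (sigma 3 i)))"
      by (elim disjE) (simp_all only: iota_T3 iota_hat(3)[OF s(1)] iota_hat(3)[OF s(2)] iota T4)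
  qed
  show "T4 (iota_hat 1 u) = inv\<^bsub>hat B4\<^esub> hh \<otimes>\<^bsub>hat B4\<^esub> iota_hat 1 (T3 u) \<otimes>\<^bsub>hat B4\<^esub> hh"
  proof (rule braid_hat_eqI[OF braid_group chom_comp[OF iota_hat(2) T4(1)]
      B3.chom_conj[OF braid_group chom_comp[OF T3(1) iota_hat(2)] hh] _ assms])
    fix i :: nat assume "1 \<le> i" "i < 3"
    from nat_1_2[OF this] show "T4 (iota_hat 1 (eta B3 (sigma 3 i))) = inv\<^bsub>hat B4\<^esub> hh \<otimes>\<^bsub>hat B4\<^esub> iota_hat 1 (T3 (eta B3 (sigma 3 i))) \<otimes>\<^bsub>hat B4\<^esub> hh"
      by (elim disjE) (simp_all only: conj_iota_T3 iota_hat(4)[OF s(1)] iota_hat(4)[OF s(2)] iota T4)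
  qed
qed

lemma phi_E:
  assumes phi: "\<phi> \<in> hom PB3 PB4"
  shows "F2_B4 \<phi> (E (eta F2 x12)) = pw (eta B4 (\<phi> x12))"
    "F2_B4 \<phi> (E (eta F2 x23)) = inv\<^bsub>hat B4\<^esub> F2_B4 \<phi> f \<otimes>\<^bsub>hat B4\<^esub> pw (eta B4 (\<phi> x23)) \<otimes>\<^bsub>hat B4\<^esub> F2_B4 \<phi> f"
proof -
  note c = F2_B4[OF phi]
  have g: "eta F2 x12 \<in> carrier F2hat" "eta F2 x23 \<in> carrier F2hat" using F2.eta_closed F2_gens by simp_all
  have y: "zhat_pow F2 (eta F2 x23) lam \<in> carrier F2hat" by (rule F2.zhat_pow_closed[OF g(2) lam])
  show "F2_B4 \<phi> (E (eta F2 x12)) = pw (eta B4 (\<phi> x12))"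
    by (simp only: E F2.zhat_pow_chom[OF braid_group c(1) g(1) lam] c)
  show "F2_B4 \<phi> (E (eta F2 x23)) = inv\<^bsub>hat B4\<^esub> F2_B4 \<phi> f \<otimes>\<^bsub>hat B4\<^esub> pw (eta B4 (\<phi> x23)) \<otimes>\<^bsub>hat B4\<^esub> F2_B4 \<phi> f"
    by (simp only: E chom_mult[OF c(1)] chom_inv[OF F2_group braid_group c(1)] f y F2h.inv_closed F2h.m_closed
        F2.zhat_pow_chom[OF braid_group c(1) g(2) lam] c(3))
qed

lemma pw_sq:
  assumes "u \<in> carrier (hat B4)" shows "pw (u \<otimes>\<^bsub>hat B4\<^esub> u) = pw u \<otimes>\<^bsub>hat B4\<^esub> pw u"
  by (rule B4.zhat_pow_mult_distrib[OF assms assms lam HOL.refl])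

lemma eta4_sq:
  "g \<in> carrier B4 \<Longrightarrow> eta B4 (g \<otimes>\<^bsub>B4\<^esub> g) = eta B4 g \<otimes>\<^bsub>hat B4\<^esub> eta B4 g"
  by (rule hom_mult[OF B4.eta_hom])

text \<open>The cablings are images of \<open>x13 x23\<close> and \<open>x12 x13\<close> under the
  two maps from \<open>B3\<close>, so \<open>T4_iota\<close> reduces the computation to
  \<open>T3_products\<close>.\<close>

lemma T4_cab:
  "T4 (eta B4 cab12_3) = pw (eta B4 cab12_3)"
  "T4 (eta B4 cab1_23) = inv\<^bsub>hat B4\<^esub> p123 \<otimes>\<^bsub>hat B4\<^esub> pw (eta B4 cab1_23) \<otimes>\<^bsub>hat B4\<^esub> p123"
  "T4 (eta B4 cab23_4) = inv\<^bsub>hat B4\<^esub> hh \<otimes>\<^bsub>hat B4\<^esub> pw (eta B4 cab23_4) \<otimes>\<^bsub>hat B4\<^esub> hh"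
  "T4 (eta B4 cab2_34) = inv\<^bsub>hat B4\<^esub> hh \<otimes>\<^bsub>hat B4\<^esub> (inv\<^bsub>hat B4\<^esub> p234 \<otimes>\<^bsub>hat B4\<^esub> pw (eta B4 cab2_34) \<otimes>\<^bsub>hat B4\<^esub> p234) \<otimes>\<^bsub>hat B4\<^esub> hh"
proof -
  let ?zy = "x13 \<otimes>\<^bsub>B3\<^esub> x23" and ?xz = "x12 \<otimes>\<^bsub>B3\<^esub> x13"
  have g: "?zy \<in> carrier B3" "?xz \<in> carrier B3" using B3_gens_closed by simp_all
  note gh = B3.eta_closed[OF g(1)] B3.eta_closed[OF g(2)]
  note z = B3.zhat_pow_closed[OF gh(1) lam] B3.zhat_pow_closed[OF gh(2) lam]
  note p = B3.zhat_pow_chom[OF braid_group _ _ lam]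
  note cl = F3 B3h.inv_closed B3h.m_closed z gh
  show "T4 (eta B4 cab12_3) = pw (eta B4 cab12_3)"
    unfolding iota_gens(5)[symmetric] iota_hat(3)[OF g(1), symmetric] T4_iota(1)[OF gh(1)] T3_products p[OF iota_hat(1) gh(1)] ..
  show "T4 (eta B4 cab1_23) = inv\<^bsub>hat B4\<^esub> p123 \<otimes>\<^bsub>hat B4\<^esub> pw (eta B4 cab1_23) \<otimes>\<^bsub>hat B4\<^esub> p123"
    unfolding iota_gens(6)[symmetric] iota_hat(3)[OF g(2), symmetric] T4_iota(1)[OF gh(2)] T3_products
    by (simp only: cl chom_mult[OF iota_hat(1)] chom_inv[OF braid_group braid_group iota_hat(1)] p[OF iota_hat(1) gh(2)] iota_hat_F2(1)[OF f])
  show "T4 (eta B4 cab23_4) = inv\<^bsub>hat B4\<^esub> hh \<otimes>\<^bsub>hat B4\<^esub> pw (eta B4 cab23_4) \<otimes>\<^bsub>hat B4\<^esub> hh"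
    unfolding iota_gens(7)[symmetric] iota_hat(4)[OF g(1), symmetric] T4_iota(2)[OF gh(1)] T3_products p[OF iota_hat(2) gh(1)] ..
  show "T4 (eta B4 cab2_34) = inv\<^bsub>hat B4\<^esub> hh \<otimes>\<^bsub>hat B4\<^esub> (inv\<^bsub>hat B4\<^esub> p234 \<otimes>\<^bsub>hat B4\<^esub> pw (eta B4 cab2_34) \<otimes>\<^bsub>hat B4\<^esub> p234) \<otimes>\<^bsub>hat B4\<^esub> hh"
    unfolding iota_gens(8)[symmetric] iota_hat(4)[OF g(2), symmetric] T4_iota(2)[OF gh(2)] T3_products
    by (simp only: cl chom_mult[OF iota_hat(2)] chom_inv[OF braid_group braid_group iota_hat(2)] p[OF iota_hat(2) gh(2)] iota_hat_F2(2)[OF f])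
qed

text \<open>For \<open>phi_123\<close> and \<open>phi_234\<close> this is \<open>T4_iota\<close> on
  the image of \<open>F2\<close>. For the others it suffices to compare at \<open>x12\<close> and
  \<open>x23\<close>, whose images are squares of generators and cablings; for
  \<open>phi_1_2_34\<close> the pentagon makes the conjugator at \<open>x23\<close> agree with the
  one at \<open>x12\<close>.\<close>

lemma T4_phi:
  assumes u: "u \<in> carrier F2hat"
  shows "T4 (F2_B4 phi_123 u) = F2_B4 phi_123 (E u)"
    "T4 (F2_B4 phi_234 u) = inv\<^bsub>hat B4\<^esub> hh \<otimes>\<^bsub>hat B4\<^esub> F2_B4 phi_234 (E u) \<otimes>\<^bsub>hat B4\<^esub> hh"
    "T4 (F2_B4 phi_12_3_4 u) = F2_B4 phi_12_3_4 (E u)"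
    "T4 (F2_B4 phi_1_23_4 u) = inv\<^bsub>hat B4\<^esub> p123 \<otimes>\<^bsub>hat B4\<^esub> F2_B4 phi_1_23_4 (E u) \<otimes>\<^bsub>hat B4\<^esub> p123"
    "T4 (F2_B4 phi_1_2_34 u) = inv\<^bsub>hat B4\<^esub> p12_3_4 \<otimes>\<^bsub>hat B4\<^esub> F2_B4 phi_1_2_34 (E u) \<otimes>\<^bsub>hat B4\<^esub> p12_3_4"
proof -
  have Iu: "F2_B3 u \<in> carrier B3hat" by (rule chom_closed[OF F2_B3(1) u])
  have Eu: "E u \<in> carrier F2hat" by (rule chom_closed[OF E(1) u])
  show "T4 (F2_B4 phi_123 u) = F2_B4 phi_123 (E u)"
    unfolding iota_hat_F2(1)[OF u, symmetric] T4_iota(1)[OF Iu] T3_F2[OF u] iota_hat_F2(1)[OF Eu] ..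
  show "T4 (F2_B4 phi_234 u) = inv\<^bsub>hat B4\<^esub> hh \<otimes>\<^bsub>hat B4\<^esub> F2_B4 phi_234 (E u) \<otimes>\<^bsub>hat B4\<^esub> hh"
    unfolding iota_hat_F2(2)[OF u, symmetric] T4_iota(2)[OF Iu] T3_F2[OF u] iota_hat_F2(2)[OF Eu] ..
  note q = pw_closed[OF eta4(1)] pw_closed[OF eta4(2)] pw_closed[OF eta4(3)]
  show "T4 (F2_B4 phi_12_3_4 u) = F2_B4 phi_12_3_4 (E u)"
  proof (rule F2hat_eqI[OF braid_group chom_comp[OF F2_B4(1)[OF phi_12_3_4(1)] T4(1)] chom_comp[OF E(1) F2_B4(1)[OF phi_12_3_4(1)]] _ _ u])
    show "T4 (F2_B4 phi_12_3_4 (eta F2 x12)) = F2_B4 phi_12_3_4 (E (eta F2 x12))"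
      unfolding phi_E[OF phi_12_3_4(1)] F2_B4[OF phi_12_3_4(1)] phi_12_3_4 by (rule T4_cab(1))
    show "T4 (F2_B4 phi_12_3_4 (eta F2 x23)) = F2_B4 phi_12_3_4 (E (eta F2 x23))"
      unfolding phi_E[OF phi_12_3_4(1)] F2_B4[OF phi_12_3_4(1)] phi_12_3_4 eta4_sq[OF B4_sigmas(3)] pw_sq[OF eta4(3)]
        chom_mult[OF T4(1) eta4(3) eta4(3)] T4 B4h.conj_mult[OF p_closed(3) q(3) q(3)] ..
  qed
  show "T4 (F2_B4 phi_1_23_4 u) = inv\<^bsub>hat B4\<^esub> p123 \<otimes>\<^bsub>hat B4\<^esub> F2_B4 phi_1_23_4 (E u) \<otimes>\<^bsub>hat B4\<^esub> p123"
  proof (rule F2hat_eqI[OF braid_group chom_comp[OF F2_B4(1)[OF phi_1_23_4(1)] T4(1)]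
      F2.chom_conj[OF braid_group chom_comp[OF E(1) F2_B4(1)[OF phi_1_23_4(1)]] p_closed(1)] _ _ u])
    show "T4 (F2_B4 phi_1_23_4 (eta F2 x12)) = inv\<^bsub>hat B4\<^esub> p123 \<otimes>\<^bsub>hat B4\<^esub> F2_B4 phi_1_23_4 (E (eta F2 x12)) \<otimes>\<^bsub>hat B4\<^esub> p123"
      unfolding phi_E[OF phi_1_23_4(1)] F2_B4[OF phi_1_23_4(1)] phi_1_23_4 by (rule T4_cab(2))
    show "T4 (F2_B4 phi_1_23_4 (eta F2 x23)) = inv\<^bsub>hat B4\<^esub> p123 \<otimes>\<^bsub>hat B4\<^esub> F2_B4 phi_1_23_4 (E (eta F2 x23)) \<otimes>\<^bsub>hat B4\<^esub> p123"
      unfolding phi_E[OF phi_1_23_4(1)] F2_B4[OF phi_1_23_4(1)] phi_1_23_4 T4_cab(3)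
      by (rule B4h.conj_conj[OF p_closed(4,1) pw_closed[OF B4.eta_closed[OF cab_closed(3)]], symmetric])
  qed
  show "T4 (F2_B4 phi_1_2_34 u) = inv\<^bsub>hat B4\<^esub> p12_3_4 \<otimes>\<^bsub>hat B4\<^esub> F2_B4 phi_1_2_34 (E u) \<otimes>\<^bsub>hat B4\<^esub> p12_3_4"
  proof (rule F2hat_eqI[OF braid_group chom_comp[OF F2_B4(1)[OF phi_1_2_34(1)] T4(1)]
      F2.chom_conj[OF braid_group chom_comp[OF E(1) F2_B4(1)[OF phi_1_2_34(1)]] p_closed(3)] _ _ u])
    have "(pw (eta B4 s1) \<otimes>\<^bsub>hat B4\<^esub> pw (eta B4 s1)) \<otimes>\<^bsub>hat B4\<^esub> p12_3_4 = p12_3_4 \<otimes>\<^bsub>hat B4\<^esub> (pw (eta B4 s1) \<otimes>\<^bsub>hat B4\<^esub> pw (eta B4 s1))"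
      by (rule B4h.commute_sq[OF pw_commute(1) q(1) p_closed(3)])
    from B4h.commute_conj[OF this[symmetric] p_closed(3) B4h.m_closed[OF q(1,1)]]
    show "T4 (F2_B4 phi_1_2_34 (eta F2 x12)) = inv\<^bsub>hat B4\<^esub> p12_3_4 \<otimes>\<^bsub>hat B4\<^esub> F2_B4 phi_1_2_34 (E (eta F2 x12)) \<otimes>\<^bsub>hat B4\<^esub> p12_3_4"
      unfolding phi_E[OF phi_1_2_34(1)] F2_B4[OF phi_1_2_34(1)] phi_1_2_34 eta4_sq[OF B4_sigmas(1)] pw_sq[OF eta4(1)]
        chom_mult[OF T4(1) eta4(1) eta4(1)] T4 by (rule HOL.sym)
    show "T4 (F2_B4 phi_1_2_34 (eta F2 x23)) = inv\<^bsub>hat B4\<^esub> p12_3_4 \<otimes>\<^bsub>hat B4\<^esub> F2_B4 phi_1_2_34 (E (eta F2 x23)) \<otimes>\<^bsub>hat B4\<^esub> p12_3_4"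
      unfolding phi_E[OF phi_1_2_34(1)] F2_B4[OF phi_1_2_34(1)] phi_1_2_34 T4_cab(4)
      by (rule B4h.pentagon_algebra(2)[OF p_closed(2,4,1,5,3) pw_closed[OF B4.eta_closed[OF cab_closed(4)]] pent4])
  qed
qed

end

section \<open>The monoid structure\<close>

text \<open>Determined by \<open>2 m + 1 = (2 a + 1) (2 b + 1)\<close>: under composition the
  exponents \<open>2 m + 1\<close> multiply.\<close>

definition gt_fst :: "zhat \<Rightarrow> zhat \<Rightarrow> zhat" where
  "gt_fst a b = a \<otimes>\<^bsub>Zhat\<^esub> b \<oplus>\<^bsub>Zhat\<^esub> a \<otimes>\<^bsub>Zhat\<^esub> b \<oplus>\<^bsub>Zhat\<^esub> a \<oplus>\<^bsub>Zhat\<^esub> b"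

lemma gt_fst_closed: "a \<in> carrier Zhat \<Longrightarrow> b \<in> carrier Zhat \<Longrightarrow> gt_fst a b \<in> carrier Zhat"
  by (simp add: gt_fst_def Zhat_closed)

lemma mod_linear: "(p * (r mod n) + q) mod n = (p * r + q) mod (n::int)"
  by (metis mod_add_left_eq mod_mult_right_eq)

lemma gt_fst_coord: "n > 0 \<Longrightarrow> gt_fst a b n = (2 * a n * b n + a n + b n) mod int n"
  by (simp add: gt_fst_def Zhat_coord mod_simps algebra_simps)

lemma dbl_one_coord: "n > 0 \<Longrightarrow> dbl_one a n = (2 * a n + 1) mod int n"
  by (simp add: Zhat_coord mod_simps algebra_simps)

lemma dbl_one_gt_fst:
  assumes "a \<in> carrier Zhat" "b \<in> carrier Zhat"
  shows "dbl_one (gt_fst a b) = dbl_one a \<otimes>\<^bsub>Zhat\<^esub> dbl_one b"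
proof (rule Zhat_eqI)
  show "dbl_one (gt_fst a b) \<in> carrier Zhat" "dbl_one a \<otimes>\<^bsub>Zhat\<^esub> dbl_one b \<in> carrier Zhat"
    using assms by (simp_all add: gt_fst_closed dbl_one_closed Zhat_closed)
  fix n :: nat assume n: "n > 0"
  have "dbl_one (gt_fst a b) n = (2 * (2 * a n * b n + a n + b n) + 1) mod int n"
    unfolding dbl_one_coord[OF n] gt_fst_coord[OF n] by (rule mod_linear)
  moreover have "(dbl_one a \<otimes>\<^bsub>Zhat\<^esub> dbl_one b) n = ((2 * a n + 1) * (2 * b n + 1)) mod int n"
    using n by (simp only: Zhat_coord(2) dbl_one_coord mod_simps)
  moreover have "2 * (2 * a n * b n + a n + b n) + 1 = (2 * a n + 1) * (2 * b n + 1)" by (simp add: algebra_simps)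
  ultimately show "dbl_one (gt_fst a b) n = (dbl_one a \<otimes>\<^bsub>Zhat\<^esub> dbl_one b) n" by simp
qed

text \<open>The form \<open>(2 a + 1) b + a\<close> splits a power occurring in the hexagon of a
  product into the image, up to conjugation, of a \<open>b\<close>-th power under the first pair and
  an \<open>a\<close>-th power.\<close>

lemma gt_fst_add:
  assumes "a \<in> carrier Zhat" "b \<in> carrier Zhat"
  shows "gt_fst a b = (dbl_one a \<otimes>\<^bsub>Zhat\<^esub> b) \<oplus>\<^bsub>Zhat\<^esub> a"
proof (rule Zhat_eqI)
  show "gt_fst a b \<in> carrier Zhat" "(dbl_one a \<otimes>\<^bsub>Zhat\<^esub> b) \<oplus>\<^bsub>Zhat\<^esub> a \<in> carrier Zhat"
    using assms by (simp_all add: gt_fst_closed dbl_one_closed Zhat_closed)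
  fix n :: nat assume n: "n > 0"
  have "((dbl_one a \<otimes>\<^bsub>Zhat\<^esub> b) \<oplus>\<^bsub>Zhat\<^esub> a) n = ((2 * a n + 1) * b n + a n) mod int n"
    using n by (simp only: Zhat_coord(1,2) dbl_one_coord[OF n] mod_simps)
  thus "gt_fst a b n = ((dbl_one a \<otimes>\<^bsub>Zhat\<^esub> b) \<oplus>\<^bsub>Zhat\<^esub> a) n"
    using n by (simp add: gt_fst_coord algebra_simps)
qed

lemma gt_fst_assoc:
  assumes "a \<in> carrier Zhat" "b \<in> carrier Zhat" "c \<in> carrier Zhat"
  shows "gt_fst (gt_fst a b) c = gt_fst a (gt_fst b c)"
proof (rule Zhat_eqI)
  show "gt_fst (gt_fst a b) c \<in> carrier Zhat" "gt_fst a (gt_fst b c) \<in> carrier Zhat"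
    using assms by (simp_all add: gt_fst_closed)
  fix n :: nat assume n: "n > 0"
  have "gt_fst (gt_fst a b) c n = (2 * (2 * a n * b n + a n + b n) * c n + (2 * a n * b n + a n + b n) + c n) mod int n"
    using mod_linear[of "2 * c n + 1" "2 * a n * b n + a n + b n" "int n" "c n"]
    unfolding gt_fst_coord[OF n] by (simp add: algebra_simps)
  moreover have "gt_fst a (gt_fst b c) n = (2 * a n * (2 * b n * c n + b n + c n) + a n + (2 * b n * c n + b n + c n)) mod int n"
    using mod_linear[of "2 * a n + 1" "2 * b n * c n + b n + c n" "int n" "a n"]
    unfolding gt_fst_coord[OF n] by (simp add: algebra_simps)
  ultimately show "gt_fst (gt_fst a b) c n = gt_fst a (gt_fst b c) n" by (simp add: algebra_simps)
qed

lemma gt_fst_zero: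
  assumes "a \<in> carrier Zhat" shows "gt_fst \<zero>\<^bsub>Zhat\<^esub> a = a" "gt_fst a \<zero>\<^bsub>Zhat\<^esub> = a"
  by (rule Zhat_eqI; simp add: gt_fst_closed Zhat_closed assms gt_fst_coord Zhat_coord Zhat_range)+

lemma (in group) zhat_pow_conj_mult:
  assumes "u \<in> carrier (hat G)" "w \<in> carrier (hat G)" "a \<in> carrier Zhat" "b \<in> carrier Zhat"
  shows "zhat_pow G (inv\<^bsub>hat G\<^esub> w \<otimes>\<^bsub>hat G\<^esub> zhat_pow G u a \<otimes>\<^bsub>hat G\<^esub> w) b =
    inv\<^bsub>hat G\<^esub> w \<otimes>\<^bsub>hat G\<^esub> zhat_pow G u (a \<otimes>\<^bsub>Zhat\<^esub> b) \<otimes>\<^bsub>hat G\<^esub> w"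
  using zhat_pow_conj[OF zhat_pow_closed[OF assms(1,3)] assms(2,4)] zhat_pow_mult[OF assms(1,3,4)] by simp

context
  fixes m :: zhat and f :: pro_braid
  assumes m: "m \<in> carrier Zhat" and f: "f \<in> carrier F2hat"
begin

interpretation B3: group B3 by (rule braid_group)
interpretation B3h: group B3hat by (rule B3.hat_group)

private lemma cl:
  "eta B3 (sigma 3 1) \<in> carrier B3hat" "eta B3 (sigma 3 2) \<in> carrier B3hat"
  "zhat_pow B3 (eta B3 x12) m \<in> carrier B3hat" "zhat_pow B3 (eta B3 x23) m \<in> carrier B3hat"
  "zhat_pow B3 (eta B3 c3) m \<in> carrier B3hat" "F2_B3 f \<in> carrier B3hat"
  "zhat_pow B3 (eta B3 (sigma 3 1)) (dbl_one m) = eta B3 (sigma 3 1) \<otimes>\<^bsub>B3hat\<^esub> zhat_pow B3 (eta B3 x12) m"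
  "zhat_pow B3 (eta B3 (sigma 3 2)) (dbl_one m) = eta B3 (sigma 3 2) \<otimes>\<^bsub>B3hat\<^esub> zhat_pow B3 (eta B3 x23) m"
proof -
  show s: "eta B3 (sigma 3 1) \<in> carrier B3hat" "eta B3 (sigma 3 2) \<in> carrier B3hat" using B3_sigmas B3.eta_closed by simp_all
  show "zhat_pow B3 (eta B3 x12) m \<in> carrier B3hat" "zhat_pow B3 (eta B3 x23) m \<in> carrier B3hat"
    "zhat_pow B3 (eta B3 c3) m \<in> carrier B3hat" using B3_gens_closed B3.eta_closed B3.zhat_pow_closed m by simp_all
  show "F2_B3 f \<in> carrier B3hat" by (rule chom_closed[OF F2_B3(1) f])
  have e: "eta B3 x12 = eta B3 (sigma 3 1) \<otimes>\<^bsub>B3hat\<^esub> eta B3 (sigma 3 1)" "eta B3 x23 = eta B3 (sigma 3 2) \<otimes>\<^bsub>B3hat\<^esub> eta B3 (sigma 3 2)"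
    by (simp_all add: B3_pure_gens hom_mult[OF B3.eta_hom] B3_sigmas)
  show "zhat_pow B3 (eta B3 (sigma 3 1)) (dbl_one m) = eta B3 (sigma 3 1) \<otimes>\<^bsub>B3hat\<^esub> zhat_pow B3 (eta B3 x12) m"
    "zhat_pow B3 (eta B3 (sigma 3 2)) (dbl_one m) = eta B3 (sigma 3 2) \<otimes>\<^bsub>B3hat\<^esub> zhat_pow B3 (eta B3 x23) m"
    unfolding e by (rule B3.zhat_pow_dbl_one[OF s(1) m], rule B3.zhat_pow_dbl_one[OF s(2) m])
qed

text \<open>Regrouped so that the left side is the product of the twisted generators: the hexagon
  evaluates the endomorphism at \<open>\<sigma>_1 \<sigma>_2\<close>, and the second one evaluates
  it at \<open>\<sigma>_2 \<sigma>_1\<close>.\<close>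

lemma hexagon1_iff:
  "hexagon1 m f \<longleftrightarrow>
    zhat_pow B3 (eta B3 (sigma 3 1)) (dbl_one m) \<otimes>\<^bsub>B3hat\<^esub>
      (inv\<^bsub>B3hat\<^esub> F2_B3 f \<otimes>\<^bsub>B3hat\<^esub> zhat_pow B3 (eta B3 (sigma 3 2)) (dbl_one m) \<otimes>\<^bsub>B3hat\<^esub> F2_B3 f) =
    inv\<^bsub>B3hat\<^esub> F2_B3 f \<otimes>\<^bsub>B3hat\<^esub> (eta B3 (sigma 3 1) \<otimes>\<^bsub>B3hat\<^esub> eta B3 (sigma 3 2)) \<otimes>\<^bsub>B3hat\<^esub>
      (inv\<^bsub>B3hat\<^esub> zhat_pow B3 (eta B3 x12) m \<otimes>\<^bsub>B3hat\<^esub> zhat_pow B3 (eta B3 c3) m)"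
  unfolding hexagon1_def Let_def cl(7,8) using cl(1-6) by (simp add: B3h.m_assoc)

lemma hexagon2_iff:
  "hexagon2 m f \<longleftrightarrow>
    (inv\<^bsub>B3hat\<^esub> F2_B3 f \<otimes>\<^bsub>B3hat\<^esub> zhat_pow B3 (eta B3 (sigma 3 2)) (dbl_one m) \<otimes>\<^bsub>B3hat\<^esub> F2_B3 f) \<otimes>\<^bsub>B3hat\<^esub>
      zhat_pow B3 (eta B3 (sigma 3 1)) (dbl_one m) =
    (eta B3 (sigma 3 2) \<otimes>\<^bsub>B3hat\<^esub> eta B3 (sigma 3 1)) \<otimes>\<^bsub>B3hat\<^esub>
      ((inv\<^bsub>B3hat\<^esub> zhat_pow B3 (eta B3 x23) m \<otimes>\<^bsub>B3hat\<^esub> zhat_pow B3 (eta B3 c3) m) \<otimes>\<^bsub>B3hat\<^esub> F2_B3 f)"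
  unfolding hexagon2_def Let_def cl(7,8) using cl(1-6) by (simp add: B3h.m_assoc)

end

section \<open>Products of two pairs\<close>

text \<open>\<open>T\<close> is the left factor of the product and \<open>S\<close> the right one;
  the endomorphism of the product is that of \<open>S\<close> followed by that of
  \<open>T\<close>.\<close>

locale gt_two = T: gt_pair m1 f1 + S: gt_pair m2 f2 for m1 f1 m2 f2
begin

abbreviation "mm \<equiv> gt_fst m1 m2"
abbreviation "g \<equiv> F2hat_endo (m1, f1) f2"
abbreviation "ff \<equiv> f1 \<otimes>\<^bsub>F2hat\<^esub> g"

lemma g: "g \<in> carrier F2hat" by (rule chom_closed[OF T.E(1) S.f])
lemma ff: "ff \<in> carrier F2hat" using g T.f by simp
lemma mm: "mm \<in> carrier Zhat" by (rule gt_fst_closed[OF T.m S.m])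

lemmas lamlam = dbl_one_gt_fst[OF T.m S.m]

lemma F2_B3_ff: "F2_B3 ff = F2_B3 f1 \<otimes>\<^bsub>B3hat\<^esub> F2_B3 g"
  by (rule chom_mult[OF F2_B3(1) T.f g])

lemma F2_B4_ff: "\<phi> \<in> hom PB3 PB4 \<Longrightarrow> F2_B4 \<phi> ff = F2_B4 \<phi> f1 \<otimes>\<^bsub>hat B4\<^esub> F2_B4 \<phi> g"
  by (rule chom_mult[OF F2_B4(1) T.f g])

lemma T3_images:
  "T.T3 (zhat_pow B3 (eta B3 (sigma 3 1)) (dbl_one m2)) = zhat_pow B3 (eta B3 (sigma 3 1)) (dbl_one mm)"
  "T.T3 (inv\<^bsub>B3hat\<^esub> F2_B3 f2 \<otimes>\<^bsub>B3hat\<^esub> zhat_pow B3 (eta B3 (sigma 3 2)) (dbl_one m2) \<otimes>\<^bsub>B3hat\<^esub> F2_B3 f2) =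
    inv\<^bsub>B3hat\<^esub> F2_B3 ff \<otimes>\<^bsub>B3hat\<^esub> zhat_pow B3 (eta B3 (sigma 3 2)) (dbl_one mm) \<otimes>\<^bsub>B3hat\<^esub> F2_B3 ff"
proof -
  note p = T.B3.zhat_pow_chom[OF braid_group T.T3(1) _ S.lam]
  show "T.T3 (zhat_pow B3 (eta B3 (sigma 3 1)) (dbl_one m2)) = zhat_pow B3 (eta B3 (sigma 3 1)) (dbl_one mm)"
    by (simp only: p[OF T.eta3(1)] T.T3(2) T.B3.zhat_pow_mult[OF T.eta3(1) T.lam S.lam, symmetric] lamlam)
  have G: "F2_B3 g \<in> carrier B3hat" by (rule chom_closed[OF F2_B3(1) g])
  have z: "zhat_pow B3 (eta B3 (sigma 3 2)) (dbl_one m2) \<in> carrier B3hat"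
    "zhat_pow B3 (eta B3 (sigma 3 2)) (dbl_one mm) \<in> carrier B3hat"
    by (rule T.B3.zhat_pow_closed[OF T.eta3(2) S.lam], rule T.B3.zhat_pow_closed[OF T.eta3(2) dbl_one_closed[OF mm]])
  show "T.T3 (inv\<^bsub>B3hat\<^esub> F2_B3 f2 \<otimes>\<^bsub>B3hat\<^esub> zhat_pow B3 (eta B3 (sigma 3 2)) (dbl_one m2) \<otimes>\<^bsub>B3hat\<^esub> F2_B3 f2) =
    inv\<^bsub>B3hat\<^esub> F2_B3 ff \<otimes>\<^bsub>B3hat\<^esub> zhat_pow B3 (eta B3 (sigma 3 2)) (dbl_one mm) \<otimes>\<^bsub>B3hat\<^esub> F2_B3 ff"
    by (simp only: chom_mult[OF T.T3(1)] chom_inv[OF braid_group braid_group T.T3(1)] z S.F3 T.B3h.inv_closed T.B3h.m_closed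
        T.T3_F2[OF S.f] p[OF T.eta3(2)] T.T3(3) T.B3.zhat_pow_conj_mult[OF T.eta3(2) T.F3 T.lam S.lam] lamlam[symmetric]
        T.B3h.conj_conj[OF T.F3 G z(2)] F2_B3_ff)
qed

lemma T3_powers:
  "T.T3 (zhat_pow B3 (eta B3 x12) m2) = zhat_pow B3 (eta B3 x12) (dbl_one m1 \<otimes>\<^bsub>Zhat\<^esub> m2)"
  "T.T3 (zhat_pow B3 (eta B3 x23) m2) = inv\<^bsub>B3hat\<^esub> F2_B3 f1 \<otimes>\<^bsub>B3hat\<^esub> zhat_pow B3 (eta B3 x23) (dbl_one m1 \<otimes>\<^bsub>Zhat\<^esub> m2) \<otimes>\<^bsub>B3hat\<^esub> F2_B3 f1"
  "T.T3 (zhat_pow B3 (eta B3 c3) m2) = zhat_pow B3 (eta B3 c3) (dbl_one m1 \<otimes>\<^bsub>Zhat\<^esub> m2)"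
  by (simp_all only: T.B3.zhat_pow_chom[OF braid_group T.T3(1) _ S.m] T.eta3 T.T3_x12 T.T3_x23 T.T3_c3
      T.B3.zhat_pow_mult[OF _ T.lam S.m, symmetric] T.B3.zhat_pow_conj_mult[OF _ T.F3 T.lam S.m])

lemma powers_mm:
  assumes "u \<in> carrier B3hat"
  shows "zhat_pow B3 u mm = zhat_pow B3 u (dbl_one m1 \<otimes>\<^bsub>Zhat\<^esub> m2) \<otimes>\<^bsub>B3hat\<^esub> zhat_pow B3 u m1"
  unfolding gt_fst_add[OF T.m S.m]
  by (rule T.B3.zhat_pow_add[OF assms Zhat_closed(2)[OF T.lam S.m] T.m])

text \<open>\<open>T.T3\<close> is applied to a hexagon of the second pair, and its value at
  \<open>\<sigma>_1 \<sigma>_2\<close> or \<open>\<sigma>_2 \<sigma>_1\<close> is taken from the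
  hexagon of the first pair. Centrality of the powers of \<open>c3\<close> lets
  \<open>powers_mm\<close> collect the exponents.\<close>

lemma hexagons_product: "hexagon1 mm ff" "hexagon2 mm ff"
proof -
  let ?a = "eta B3 (sigma 3 1)" and ?b = "eta B3 (sigma 3 2)"
  let ?X = "zhat_pow B3 (eta B3 x12)" and ?Y = "zhat_pow B3 (eta B3 x23)" and ?C = "zhat_pow B3 (eta B3 c3)"
  let ?n = "dbl_one m1 \<otimes>\<^bsub>Zhat\<^esub> m2"
  have n: "?n \<in> carrier Zhat" by (rule Zhat_closed(2)[OF T.lam S.m])
  note z = T.B3.zhat_pow_closed[OF T.eta3(3)] T.B3.zhat_pow_closed[OF T.eta3(4)] T.B3.zhat_pow_closed[OF T.eta3(6)]
  note zs = z(1)[OF T.m] z(1)[OF S.m] z(1)[OF n] z(2)[OF T.m] z(2)[OF S.m] z(2)[OF n] z(3)[OF T.m] z(3)[OF S.m] z(3)[OF n]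
  have G: "F2_B3 g \<in> carrier B3hat" by (rule chom_closed[OF F2_B3(1) g])
  have Cn: "?C ?n \<otimes>\<^bsub>B3hat\<^esub> u = u \<otimes>\<^bsub>B3hat\<^esub> ?C ?n" if "u \<in> carrier B3hat" for u by (rule T.c3_pow_central[OF n that])
  have C1: "?C m1 \<otimes>\<^bsub>B3hat\<^esub> u = u \<otimes>\<^bsub>B3hat\<^esub> ?C m1" if "u \<in> carrier B3hat" for u by (rule T.c3_pow_central[OF T.m that])
  note cl = zs G T.F3 S.F3 T.eta3 T.B3h.inv_closed T.B3h.m_closed
  note mm3 = powers_mm[OF T.eta3(3)] powers_mm[OF T.eta3(4)] powers_mm[OF T.eta3(6)]
  note hT1 = iffD1[OF hexagon1_iff[OF T.m T.f] T.hex1] and hS1 = iffD1[OF hexagon1_iff[OF S.m S.f] S.hex1]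
  note hT2 = iffD1[OF hexagon2_iff[OF T.m T.f] T.hex2] and hS2 = iffD1[OF hexagon2_iff[OF S.m S.f] S.hex2]
  note T3m = chom_mult[OF T.T3(1)] chom_inv[OF braid_group braid_group T.T3(1)]
  have zl: "zhat_pow B3 ?a (dbl_one m2) \<in> carrier B3hat" "zhat_pow B3 ?b (dbl_one m2) \<in> carrier B3hat"
    by (rule T.B3.zhat_pow_closed[OF T.eta3(1) S.lam], rule T.B3.zhat_pow_closed[OF T.eta3(2) S.lam])
  let ?M1 = "zhat_pow B3 ?a (dbl_one mm)" and ?M2 = "inv\<^bsub>B3hat\<^esub> F2_B3 ff \<otimes>\<^bsub>B3hat\<^esub> zhat_pow B3 ?b (dbl_one mm) \<otimes>\<^bsub>B3hat\<^esub> F2_B3 ff"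
  let ?L1 = "zhat_pow B3 ?a (dbl_one m2)" and ?L2 = "inv\<^bsub>B3hat\<^esub> F2_B3 f2 \<otimes>\<^bsub>B3hat\<^esub> zhat_pow B3 ?b (dbl_one m2) \<otimes>\<^bsub>B3hat\<^esub> F2_B3 f2"
  have L: "?L1 \<in> carrier B3hat" "?L2 \<in> carrier B3hat" using zl S.F3 by simp_all
  have Tab: "T.T3 (?a \<otimes>\<^bsub>B3hat\<^esub> ?b) = inv\<^bsub>B3hat\<^esub> F2_B3 f1 \<otimes>\<^bsub>B3hat\<^esub> (?a \<otimes>\<^bsub>B3hat\<^esub> ?b) \<otimes>\<^bsub>B3hat\<^esub> (inv\<^bsub>B3hat\<^esub> ?X m1 \<otimes>\<^bsub>B3hat\<^esub> ?C m1)"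
    using hT1 by (simp add: T3m T.eta3 T.T3)
  have Tba: "T.T3 (?b \<otimes>\<^bsub>B3hat\<^esub> ?a) = (?b \<otimes>\<^bsub>B3hat\<^esub> ?a) \<otimes>\<^bsub>B3hat\<^esub> ((inv\<^bsub>B3hat\<^esub> ?Y m1 \<otimes>\<^bsub>B3hat\<^esub> ?C m1) \<otimes>\<^bsub>B3hat\<^esub> F2_B3 f1)"
    using hT2 by (simp add: T3m T.eta3 T.T3)
  have "?M1 \<otimes>\<^bsub>B3hat\<^esub> ?M2 = T.T3 (?L1 \<otimes>\<^bsub>B3hat\<^esub> ?L2)"
    by (simp only: T3m L T3_images)
  also have "\<dots> = T.T3 (inv\<^bsub>B3hat\<^esub> F2_B3 f2 \<otimes>\<^bsub>B3hat\<^esub> (?a \<otimes>\<^bsub>B3hat\<^esub> ?b) \<otimes>\<^bsub>B3hat\<^esub> (inv\<^bsub>B3hat\<^esub> ?X m2 \<otimes>\<^bsub>B3hat\<^esub> ?C m2))"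
    unfolding hS1 ..
  also have "\<dots> = inv\<^bsub>B3hat\<^esub> F2_B3 g \<otimes>\<^bsub>B3hat\<^esub> T.T3 (?a \<otimes>\<^bsub>B3hat\<^esub> ?b) \<otimes>\<^bsub>B3hat\<^esub> (inv\<^bsub>B3hat\<^esub> ?X ?n \<otimes>\<^bsub>B3hat\<^esub> ?C ?n)"
    by (simp only: chom_mult[OF T.T3(1), of _ "inv\<^bsub>B3hat\<^esub> ?X m2 \<otimes>\<^bsub>B3hat\<^esub> ?C m2"] chom_mult[OF T.T3(1), of "inv\<^bsub>B3hat\<^esub> F2_B3 f2"]
        chom_mult[OF T.T3(1), of "inv\<^bsub>B3hat\<^esub> ?X m2"] T3m(2) cl T3_powers T.T3_F2[OF S.f])
  also have "\<dots> = inv\<^bsub>B3hat\<^esub> F2_B3 g \<otimes>\<^bsub>B3hat\<^esub> (inv\<^bsub>B3hat\<^esub> F2_B3 f1 \<otimes>\<^bsub>B3hat\<^esub> (?a \<otimes>\<^bsub>B3hat\<^esub> (?b \<otimes>\<^bsub>B3hat\<^esub>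
      (inv\<^bsub>B3hat\<^esub> ?X m1 \<otimes>\<^bsub>B3hat\<^esub> ((?C m1 \<otimes>\<^bsub>B3hat\<^esub> inv\<^bsub>B3hat\<^esub> ?X ?n) \<otimes>\<^bsub>B3hat\<^esub> ?C ?n)))))"
    unfolding Tab by (simp only: T.B3h.m_assoc cl)
  also have "?C m1 \<otimes>\<^bsub>B3hat\<^esub> inv\<^bsub>B3hat\<^esub> ?X ?n = inv\<^bsub>B3hat\<^esub> ?X ?n \<otimes>\<^bsub>B3hat\<^esub> ?C m1" by (rule C1) (simp only: cl)
  also have "(inv\<^bsub>B3hat\<^esub> ?X ?n \<otimes>\<^bsub>B3hat\<^esub> ?C m1) \<otimes>\<^bsub>B3hat\<^esub> ?C ?n = inv\<^bsub>B3hat\<^esub> ?X ?n \<otimes>\<^bsub>B3hat\<^esub> (?C ?n \<otimes>\<^bsub>B3hat\<^esub> ?C m1)"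
    by (simp only: T.B3h.m_assoc cl C1)
  finally have "?M1 \<otimes>\<^bsub>B3hat\<^esub> ?M2 = inv\<^bsub>B3hat\<^esub> F2_B3 ff \<otimes>\<^bsub>B3hat\<^esub> (?a \<otimes>\<^bsub>B3hat\<^esub> ?b) \<otimes>\<^bsub>B3hat\<^esub> (inv\<^bsub>B3hat\<^esub> ?X mm \<otimes>\<^bsub>B3hat\<^esub> ?C mm)"
    by (simp only: F2_B3_ff mm3 T.B3h.inv_mult_group T.B3h.m_assoc cl)
  thus "hexagon1 mm ff" unfolding hexagon1_iff[OF mm ff] .
  have "?M2 \<otimes>\<^bsub>B3hat\<^esub> ?M1 = T.T3 (?L2 \<otimes>\<^bsub>B3hat\<^esub> ?L1)"
    by (simp only: T3m L T3_images)
  also have "\<dots> = T.T3 ((?b \<otimes>\<^bsub>B3hat\<^esub> ?a) \<otimes>\<^bsub>B3hat\<^esub> ((inv\<^bsub>B3hat\<^esub> ?Y m2 \<otimes>\<^bsub>B3hat\<^esub> ?C m2) \<otimes>\<^bsub>B3hat\<^esub> F2_B3 f2))"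
    unfolding hS2 ..
  also have "\<dots> = T.T3 (?b \<otimes>\<^bsub>B3hat\<^esub> ?a) \<otimes>\<^bsub>B3hat\<^esub> ((inv\<^bsub>B3hat\<^esub> T.T3 (?Y m2) \<otimes>\<^bsub>B3hat\<^esub> T.T3 (?C m2)) \<otimes>\<^bsub>B3hat\<^esub> F2_B3 g)"
    by (simp only: chom_mult[OF T.T3(1), of _ "(inv\<^bsub>B3hat\<^esub> ?Y m2 \<otimes>\<^bsub>B3hat\<^esub> ?C m2) \<otimes>\<^bsub>B3hat\<^esub> F2_B3 f2"]
        chom_mult[OF T.T3(1), of _ "F2_B3 f2"] chom_mult[OF T.T3(1), of "inv\<^bsub>B3hat\<^esub> ?Y m2"] T3m(2) cl T.T3_F2[OF S.f])
  also have "\<dots> = (?b \<otimes>\<^bsub>B3hat\<^esub> ?a) \<otimes>\<^bsub>B3hat\<^esub> (inv\<^bsub>B3hat\<^esub> ?Y m1 \<otimes>\<^bsub>B3hat\<^esub> (?C m1 \<otimes>\<^bsub>B3hat\<^esub>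
      (inv\<^bsub>B3hat\<^esub> ?Y ?n \<otimes>\<^bsub>B3hat\<^esub> ((F2_B3 f1 \<otimes>\<^bsub>B3hat\<^esub> ?C ?n) \<otimes>\<^bsub>B3hat\<^esub> F2_B3 g))))"
    unfolding Tba T3_powers by (simp only: T.B3h.inv_mult_group T.B3h.inv_inv T.B3h.m_assoc T.B3h.mult_inv_cancel cl)
  also have "F2_B3 f1 \<otimes>\<^bsub>B3hat\<^esub> ?C ?n = ?C ?n \<otimes>\<^bsub>B3hat\<^esub> F2_B3 f1" by (rule Cn[symmetric]) (simp only: cl)
  also have "?C m1 \<otimes>\<^bsub>B3hat\<^esub> (inv\<^bsub>B3hat\<^esub> ?Y ?n \<otimes>\<^bsub>B3hat\<^esub> ((?C ?n \<otimes>\<^bsub>B3hat\<^esub> F2_B3 f1) \<otimes>\<^bsub>B3hat\<^esub> F2_B3 g)) =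
      (inv\<^bsub>B3hat\<^esub> ?Y ?n \<otimes>\<^bsub>B3hat\<^esub> ((?C ?n \<otimes>\<^bsub>B3hat\<^esub> F2_B3 f1) \<otimes>\<^bsub>B3hat\<^esub> F2_B3 g)) \<otimes>\<^bsub>B3hat\<^esub> ?C m1"
    by (rule C1) (simp only: cl)
  also have "\<dots> = inv\<^bsub>B3hat\<^esub> ?Y ?n \<otimes>\<^bsub>B3hat\<^esub> (?C ?n \<otimes>\<^bsub>B3hat\<^esub> ((F2_B3 f1 \<otimes>\<^bsub>B3hat\<^esub> F2_B3 g) \<otimes>\<^bsub>B3hat\<^esub> ?C m1))"
    by (simp only: T.B3h.m_assoc cl)
  also have "(F2_B3 f1 \<otimes>\<^bsub>B3hat\<^esub> F2_B3 g) \<otimes>\<^bsub>B3hat\<^esub> ?C m1 = ?C m1 \<otimes>\<^bsub>B3hat\<^esub> (F2_B3 f1 \<otimes>\<^bsub>B3hat\<^esub> F2_B3 g)"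
    by (rule C1[symmetric]) (simp only: cl)
  finally have "?M2 \<otimes>\<^bsub>B3hat\<^esub> ?M1 = (?b \<otimes>\<^bsub>B3hat\<^esub> ?a) \<otimes>\<^bsub>B3hat\<^esub> ((inv\<^bsub>B3hat\<^esub> ?Y mm \<otimes>\<^bsub>B3hat\<^esub> ?C mm) \<otimes>\<^bsub>B3hat\<^esub> F2_B3 ff)"
    by (simp only: F2_B3_ff mm3 T.B3h.inv_mult_group T.B3h.m_assoc cl)
  thus "hexagon2 mm ff" unfolding hexagon2_iff[OF mm ff] .
qed

text \<open>\<open>T.T4\<close> turns the pentagon of the second pair into an identity between
  conjugated terms. Multiplied on the left by the pentagon of the first pair, the conjugators
  telescope into the values at \<open>ff\<close>.\<close>

lemma pentagon_product: "pentagon ff"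
proof -
  note \<phi> = phi_123(1) phi_234(1) phi_12_3_4(1) phi_1_23_4(1) phi_1_2_34(1)
  note gc = chom_closed[OF F2_B4(1)[OF \<phi>(1)] g] chom_closed[OF F2_B4(1)[OF \<phi>(2)] g] chom_closed[OF F2_B4(1)[OF \<phi>(3)] g]
    chom_closed[OF F2_B4(1)[OF \<phi>(4)] g] chom_closed[OF F2_B4(1)[OF \<phi>(5)] g]
  note cl = gc T.p_closed S.p_closed T.B4h.inv_closed T.B4h.m_closed
  note e = F2_B4_ff[OF \<phi>(1)] F2_B4_ff[OF \<phi>(2)] F2_B4_ff[OF \<phi>(3)] F2_B4_ff[OF \<phi>(4)] F2_B4_ff[OF \<phi>(5)]
  note T4m = chom_mult[OF T.T4(1)]
  let ?h = "F2_B4 phi_1_23_4 f1 \<otimes>\<^bsub>hat B4\<^esub> F2_B4 phi_123 f1"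
  have "T.T4 (F2_B4 phi_234 f2 \<otimes>\<^bsub>hat B4\<^esub> F2_B4 phi_1_23_4 f2 \<otimes>\<^bsub>hat B4\<^esub> F2_B4 phi_123 f2)
      = T.T4 (F2_B4 phi_1_2_34 f2 \<otimes>\<^bsub>hat B4\<^esub> F2_B4 phi_12_3_4 f2)"
    unfolding S.pent4 ..
  hence t: "(inv\<^bsub>hat B4\<^esub> ?h \<otimes>\<^bsub>hat B4\<^esub> F2_B4 phi_234 g \<otimes>\<^bsub>hat B4\<^esub> ?h) \<otimes>\<^bsub>hat B4\<^esub>
      (inv\<^bsub>hat B4\<^esub> F2_B4 phi_123 f1 \<otimes>\<^bsub>hat B4\<^esub> F2_B4 phi_1_23_4 g \<otimes>\<^bsub>hat B4\<^esub> F2_B4 phi_123 f1) \<otimes>\<^bsub>hat B4\<^esub> F2_B4 phi_123 g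
    = (inv\<^bsub>hat B4\<^esub> F2_B4 phi_12_3_4 f1 \<otimes>\<^bsub>hat B4\<^esub> F2_B4 phi_1_2_34 g \<otimes>\<^bsub>hat B4\<^esub> F2_B4 phi_12_3_4 f1) \<otimes>\<^bsub>hat B4\<^esub> F2_B4 phi_12_3_4 g"
    (is "?l = ?r") by (simp only: T4m cl T.T4_phi[OF S.f])
  have "(F2_B4 phi_234 f1 \<otimes>\<^bsub>hat B4\<^esub> F2_B4 phi_1_23_4 f1 \<otimes>\<^bsub>hat B4\<^esub> F2_B4 phi_123 f1) \<otimes>\<^bsub>hat B4\<^esub> ?l
      = (F2_B4 phi_1_2_34 f1 \<otimes>\<^bsub>hat B4\<^esub> F2_B4 phi_12_3_4 f1) \<otimes>\<^bsub>hat B4\<^esub> ?r"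
    unfolding t T.pent4 ..
  hence "F2_B4 phi_234 ff \<otimes>\<^bsub>hat B4\<^esub> F2_B4 phi_1_23_4 ff \<otimes>\<^bsub>hat B4\<^esub> F2_B4 phi_123 ff
    = F2_B4 phi_1_2_34 ff \<otimes>\<^bsub>hat B4\<^esub> F2_B4 phi_12_3_4 ff"
    unfolding e by (simp only: T.B4h.inv_mult_group T.B4h.m_assoc T.B4h.mult_inv_cancel cl)
  thus ?thesis unfolding pentagon_B4[OF ff] .
qed

lemma product: "gt_pair mm ff"
  by (rule gt_pair.intro[OF mm ff hexagons_product pentagon_product])

lemma E_product:
  assumes "u \<in> carrier F2hat"
  shows "F2hat_endo (m1, f1) (F2hat_endo (m2, f2) u) = F2hat_endo (mm, ff) u"
proof (rule F2hat_endo_unique[OF mm ff chom_comp[OF S.E(1) T.E(1)] _ _ assms])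
  have x: "eta F2 x12 \<in> carrier F2hat" "eta F2 x23 \<in> carrier F2hat" using T.F2.eta_closed F2_gens by simp_all
  note p = T.F2.zhat_pow_chom[OF F2_group T.E(1) _ S.lam]
  show "F2hat_endo (m1, f1) (F2hat_endo (m2, f2) (eta F2 x12)) = zhat_pow F2 (eta F2 x12) (dbl_one mm)"
    by (simp only: S.E p[OF x(1)] T.E T.F2.zhat_pow_mult[OF x(1) T.lam S.lam, symmetric] lamlam)
  have z: "zhat_pow F2 (eta F2 x23) (dbl_one m2) \<in> carrier F2hat" "zhat_pow F2 (eta F2 x23) (dbl_one mm) \<in> carrier F2hat"
    by (rule T.F2.zhat_pow_closed[OF x(2) S.lam], rule T.F2.zhat_pow_closed[OF x(2) dbl_one_closed[OF mm]])
  show "F2hat_endo (m1, f1) (F2hat_endo (m2, f2) (eta F2 x23)) =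
      inv\<^bsub>F2hat\<^esub> ff \<otimes>\<^bsub>F2hat\<^esub> zhat_pow F2 (eta F2 x23) (dbl_one mm) \<otimes>\<^bsub>F2hat\<^esub> ff"
    by (simp only: S.E chom_mult[OF T.E(1)] chom_inv[OF F2_group F2_group T.E(1)] S.f z T.F2h.inv_closed T.F2h.m_closed
        p[OF x(2)] T.E(3) T.F2.zhat_pow_conj_mult[OF x(2) T.f T.lam S.lam] lamlam[symmetric] T.F2h.conj_conj[OF T.f g z(2)])
qed

text \<open>The conjugators compose correctly because \<open>T.T4\<close> commutes exactly, without
  an inner automorphism, with the two homomorphisms occurring in the images of \<open>s2\<close> and
  \<open>s3\<close>, namely \<open>phi_123\<close> and \<open>phi_12_3_4\<close>.\<close>

lemma T4_product:
  assumes "u \<in> carrier (hat B4)"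
  shows "T.T4 (S.T4 u) = gt_pair.T4 mm ff u"
proof -
  interpret P: gt_pair mm ff by (rule product)
  note p = T.B4.zhat_pow_chom[OF braid_group T.T4(1) _ S.lam]
  have pp: "T.T4 (inv\<^bsub>hat B4\<^esub> F2_B4 \<phi> f2 \<otimes>\<^bsub>hat B4\<^esub> zhat_pow B4 s (dbl_one m2) \<otimes>\<^bsub>hat B4\<^esub> F2_B4 \<phi> f2) =
      inv\<^bsub>hat B4\<^esub> F2_B4 \<phi> ff \<otimes>\<^bsub>hat B4\<^esub> zhat_pow B4 s (dbl_one mm) \<otimes>\<^bsub>hat B4\<^esub> F2_B4 \<phi> ff"
    if \<phi>: "\<phi> \<in> hom PB3 PB4" and s: "s \<in> carrier (hat B4)"
      and a: "T.T4 s = inv\<^bsub>hat B4\<^esub> F2_B4 \<phi> f1 \<otimes>\<^bsub>hat B4\<^esub> zhat_pow B4 s (dbl_one m1) \<otimes>\<^bsub>hat B4\<^esub> F2_B4 \<phi> f1"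
      and b: "T.T4 (F2_B4 \<phi> f2) = F2_B4 \<phi> g" for \<phi> s
  proof -
    note c = chom_closed[OF F2_B4(1)[OF \<phi>] S.f] chom_closed[OF F2_B4(1)[OF \<phi>] T.f] chom_closed[OF F2_B4(1)[OF \<phi>] g]
    have z: "zhat_pow B4 s (dbl_one m2) \<in> carrier (hat B4)" "zhat_pow B4 s (dbl_one mm) \<in> carrier (hat B4)"
      by (rule T.B4.zhat_pow_closed[OF s S.lam], rule T.B4.zhat_pow_closed[OF s dbl_one_closed[OF mm]])
    show ?thesis
      by (simp only: chom_mult[OF T.T4(1)] chom_inv[OF braid_group braid_group T.T4(1)] c z T.B4h.inv_closed T.B4h.m_closed
          p[OF s] a b T.B4.zhat_pow_conj_mult[OF s c(2) T.lam S.lam] lamlam[symmetric]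
          T.B4h.conj_conj[OF c(2,3) z(2)] F2_B4_ff[OF \<phi>])
  qed
  show ?thesis
  proof (rule braid_hat_eqI[OF braid_group chom_comp[OF S.T4(1) T.T4(1)] P.T4(1) _ assms])
    fix i :: nat assume "1 \<le> i" "i < 4"
    hence "i = 1 \<or> i = 2 \<or> i = 3" by auto
    moreover have "T.T4 (S.T4 (eta B4 s1)) = P.T4 (eta B4 s1)"
      by (simp only: S.T4 p[OF T.eta4(1)] T.T4(2) T.B4.zhat_pow_mult[OF T.eta4(1) T.lam S.lam, symmetric] lamlam P.T4)
    moreover have "T.T4 (S.T4 (eta B4 s2)) = P.T4 (eta B4 s2)"
      unfolding S.T4 P.T4 by (rule pp[OF phi_123(1) T.eta4(2) T.T4(3) T.T4_phi(1)[OF S.f]])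
    moreover have "T.T4 (S.T4 (eta B4 s3)) = P.T4 (eta B4 s3)"
      unfolding S.T4 P.T4 by (rule pp[OF phi_12_3_4(1) T.eta4(3) T.T4(4) T.T4_phi(3)[OF S.f]])
    ultimately show "T.T4 (S.T4 (eta B4 (sigma 4 i))) = P.T4 (eta B4 (sigma 4 i))" by (elim disjE) simp_all
  qed
qed

end

section \<open>The unit, the monoid laws and the group of invertible pairs\<close>

lemma dbl_one_zero: "dbl_one \<zero>\<^bsub>Zhat\<^esub> = \<one>\<^bsub>Zhat\<^esub>"
  by (rule Zhat_eqI) (simp_all add: Zhat_closed Zhat_coord mod_simps)

lemma completion_map_one:
  "group G \<Longrightarrow> group H \<Longrightarrow> \<phi> \<in> hom G H \<Longrightarrow> completion_map G H \<phi> \<one>\<^bsub>hat G\<^esub> = \<one>\<^bsub>hat H\<^esub>"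
  by (rule chom_one[OF _ _ group.completion_map(1)])

lemma gt_pair_one: "gt_pair \<zero>\<^bsub>Zhat\<^esub> \<one>\<^bsub>F2hat\<^esub>"
proof
  interpret F2: group F2 by (rule F2_group)
  interpret F2h: group F2hat by (rule F2.hat_group)
  interpret B3: group B3 by (rule braid_group)
  interpret B3h: group B3hat by (rule B3.hat_group)
  interpret B4h: group "hat B4" by (rule group.hat_group[OF braid_group])
  have s: "eta B3 (sigma 3 1) \<in> carrier B3hat" "eta B3 (sigma 3 2) \<in> carrier B3hat" using B3_sigmas B3.eta_closed by simp_all
  note one3 = completion_map_one[OF F2_group braid_group F2_inclusion(2)]
  show "\<one>\<^bsub>F2hat\<^esub> \<in> carrier F2hat" by (rule F2h.one_closed)
  show "hexagon1 \<zero>\<^bsub>Zhat\<^esub> \<one>\<^bsub>F2hat\<^esub>" "hexagon2 \<zero>\<^bsub>Zhat\<^esub> \<one>\<^bsub>F2hat\<^esub>"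
    unfolding hexagon1_def hexagon2_def Let_def one3 B3.zhat_pow_zero using s by (simp_all del: hat_one)
  have o: "F2_B4 \<phi> \<one>\<^bsub>F2hat\<^esub> = \<one>\<^bsub>hat B4\<^esub>" if "\<phi> \<in> hom PB3 PB4" for \<phi>
    by (rule completion_map_one[OF F2_group braid_group phi_F2_B4[OF that]])
  show "pentagon \<one>\<^bsub>F2hat\<^esub>"
    unfolding pentagon_B4[OF F2h.one_closed] by (simp add: o phi_123 phi_234 phi_12_3_4 phi_1_23_4 phi_1_2_34 del: hat_one)
qed (rule Zhat_closed)

lemma E_one:
  assumes "u \<in> carrier F2hat" shows "F2hat_endo (\<zero>\<^bsub>Zhat\<^esub>, \<one>\<^bsub>F2hat\<^esub>) u = u"
proof -
  interpret P: gt_pair "\<zero>\<^bsub>Zhat\<^esub>" "\<one>\<^bsub>F2hat\<^esub>" by (rule gt_pair_one)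
  have x: "eta F2 x12 \<in> carrier F2hat" "eta F2 x23 \<in> carrier F2hat" using P.F2.eta_closed F2_gens by simp_all
  have "u = F2hat_endo (\<zero>\<^bsub>Zhat\<^esub>, \<one>\<^bsub>F2hat\<^esub>) u"
    by (rule F2hat_endo_unique[OF P.m P.f chom_id _ _ assms])
      (use x in \<open>simp_all add: dbl_one_zero P.F2.zhat_pow_one del: hat_one\<close>)
  thus ?thesis by simp
qed

lemma T4_one:
  assumes "u \<in> carrier (hat B4)" shows "gt_pair.T4 \<zero>\<^bsub>Zhat\<^esub> \<one>\<^bsub>F2hat\<^esub> u = u"
proof -
  interpret P: gt_pair "\<zero>\<^bsub>Zhat\<^esub>" "\<one>\<^bsub>F2hat\<^esub>" by (rule gt_pair_one)
  have o: "F2_B4 \<phi> \<one>\<^bsub>F2hat\<^esub> = \<one>\<^bsub>hat B4\<^esub>" if "\<phi> \<in> hom PB3 PB4" for \<phi>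
    by (rule completion_map_one[OF F2_group braid_group phi_F2_B4[OF that]])
  show ?thesis
  proof (rule braid_hat_eqI[OF braid_group P.T4(1) chom_id _ assms])
    fix i :: nat assume "1 \<le> i" "i < 4"
    hence "i = 1 \<or> i = 2 \<or> i = 3" by auto
    thus "P.T4 (eta B4 (sigma 4 i)) = eta B4 (sigma 4 i)"
      by (elim disjE) (simp_all add: P.T4 o phi_123 phi_12_3_4 dbl_one_zero P.B4.zhat_pow_one P.eta4 del: hat_one)
  qed
qed

lemma GT_carrier: "(m, f) \<in> carrier GT_monoid \<longleftrightarrow> gt_pair m f"
  by (simp add: GT_monoid_def gt_pair_def)

lemma GT_mult: "(m1, f1) \<otimes>\<^bsub>GT_monoid\<^esub> (m2, f2) = (gt_fst m1 m2, f1 \<otimes>\<^bsub>F2hat\<^esub> F2hat_endo (m1, f1) f2)"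
  by (simp add: GT_monoid_def gt_fst_def)

lemma GT_one: "\<one>\<^bsub>GT_monoid\<^esub> = (\<zero>\<^bsub>Zhat\<^esub>, \<one>\<^bsub>F2hat\<^esub>)"
  by (simp add: GT_monoid_def del: hat_one)

lemma GT_monoid: "Group.monoid GT_monoid"
proof (rule Group.monoidI)
  interpret F2h: group F2hat by (rule group.hat_group[OF F2_group])
  show "\<one>\<^bsub>GT_monoid\<^esub> \<in> carrier GT_monoid" unfolding GT_one GT_carrier by (rule gt_pair_one)
  fix S T assume ST: "S \<in> carrier GT_monoid" "T \<in> carrier GT_monoid"
  obtain m1 f1 m2 f2 where e: "S = (m1, f1)" "T = (m2, f2)" by (cases S; cases T)
  interpret ST: gt_two m1 f1 m2 f2 using ST unfolding e GT_carrier by (simp add: gt_two_def)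
  show "S \<otimes>\<^bsub>GT_monoid\<^esub> T \<in> carrier GT_monoid" unfolding e GT_mult GT_carrier by (rule ST.product)
  show "\<one>\<^bsub>GT_monoid\<^esub> \<otimes>\<^bsub>GT_monoid\<^esub> S = S" "S \<otimes>\<^bsub>GT_monoid\<^esub> \<one>\<^bsub>GT_monoid\<^esub> = S"
    unfolding GT_one e GT_mult
    by (simp_all add: gt_fst_zero ST.T.m ST.T.f E_one chom_one[OF F2_group F2_group ST.T.E(1)] del: hat_one)
  fix U assume U: "U \<in> carrier GT_monoid"
  obtain m3 f3 where u: "U = (m3, f3)" by (cases U)
  interpret U: gt_pair m3 f3 using U unfolding u GT_carrier .
  have c: "F2hat_endo (m2, f2) f3 \<in> carrier F2hat" by (rule chom_closed[OF ST.S.E(1) U.f])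
  have "F2hat_endo (ST.mm, ST.ff) f3 = F2hat_endo (m1, f1) (F2hat_endo (m2, f2) f3)"
    by (rule ST.E_product[OF U.f, symmetric])
  thus "S \<otimes>\<^bsub>GT_monoid\<^esub> T \<otimes>\<^bsub>GT_monoid\<^esub> U = S \<otimes>\<^bsub>GT_monoid\<^esub> (T \<otimes>\<^bsub>GT_monoid\<^esub> U)"
    unfolding e u GT_mult
    using c ST.g ST.T.f chom_closed[OF ST.T.E(1) c]
    by (simp add: gt_fst_assoc[OF ST.T.m ST.S.m U.m] chom_mult[OF ST.T.E(1) ST.S.f c] F2h.m_assoc)
qed

lemma GThat_group: "group GThat"
  unfolding GThat_def by (rule monoid.units_group[OF GT_monoid])

lemma GThat_ops [simp]: "(\<otimes>\<^bsub>GThat\<^esub>) = (\<otimes>\<^bsub>GT_monoid\<^esub>)" "\<one>\<^bsub>GThat\<^esub> = \<one>\<^bsub>GT_monoid\<^esub>"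
  by (simp_all add: GThat_def units_of_def)

lemma GThat_carrier_monoid: "T \<in> carrier GThat \<Longrightarrow> T \<in> carrier GT_monoid"
  by (simp add: GThat_def units_of_def Units_def)

lemma GThat_pair: "(m, f) \<in> carrier GThat \<Longrightarrow> gt_pair m f"
  using GThat_carrier_monoid GT_carrier by blast

lemma GThat_two: "(m1, f1) \<in> carrier GThat \<Longrightarrow> (m2, f2) \<in> carrier GThat \<Longrightarrow> gt_two m1 f1 m2 f2"
  by (simp add: gt_two_def GThat_pair)

text \<open>By \<open>E_product\<close>, the endomorphism attached to the inverse of
  \<open>T\<close> supplies the preimage.\<close>

lemma GThat_E_surj:
  assumes T: "T \<in> carrier GThat" and u: "u \<in> carrier F2hat"
  shows "\<exists>v\<in>carrier F2hat. F2hat_endo T v = u"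
proof -
  interpret G: group GThat by (rule GThat_group)
  obtain m1 f1 m2 f2 where e: "T = (m1, f1)" "inv\<^bsub>GThat\<^esub> T = (m2, f2)" by (cases T; cases "inv\<^bsub>GThat\<^esub> T")
  interpret P: gt_two m1 f1 m2 f2
  proof (rule GThat_two)
    show "(m1, f1) \<in> carrier GThat" using T e(1) by simp
    show "(m2, f2) \<in> carrier GThat" using G.inv_closed[OF T] unfolding e(2) .
  qed
  have "T \<otimes>\<^bsub>GThat\<^esub> (m2, f2) = \<one>\<^bsub>GThat\<^esub>" using G.r_inv[OF T] unfolding e(2) .
  hence "(m1, f1) \<otimes>\<^bsub>GT_monoid\<^esub> (m2, f2) = \<one>\<^bsub>GT_monoid\<^esub>" unfolding e(1) by simp
  hence "(P.mm, P.ff) = (\<zero>\<^bsub>Zhat\<^esub>, \<one>\<^bsub>F2hat\<^esub>)" unfolding GT_mult GT_one .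
  hence "F2hat_endo T (F2hat_endo (m2, f2) u) = u" using P.E_product[OF u] E_one[OF u] e by simp
  thus ?thesis using chom_closed[OF P.S.E(1) u] by blast
qed

section \<open>The action on \<open>NFI\<close>\<close>

lemma NFI_FIN: "N \<in> NFI \<Longrightarrow> N \<in> FIN B4" "N \<in> NFI \<Longrightarrow> N \<subseteq> carrier PB4"
  by (simp_all add: NFI_def)

abbreviation "five_phis \<equiv> {phi_123, phi_234, phi_12_3_4, phi_1_23_4, phi_1_2_34}"

lemma five_phis_hom: "\<phi> \<in> five_phis \<Longrightarrow> \<phi> \<in> hom PB3 PB4"
  using phi_123(1) phi_234(1) phi_12_3_4(1) phi_1_23_4(1) phi_1_2_34(1) by auto

lemma phi_PB3_B4: "\<phi> \<in> hom PB3 PB4 \<Longrightarrow> \<phi> \<in> hom PB3 B4"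
  by (rule hom_comp[OF _ pure_braid_inclusion])

lemma N_PB3_FIN:
  assumes "N \<in> NFI" shows "N_PB3 N \<in> FIN PB3"
proof -
  interpret P: group PB3 by (rule pure_braid_group)
  have f: "{g \<in> carrier PB3. \<phi> g \<in> N} \<in> FIN PB3" if "\<phi> \<in> hom PB3 PB4" for \<phi>
    by (rule FIN_preimage[OF pure_braid_group braid_group phi_PB3_B4[OF that] NFI_FIN(1)[OF assms]])
  show ?thesis unfolding N_PB3_def
    by (simp only: INT_insert INT_empty Int_UNIV_right)
      (intro P.FIN_Int f phi_123(1) phi_234(1) phi_12_3_4(1) phi_1_23_4(1) phi_1_2_34(1))
qed

lemma N_PB3_mem: "g \<in> N_PB3 N \<longleftrightarrow> g \<in> carrier PB3 \<and> (\<forall>\<phi>\<in>five_phis. \<phi> g \<in> N)"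
  by (auto simp: N_PB3_def)

lemma N_F2_FIN:
  assumes "N \<in> NFI" shows "{g \<in> carrier F2. g \<in> N_PB3 N} \<in> FIN F2"
  by (rule FIN_preimage[OF F2_group pure_braid_group F2_inclusion(1) N_PB3_FIN[OF assms]])

text \<open>The order of \<open>x\<close> modulo \<open>N_PB3 N\<close> divides
  \<open>N_ord N\<close>, and \<open>N_PB3 N\<close> lies in the preimage of \<open>N\<close> under
  each of the five homomorphisms.\<close>

lemma N_ord_props:
  assumes "N \<in> NFI"
  shows "N_ord N > 0" "\<phi> \<in> five_phis \<Longrightarrow> x \<in> {x12, x23} \<Longrightarrow> (N #>\<^bsub>B4\<^esub> \<phi> x) [^]\<^bsub>B4 Mod N\<^esub> N_ord N = \<one>\<^bsub>B4 Mod N\<^esub>"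
proof -
  let ?K = "N_PB3 N"
  let ?Q = "PB3 Mod ?K"
  have K: "?K \<in> FIN PB3" by (rule N_PB3_FIN[OF assms])
  interpret Q: group ?Q by (rule FIN_quotient_group[OF K])
  interpret P: group PB3 by (rule pure_braid_group)
  interpret R: group "B4 Mod N" by (rule FIN_quotient_group[OF NFI_FIN(1)[OF assms]])
  interpret B: group B4 by (rule braid_group)
  have c: "?K #>\<^bsub>PB3\<^esub> g \<in> carrier ?Q" if "g \<in> carrier PB3" for g using that by (simp add: carrier_FactGroup)
  have pos: "Q.ord (?K #>\<^bsub>PB3\<^esub> g) > 0" if "g \<in> carrier PB3" for g
    using Q.ord_ge_1[OF FIN_quotient_finite[OF K] c[OF that]] by simp
  show "N_ord N > 0" using pos PB3_gens_pure by (simp add: N_ord_def Let_def lcm_pos_nat)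
  assume \<phi>: "\<phi> \<in> five_phis" and x: "x \<in> {x12, x23}"
  have xc: "x \<in> carrier PB3" using x PB3_gens_pure by auto
  let ?r = "Q.ord (?K #>\<^bsub>PB3\<^esub> x)"
  have "?r dvd N_ord N" using x by (auto simp: N_ord_def Let_def)
  then obtain k where k: "N_ord N = ?r * k" ..
  have "?K #>\<^bsub>PB3\<^esub> (x [^]\<^bsub>PB3\<^esub> ?r) = ?K"
    using Q.pow_ord_eq_1[OF c[OF xc]] normal.FactGroup_pow[OF FIN_normal[OF K] xc, of ?r] by simp
  hence "x [^]\<^bsub>PB3\<^esub> ?r \<in> ?K" by (rule P.coset_join1[OF _ P.nat_pow_closed[OF xc] FIN_subgroup[OF K]])
  hence "\<phi> (x [^]\<^bsub>PB3\<^esub> ?r) \<in> N" using \<phi> unfolding N_PB3_mem by blast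
  moreover have ph: "\<phi> \<in> hom PB3 B4" by (rule phi_PB3_B4[OF five_phis_hom[OF \<phi>]])
  ultimately have n: "\<phi> x [^]\<^bsub>B4\<^esub> ?r \<in> N" using hom_nat_pow[OF ph xc P.is_group B.is_group] by simp
  have pc: "\<phi> x \<in> carrier B4" by (rule hom_in_carrier[OF ph xc])
  have "(N #>\<^bsub>B4\<^esub> \<phi> x) [^]\<^bsub>B4 Mod N\<^esub> ?r = \<one>\<^bsub>B4 Mod N\<^esub>"
    using normal.FactGroup_pow[OF FIN_normal[OF NFI_FIN(1)[OF assms]] pc, of ?r]
      B.coset_join2[OF B.nat_pow_closed[OF pc] FIN_subgroup[OF NFI_FIN(1)[OF assms]] n] by simp
  moreover have "N #>\<^bsub>B4\<^esub> \<phi> x \<in> carrier (B4 Mod N)" using pc by (simp add: carrier_FactGroup)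
  ultimately show "(N #>\<^bsub>B4\<^esub> \<phi> x) [^]\<^bsub>B4 Mod N\<^esub> N_ord N = \<one>\<^bsub>B4 Mod N\<^esub>"
    unfolding k by (metis R.nat_pow_pow R.nat_pow_one)
qed

lemma (in group) hat_conj_coord:
  assumes "K \<in> FIN G" "p \<in> carrier (hat G)" "z \<in> carrier (hat G)" "a \<in> carrier G" "b \<in> carrier G"
    "p K = K #> a" "z K = K #> b"
  shows "(inv\<^bsub>hat G\<^esub> p \<otimes>\<^bsub>hat G\<^esub> z \<otimes>\<^bsub>hat G\<^esub> p) K = K #> (inv a \<otimes> b \<otimes> a)"
proof -
  interpret h: group "hat G" by (rule hat_group)
  interpret Q: group "G Mod K" by (rule FIN_quotient_group[OF assms(1)])
  interpret c: group_hom "hat G" "G Mod K" "\<lambda>u. u K"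
    using hat_coord_hom[OF assms(1)] by unfold_locales
  interpret q: group_hom G "G Mod K" "\<lambda>g. K #> g"
    using FIN_quotient_hom[OF assms(1)] by unfold_locales
  have "(inv\<^bsub>hat G\<^esub> p \<otimes>\<^bsub>hat G\<^esub> z \<otimes>\<^bsub>hat G\<^esub> p) K = inv\<^bsub>G Mod K\<^esub> (p K) \<otimes>\<^bsub>G Mod K\<^esub> z K \<otimes>\<^bsub>G Mod K\<^esub> p K"
    by (simp only: c.hom_mult c.hom_inv assms h.inv_closed h.m_closed)
  also have "\<dots> = K #> (inv a \<otimes> b \<otimes> a)"
    unfolding assms(6,7) by (simp only: q.hom_mult q.hom_inv assms inv_closed m_closed)
  finally show ?thesis .
qed

section \<open>Approximation of a profinite pair modulo \<open>N\<close>\<close>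

context gt_pair
begin

lemma approx_exists:
  assumes "N \<in> NFI" shows "\<exists>p. approximates N (m, f) p"
proof -
  let ?L = "{g \<in> carrier F2. g \<in> N_PB3 N}"
  obtain f0 where f0: "f0 \<in> carrier F2" "f ?L = ?L #>\<^bsub>F2\<^esub> f0" using hat_rep[OF f N_F2_FIN[OF assms]] .
  have "completion_map F2 PB3 (\<lambda>g. g) f (N_PB3 N) = N_PB3 N #>\<^bsub>PB3\<^esub> f0"
    by (rule F2.completion_map_coord[where u = f and \<phi> = "\<lambda>g. g", OF pure_braid_group F2_inclusion(1) N_PB3_FIN[OF assms] f0])
  moreover have "m (N_ord N) mod int (N_ord N) = m (N_ord N)"
    by (rule Zhat_range[OF m N_ord_props(1)[OF assms]])
  ultimately have "approximates N (m, f) (m (N_ord N), f0)" using f0(1) by (simp add: approximates_def)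
  thus ?thesis by blast
qed

text \<open>Agreement of \<open>f\<close> and \<open>f0\<close> modulo \<open>N_PB3 N\<close>
  descends to \<open>F2\<close>, since both representatives lie in \<open>F2\<close>. The resulting
  subgroup of \<open>F2\<close> is contained in the preimage of \<open>N\<close> under each
  \<open>\<phi>\<close>.\<close>

lemma approx_phi:
  assumes N: "N \<in> NFI" and a: "approximates N (m, f) (m0, f0)" and \<phi>: "\<phi> \<in> five_phis"
  shows "F2_B4 \<phi> f N = N #>\<^bsub>B4\<^esub> \<phi> f0"
proof -
  let ?K = "N_PB3 N" and ?L = "{g \<in> carrier F2. g \<in> N_PB3 N}" and ?M = "{g \<in> carrier F2. \<phi> g \<in> N}"
  have f0: "f0 \<in> carrier F2" "?K #>\<^bsub>PB3\<^esub> f0 = completion_map F2 PB3 (\<lambda>g. g) f ?K"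
    using a by (simp_all add: approximates_def)
  interpret P: group PB3 by (rule pure_braid_group)
  have L: "?L \<in> FIN F2" by (rule N_F2_FIN[OF N])
  obtain g where g: "g \<in> carrier F2" "f ?L = ?L #>\<^bsub>F2\<^esub> g" using hat_rep[OF f L] .
  have gp: "g \<in> carrier PB3" "f0 \<in> carrier PB3" using F2_PB3 g f0 by simp_all
  have K: "subgroup ?K PB3" by (rule FIN_subgroup[OF N_PB3_FIN[OF N]])
  have "?K #>\<^bsub>PB3\<^esub> g = ?K #>\<^bsub>PB3\<^esub> f0"
    unfolding f0(2) by (rule F2.completion_map_coord[where u = f and \<phi> = "\<lambda>g. g", OF pure_braid_group F2_inclusion(1) N_PB3_FIN[OF N] g, symmetric])
  hence "f0 \<otimes>\<^bsub>PB3\<^esub> inv\<^bsub>PB3\<^esub> g \<in> ?K"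
    using P.coset_eq_iff[OF K gp] P.coset_mem_iff[OF K gp] by simp
  moreover have "inv\<^bsub>PB3\<^esub> g = inv\<^bsub>F2\<^esub> g" using F2_inv[OF g(1)] pure_braid_inv[OF gp(1)] by simp
  ultimately have "f0 \<otimes>\<^bsub>F2\<^esub> inv\<^bsub>F2\<^esub> g \<in> ?L" using f0(1) g(1) F2.m_closed[of f0 "inv\<^bsub>F2\<^esub> g"] by simp
  hence "?L #>\<^bsub>F2\<^esub> g = ?L #>\<^bsub>F2\<^esub> f0"
    using F2.coset_eq_iff[OF FIN_subgroup[OF L] g(1) f0(1)] F2.coset_mem_iff[OF FIN_subgroup[OF L] g(1) f0(1)] by blast
  hence fL: "f ?L = ?L #>\<^bsub>F2\<^esub> f0" using g(2) by simp
  have ph: "\<phi> \<in> hom F2 B4" by (rule phi_F2_B4[OF five_phis_hom[OF \<phi>]])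
  have M: "?M \<in> FIN F2" by (rule FIN_preimage[OF F2_group braid_group ph NFI_FIN(1)[OF N]])
  have "?L \<subseteq> ?M" using \<phi> unfolding N_PB3_mem by blast
  hence "f ?M = ?M #>\<^bsub>F2\<^esub> f0" by (rule F2.hat_coarsen[OF f L M _ f0(1) fL])
  thus ?thesis by (rule F2.completion_map_coord[where u = f and \<phi> = \<phi>, OF braid_group ph NFI_FIN(1)[OF N] f0(1)])
qed

text \<open>The order of \<open>s\<close> modulo \<open>N\<close> need not divide
  \<open>N_ord N\<close>, but that of \<open>s^2\<close>, which is an image \<open>\<phi> x\<close>,
  does. Writing \<open>s^(2m+1)\<close> as \<open>(s^2)^m s\<close> makes \<open>m\<close> matter
  only modulo \<open>N_ord N\<close>.\<close>

lemma approx_pow: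
  assumes N: "N \<in> NFI" and a: "approximates N (m, f) (m0, f0)" and s: "s \<in> carrier B4"
    and \<phi>: "\<phi> \<in> five_phis" "x \<in> {x12, x23}" "\<phi> x = s \<otimes>\<^bsub>B4\<^esub> s"
  shows "pw (eta B4 s) N = N #>\<^bsub>B4\<^esub> (s [^]\<^bsub>B4\<^esub> (2 * m0 + 1))"
proof -
  note FN = NFI_FIN(1)[OF N]
  interpret Q: group "B4 Mod N" by (rule FIN_quotient_group[OF FN])
  let ?q = "N #>\<^bsub>B4\<^esub> s" and ?y = "N #>\<^bsub>B4\<^esub> (s \<otimes>\<^bsub>B4\<^esub> s)"
  \<comment> \<open>A modulus divisible by the order of the quotient, to evaluate the profinite
    power, and by \<open>N_ord N\<close>, to compare \<open>m\<close> with
    \<open>m0\<close>.\<close>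
  let ?M = "order (B4 Mod N) * N_ord N"
  have q: "?q \<in> carrier (B4 Mod N)" "?y \<in> carrier (B4 Mod N)" using s by (simp_all add: carrier_FactGroup)
  have M: "?M > 0" using FIN_order_pos[OF FN] N_ord_props(1)[OF N] by simp
  have y: "?y [^]\<^bsub>B4 Mod N\<^esub> N_ord N = \<one>\<^bsub>B4 Mod N\<^esub>" using N_ord_props(2)[OF N \<phi>(1,2)] \<phi>(3) by simp
  have "int (N_ord N) dvd m0 - m ?M"
  proof -
    have "m ?M mod int (N_ord N) = m (N_ord N)" using Zhat_dvd[OF m M N_ord_props(1)[OF N]] by simp
    also have "\<dots> = m0 mod int (N_ord N)" using a by (simp add: approximates_def)
    finally show ?thesis by (metis mod_eq_dvd_iff)
  qed
  moreover have "int (Q.ord ?y) dvd int (N_ord N)" using y Q.pow_eq_id[OF q(2)] by simp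
  ultimately have e: "?y [^]\<^bsub>B4 Mod N\<^esub> m ?M = ?y [^]\<^bsub>B4 Mod N\<^esub> m0"
    using Q.int_pow_eq[OF q(2)] by (meson dvd_trans)
  have yq: "?y = ?q \<otimes>\<^bsub>B4 Mod N\<^esub> ?q" using FIN_coset_mult[OF FN s s] by simp
  have yk: "?y [^]\<^bsub>B4 Mod N\<^esub> k \<otimes>\<^bsub>B4 Mod N\<^esub> ?q = ?q [^]\<^bsub>B4 Mod N\<^esub> (2 * k + 1)" for k :: int
  proof -
    have "?y [^]\<^bsub>B4 Mod N\<^esub> k = ?q [^]\<^bsub>B4 Mod N\<^esub> (2 * k)"
      unfolding yq mult_2 using Q.int_pow_mult_distrib[OF HOL.refl q(1,1), of k] Q.int_pow_mult[OF q(1), of k k] by simp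
    thus ?thesis using Q.int_pow_mult[OF q(1), of "2 * k" 1] q(1) by simp
  qed
  have "pw (eta B4 s) N = (eta B4 s [^]\<^bsub>hat B4\<^esub> lam ?M) N"
    by (rule zhat_pow_coord[OF braid_group B4.eta_closed[OF s] lam FN M]) simp
  also have "\<dots> = ?q [^]\<^bsub>B4 Mod N\<^esub> lam ?M"
    using hat_int_pow_coord[OF braid_group B4.eta_closed[OF s] FN] by (simp add: eta_coord[OF FN])
  also have "lam ?M = (2 * m ?M + 1) mod int ?M" by (rule dbl_one_coord[OF M])
  also have "?q [^]\<^bsub>B4 Mod N\<^esub> ((2 * m ?M + 1) mod int ?M) = ?q [^]\<^bsub>B4 Mod N\<^esub> (2 * m ?M + 1)"
    by (rule Q.int_pow_mod_order[OF q(1)]) simp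
  also have "\<dots> = ?q [^]\<^bsub>B4 Mod N\<^esub> (2 * m0 + 1)" unfolding yk[symmetric] e ..
  also have "\<dots> = N #>\<^bsub>B4\<^esub> (s [^]\<^bsub>B4\<^esub> (2 * m0 + 1))"
    by (rule normal.FactGroup_int_pow[OF FIN_normal[OF FN] s])
  finally show ?thesis .
qed

text \<open>Reducing \<open>T4\<close> modulo \<open>N\<close> gives a homomorphism with the
  prescribed values. This settles its existence and at the same time its independence of the
  approximation \<open>p\<close>.\<close>

lemma B4_hom_eq:
  assumes N: "N \<in> NFI" and a: "approximates N (m, f) p" and g: "g \<in> carrier B4"
  shows "B4_hom N p g = T4 (eta B4 g) N"
proof -
  obtain m0 f0 where p: "p = (m0, f0)" by (cases p)
  note a = a[unfolded p] and FN = NFI_FIN(1)[OF N]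
  have f0: "f0 \<in> carrier F2" using a by (simp add: approximates_def)
  have ph: "phi_123 f0 \<in> carrier B4" "phi_12_3_4 f0 \<in> carrier B4"
    using hom_in_carrier[OF phi_F2_B4[OF phi_123(1)] f0] hom_in_carrier[OF phi_F2_B4[OF phi_12_3_4(1)] f0] by simp_all
  note k = approx_pow[OF N a B4_sigmas(1), of phi_123 x12] approx_pow[OF N a B4_sigmas(2), of phi_123 x23]
    approx_pow[OF N a B4_sigmas(3), of phi_234 x23]
  have sp: "s1 [^]\<^bsub>B4\<^esub> (2 * m0 + 1) \<in> carrier B4" "s2 [^]\<^bsub>B4\<^esub> (2 * m0 + 1) \<in> carrier B4" "s3 [^]\<^bsub>B4\<^esub> (2 * m0 + 1) \<in> carrier B4"
    using B4_sigmas(1-3) by simp_all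
  let ?V = "{(s1, N #>\<^bsub>B4\<^esub> (s1 [^]\<^bsub>B4\<^esub> (2 * m0 + 1))),
        (s2, N #>\<^bsub>B4\<^esub> (inv\<^bsub>B4\<^esub> phi_123 f0 \<otimes>\<^bsub>B4\<^esub> (s2 [^]\<^bsub>B4\<^esub> (2 * m0 + 1)) \<otimes>\<^bsub>B4\<^esub> phi_123 f0)),
        (s3, N #>\<^bsub>B4\<^esub> (inv\<^bsub>B4\<^esub> phi_12_3_4 f0 \<otimes>\<^bsub>B4\<^esub> (s3 [^]\<^bsub>B4\<^esub> (2 * m0 + 1)) \<otimes>\<^bsub>B4\<^esub> phi_12_3_4 f0))}"
  have v1: "T4 (eta B4 s1) N = N #>\<^bsub>B4\<^esub> (s1 [^]\<^bsub>B4\<^esub> (2 * m0 + 1))"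
    unfolding T4 by (rule k(1)) (simp_all add: phi_123)
  have v2: "T4 (eta B4 s2) N = N #>\<^bsub>B4\<^esub> (inv\<^bsub>B4\<^esub> phi_123 f0 \<otimes>\<^bsub>B4\<^esub> (s2 [^]\<^bsub>B4\<^esub> (2 * m0 + 1)) \<otimes>\<^bsub>B4\<^esub> phi_123 f0)"
    unfolding T4
    by (rule B4.hat_conj_coord[OF FN p_closed(1) pw_closed[OF eta4(2)] ph(1) sp(2) approx_phi[OF N a] k(2)]) (simp_all add: phi_123)
  have v3: "T4 (eta B4 s3) N = N #>\<^bsub>B4\<^esub> (inv\<^bsub>B4\<^esub> phi_12_3_4 f0 \<otimes>\<^bsub>B4\<^esub> (s3 [^]\<^bsub>B4\<^esub> (2 * m0 + 1)) \<otimes>\<^bsub>B4\<^esub> phi_12_3_4 f0)"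
    unfolding T4
    by (rule B4.hat_conj_coord[OF FN p_closed(3) pw_closed[OF eta4(3)] ph(2) sp(3) approx_phi[OF N a] k(3)]) (simp_all add: phi_234)
  have h: "(\<lambda>g. T4 (eta B4 g) N) \<in> hom B4 (B4 Mod N)"
    by (rule hom_comp[OF B4.eta_hom hom_comp[OF chom_hom[OF T4(1)] hat_coord_hom[OF FN]]])
  have fV: "fst ` ?V = sigma 4 ` {1..<4}"
  proof -
    have "{1..<4} = {1, 2, 3::nat}" by auto
    thus ?thesis by simp
  qed
  have "B4_hom N p = restrict (\<lambda>g. T4 (eta B4 g) N) (carrier B4)"
    unfolding B4_hom_def p prod.case
  proof (rule hom_with_values_eq[OF braid_group FIN_quotient_group[OF FN] h])
    show "T4 (eta B4 s) N = v" if "(s, v) \<in> ?V" for s v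
      using that v1 v2 v3 unfolding insert_iff prod.inject empty_iff by (elim disjE conjE FalseE) simp_all
    show "fst ` ?V \<subseteq> carrier B4" unfolding fV by (rule image_subsetI) (simp add: sigma_closed)
    show "generate B4 (fst ` ?V) = carrier B4" unfolding fV by (rule braid_generated)
  qed
  thus ?thesis using g by simp
qed

lemma NFI_act_eq:
  assumes N: "N \<in> NFI"
  shows "NFI_act N (m, f) = {g \<in> carrier PB4. T4 (eta B4 g) N = N}"
proof -
  have "approximates N (m, f) (SOME p. approximates N (m, f) p)" by (rule someI_ex[OF approx_exists[OF N]])
  note e = B4_hom_eq[OF N this]
  \<comment> \<open>The unit of \<open>PB4 Mod N\<close> is the set \<open>N\<close>, the same as
    that of \<open>B4 Mod N\<close>, so the kernel is described by equality with
    \<open>N\<close>.\<close>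
  have "x \<in> NFI_act N (m, f) \<longleftrightarrow> x \<in> {g \<in> carrier PB4. T4 (eta B4 g) N = N}" for x
    using e[of x] PB_B[of x 4] unfolding NFI_act_def kernel_def one_FactGroup by auto
  thus ?thesis by blast
qed

lemma NFI_act_NFI:
  assumes N: "N \<in> NFI" shows "NFI_act N (m, f) \<in> NFI"
proof -
  have "{g \<in> carrier B4. T4 (eta B4 g) N = N} \<in> FIN B4"
    by (rule B4.chom_coord_factor(1)[OF braid_group T4(1) NFI_FIN(1)[OF N]])
  from B4.FIN_Int[OF pure_braid_FIN this]
  have "carrier PB4 \<inter> {g \<in> carrier B4. T4 (eta B4 g) N = N} \<in> FIN B4" .
  moreover have "carrier PB4 \<inter> {g \<in> carrier B4. T4 (eta B4 g) N = N} = NFI_act N (m, f)"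
    unfolding NFI_act_eq[OF N] using PB_B by auto
  ultimately show ?thesis unfolding NFI_def using NFI_act_eq[OF N] by auto
qed

lemma zhat_pow_trivial_coord:
  assumes "K \<in> FIN B4" "u K = K" shows "zhat_pow B4 u a K = K"
  using assms group.int_pow_one[OF FIN_quotient_group[OF assms(1)], of "a (order (B4 Mod K))"]
  by (simp add: zhat_pow_def)

text \<open>Modulo \<open>PB4\<close> the conjugators are trivial, coming from pure braids, and
  \<open>\<sigma>^(2m+1)\<close> is \<open>\<sigma>\<close> because \<open>\<sigma>^2\<close> is
  pure. As \<open>N^T\<close> is cut out inside \<open>PB4\<close>, iterating the action requires
  that permutations be preserved.\<close>

lemma T4_perm:
  assumes u: "u \<in> carrier (hat B4)" shows "T4 u (carrier PB4) = u (carrier PB4)"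
proof -
  let ?K = "carrier PB4"
  have K: "?K \<in> FIN B4" by (rule pure_braid_FIN)
  interpret Q: group "B4 Mod ?K" by (rule FIN_quotient_group[OF K])
  have KP: "?K #>\<^bsub>B4\<^esub> g = ?K" if "g \<in> carrier PB4" for g
    by (rule B4.coset_join2[OF PB_B[OF that] pure_braid_subgroup that])
  have pK: "F2_B4 \<phi> f ?K = ?K #>\<^bsub>B4\<^esub> \<one>\<^bsub>B4\<^esub>" if \<phi>: "\<phi> \<in> hom PB3 PB4" for \<phi>
  proof -
    note ph = phi_F2_B4[OF \<phi>]
    obtain g where g: "g \<in> carrier F2" "f {g \<in> carrier F2. \<phi> g \<in> ?K} = {g \<in> carrier F2. \<phi> g \<in> ?K} #>\<^bsub>F2\<^esub> g"
      using hat_rep[OF f FIN_preimage[OF F2_group braid_group ph K]] .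
    have "F2_B4 \<phi> f ?K = ?K #>\<^bsub>B4\<^esub> \<phi> g" by (rule F2.completion_map_coord[where u = f and \<phi> = \<phi>, OF braid_group ph K g])
    also have "\<dots> = ?K" by (rule KP[OF hom_in_carrier[OF \<phi> F2_PB3[OF g(1)]]])
    finally show ?thesis using B4.coset_mult_one[OF FIN_subset[OF K]] by simp
  qed
  have pwK: "pw (eta B4 s) ?K = ?K #>\<^bsub>B4\<^esub> s" if s: "s \<in> carrier B4" "s \<otimes>\<^bsub>B4\<^esub> s \<in> carrier PB4" for s
  proof -
    have "eta B4 (s \<otimes>\<^bsub>B4\<^esub> s) ?K = ?K" using KP[OF s(2)] by (simp add: eta_coord[OF K])
    hence z: "zhat_pow B4 (eta B4 s \<otimes>\<^bsub>hat B4\<^esub> eta B4 s) m ?K = ?K #>\<^bsub>B4\<^esub> \<one>\<^bsub>B4\<^esub>"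
      using zhat_pow_trivial_coord[OF K] eta4_sq[OF s(1)] B4.coset_mult_one[OF FIN_subset[OF K]] by simp
    have "pw (eta B4 s) ?K = eta B4 s ?K <#>\<^bsub>B4\<^esub> zhat_pow B4 (eta B4 s \<otimes>\<^bsub>hat B4\<^esub> eta B4 s) m ?K"
      unfolding B4.zhat_pow_dbl_one[OF B4.eta_closed[OF s(1)] m] using K by (simp add: hat_mult[where G = B4])
    also have "\<dots> = ?K #>\<^bsub>B4\<^esub> s"
      unfolding z eta_coord[OF K] FIN_coset_mult[OF K s(1) B4.one_closed] using s by simp
    finally show ?thesis .
  qed
  have sq: "s1 \<otimes>\<^bsub>B4\<^esub> s1 \<in> carrier PB4" "s2 \<otimes>\<^bsub>B4\<^esub> s2 \<in> carrier PB4" "s3 \<otimes>\<^bsub>B4\<^esub> s3 \<in> carrier PB4"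
    unfolding B4_pure_gens(1-3)[symmetric] by (simp_all add: PB4_gens_pure)
  note p = pwK[OF B4_sigmas(1) sq(1)] pwK[OF B4_sigmas(2) sq(2)] pwK[OF B4_sigmas(3) sq(3)]
  have v1: "T4 (eta B4 s1) ?K = eta B4 s1 ?K" unfolding T4 p eta_coord[OF K] ..
  have v2: "T4 (eta B4 s2) ?K = eta B4 s2 ?K"
    unfolding T4 eta_coord[OF K]
    using B4.hat_conj_coord[OF K p_closed(1) pw_closed[OF eta4(2)] B4.one_closed B4_sigmas(2) pK[OF phi_123(1)] p(2)] B4_sigmas(2) by simp
  have v3: "T4 (eta B4 s3) ?K = eta B4 s3 ?K"
    unfolding T4 eta_coord[OF K]
    using B4.hat_conj_coord[OF K p_closed(3) pw_closed[OF eta4(3)] B4.one_closed B4_sigmas(3) pK[OF phi_12_3_4(1)] p(3)] B4_sigmas(3) by simp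
  have h: "(\<lambda>g. T4 (eta B4 g) ?K) \<in> hom B4 (B4 Mod ?K)" "(\<lambda>g. eta B4 g ?K) \<in> hom B4 (B4 Mod ?K)"
    by (rule hom_comp[OF B4.eta_hom hom_comp[OF chom_hom[OF T4(1)] hat_coord_hom[OF K]]],
        rule hom_comp[OF B4.eta_hom hat_coord_hom[OF K]])
  show ?thesis
  proof (rule B4.locconst_eqI[OF chom_locconst[OF T4(1) K] locconst_coord[OF K] u])
    fix g assume g: "g \<in> carrier B4"
    show "T4 (eta B4 g) ?K = eta B4 g ?K"
    proof (rule hom_eq_on_generate[OF braid_group Q.is_group h, of "sigma 4 ` {1..<4}"])
      show "sigma 4 ` {1..<4} \<subseteq> carrier B4" by (rule image_subsetI) (simp add: sigma_closed)
      show "g \<in> generate B4 (sigma 4 ` {1..<4})" using g braid_generated by simp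
      fix s assume "s \<in> sigma 4 ` {1..<4}"
      then obtain i :: nat where i: "1 \<le> i" "i < 4" "s = sigma 4 i" by auto
      hence "i = 1 \<or> i = 2 \<or> i = 3" by auto
      thus "T4 (eta B4 s) ?K = eta B4 s ?K" using v1 v2 v3 i(3) by (elim disjE) simp_all
    qed
  qed
qed

end

section \<open>The laws of a right action\<close>

lemma NFI_act_one:
  assumes N: "N \<in> NFI" shows "NFI_act N \<one>\<^bsub>GThat\<^esub> = N"
proof -
  interpret P: gt_pair "\<zero>\<^bsub>Zhat\<^esub>" "\<one>\<^bsub>F2hat\<^esub>" by (rule gt_pair_one)
  have "g \<in> NFI_act N \<one>\<^bsub>GThat\<^esub> \<longleftrightarrow> g \<in> N" for g
  proof -
    have "g \<in> NFI_act N \<one>\<^bsub>GThat\<^esub> \<longleftrightarrow> g \<in> carrier PB4 \<and> eta B4 g N = N"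
      unfolding GThat_ops GT_one P.NFI_act_eq[OF N] using T4_one[OF P.B4.eta_closed[OF PB_B]] by auto
    also have "\<dots> \<longleftrightarrow> g \<in> carrier PB4 \<and> g \<in> N"
      unfolding eta_coord[OF NFI_FIN(1)[OF N]]
      using P.B4.coset_join1[OF _ PB_B FIN_subgroup[OF NFI_FIN(1)[OF N]]]
        P.B4.coset_join2[OF PB_B FIN_subgroup[OF NFI_FIN(1)[OF N]]] by blast
    also have "\<dots> \<longleftrightarrow> g \<in> N" using NFI_FIN(2)[OF N] by blast
    finally show ?thesis .
  qed
  thus ?thesis by blast
qed

context gt_two
begin

lemma NFI_act_product:
  assumes N: "N \<in> NFI"
  shows "NFI_act N (mm, ff) = NFI_act (NFI_act N (m1, f1)) (m2, f2)"
proof -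
  interpret P: gt_pair mm ff by (rule product)
  let ?N = "NFI_act N (m1, f1)"
  note FN = NFI_FIN(1)[OF N]
  have N': "?N \<in> NFI" by (rule T.NFI_act_NFI[OF N])
  note FN' = NFI_FIN(1)[OF N']
  have mem: "g \<in> ?N \<longleftrightarrow> g \<in> carrier PB4 \<and> T.T4 (eta B4 g) N = N" for g unfolding T.NFI_act_eq[OF N] by simp
  have h: "(\<lambda>u. T.T4 u N) \<in> hom (hat B4) (B4 Mod N)"
    by (rule hom_comp[OF chom_hom[OF T.T4(1)] hat_coord_hom[OF FN]])
  \<comment> \<open>A profinite \<open>u\<close> is replaced by a representative \<open>g\<close>
    modulo \<open>N^T\<close>. The hypothesis on the coordinate at \<open>PB4\<close> forces
    \<open>g\<close> to be pure, so that its membership in \<open>N^T\<close> is decided by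
    \<open>T.T4\<close> alone.\<close>
  have key: "T.T4 u N = N \<longleftrightarrow> u ?N = ?N" if u: "u \<in> carrier (hat B4)" "u (carrier PB4) = carrier PB4" for u
  proof -
    obtain g where g: "g \<in> carrier B4" "u ?N = ?N #>\<^bsub>B4\<^esub> g" using hat_rep[OF u(1) FN'] .
    have "u (carrier PB4) = carrier PB4 #>\<^bsub>B4\<^esub> g"
      by (rule T.B4.hat_coarsen[OF u(1) FN' pure_braid_FIN NFI_FIN(2)[OF N'] g])
    hence gp: "g \<in> carrier PB4" using u(2) T.B4.coset_join1[OF _ g(1) pure_braid_subgroup] by simp
    have "T.T4 u N = T.T4 (eta B4 g) N"
      by (rule T.B4.locconst_factor[OF FIN_quotient_group[OF FN] h chom_locconst[OF T.T4(1) FN] FN' _ u(1) g])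
        (simp add: mem)
    hence "T.T4 u N = N \<longleftrightarrow> g \<in> ?N" using mem gp by simp
    also have "\<dots> \<longleftrightarrow> u ?N = ?N"
      unfolding g(2) using T.B4.coset_join1[OF _ g(1) FIN_subgroup[OF FN']] T.B4.coset_join2[OF g(1) FIN_subgroup[OF FN']] by blast
    finally show ?thesis .
  qed
  have "g \<in> NFI_act N (mm, ff) \<longleftrightarrow> g \<in> NFI_act ?N (m2, f2)" for g
  proof (cases "g \<in> carrier PB4")
    case True
    have e: "eta B4 g \<in> carrier (hat B4)" by (rule T.B4.eta_closed[OF PB_B[OF True]])
    have u: "S.T4 (eta B4 g) \<in> carrier (hat B4)" by (rule chom_closed[OF S.T4(1) e])
    have "S.T4 (eta B4 g) (carrier PB4) = carrier PB4"
      unfolding S.T4_perm[OF e] eta_coord[OF pure_braid_FIN]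
      by (rule T.B4.coset_join2[OF PB_B[OF True] pure_braid_subgroup True])
    \<comment> \<open>Here \<open>u\<close> is the image of \<open>g\<close> under the second pair,
      and \<open>T.T4\<close> after \<open>S.T4\<close> is the endomorphism of the product.\<close>
    from key[OF u this] show ?thesis
      unfolding P.NFI_act_eq[OF N] S.NFI_act_eq[OF N'] T4_product[OF e, symmetric] using True T4_product[OF e] by simp
  next
    case False thus ?thesis unfolding P.NFI_act_eq[OF N] S.NFI_act_eq[OF N'] by simp
  qed
  thus ?thesis by blast
qed

end

section \<open>Child's drawings\<close>

lemma sym_group_finite: "finite (carrier (sym_group d))"
  by (simp add: sym_group_def finite_permutations)

lemma sym_hom_finite: "\<psi> \<in> hom F2 (sym_group d) \<Longrightarrow> finite (\<psi> ` carrier F2)"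
  by (rule finite_subset[OF _ sym_group_finite[of d]]) (auto simp: hom_in_carrier)

text \<open>Extension by continuity provides the object described by \<open>continuous_ext\<close>,
  and density of \<open>F2\<close> its uniqueness.\<close>

lemma continuous_ext:
  assumes "\<psi> \<in> hom F2 (sym_group d)"
  shows "continuous_ext d \<psi> \<in> hom F2hat (sym_group d)" "locconst F2 (continuous_ext d \<psi>)"
    "g \<in> carrier F2 \<Longrightarrow> continuous_ext d \<psi> (eta F2 g) = \<psi> g"
proof -
  interpret F: group F2 by (rule F2_group)
  define k where "k = restrict (lim_ext F2 (sym_group d) \<psi>) (carrier F2hat)"
  note l = F.lim_ext_props[OF sym_group_is_group assms sym_hom_finite[OF assms]]
  have k1: "k \<in> hom F2hat (sym_group d)"
    using l(1) F.hat_mult_closed by (simp add: k_def hom_def Pi_iff)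
  have k2: "locconst F2 k" using l(2) by (simp add: k_def locconst_def)
  have k3: "k (eta F2 g) = \<psi> g" if "g \<in> carrier F2" for g
    using l(3)[OF that] F.eta_closed[OF that] by (simp add: k_def)
  have "continuous_ext d \<psi> = k"
    unfolding continuous_ext_def
  proof (rule the_equality)
    show "k \<in> hom F2hat (sym_group d) \<and> k \<in> extensional (carrier F2hat) \<and>
      continuous_map (profinite_topology F2) (discrete_topology (carrier (sym_group d))) k \<and> (\<forall>g\<in>carrier F2. k (eta F2 g) = \<psi> g)"
    proof (intro conjI ballI)
      show "k \<in> hom F2hat (sym_group d)" by (rule k1)
      show "k \<in> extensional (carrier F2hat)" by (simp add: k_def)
      show "continuous_map (profinite_topology F2) (discrete_topology (carrier (sym_group d))) k"
        by (rule locconst_continuous[OF k2 hom_in_carrier[OF k1]])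
      show "k (eta F2 g) = \<psi> g" if "g \<in> carrier F2" for g by (rule k3[OF that])
    qed
    fix h assume h: "h \<in> hom F2hat (sym_group d) \<and> h \<in> extensional (carrier F2hat) \<and>
      continuous_map (profinite_topology F2) (discrete_topology (carrier (sym_group d))) h \<and> (\<forall>g\<in>carrier F2. h (eta F2 g) = \<psi> g)"
    have "locconst F2 h" using h F.continuous_locconst by blast
    show "h = k"
    proof (rule extensionalityI[of h "carrier F2hat"])
      show "h u = k u" if "u \<in> carrier F2hat" for u
        by (rule F.locconst_eqI[OF \<open>locconst F2 h\<close> k2 that]) (use h k3 in simp)
    qed (use h in \<open>simp_all add: k_def\<close>)
  qed
  thus "continuous_ext d \<psi> \<in> hom F2hat (sym_group d)" "locconst F2 (continuous_ext d \<psi>)"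
    "g \<in> carrier F2 \<Longrightarrow> continuous_ext d \<psi> (eta F2 g) = \<psi> g"
    using k1 k2 k3 by simp_all
qed

lemma continuous_ext_unique:
  assumes "\<psi> \<in> hom F2 (sym_group d)" "locconst F2 h" "\<And>g. g \<in> carrier F2 \<Longrightarrow> h (eta F2 g) = \<psi> g" "u \<in> carrier F2hat"
  shows "continuous_ext d \<psi> u = h u"
  by (rule group.locconst_eqI[OF F2_group continuous_ext(2)[OF assms(1)] assms(2,4)])
    (simp add: continuous_ext(3)[OF assms(1)] assms(3))

context gt_pair
begin

text \<open>The second claim returns from the restriction to \<open>F2\<close> to the whole
  completion, which is what allows two twists to be composed.\<close>

lemma twisted_hom:
  assumes "\<psi> \<in> hom F2 (sym_group d)"
  shows "twisted_hom (m, f) d \<psi> \<in> hom F2 (sym_group d)"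
    "u \<in> carrier F2hat \<Longrightarrow> continuous_ext d (twisted_hom (m, f) d \<psi>) u = continuous_ext d \<psi> (E u)"
proof -
  have h: "(\<lambda>g. continuous_ext d \<psi> (E (eta F2 g))) \<in> hom F2 (sym_group d)"
    by (rule hom_comp[OF F2.eta_hom hom_comp[OF chom_hom[OF E(1)] continuous_ext(1)[OF assms]]])
  have "restrict (\<lambda>g. continuous_ext d \<psi> (E (eta F2 g))) (carrier F2) \<in> hom F2 (sym_group d)"
    using h F2.m_closed by (simp add: hom_def Pi_iff)
  thus t: "twisted_hom (m, f) d \<psi> \<in> hom F2 (sym_group d)" unfolding twisted_hom_def .
  show "continuous_ext d (twisted_hom (m, f) d \<psi>) u = continuous_ext d \<psi> (E u)" if "u \<in> carrier F2hat"
    by (rule continuous_ext_unique[OF t chom_locconst_comp[OF E(1) continuous_ext(2)[OF assms]] _ that])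
      (simp add: twisted_hom_def)
qed

text \<open>Since \<open>T\<close> commutes with each \<open>\<phi>\<close> up to conjugation, \<open>E\<close> carries an element of \<open>N\<^sup>T\<close> to a profinite
  element whose image under each \<open>\<phi>\<close> is trivial modulo \<open>N\<close>; it is approximated by an element of \<open>N\<close>.\<close>

lemma twisted_subordinate:
  assumes N: "N \<in> NFI" and \<psi>: "\<psi> \<in> hom F2 (sym_group d)" and sub: "N_F2 N \<subseteq> kernel F2 (sym_group d) \<psi>"
  shows "N_F2 (NFI_act N (m, f)) \<subseteq> kernel F2 (sym_group d) (twisted_hom (m, f) d \<psi>)"
proof
  note FN = NFI_FIN(1)[OF N]
  let ?L = "{g \<in> carrier F2. g \<in> N_PB3 N}"
  have L: "?L \<in> FIN F2" by (rule N_F2_FIN[OF N])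
  fix g assume "g \<in> N_F2 (NFI_act N (m, f))"
  hence g: "g \<in> carrier F2" and gN: "\<phi> g \<in> NFI_act N (m, f)" if "\<phi> \<in> five_phis" for \<phi>
    using that unfolding N_F2_def Int_iff N_PB3_mem by blast+
  have g: "g \<in> carrier F2" using g[of phi_123] by simp
  have eg: "eta F2 g \<in> carrier F2hat" by (rule F2.eta_closed[OF g])
  have Eg: "E (eta F2 g) \<in> carrier F2hat" by (rule chom_closed[OF E(1) eg])
  have T: "T4 (F2_B4 \<phi> (eta F2 g)) N = N" if "\<phi> \<in> five_phis" for \<phi>
    using gN[OF that] F2.completion_map(2)[OF braid_group phi_F2_B4[OF five_phis_hom[OF that]] g]
    unfolding NFI_act_eq[OF N] by simp
  have conj: "u N = N" if u: "u \<in> carrier (hat B4)" "w \<in> carrier (hat B4)"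
      and e: "(inv\<^bsub>hat B4\<^esub> w \<otimes>\<^bsub>hat B4\<^esub> u \<otimes>\<^bsub>hat B4\<^esub> w) N = N" for u w
  proof -
    interpret Q: group "B4 Mod N" by (rule FIN_quotient_group[OF FN])
    interpret c: group_hom "hat B4" "B4 Mod N" "\<lambda>u. u N" using hat_coord_hom[OF FN] by unfold_locales
    let ?v = "inv\<^bsub>hat B4\<^esub> w \<otimes>\<^bsub>hat B4\<^esub> u \<otimes>\<^bsub>hat B4\<^esub> w"
    have v: "?v \<in> carrier (hat B4)" using u by simp
    have "u = w \<otimes>\<^bsub>hat B4\<^esub> ?v \<otimes>\<^bsub>hat B4\<^esub> inv\<^bsub>hat B4\<^esub> w" using u by (simp add: B4h.m_assoc B4h.mult_inv_cancel del: hat_one)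
    hence "u N = (w \<otimes>\<^bsub>hat B4\<^esub> ?v \<otimes>\<^bsub>hat B4\<^esub> inv\<^bsub>hat B4\<^esub> w) N" by simp
    also have "\<dots> = w N \<otimes>\<^bsub>B4 Mod N\<^esub> ?v N \<otimes>\<^bsub>B4 Mod N\<^esub> inv\<^bsub>B4 Mod N\<^esub> (w N)"
      by (simp only: c.hom_mult c.hom_inv u v B4h.m_closed B4h.inv_closed)
    also have "?v N = \<one>\<^bsub>B4 Mod N\<^esub>" using e by simp
    also have "w N \<otimes>\<^bsub>B4 Mod N\<^esub> \<one>\<^bsub>B4 Mod N\<^esub> \<otimes>\<^bsub>B4 Mod N\<^esub> inv\<^bsub>B4 Mod N\<^esub> (w N) = \<one>\<^bsub>B4 Mod N\<^esub>"
      by (simp only: Q.r_one Q.r_inv hat_coord_closed[OF u(2) FN])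
    finally show ?thesis by simp
  qed
  have pc: "F2_B4 \<phi> (E (eta F2 g)) \<in> carrier (hat B4)" if "\<phi> \<in> hom PB3 PB4" for \<phi>
    by (rule chom_closed[OF F2_B4(1)[OF that] Eg])
  note t = T4_phi[OF eg]
  have pN: "F2_B4 \<phi> (E (eta F2 g)) N = N" if "\<phi> \<in> five_phis" for \<phi>
  proof -
    have "F2_B4 phi_123 (E (eta F2 g)) N = N" using T[of phi_123] t(1) by simp
    moreover have "F2_B4 phi_234 (E (eta F2 g)) N = N"
      using T[of phi_234] t(2) by (intro conj[OF pc[OF phi_234(1)] hh]) simp
    moreover have "F2_B4 phi_12_3_4 (E (eta F2 g)) N = N" using T[of phi_12_3_4] t(3) by simp
    moreover have "F2_B4 phi_1_23_4 (E (eta F2 g)) N = N"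
      using T[of phi_1_23_4] t(4) by (intro conj[OF pc[OF phi_1_23_4(1)] p_closed(1)]) simp
    moreover have "F2_B4 phi_1_2_34 (E (eta F2 g)) N = N"
      using T[of phi_1_2_34] t(5) by (intro conj[OF pc[OF phi_1_2_34(1)] p_closed(3)]) simp
    ultimately show ?thesis using that by auto
  qed
  obtain r where r: "r \<in> carrier F2" "E (eta F2 g) ?L = ?L #>\<^bsub>F2\<^esub> r" using hat_rep[OF Eg L] .
  have "\<phi> r \<in> N" if \<phi>: "\<phi> \<in> five_phis" for \<phi>
  proof -
    note ph = phi_F2_B4[OF five_phis_hom[OF \<phi>]]
    let ?M = "{g \<in> carrier F2. \<phi> g \<in> N}"
    have "?L \<subseteq> ?M" using \<phi> unfolding N_PB3_mem by blast
    hence "E (eta F2 g) ?M = ?M #>\<^bsub>F2\<^esub> r"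
      by (rule F2.hat_coarsen[OF Eg L FIN_preimage[OF F2_group braid_group ph FN] _ r])
    hence "F2_B4 \<phi> (E (eta F2 g)) N = N #>\<^bsub>B4\<^esub> \<phi> r"
      by (rule F2.completion_map_coord[where u = "E (eta F2 g)" and \<phi> = \<phi>, OF braid_group ph FN r(1)])
    thus ?thesis
      using pN[OF \<phi>] B4.coset_join1[OF _ hom_in_carrier[OF ph r(1)] FIN_subgroup[OF FN]] by simp
  qed
  hence "r \<in> N_F2 N" unfolding N_F2_def Int_iff N_PB3_mem using r(1) F2_PB3 by blast
  hence "\<psi> r = \<one>\<^bsub>sym_group d\<^esub>" using sub by (auto simp: kernel_def)
  \<comment> \<open>Since \<open>\<psi>\<close> kills the subgroup at whose level \<open>r\<close>
    was chosen, its extension takes the same value at the profinite element as at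
    \<open>r\<close>.\<close>
  moreover have "continuous_ext d \<psi> (E (eta F2 g)) = continuous_ext d \<psi> (eta F2 r)"
  proof (rule F2.locconst_factor[OF sym_group_is_group continuous_ext(1,2)[OF \<psi>] L _ Eg r])
    fix k assume "k \<in> ?L"
    hence "k \<in> carrier F2" "k \<in> N_F2 N" by (auto simp: N_F2_def)
    thus "continuous_ext d \<psi> (eta F2 k) = \<one>\<^bsub>sym_group d\<^esub>"
      using sub continuous_ext(3)[OF \<psi>] by (auto simp: kernel_def)
  qed
  ultimately have "twisted_hom (m, f) d \<psi> g = \<one>\<^bsub>sym_group d\<^esub>"
    using continuous_ext(3)[OF \<psi> r(1)] g by (simp add: twisted_hom_def)
  thus "g \<in> kernel F2 (sym_group d) (twisted_hom (m, f) d \<psi>)" using g by (simp add: kernel_def)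
qed

end

section \<open>Transitivity, conjugacy classes and the action on drawings\<close>

text \<open>Invertibility of \<open>T\<close> enters here: \<open>eta F2 g\<close> has a preimage in
  the completion, and an element of \<open>F2\<close> close enough to that preimage has the same
  value under the twisted homomorphism.\<close>

lemma twisted_transitive:
  assumes T: "T \<in> carrier GThat" and \<psi>: "transitive_hom d \<psi>"
  shows "transitive_hom d (twisted_hom T d \<psi>)"
proof -
  obtain m f where e: "T = (m, f)" by (cases T)
  interpret P: gt_pair m f using T unfolding e by (rule GThat_pair)
  have h: "\<psi> \<in> hom F2 (sym_group d)" using \<psi> by (simp add: transitive_hom_def)
  have "\<exists>g\<in>carrier F2. twisted_hom T d \<psi> g i = j" if ij: "i \<in> {1..d}" "j \<in> {1..d}" for i j
  proof -
    obtain g where g: "g \<in> carrier F2" "\<psi> g i = j" using \<psi> ij unfolding transitive_hom_def by blast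
    obtain v where v: "v \<in> carrier F2hat" "F2hat_endo T v = eta F2 g"
      using GThat_E_surj[OF T P.F2.eta_closed[OF g(1)]] by blast
    obtain K where K: "K \<in> FIN F2" "\<And>w. w \<in> carrier F2hat \<Longrightarrow> w K = v K \<Longrightarrow>
        continuous_ext d \<psi> (F2hat_endo (m, f) w) = continuous_ext d \<psi> (F2hat_endo (m, f) v)"
      using locconstE[OF chom_locconst_comp[OF P.E(1) continuous_ext(2)[OF h]] v(1)] by metis
    obtain r where r: "r \<in> carrier F2" "v K = eta F2 r K" using P.F2.eta_dense[OF v(1) K(1)] .
    have "twisted_hom T d \<psi> r = continuous_ext d \<psi> (F2hat_endo (m, f) v)"
      using K(2)[OF P.F2.eta_closed[OF r(1)]] r e by (simp add: twisted_hom_def)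
    also have "\<dots> = \<psi> g" using v(2) continuous_ext(3)[OF h g(1)] e by simp
    finally show ?thesis using g(2) by (intro bexI[OF _ r(1)]) simp
  qed
  thus ?thesis using \<psi> P.twisted_hom(1)[OF h] e by (simp add: transitive_hom_def)
qed

text \<open>The restriction of \<open>\<psi>'\<close> to \<open>F2\<close> lies in its own class
  through the permutation 1, hence in the class of \<open>\<psi>\<close>, which exhibits the
  conjugating permutation.\<close>

lemma drawing_of_eqD:
  assumes "drawing_of d \<psi> = drawing_of d' \<psi>'" "\<psi>' \<in> hom F2 (sym_group d')"
  shows "d' = d" "\<exists>\<tau>\<in>carrier (sym_group d). \<forall>g\<in>carrier F2.
     \<psi>' g = \<tau> \<otimes>\<^bsub>sym_group d\<^esub> \<psi> g \<otimes>\<^bsub>sym_group d\<^esub> inv\<^bsub>sym_group d\<^esub> \<tau>"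
proof -
  interpret S: group "sym_group d" by (rule sym_group_is_group)
  show d: "d' = d" using assms(1) by (simp add: drawing_of_def)
  have h: "\<psi>' g \<in> carrier (sym_group d)" if "g \<in> carrier F2" for g
    using hom_in_carrier[OF assms(2) that] d by simp
  have r: "(\<lambda>g\<in>carrier F2. \<one>\<^bsub>sym_group d\<^esub> \<otimes>\<^bsub>sym_group d\<^esub> \<psi>' g \<otimes>\<^bsub>sym_group d\<^esub> inv\<^bsub>sym_group d\<^esub> \<one>\<^bsub>sym_group d\<^esub>)
      \<in> snd (drawing_of d' \<psi>')"
    unfolding drawing_of_def d snd_conv using S.one_closed by blast
  obtain \<tau> where \<tau>: "\<tau> \<in> carrier (sym_group d)"
    "(\<lambda>g\<in>carrier F2. \<one>\<^bsub>sym_group d\<^esub> \<otimes>\<^bsub>sym_group d\<^esub> \<psi>' g \<otimes>\<^bsub>sym_group d\<^esub> inv\<^bsub>sym_group d\<^esub> \<one>\<^bsub>sym_group d\<^esub>)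
     = (\<lambda>g\<in>carrier F2. \<tau> \<otimes>\<^bsub>sym_group d\<^esub> \<psi> g \<otimes>\<^bsub>sym_group d\<^esub> inv\<^bsub>sym_group d\<^esub> \<tau>)"
    using r unfolding assms(1)[symmetric] unfolding drawing_of_def snd_conv by blast
  have "\<psi>' g = \<tau> \<otimes>\<^bsub>sym_group d\<^esub> \<psi> g \<otimes>\<^bsub>sym_group d\<^esub> inv\<^bsub>sym_group d\<^esub> \<tau>" if g: "g \<in> carrier F2" for g
    using fun_cong[OF \<tau>(2), of g] g h[OF g] by (simp del: sym_group_inv_equality)
  thus "\<exists>\<tau>\<in>carrier (sym_group d). \<forall>g\<in>carrier F2.
     \<psi>' g = \<tau> \<otimes>\<^bsub>sym_group d\<^esub> \<psi> g \<otimes>\<^bsub>sym_group d\<^esub> inv\<^bsub>sym_group d\<^esub> \<tau>" using \<tau>(1) by blast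
qed

lemma drawing_of_subset:
  assumes "\<psi> \<in> hom F2 (sym_group d)" "\<tau> \<in> carrier (sym_group d)"
    "\<And>g. g \<in> carrier F2 \<Longrightarrow> \<psi>' g = \<tau> \<otimes>\<^bsub>sym_group d\<^esub> \<psi> g \<otimes>\<^bsub>sym_group d\<^esub> inv\<^bsub>sym_group d\<^esub> \<tau>"
  shows "snd (drawing_of d \<psi>') \<subseteq> snd (drawing_of d \<psi>)"
proof
  interpret S: group "sym_group d" by (rule sym_group_is_group)
  fix k assume "k \<in> snd (drawing_of d \<psi>')"
  then obtain \<rho> where \<rho>: "\<rho> \<in> carrier (sym_group d)"
    "k = (\<lambda>g\<in>carrier F2. \<rho> \<otimes>\<^bsub>sym_group d\<^esub> \<psi>' g \<otimes>\<^bsub>sym_group d\<^esub> inv\<^bsub>sym_group d\<^esub> \<rho>)"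
    unfolding drawing_of_def snd_conv by blast
  have "k = (\<lambda>g\<in>carrier F2. (\<rho> \<otimes>\<^bsub>sym_group d\<^esub> \<tau>) \<otimes>\<^bsub>sym_group d\<^esub> \<psi> g \<otimes>\<^bsub>sym_group d\<^esub> inv\<^bsub>sym_group d\<^esub> (\<rho> \<otimes>\<^bsub>sym_group d\<^esub> \<tau>))"
    unfolding \<rho>(2)
  proof (rule restrict_ext)
    fix g assume g: "g \<in> carrier F2"
    show "\<rho> \<otimes>\<^bsub>sym_group d\<^esub> \<psi>' g \<otimes>\<^bsub>sym_group d\<^esub> inv\<^bsub>sym_group d\<^esub> \<rho> =
      (\<rho> \<otimes>\<^bsub>sym_group d\<^esub> \<tau>) \<otimes>\<^bsub>sym_group d\<^esub> \<psi> g \<otimes>\<^bsub>sym_group d\<^esub> inv\<^bsub>sym_group d\<^esub> (\<rho> \<otimes>\<^bsub>sym_group d\<^esub> \<tau>)"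
      unfolding assms(3)[OF g] S.inv_mult_group[OF \<rho>(1) assms(2)]
      by (simp only: S.m_assoc S.m_closed S.inv_closed \<rho>(1) assms(2) hom_in_carrier[OF assms(1) g])
  qed
  thus "k \<in> snd (drawing_of d \<psi>)" unfolding drawing_of_def snd_conv using S.m_closed[OF \<rho>(1) assms(2)] by blast
qed

lemma drawing_of_conj:
  assumes "\<psi> \<in> hom F2 (sym_group d)" "\<psi>' \<in> hom F2 (sym_group d)" "\<tau> \<in> carrier (sym_group d)"
    "\<And>g. g \<in> carrier F2 \<Longrightarrow> \<psi>' g = \<tau> \<otimes>\<^bsub>sym_group d\<^esub> \<psi> g \<otimes>\<^bsub>sym_group d\<^esub> inv\<^bsub>sym_group d\<^esub> \<tau>"
  shows "drawing_of d \<psi>' = drawing_of d \<psi>"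
proof -
  interpret S: group "sym_group d" by (rule sym_group_is_group)
  have "\<psi> g = inv\<^bsub>sym_group d\<^esub> \<tau> \<otimes>\<^bsub>sym_group d\<^esub> \<psi>' g \<otimes>\<^bsub>sym_group d\<^esub> inv\<^bsub>sym_group d\<^esub> (inv\<^bsub>sym_group d\<^esub> \<tau>)"
    if g: "g \<in> carrier F2" for g
    unfolding assms(4)[OF g] S.inv_inv[OF assms(3)]
    by (simp only: S.m_assoc S.m_closed S.inv_closed S.mult_inv_cancel S.l_inv S.r_one assms(3) hom_in_carrier[OF assms(1) g])
  hence "snd (drawing_of d \<psi>) \<subseteq> snd (drawing_of d \<psi>')"
    by (rule drawing_of_subset[OF assms(2) S.inv_closed[OF assms(3)]])
  with drawing_of_subset[OF assms(1,3,4)] have "snd (drawing_of d \<psi>') = snd (drawing_of d \<psi>)" by blast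
  thus ?thesis by (simp add: drawing_of_def)
qed

text \<open>Both sides are locally constant in \<open>u\<close> and agree on the dense subgroup
  \<open>F2\<close>.\<close>

lemma continuous_ext_conj:
  assumes "\<psi> \<in> hom F2 (sym_group d)" "\<psi>' \<in> hom F2 (sym_group d)"
    "\<And>g. g \<in> carrier F2 \<Longrightarrow> \<psi>' g = \<tau> \<otimes>\<^bsub>sym_group d\<^esub> \<psi> g \<otimes>\<^bsub>sym_group d\<^esub> inv\<^bsub>sym_group d\<^esub> \<tau>" "u \<in> carrier F2hat"
  shows "continuous_ext d \<psi>' u = \<tau> \<otimes>\<^bsub>sym_group d\<^esub> continuous_ext d \<psi> u \<otimes>\<^bsub>sym_group d\<^esub> inv\<^bsub>sym_group d\<^esub> \<tau>"
  by (rule continuous_ext_unique[OF assms(2) locconst_comp_any[OF continuous_ext(2)[OF assms(1)]] _ assms(4)])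
    (simp only: continuous_ext(3)[OF assms(1)] assms(3))

lemma twisted_drawing_well_defined:
  assumes T: "T \<in> carrier GThat" and "transitive_hom d \<psi>" "transitive_hom d' \<psi>'" "drawing_of d \<psi> = drawing_of d' \<psi>'"
  shows "drawing_of d' (twisted_hom T d' \<psi>') = drawing_of d (twisted_hom T d \<psi>)"
proof -
  obtain m f where e: "T = (m, f)" by (cases T)
  interpret P: gt_pair m f using T unfolding e by (rule GThat_pair)
  have h: "\<psi> \<in> hom F2 (sym_group d)" "\<psi>' \<in> hom F2 (sym_group d')" using assms(2,3) by (simp_all add: transitive_hom_def)
  have d: "d' = d" by (rule drawing_of_eqD(1)[OF assms(4) h(2)])
  obtain \<tau> where \<tau>: "\<tau> \<in> carrier (sym_group d)"
    "\<And>g. g \<in> carrier F2 \<Longrightarrow> \<psi>' g = \<tau> \<otimes>\<^bsub>sym_group d\<^esub> \<psi> g \<otimes>\<^bsub>sym_group d\<^esub> inv\<^bsub>sym_group d\<^esub> \<tau>"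
    using drawing_of_eqD(2)[OF assms(4) h(2)] by blast
  note h' = h(2)[unfolded d]
  have "twisted_hom T d \<psi>' g = \<tau> \<otimes>\<^bsub>sym_group d\<^esub> twisted_hom T d \<psi> g \<otimes>\<^bsub>sym_group d\<^esub> inv\<^bsub>sym_group d\<^esub> \<tau>"
    if g: "g \<in> carrier F2" for g
    using continuous_ext_conj[OF h(1) h' \<tau>(2) chom_closed[OF P.E(1) P.F2.eta_closed[OF g]]] g e
    by (simp add: twisted_hom_def del: sym_group_inv_equality)
  from drawing_of_conj[OF P.twisted_hom(1)[OF h(1), folded e] P.twisted_hom(1)[OF h', folded e] \<tau>(1) this]
  show ?thesis unfolding d by simp
qed

text \<open>Twisting commutes with conjugation in the symmetric group, so all representatives of a
  drawing lead to the same class and the definite description has a unique solution.\<close>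

lemma drawing_act_eq:
  assumes "T \<in> carrier GThat" "transitive_hom d \<psi>"
  shows "drawing_act T (drawing_of d \<psi>) = drawing_of d (twisted_hom T d \<psi>)"
  unfolding drawing_act_def
proof (rule the_equality)
  show "\<exists>d' \<psi>'. transitive_hom d' \<psi>' \<and> drawing_of d \<psi> = drawing_of d' \<psi>' \<and>
      drawing_of d (twisted_hom T d \<psi>) = drawing_of d' (twisted_hom T d' \<psi>')" using assms(2) by blast
  fix D assume "\<exists>d' \<psi>'. transitive_hom d' \<psi>' \<and> drawing_of d \<psi> = drawing_of d' \<psi>' \<and> D = drawing_of d' (twisted_hom T d' \<psi>')"
  then obtain d' \<psi>' where "transitive_hom d' \<psi>'" "drawing_of d \<psi> = drawing_of d' \<psi>'" "D = drawing_of d' (twisted_hom T d' \<psi>')"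
    by blast
  thus "D = drawing_of d (twisted_hom T d \<psi>)" using twisted_drawing_well_defined[OF assms] by simp
qed

lemma Dessin_rep:
  assumes "D \<in> Dessin N"
  obtains d \<psi> where "transitive_hom d \<psi>" "N_F2 N \<subseteq> kernel F2 (sym_group d) \<psi>" "D = drawing_of d \<psi>"
  using assms unfolding Dessin_def by blast

lemma twisted_Dessin:
  assumes T: "T \<in> carrier GThat" and N: "N \<in> NFI" and D: "D \<in> Dessin N"
  shows "drawing_act T D \<in> Dessin (NFI_act N T)"
proof -
  obtain d \<psi> where \<psi>: "transitive_hom d \<psi>" "N_F2 N \<subseteq> kernel F2 (sym_group d) \<psi>" "D = drawing_of d \<psi>"
    using Dessin_rep[OF D] .
  obtain m f where e: "T = (m, f)" by (cases T)
  interpret P: gt_pair m f using T unfolding e by (rule GThat_pair)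
  have "\<psi> \<in> hom F2 (sym_group d)" using \<psi>(1) by (simp add: transitive_hom_def)
  note s = P.twisted_subordinate[OF N this \<psi>(2), folded e]
  show ?thesis unfolding \<psi>(3) drawing_act_eq[OF T \<psi>(1)] Dessin_def
    using s twisted_transitive[OF T \<psi>(1)] by blast
qed

text \<open>Twisting is precomposition, so \<open>\<psi>\<close> twisted by a product is twisted by
  the left factor before the right one. This reversal of order makes the functor
  contravariant.\<close>

lemma drawing_act_product:
  assumes S: "S \<in> carrier GThat" and T: "T \<in> carrier GThat" and "transitive_hom d \<psi>"
  shows "drawing_act (S \<otimes>\<^bsub>GThat\<^esub> T) (drawing_of d \<psi>) = drawing_act T (drawing_act S (drawing_of d \<psi>))"
proof -
  interpret G: group GThat by (rule GThat_group)
  obtain m1 f1 m2 f2 where e: "S = (m1, f1)" "T = (m2, f2)" by (cases S; cases T)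
  \<comment> \<open>The left factor, named \<open>S\<close> here, is the one called \<open>T\<close>
    inside the locale.\<close>
  interpret P: gt_two m1 f1 m2 f2 using S T unfolding e by (rule GThat_two)
  have h: "\<psi> \<in> hom F2 (sym_group d)" using assms(3) by (simp add: transitive_hom_def)
  have st: "S \<otimes>\<^bsub>GThat\<^esub> T = (P.mm, P.ff)" unfolding e by (simp add: GT_mult)
  have "twisted_hom (S \<otimes>\<^bsub>GThat\<^esub> T) d \<psi> g = twisted_hom T d (twisted_hom S d \<psi>) g" for g
  proof (cases "g \<in> carrier F2")
    case True
    have eg: "eta F2 g \<in> carrier F2hat" by (rule P.T.F2.eta_closed[OF True])
    have "twisted_hom (P.mm, P.ff) d \<psi> g = continuous_ext d \<psi> (F2hat_endo (P.mm, P.ff) (eta F2 g))"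
      unfolding twisted_hom_def using True by (rule restrict_apply')
    also have "\<dots> = continuous_ext d \<psi> (F2hat_endo (m1, f1) (F2hat_endo (m2, f2) (eta F2 g)))"
      by (simp only: P.E_product[OF eg])
    also have "\<dots> = continuous_ext d (twisted_hom (m1, f1) d \<psi>) (F2hat_endo (m2, f2) (eta F2 g))"
      by (rule P.T.twisted_hom(2)[OF h chom_closed[OF P.S.E(1) eg], symmetric])
    also have "\<dots> = twisted_hom (m2, f2) d (twisted_hom (m1, f1) d \<psi>) g"
      unfolding twisted_hom_def[of "(m2, f2)"] using True by (rule restrict_apply'[symmetric])
    finally show ?thesis unfolding st unfolding e .
  qed (simp add: twisted_hom_def)
  hence "twisted_hom (S \<otimes>\<^bsub>GThat\<^esub> T) d \<psi> = twisted_hom T d (twisted_hom S d \<psi>)" by blast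
  thus ?thesis
    by (simp only: drawing_act_eq[OF G.m_closed[OF S T] assms(3)] drawing_act_eq[OF S assms(3)]
        drawing_act_eq[OF T twisted_transitive[OF S assms(3)]])
qed

lemma drawing_act_one:
  assumes "transitive_hom d \<psi>"
  shows "drawing_act \<one>\<^bsub>GThat\<^esub> (drawing_of d \<psi>) = drawing_of d \<psi>"
proof -
  interpret G: group GThat by (rule GThat_group)
  interpret F: group F2 by (rule F2_group)
  have h: "\<psi> \<in> hom F2 (sym_group d)" using assms by (simp add: transitive_hom_def)
  have "twisted_hom \<one>\<^bsub>GThat\<^esub> d \<psi> g = \<psi> g" if "g \<in> carrier F2" for g
    using E_one[OF F.eta_closed[OF that]] continuous_ext(3)[OF h that] that
    by (simp add: twisted_hom_def GT_one del: hat_one)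
  hence "drawing_of d (twisted_hom \<one>\<^bsub>GThat\<^esub> d \<psi>) = drawing_of d \<psi>"
    unfolding drawing_of_def by (simp cong: restrict_cong del: GThat_ops sym_group_inv_equality)
  thus ?thesis using drawing_act_eq[OF G.one_closed assms] by simp
qed

lemma NFI_act_mult:
  assumes "N \<in> NFI" "S \<in> carrier GThat" "T \<in> carrier GThat"
  shows "NFI_act N (S \<otimes>\<^bsub>GThat\<^esub> T) = NFI_act (NFI_act N S) T"
proof -
  obtain m1 f1 m2 f2 where e: "S = (m1, f1)" "T = (m2, f2)" by (cases S; cases T)
  interpret P: gt_two m1 f1 m2 f2 using assms(2,3) unfolding e by (rule GThat_two)
  show ?thesis unfolding e using P.NFI_act_product[OF assms(1)] by (simp add: GT_mult)
qed

section \<open>The functor\<close>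

lemma GT_NFI_category: "category GT_NFI"
proof
  interpret G: group GThat by (rule GThat_group)
  fix a b c d f g h
  show "Ident GT_NFI a \<in> Mor GT_NFI a a" if "a \<in> Obj GT_NFI"
    using that NFI_act_one[of a] G.one_closed by (simp add: GT_NFI_def del: GThat_ops)
  show "Comp GT_NFI a b c g f \<in> Mor GT_NFI a c"
    if "a \<in> Obj GT_NFI" "b \<in> Obj GT_NFI" "c \<in> Obj GT_NFI" "f \<in> Mor GT_NFI a b" "g \<in> Mor GT_NFI b c"
    \<comment> \<open>In exponential notation: \<open>c^(g f) = (c^g)^f = b^f = a\<close>.\<close>
    using that NFI_act_mult[of c g f] G.m_closed[of g f] by (simp add: GT_NFI_def del: GThat_ops)
  show "Comp GT_NFI a b b (Ident GT_NFI b) f = f" "Comp GT_NFI a a b f (Ident GT_NFI a) = f"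
    if "f \<in> Mor GT_NFI a b"
    using that by (simp_all add: GT_NFI_def del: GThat_ops)
  show "Comp GT_NFI a b d (Comp GT_NFI b c d h g) f = Comp GT_NFI a c d h (Comp GT_NFI a b c g f)"
    if "f \<in> Mor GT_NFI a b" "g \<in> Mor GT_NFI b c" "h \<in> Mor GT_NFI c d"
    using that by (simp add: GT_NFI_def G.m_assoc del: GThat_ops)
qed

lemma Dessin_category: "category Dessin_cat"
proof
  fix a b c d f g h
  show "Ident Dessin_cat a \<in> Mor Dessin_cat a a" by (simp add: Dessin_cat_def)
  show "Comp Dessin_cat a b c g f \<in> Mor Dessin_cat a c" if "f \<in> Mor Dessin_cat a b" "g \<in> Mor Dessin_cat b c"
    using that by (auto simp: Dessin_cat_def PiE_iff compose_def)
  show "Comp Dessin_cat a b b (Ident Dessin_cat b) f = f" if "f \<in> Mor Dessin_cat a b"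
    using that unfolding Dessin_cat_def
    by (intro extensionalityI[of _ "Dessin a"]) (auto simp: PiE_iff compose_def)
  show "Comp Dessin_cat a a b f (Ident Dessin_cat a) = f" if "f \<in> Mor Dessin_cat a b"
    using that unfolding Dessin_cat_def
    by (intro extensionalityI[of _ "Dessin a"]) (auto simp: PiE_iff compose_def)
  show "Comp Dessin_cat a b d (Comp Dessin_cat b c d h g) f = Comp Dessin_cat a c d h (Comp Dessin_cat a b c g f)"
    if "f \<in> Mor Dessin_cat a b"
    using that unfolding Dessin_cat_def
    by (intro extensionalityI[of _ "Dessin a"]) (auto simp: PiE_iff compose_def)
qed

lemma A_mor_functor: "contravariant_functor GT_NFI Dessin_cat (\<lambda>N. N) A_mor"
proof (intro contravariant_functor.intro contravariant_functor_axioms.intro)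
  show "category GT_NFI" by (rule GT_NFI_category)
  show "category Dessin_cat" by (rule Dessin_category)
  fix a b c f g
  show "a \<in> Obj Dessin_cat" if "a \<in> Obj GT_NFI" using that by (simp add: GT_NFI_def Dessin_cat_def)
  show "A_mor a b f \<in> Mor Dessin_cat b a"
    if "a \<in> Obj GT_NFI" "b \<in> Obj GT_NFI" "f \<in> Mor GT_NFI a b"
    using that twisted_Dessin[of f b] by (auto simp: GT_NFI_def Dessin_cat_def A_mor_def PiE_iff)
  show "A_mor a a (Ident GT_NFI a) = Ident Dessin_cat a"
  proof -
    have "drawing_act \<one>\<^bsub>GThat\<^esub> D = D" if D: "D \<in> Dessin a" for D
      using Dessin_rep[OF D] drawing_act_one by metis
    thus ?thesis by (simp add: GT_NFI_def Dessin_cat_def A_mor_def cong: restrict_cong del: GThat_ops)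
  qed
  show "A_mor a c (Comp GT_NFI a b c g f) = Comp Dessin_cat c b a (A_mor a b f) (A_mor b c g)"
    if abc: "a \<in> Obj GT_NFI" "b \<in> Obj GT_NFI" "c \<in> Obj GT_NFI" "f \<in> Mor GT_NFI a b" "g \<in> Mor GT_NFI b c"
  proof -
    have fg: "f \<in> carrier GThat" "g \<in> carrier GThat" "NFI_act c g = b" "c \<in> NFI"
      using abc by (simp_all add: GT_NFI_def)
    have "drawing_act (g \<otimes>\<^bsub>GThat\<^esub> f) D = A_mor a b f (A_mor b c g D)" if D: "D \<in> Dessin c" for D
    proof -
      \<comment> \<open>\<open>A_mor a b f\<close> acts only on \<open>Dessin b\<close>; the
        relation \<open>c^g = b\<close> places the intermediate drawing there.\<close>
      have "drawing_act g D \<in> Dessin b" using twisted_Dessin[OF fg(2,4) D] fg(3) by simp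
      moreover obtain d \<psi> where "transitive_hom d \<psi>" "D = drawing_of d \<psi>" using Dessin_rep[OF D] .
      ultimately show ?thesis using drawing_act_product[OF fg(2,1)] D by (simp add: A_mor_def)
    qed
    thus ?thesis
      by (simp add: GT_NFI_def Dessin_cat_def compose_def A_mor_def[of a c] cong: restrict_cong del: GThat_ops)
  qed
qed

theorem proposition2p12:
  shows "(\<forall>T \<in> carrier GThat. \<forall>N \<in> NFI. \<forall>d \<psi>.
            transitive_hom d \<psi> \<and> drawing_of d \<psi> \<in> Dessin N \<longrightarrow>
              drawing_of d (twisted_hom T d \<psi>) \<in> Dessin (NFI_act N T)
              \<and> drawing_act T (drawing_of d \<psi>) = drawing_of d (twisted_hom T d \<psi>))
         \<and> contravariant_functor GT_NFI Dessin_cat (\<lambda>N. N) A_mor"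
  using drawing_act_eq twisted_Dessin A_mor_functor by metis

end
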